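(* Let $w$ be a weight structure on a triangulated category $\mathcal C$, let $A$ be an abelian category, let $H:\mathcal C\to A$ be a homological functor, and let $X\in \mathrm{Obj}\,\mathcal C$. Fix a weight Postnikov tower for $X$, let $(X^i,h^i)$ be the corresponding weight complex of $X$, and let $(E_1,D_1)$ be the exact couple with $E_1^{pq}=H_q(X^p)$, $D_1^{pq}=H_q(X^{w\ge p})$ obtained by applying $H$ to the distinguished triangles $X^{k}[-1]\to X^{w\ge k+1}[-1]\to X^{w\ge k}\to X^{k}$ of the tower. I. There exists a spectral sequence $T=T(H,X)$ coming from the exact couple $(E_1,D_1)$, with $E_1^{pq}=H_q(X^p)$, such that the map $E_1^{pq}\to E_1^{p+1,q}$ equals $H_q(h^p)$. II. $T(H,X)$ converges to $H_{p+q}(X)$ in each of the following cases: (i) $X\in\mathcal C^b$; (ii) $H$ vanishes on $\mathcal C^{w\ge q}$ for $q$ large enough and on $\mathcal C^{w\le q}$ for $q$ small enough; (iii) $X\in \mathcal C^-$ (resp. $X\in\mathcal C^+$) and $H$ vanishes on $\mathcal C^{w\le q}$ for $q$ small enough (resp. on $\mathcal C^{w\ge q}$ for $q$ large enough). In all these cases the corresponding filtration on $H_*(X)$ coincides with the weight filtration, i.e. $F_pH_{p+q}(X)=W_p(H_{p+q})(X)$. III. $T$ is functorial with respect to $H$: for any transformation of functors $H\to H'$ there is a canonical morphism of spectral sequences $T(H,X)\to T(H',X)$; these morphisms respect sums and compositions of transformations. IV. $T$ is canonical (i.e. independent of the choice of the tower) and functorial with respect to $X$ starting from $E_2$.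
   Context: For classes of objects, $D\perp E$ means $\mathcal C(X,Y)=0$ for all $X\in D$, $Y\in E$. A class is Karoubi-closed in $\mathcal C$ if it contains all retracts (in $\mathcal C$) of its objects. A weight structure $w$ on a triangulated category $\mathcal C$ is a pair of subclasses $\mathcal C^{w\le 0},\mathcal C^{w\ge 0}\subset\mathrm{Obj}\,\mathcal C$ such that: (i) both are additive and Karoubi-closed in $\mathcal C$; (ii) $\mathcal C^{w\ge 0}\subset \mathcal C^{w\ge 0}[1]$ and $\mathcal C^{w\le 0}[1]\subset \mathcal C^{w\le 0}$; (iii) $\mathcal C^{w\ge 0}\perp\mathcal C^{w\le 0}[1]$; (iv) for every $X$ there is a distinguished triangle $B[-1]\to X\to A\to B$ with $A\in\mathcal C^{w\le 0}$, $B\in\mathcal C^{w\ge 0}$ (a weight decomposition of $X$). Put $\mathcal C^{w\ge l}=\mathcal C^{w\ge 0}[-l]$, $\mathcal C^{w\le l}=\mathcal C^{w\le 0}[-l]$, $\mathcal C^{w=0}=\mathcal C^{w\ge 0}\cap \mathcal C^{w\le 0}$, $\mathcal C^-=\bigcup_i\mathcal C^{w\le i}$, $\mathcal C^+=\bigcup_i\mathcal C^{w\ge i}$, $\mathcal C^b=\mathcal C^+\cap\mathcal C^-$. Weight Postnikov tower of $X$: for each $k\in\mathbb Z$ choose a weight decomposition $X[k]\to X^{w\le k}\xrightarrow{f^k}X^{w\ge k+1}\to X[k+1]$ of $X[k]$ (so $X^{w\le k}\in\mathcal C^{w\le0}$, $X^{w\ge k+1}\in\mathcal C^{w\ge0}$).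 There are unique morphisms $X^{w\le k}[-1]\to X^{w\le k-1}$ and $X^{w\ge k+1}[-1]\to X^{w\ge k}$ compatible with these triangles and $\mathrm{id}_X$, and there are objects $X^k\in\mathcal C^{w=0}$ and distinguished triangles $X^{w\le k}[-1]\to X^{w\le k-1}\xrightarrow{c^k}X^k\xrightarrow{d^k}X^{w\le k}$ and $X^k[-1]\xrightarrow{x^k}X^{w\ge k+1}[-1]\to X^{w\ge k}\xrightarrow{y^k}X^k$ with $c^k=y^k\circ f^{k-1}$, $x^k=(f^k\circ d^k)[-1]$. All this data is a weight Postnikov tower of $X$. The weight complex of $X$ is $(X^i,h^i)$ with $h^i=c^{i+1}\circ d^i:X^i\to X^{i+1}$. Write $w_{\ge i}X=X^{w\ge i}[-i]$ and $w_{\le i}X=X^{w\le i}[-i]$. A homological functor is a covariant additive functor to an abelian category sending distinguished triangles to long exact sequences. $H_p(Y)=H(Y[p])$. The weight filtration of a covariant $H$ is $W_i(H)(X)=\mathrm{Im}(H(w_{\ge i}X)\to H(X))$ (it does not depend on choices). *)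

theory Defs
  imports "HOL-Algebra.Group"
begin

section \<open>Additive and abelian categories\<close>

record ('o, 'm) precat =
  Obj :: "'o set"
  Arr :: "'m set"
  Src :: "'m \<Rightarrow> 'o"
  Tgt :: "'m \<Rightarrow> 'o"
  Idn :: "'o \<Rightarrow> 'm"
  Cmp :: "'m \<Rightarrow> 'm \<Rightarrow> 'm"  (infixr "\<cdot>\<index>" 75)
  Nul :: "'o \<Rightarrow> 'o \<Rightarrow> 'm"
  Pls :: "'m \<Rightarrow> 'm \<Rightarrow> 'm"  (infixl "\<boxplus>\<index>" 65)

definition Hom :: "('o, 'm, 'z) precat_scheme \<Rightarrow> 'o \<Rightarrow> 'o \<Rightarrow> 'm set" where
  "Hom C X Y = {f \<in> Arr C. Src C f = X \<and> Tgt C f = Y}"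

definition hom_group :: "('o, 'm, 'z) precat_scheme \<Rightarrow> 'o \<Rightarrow> 'o \<Rightarrow> 'm monoid" where
  "hom_group C X Y = \<lparr>carrier = Hom C X Y, monoid.mult = Pls C, one = Nul C X Y\<rparr>"

definition neg :: "('o, 'm, 'z) precat_scheme \<Rightarrow> 'm \<Rightarrow> 'm" where
  "neg C f = inv\<^bsub>hom_group C (Src C f) (Tgt C f)\<^esub> f"

locale category =
  fixes C :: "('o, 'm, 'z) precat_scheme" (structure)
  assumes Src_Obj: "f \<in> Arr C \<Longrightarrow> Src C f \<in> Obj C"
    and Tgt_Obj: "f \<in> Arr C \<Longrightarrow> Tgt C f \<in> Obj C"
    and Idn_Hom: "X \<in> Obj C \<Longrightarrow> Idn C X \<in> Hom C X X"
    and Cmp_Hom: "\<lbrakk>f \<in> Hom C X Y; g \<in> Hom C Y Z\<rbrakk> \<Longrightarrow> g \<cdot> f \<in> Hom C X Z"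
    and Cmp_assoc: "\<lbrakk>f \<in> Hom C X Y; g \<in> Hom C Y Z; h \<in> Hom C Z W\<rbrakk>
                      \<Longrightarrow> (h \<cdot> g) \<cdot> f = h \<cdot> (g \<cdot> f)"
    and Cmp_Idn_right: "f \<in> Hom C X Y \<Longrightarrow> f \<cdot> Idn C X = f"
    and Cmp_Idn_left: "f \<in> Hom C X Y \<Longrightarrow> Idn C Y \<cdot> f = f"

definition zero_object :: "('o, 'm, 'z) precat_scheme \<Rightarrow> 'o \<Rightarrow> bool" where
  "zero_object C Z \<longleftrightarrow> Z \<in> Obj C \<and>
     (\<forall>X\<in>Obj C. (\<exists>!f. f \<in> Hom C X Z) \<and> (\<exists>!f. f \<in> Hom C Z X))"

definition biproduct :: "('o, 'm, 'z) precat_scheme \<Rightarrow> 'o \<Rightarrow> 'o \<Rightarrow> 'o \<Rightarrow> bool" where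
  "biproduct C X Y Z \<longleftrightarrow>
     (\<exists>i1 \<in> Hom C X Z. \<exists>i2 \<in> Hom C Y Z. \<exists>p1 \<in> Hom C Z X. \<exists>p2 \<in> Hom C Z Y.
        p1 \<cdot>\<^bsub>C\<^esub> i1 = Idn C X \<and> p2 \<cdot>\<^bsub>C\<^esub> i2 = Idn C Y \<and>
        p1 \<cdot>\<^bsub>C\<^esub> i2 = Nul C Y X \<and> p2 \<cdot>\<^bsub>C\<^esub> i1 = Nul C X Y \<and>
        (i1 \<cdot>\<^bsub>C\<^esub> p1) \<boxplus>\<^bsub>C\<^esub> (i2 \<cdot>\<^bsub>C\<^esub> p2) = Idn C Z)"

locale additive_category = category C for C :: "('o, 'm, 'z) precat_scheme" (structure) +
  assumes hom_group: "\<lbrakk>X \<in> Obj C; Y \<in> Obj C\<rbrakk> \<Longrightarrow> comm_group (hom_group C X Y)"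
    and Cmp_Pls_right: "\<lbrakk>f \<in> Hom C X Y; g \<in> Hom C X Y; h \<in> Hom C Y Z\<rbrakk>
                          \<Longrightarrow> h \<cdot> (f \<boxplus> g) = (h \<cdot> f) \<boxplus> (h \<cdot> g)"
    and Cmp_Pls_left: "\<lbrakk>f \<in> Hom C X Y; g \<in> Hom C Y Z; h \<in> Hom C Y Z\<rbrakk>
                          \<Longrightarrow> (g \<boxplus> h) \<cdot> f = (g \<cdot> f) \<boxplus> (h \<cdot> f)"
    and ex_zero: "\<exists>Z. zero_object C Z"
    and ex_biproduct: "\<lbrakk>X \<in> Obj C; Y \<in> Obj C\<rbrakk> \<Longrightarrow> \<exists>Z\<in>Obj C. biproduct C X Y Z"

definition monic :: "('o, 'm, 'z) precat_scheme \<Rightarrow> 'm \<Rightarrow> bool" where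
  "monic C f \<longleftrightarrow> f \<in> Arr C \<and>
     (\<forall>W\<in>Obj C. \<forall>g\<in>Hom C W (Src C f). \<forall>h\<in>Hom C W (Src C f). f \<cdot>\<^bsub>C\<^esub> g = f \<cdot>\<^bsub>C\<^esub> h \<longrightarrow> g = h)"

definition epic :: "('o, 'm, 'z) precat_scheme \<Rightarrow> 'm \<Rightarrow> bool" where
  "epic C f \<longleftrightarrow> f \<in> Arr C \<and>
     (\<forall>W\<in>Obj C. \<forall>g\<in>Hom C (Tgt C f) W. \<forall>h\<in>Hom C (Tgt C f) W. g \<cdot>\<^bsub>C\<^esub> f = h \<cdot>\<^bsub>C\<^esub> f \<longrightarrow> g = h)"

definition is_iso :: "('o, 'm, 'z) precat_scheme \<Rightarrow> 'm \<Rightarrow> bool" where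
  "is_iso C f \<longleftrightarrow> f \<in> Arr C \<and>
     (\<exists>g \<in> Hom C (Tgt C f) (Src C f). g \<cdot>\<^bsub>C\<^esub> f = Idn C (Src C f) \<and> f \<cdot>\<^bsub>C\<^esub> g = Idn C (Tgt C f))"

definition is_kernel :: "('o, 'm, 'z) precat_scheme \<Rightarrow> 'm \<Rightarrow> 'm \<Rightarrow> bool" where
  "is_kernel C f k \<longleftrightarrow> f \<in> Arr C \<and> k \<in> Arr C \<and> Tgt C k = Src C f \<and>
     f \<cdot>\<^bsub>C\<^esub> k = Nul C (Src C k) (Tgt C f) \<and>
     (\<forall>W\<in>Obj C. \<forall>g\<in>Hom C W (Src C f). f \<cdot>\<^bsub>C\<^esub> g = Nul C W (Tgt C f) \<longrightarrow>
        (\<exists>!u. u \<in> Hom C W (Src C k) \<and> k \<cdot>\<^bsub>C\<^esub> u = g))"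

definition is_cokernel :: "('o, 'm, 'z) precat_scheme \<Rightarrow> 'm \<Rightarrow> 'm \<Rightarrow> bool" where
  "is_cokernel C f c \<longleftrightarrow> f \<in> Arr C \<and> c \<in> Arr C \<and> Src C c = Tgt C f \<and>
     c \<cdot>\<^bsub>C\<^esub> f = Nul C (Src C f) (Tgt C c) \<and>
     (\<forall>W\<in>Obj C. \<forall>g\<in>Hom C (Tgt C f) W. g \<cdot>\<^bsub>C\<^esub> f = Nul C (Src C f) W \<longrightarrow>
        (\<exists>!u. u \<in> Hom C (Tgt C c) W \<and> u \<cdot>\<^bsub>C\<^esub> c = g))"

locale abelian_category = additive_category C for C :: "('o, 'm, 'z) precat_scheme" (structure) +
  assumes ex_kernel: "f \<in> Arr C \<Longrightarrow> \<exists>k. is_kernel C f k"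
    and ex_cokernel: "f \<in> Arr C \<Longrightarrow> \<exists>c. is_cokernel C f c"
    and monic_kernel: "monic C f \<Longrightarrow> \<exists>g. is_kernel C g f"
    and epic_cokernel: "epic C f \<Longrightarrow> \<exists>g. is_cokernel C g f"

text \<open>Subobjects are represented by monomorphisms; the image is the kernel of the cokernel.\<close>

definition is_image :: "('o, 'm, 'z) precat_scheme \<Rightarrow> 'm \<Rightarrow> 'm \<Rightarrow> bool" where
  "is_image C f m \<longleftrightarrow> (\<exists>c. is_cokernel C f c \<and> is_kernel C c m)"

definition exact_at :: "('o, 'm, 'z) precat_scheme \<Rightarrow> 'm \<Rightarrow> 'm \<Rightarrow> bool" where
  "exact_at C f g \<longleftrightarrow> (\<exists>m. is_image C f m \<and> is_kernel C g m)"

text \<open>The homology of \<open>\<bullet> \<rightarrow>\<^bsub>f\<^esub> \<bullet> \<rightarrow>\<^bsub>g\<^esub> \<bullet>\<close> is the target of \<open>e\<close>: \<open>z\<close> embeds the cycles (the kernel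
  of \<open>g\<close>), and \<open>e\<close> is the quotient of the cycles by the boundaries.\<close>

definition is_homology :: "('o, 'm, 'z) precat_scheme \<Rightarrow> 'm \<Rightarrow> 'm \<Rightarrow> 'm \<Rightarrow> 'm \<Rightarrow> bool" where
  "is_homology C f g z e \<longleftrightarrow> is_kernel C g z \<and>
     (\<exists>b \<in> Hom C (Src C f) (Src C z). z \<cdot>\<^bsub>C\<^esub> b = f \<and> is_cokernel C b e)"

section \<open>Functors\<close>

record ('o, 'm, 'p, 'n) functr =
  FO :: "'o \<Rightarrow> 'p"
  FM :: "'m \<Rightarrow> 'n"

locale additive_functor =
  fixes C :: "('o, 'm, 'y) precat_scheme" and D :: "('p, 'n, 'z) precat_scheme"
    and F :: "('o, 'm, 'p, 'n) functr"
  assumes FO_Obj: "X \<in> Obj C \<Longrightarrow> FO F X \<in> Obj D"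
    and FM_Hom: "f \<in> Hom C X Y \<Longrightarrow> FM F f \<in> Hom D (FO F X) (FO F Y)"
    and FM_Idn: "X \<in> Obj C \<Longrightarrow> FM F (Idn C X) = Idn D (FO F X)"
    and FM_Cmp: "\<lbrakk>f \<in> Hom C X Y; g \<in> Hom C Y Z\<rbrakk> \<Longrightarrow> FM F (g \<cdot>\<^bsub>C\<^esub> f) = FM F g \<cdot>\<^bsub>D\<^esub> FM F f"
    and FM_Pls: "\<lbrakk>f \<in> Hom C X Y; g \<in> Hom C X Y\<rbrakk> \<Longrightarrow> FM F (f \<boxplus>\<^bsub>C\<^esub> g) = FM F f \<boxplus>\<^bsub>D\<^esub> FM F g"

definition transformation ::
  "('o, 'm, 'y) precat_scheme \<Rightarrow> ('p, 'n, 'z) precat_scheme \<Rightarrow>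
   ('o, 'm, 'p, 'n) functr \<Rightarrow> ('o, 'm, 'p, 'n) functr \<Rightarrow> ('o \<Rightarrow> 'n) \<Rightarrow> bool" where
  "transformation C D F G \<Phi> \<longleftrightarrow>
     (\<forall>X\<in>Obj C. \<Phi> X \<in> Hom D (FO F X) (FO G X)) \<and>
     (\<forall>f\<in>Arr C. \<Phi> (Tgt C f) \<cdot>\<^bsub>D\<^esub> FM F f = FM G f \<cdot>\<^bsub>D\<^esub> \<Phi> (Src C f))"

section \<open>Triangulated categories\<close>

text \<open>The translation functor is an automorphism. Its powers are part of the structure, as a strict
  action of the integers: \<open>ShO C n X\<close> and \<open>ShM C n f\<close> are \<open>X[n]\<close> and \<open>f[n]\<close>.
  A triple \<open>(f, g, h)\<close> in \<open>Dist C\<close> is the distinguished triangle with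
  \<open>f : X \<rightarrow> Y\<close>, \<open>g : Y \<rightarrow> Z\<close>, \<open>h : Z \<rightarrow> X[1]\<close>.\<close>

record ('o, 'm) tricat = "('o, 'm) precat" +
  ShO :: "int \<Rightarrow> 'o \<Rightarrow> 'o"
  ShM :: "int \<Rightarrow> 'm \<Rightarrow> 'm"
  Dist :: "('m \<times> 'm \<times> 'm) set"

definition triangle :: "('o, 'm, 'z) tricat_scheme \<Rightarrow> 'm \<Rightarrow> 'm \<Rightarrow> 'm \<Rightarrow> bool" where
  "triangle C f g h \<longleftrightarrow> f \<in> Arr C \<and> g \<in> Arr C \<and> h \<in> Arr C \<and>
     Tgt C f = Src C g \<and> Tgt C g = Src C h \<and> Tgt C h = ShO C 1 (Src C f)"

locale triangulated_category = additive_category C for C :: "('o, 'm, 'z) tricat_scheme" (structure) +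
  assumes shift_functor: "additive_functor C C \<lparr>FO = ShO C n, FM = ShM C n\<rparr>"
    and ShO_0: "X \<in> Obj C \<Longrightarrow> ShO C 0 X = X"
    and ShO_add: "X \<in> Obj C \<Longrightarrow> ShO C (m + n) X = ShO C m (ShO C n X)"
    and ShM_0: "f \<in> Arr C \<Longrightarrow> ShM C 0 f = f"
    and ShM_add: "f \<in> Arr C \<Longrightarrow> ShM C (m + n) f = ShM C m (ShM C n f)"
    and Dist_triangle: "(f, g, h) \<in> Dist C \<Longrightarrow> triangle C f g h"
    and TR1_iso: "\<lbrakk>(f, g, h) \<in> Dist C; triangle C f' g' h'; is_iso C a; is_iso C b; is_iso C c;
        a \<in> Hom C (Src C f) (Src C f'); b \<in> Hom C (Src C g) (Src C g'); c \<in> Hom C (Src C h) (Src C h');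
        b \<cdot> f = f' \<cdot> a; c \<cdot> g = g' \<cdot> b; ShM C 1 a \<cdot> h = h' \<cdot> c\<rbrakk> \<Longrightarrow> (f', g', h') \<in> Dist C"
    and TR1_id: "\<lbrakk>X \<in> Obj C; zero_object C Z\<rbrakk>
        \<Longrightarrow> (Idn C X, Nul C X Z, Nul C Z (ShO C 1 X)) \<in> Dist C"
    and TR1_cone: "f \<in> Arr C \<Longrightarrow> \<exists>g h. (f, g, h) \<in> Dist C"
    and TR2: "triangle C f g h \<Longrightarrow> (f, g, h) \<in> Dist C \<longleftrightarrow> (g, h, neg C (ShM C 1 f)) \<in> Dist C"
    and TR3: "\<lbrakk>(f, g, h) \<in> Dist C; (f', g', h') \<in> Dist C;
        a \<in> Hom C (Src C f) (Src C f'); b \<in> Hom C (Src C g) (Src C g'); b \<cdot> f = f' \<cdot> a\<rbrakk>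
        \<Longrightarrow> \<exists>c \<in> Hom C (Src C h) (Src C h'). c \<cdot> g = g' \<cdot> b \<and> ShM C 1 a \<cdot> h = h' \<cdot> c"
    and TR4: "\<lbrakk>(f, f', f'') \<in> Dist C; (g, g', g'') \<in> Dist C; Tgt C f = Src C g;
        (g \<cdot> f, k', k'') \<in> Dist C\<rbrakk>
        \<Longrightarrow> \<exists>a \<in> Hom C (Src C f'') (Src C k''). \<exists>b \<in> Hom C (Src C k'') (Src C g'').
              (a, b, ShM C 1 f' \<cdot> g'') \<in> Dist C \<and> a \<cdot> f' = k' \<cdot> g \<and> k'' \<cdot> a = f'' \<and>
              b \<cdot> k' = g' \<and> g'' \<cdot> b = ShM C 1 f \<cdot> k''"

locale homological_functor =
  triangulated_category C + abelian_category A + additive_functor C A H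
  for C :: "('o, 'm, 'y) tricat_scheme" and A :: "('p, 'n, 'z) precat_scheme"
    and H :: "('o, 'm, 'p, 'n) functr" +
  assumes long_exact: "(f, g, h) \<in> Dist C \<Longrightarrow>
      exact_at A (FM H (ShM C n f)) (FM H (ShM C n g)) \<and>
      exact_at A (FM H (ShM C n g)) (FM H (ShM C n h)) \<and>
      exact_at A (FM H (ShM C n h)) (FM H (ShM C (n + 1) f))"

text \<open>The functor \<open>H\<^sub>n\<close>.\<close>

definition shifted ::
  "('o, 'm, 'z) tricat_scheme \<Rightarrow> ('o, 'm, 'p, 'n) functr \<Rightarrow> int \<Rightarrow> ('o, 'm, 'p, 'n) functr" where
  "shifted C H n = \<lparr>FO = \<lambda>X. FO H (ShO C n X), FM = \<lambda>f. FM H (ShM C n f)\<rparr>"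

section \<open>Weight structures\<close>

definition orthogonal :: "('o, 'm, 'z) precat_scheme \<Rightarrow> 'o set \<Rightarrow> 'o set \<Rightarrow> bool" where
  "orthogonal C D E \<longleftrightarrow> (\<forall>X\<in>D. \<forall>Y\<in>E. Hom C X Y = {Nul C X Y})"

definition additive_class :: "('o, 'm, 'z) precat_scheme \<Rightarrow> 'o set \<Rightarrow> bool" where
  "additive_class C S \<longleftrightarrow> S \<subseteq> Obj C \<and> (\<exists>Z\<in>S. zero_object C Z) \<and>
     (\<forall>X\<in>S. \<forall>Y\<in>S. \<exists>Z\<in>S. biproduct C X Y Z)"

definition Karoubi_closed :: "('o, 'm, 'z) precat_scheme \<Rightarrow> 'o set \<Rightarrow> bool" where
  "Karoubi_closed C S \<longleftrightarrow>
     (\<forall>X\<in>S. \<forall>Y\<in>Obj C. (\<exists>s\<in>Hom C Y X. \<exists>r\<in>Hom C X Y. r \<cdot>\<^bsub>C\<^esub> s = Idn C Y) \<longrightarrow> Y \<in> S)"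

record 'o weights =
  Wle :: "'o set"
  Wge :: "'o set"

definition wle :: "('o, 'm, 'z) tricat_scheme \<Rightarrow> 'o weights \<Rightarrow> int \<Rightarrow> 'o set" where
  "wle C w l = ShO C (- l) ` Wle w"

definition wge :: "('o, 'm, 'z) tricat_scheme \<Rightarrow> 'o weights \<Rightarrow> int \<Rightarrow> 'o set" where
  "wge C w l = ShO C (- l) ` Wge w"

locale weight_structure = triangulated_category C for C :: "('o, 'm, 'z) tricat_scheme" +
  fixes w :: "'o weights"
  assumes Wle_additive: "additive_class C (Wle w)"
    and Wge_additive: "additive_class C (Wge w)"
    and Wle_Karoubi: "Karoubi_closed C (Wle w)"
    and Wge_Karoubi: "Karoubi_closed C (Wge w)"
    and Wge_shift: "Wge w \<subseteq> ShO C 1 ` Wge w"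
    and Wle_shift: "ShO C 1 ` Wle w \<subseteq> Wle w"
    and orthogonality: "orthogonal C (Wge w) (ShO C 1 ` Wle w)"
    and decomposition: "X \<in> Obj C \<Longrightarrow> \<exists>A\<in>Wle w. \<exists>B\<in>Wge w.
        \<exists>a \<in> Hom C (ShO C (- 1) B) X. \<exists>b \<in> Hom C X A. \<exists>c \<in> Hom C A B. (a, b, c) \<in> Dist C"

definition bounded_below :: "('o, 'm, 'z) tricat_scheme \<Rightarrow> 'o weights \<Rightarrow> 'o set" where
  "bounded_below C w = (\<Union>i. wge C w i)"

definition bounded_above :: "('o, 'm, 'z) tricat_scheme \<Rightarrow> 'o weights \<Rightarrow> 'o set" where
  "bounded_above C w = (\<Union>i. wle C w i)"

text \<open>A weight decomposition of \<open>X\<close>, written in the rotated form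
  \<open>X \<rightarrow>\<^bsub>g\<^esub> A \<rightarrow>\<^bsub>f\<^esub> B \<rightarrow>\<^bsub>e\<^esub> X[1]\<close>.\<close>

definition weight_decomposition ::
  "('o, 'm, 'z) tricat_scheme \<Rightarrow> 'o weights \<Rightarrow> 'o \<Rightarrow> 'm \<Rightarrow> 'm \<Rightarrow> 'm \<Rightarrow> bool" where
  "weight_decomposition C w X g f e \<longleftrightarrow>
     (g, f, e) \<in> Dist C \<and> Src C g = X \<and> Tgt C g \<in> Wle w \<and> Tgt C f \<in> Wge w"

text \<open>\<open>s\<close> is a possible choice of the map \<open>w\<^sub>\<ge>\<^sub>iX \<rightarrow> X\<close>. It comes from a weight decomposition of
  \<open>X[i-1]\<close>, whose last map goes from \<open>X\<^bsup>w\<ge>i\<^esup>\<close> to \<open>X[i]\<close>.\<close>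

definition weight_truncation ::
  "('o, 'm, 'z) tricat_scheme \<Rightarrow> 'o weights \<Rightarrow> int \<Rightarrow> 'o \<Rightarrow> 'm \<Rightarrow> bool" where
  "weight_truncation C w i X s \<longleftrightarrow>
     (\<exists>g f e. weight_decomposition C w (ShO C (i - 1) X) g f e \<and> s = ShM C (- i) e)"

text \<open>\<open>m\<close> represents the subobject \<open>W\<^sub>i(H)(X)\<close> of \<open>H(X)\<close>. The subobject does not depend on the choice
  of \<open>w\<^sub>\<ge>\<^sub>iX\<close>, so \<open>m\<close> is required to be the image for every choice.\<close>

definition weight_filtration ::
  "('o, 'm, 'y) tricat_scheme \<Rightarrow> 'o weights \<Rightarrow> ('p, 'n, 'z) precat_scheme \<Rightarrow>
   ('o, 'm, 'p, 'n) functr \<Rightarrow> int \<Rightarrow> 'o \<Rightarrow> 'n \<Rightarrow> bool" where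
  "weight_filtration C w A H i X m \<longleftrightarrow> m \<in> Arr A \<and> Tgt A m = FO H X \<and>
     (\<forall>s. weight_truncation C w i X s \<longrightarrow> is_image A (FM H s) m)"

text \<open>The data of a weight Postnikov tower of \<open>X\<close>, with \<open>tw_le k\<close>, \<open>tw_ge k\<close>, \<open>tw_gr k\<close> standing for
  \<open>X\<^bsup>w\<le>k\<^esup>\<close>, \<open>X\<^bsup>w\<ge>k\<^esup>\<close>, \<open>X\<^sup>k\<close>, and with
    \<^item> \<open>tw_g k : X[k] \<rightarrow> X\<^bsup>w\<le>k\<^esup>\<close>, \<open>tw_f k : X\<^bsup>w\<le>k\<^esup> \<rightarrow> X\<^bsup>w\<ge>k+1\<^esup>\<close>, \<open>tw_e k : X\<^bsup>w\<ge>k+1\<^esup> \<rightarrow> X[k+1]\<close>;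
    \<^item> \<open>tw_u k : X\<^bsup>w\<le>k\<^esup>[-1] \<rightarrow> X\<^bsup>w\<le>k-1\<^esup>\<close>, \<open>tw_v k : X\<^bsup>w\<ge>k+1\<^esup>[-1] \<rightarrow> X\<^bsup>w\<ge>k\<^esup>\<close>;
    \<^item> \<open>tw_c k : X\<^bsup>w\<le>k-1\<^esup> \<rightarrow> X\<^sup>k\<close>, \<open>tw_d k : X\<^sup>k \<rightarrow> X\<^bsup>w\<le>k\<^esup>\<close>, \<open>tw_y k : X\<^bsup>w\<ge>k\<^esup> \<rightarrow> X\<^sup>k\<close>.\<close>

record ('o, 'm) tower =
  tw_le :: "int \<Rightarrow> 'o"
  tw_ge :: "int \<Rightarrow> 'o"
  tw_gr :: "int \<Rightarrow> 'o"
  tw_g :: "int \<Rightarrow> 'm"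
  tw_f :: "int \<Rightarrow> 'm"
  tw_e :: "int \<Rightarrow> 'm"
  tw_u :: "int \<Rightarrow> 'm"
  tw_v :: "int \<Rightarrow> 'm"
  tw_c :: "int \<Rightarrow> 'm"
  tw_d :: "int \<Rightarrow> 'm"
  tw_y :: "int \<Rightarrow> 'm"

definition tw_x :: "('o, 'm, 'z) tricat_scheme \<Rightarrow> ('o, 'm) tower \<Rightarrow> int \<Rightarrow> 'm" where
  "tw_x C P k = ShM C (- 1) (tw_f P k \<cdot>\<^bsub>C\<^esub> tw_d P k)"

text \<open>Compatibility of \<open>tw_u\<close> and \<open>tw_v\<close> with \<open>id\<^sub>X\<close> is required only in the squares involving \<open>X\<close>; it
  determines both maps. With the sign conventions of the axioms the remaining square
  (between \<open>X\<^bsup>w\<le>k\<^esup>[-1]\<close> and \<open>X\<^bsup>w\<ge>k\<^esup>\<close>) then anticommutes, because shifting a distinguished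
  triangle by \<open>-1\<close> changes a sign.\<close>

definition weight_tower ::
  "('o, 'm, 'z) tricat_scheme \<Rightarrow> 'o weights \<Rightarrow> 'o \<Rightarrow> ('o, 'm) tower \<Rightarrow> bool" where
  "weight_tower C w X P \<longleftrightarrow> (\<forall>k.
     weight_decomposition C w (ShO C k X) (tw_g P k) (tw_f P k) (tw_e P k) \<and>
     Tgt C (tw_g P k) = tw_le P k \<and> Tgt C (tw_f P k) = tw_ge P (k + 1) \<and>
     tw_u P k \<in> Hom C (ShO C (- 1) (tw_le P k)) (tw_le P (k - 1)) \<and>
     tw_u P k \<cdot>\<^bsub>C\<^esub> ShM C (- 1) (tw_g P k) = tw_g P (k - 1) \<and>
     tw_v P k \<in> Hom C (ShO C (- 1) (tw_ge P (k + 1))) (tw_ge P k) \<and>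
     tw_e P (k - 1) \<cdot>\<^bsub>C\<^esub> tw_v P k = ShM C (- 1) (tw_e P k) \<and>
     tw_gr P k \<in> Wle w \<inter> Wge w \<and>
     tw_c P k \<in> Hom C (tw_le P (k - 1)) (tw_gr P k) \<and>
     tw_d P k \<in> Hom C (tw_gr P k) (tw_le P k) \<and>
     tw_y P k \<in> Hom C (tw_ge P k) (tw_gr P k) \<and>
     (tw_u P k, tw_c P k, tw_d P k) \<in> Dist C \<and>
     (tw_x C P k, tw_v P k, tw_y P k) \<in> Dist C \<and>
     tw_c P k = tw_y P k \<cdot>\<^bsub>C\<^esub> tw_f P (k - 1))"

text \<open>The boundary \<open>h\<^sup>k : X\<^sup>k \<rightarrow> X\<^bsup>k+1\<^esup>\<close> of the weight complex \<open>(tw_gr P, tw_h C P)\<close>.\<close>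

definition tw_h :: "('o, 'm, 'z) tricat_scheme \<Rightarrow> ('o, 'm) tower \<Rightarrow> int \<Rightarrow> 'm" where
  "tw_h C P k = tw_c P (k + 1) \<cdot>\<^bsub>C\<^esub> tw_d P k"

text \<open>An extension of \<open>g : X \<rightarrow> X'\<close> to the part of the towers that enters the exact couple: maps
  \<open>\<beta> k : X\<^bsup>w\<ge>k\<^esup> \<rightarrow> X'\<^bsup>w\<ge>k\<^esup>\<close> and \<open>\<alpha> k : X\<^sup>k \<rightarrow> X'\<^sup>k\<close> forming morphisms of the triangles
  \<open>X\<^sup>k[-1] \<rightarrow> X\<^bsup>w\<ge>k+1\<^esup>[-1] \<rightarrow> X\<^bsup>w\<ge>k\<^esup> \<rightarrow> X\<^sup>k\<close>.\<close>

definition tower_extension ::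
  "('o, 'm, 'z) tricat_scheme \<Rightarrow> ('o, 'm) tower \<Rightarrow> ('o, 'm) tower \<Rightarrow> 'm \<Rightarrow>
   (int \<Rightarrow> 'm) \<Rightarrow> (int \<Rightarrow> 'm) \<Rightarrow> bool" where
  "tower_extension C P P' g \<beta> \<alpha> \<longleftrightarrow> (\<forall>k.
     \<beta> k \<in> Hom C (tw_ge P k) (tw_ge P' k) \<and>
     \<alpha> k \<in> Hom C (tw_gr P k) (tw_gr P' k) \<and>
     tw_e P' (k - 1) \<cdot>\<^bsub>C\<^esub> \<beta> k = ShM C k g \<cdot>\<^bsub>C\<^esub> tw_e P (k - 1) \<and>
     ShM C (- 1) (\<beta> (k + 1)) \<cdot>\<^bsub>C\<^esub> tw_x C P k = tw_x C P' k \<cdot>\<^bsub>C\<^esub> ShM C (- 1) (\<alpha> k) \<and>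
     \<beta> k \<cdot>\<^bsub>C\<^esub> tw_v P k = tw_v P' k \<cdot>\<^bsub>C\<^esub> ShM C (- 1) (\<beta> (k + 1)) \<and>
     \<alpha> k \<cdot>\<^bsub>C\<^esub> tw_y P k = tw_y P' k \<cdot>\<^bsub>C\<^esub> \<beta> k)"

section \<open>Exact couples and spectral sequences\<close>

record ('p, 'n) couple =
  cD :: "int \<Rightarrow> int \<Rightarrow> 'p"
  cE :: "int \<Rightarrow> int \<Rightarrow> 'p"
  ci :: "int \<Rightarrow> int \<Rightarrow> 'n"
  cj :: "int \<Rightarrow> int \<Rightarrow> 'n"
  ck :: "int \<Rightarrow> int \<Rightarrow> 'n"

text \<open>Maps are indexed by the bidegree of their source. In the \<open>r\<close>-th couple of a sequence of derived
  couples, \<open>i\<close>, \<open>j\<close>, \<open>k\<close> have bidegrees \<open>(-1, 1)\<close>, \<open>(r-1, 1-r)\<close>, \<open>(1, 0)\<close>.\<close>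

definition exact_couple ::
  "('p, 'n, 'z) precat_scheme \<Rightarrow> nat \<Rightarrow> ('p, 'n) couple \<Rightarrow> bool" where
  "exact_couple A r K \<longleftrightarrow> (\<forall>p q.
     cD K p q \<in> Obj A \<and> cE K p q \<in> Obj A \<and>
     ci K p q \<in> Hom A (cD K p q) (cD K (p - 1) (q + 1)) \<and>
     cj K p q \<in> Hom A (cD K p q) (cE K (p + int r - 1) (q - int r + 1)) \<and>
     ck K p q \<in> Hom A (cE K p q) (cD K (p + 1) q) \<and>
     exact_at A (ck K (p - 1) q) (ci K p q) \<and>
     exact_at A (ci K (p + 1) (q - 1)) (cj K p q) \<and>
     exact_at A (cj K (p - int r + 1) (q + int r - 1)) (ck K p q))"

definition couple_diff ::
  "('p, 'n, 'z) precat_scheme \<Rightarrow> ('p, 'n) couple \<Rightarrow> int \<Rightarrow> int \<Rightarrow> 'n" where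
  "couple_diff A K p q = cj K (p + 1) q \<cdot>\<^bsub>A\<^esub> ck K p q"

text \<open>\<open>K'\<close> is the derived couple of \<open>K\<close> (the \<open>r\<close>-th couple): \<open>D' = Im i\<close>, with \<open>i\<close> factored as \<open>s \<circ> t\<close>
  through \<open>D'\<close>, and \<open>E'\<close> is the homology of \<open>E\<close> with respect to \<open>j \<circ> k\<close>, exhibited by \<open>z\<close> and \<open>e\<close>;
  \<open>i'\<close> is the restriction of \<open>i\<close>, \<open>j' (i x) = [j x]\<close>, and \<open>k' [x] = k x\<close>.\<close>

definition derived_couple ::
  "('p, 'n, 'z) precat_scheme \<Rightarrow> nat \<Rightarrow> ('p, 'n) couple \<Rightarrow> ('p, 'n) couple \<Rightarrow>
   (int \<Rightarrow> int \<Rightarrow> 'n) \<Rightarrow> (int \<Rightarrow> int \<Rightarrow> 'n) \<Rightarrow> bool" where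
  "derived_couple A r K K' z e \<longleftrightarrow>
     (\<forall>p q. is_homology A (couple_diff A K (p - int r) (q + int r - 1)) (couple_diff A K p q)
              (z p q) (e p q) \<and> Tgt A (e p q) = cE K' p q) \<and>
     (\<exists>s t. \<forall>p q.
        s p q \<in> Hom A (cD K' p q) (cD K p q) \<and>
        t p q \<in> Hom A (cD K p q) (cD K' (p - 1) (q + 1)) \<and>
        is_image A (ci K p q) (s (p - 1) (q + 1)) \<and>
        s (p - 1) (q + 1) \<cdot>\<^bsub>A\<^esub> t p q = ci K p q \<and>
        ci K' p q = t p q \<cdot>\<^bsub>A\<^esub> s p q \<and>
        (\<exists>l \<in> Hom A (cD K p q) (Src A (z (p + int r - 1) (q - int r + 1))).
           z (p + int r - 1) (q - int r + 1) \<cdot>\<^bsub>A\<^esub> l = cj K p q \<and>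
           cj K' (p - 1) (q + 1) \<cdot>\<^bsub>A\<^esub> t p q = e (p + int r - 1) (q - int r + 1) \<cdot>\<^bsub>A\<^esub> l) \<and>
        s (p + 1) q \<cdot>\<^bsub>A\<^esub> ck K' p q \<cdot>\<^bsub>A\<^esub> e p q = ck K p q \<cdot>\<^bsub>A\<^esub> z p q)"

text \<open>A spectral sequence has pages \<open>E\<^sub>r\<close> for \<open>r \<ge> 1\<close> (the values at \<open>r = 0\<close> are irrelevant),
  differentials of bidegree \<open>(r, 1-r)\<close>, and an identification of \<open>E\<^bsub>r+1\<^esub>\<close> with the homology of
  \<open>(E\<^sub>r, d\<^sub>r)\<close>, given by the inclusion \<open>sZ\<close> of the cycles into \<open>E\<^sub>r\<close> and the projection \<open>sQ\<close> of the
  cycles onto \<open>E\<^bsub>r+1\<^esub>\<close>.\<close>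

record ('p, 'n) specseq =
  sE :: "nat \<Rightarrow> int \<Rightarrow> int \<Rightarrow> 'p"
  sd :: "nat \<Rightarrow> int \<Rightarrow> int \<Rightarrow> 'n"
  sZ :: "nat \<Rightarrow> int \<Rightarrow> int \<Rightarrow> 'n"
  sQ :: "nat \<Rightarrow> int \<Rightarrow> int \<Rightarrow> 'n"

definition spectral_sequence ::
  "('p, 'n, 'z) precat_scheme \<Rightarrow> ('p, 'n) specseq \<Rightarrow> bool" where
  "spectral_sequence A T \<longleftrightarrow> (\<forall>r\<ge>1. \<forall>p q.
     sE T r p q \<in> Obj A \<and>
     sd T r p q \<in> Hom A (sE T r p q) (sE T r (p + int r) (q - int r + 1)) \<and>
     sd T r (p + int r) (q - int r + 1) \<cdot>\<^bsub>A\<^esub> sd T r p q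
       = Nul A (sE T r p q) (sE T r (p + 2 * int r) (q - 2 * int r + 2)) \<and>
     is_homology A (sd T r (p - int r) (q + int r - 1)) (sd T r p q) (sZ T r p q) (sQ T r p q) \<and>
     Tgt A (sQ T r p q) = sE T (Suc r) p q)"

definition comes_from_couple ::
  "('p, 'n, 'z) precat_scheme \<Rightarrow> ('p, 'n) couple \<Rightarrow> ('p, 'n) specseq \<Rightarrow> bool" where
  "comes_from_couple A K T \<longleftrightarrow>
     (\<exists>Ks. Ks 1 = K \<and>
       (\<forall>r\<ge>1. exact_couple A r (Ks r) \<and>
          derived_couple A r (Ks r) (Ks (Suc r)) (sZ T r) (sQ T r) \<and>
          (\<forall>p q. sE T r p q = cE (Ks r) p q \<and> sd T r p q = couple_diff A (Ks r) p q)))"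

text \<open>A morphism of spectral sequences defined from the page \<open>r\<^sub>0\<close> on; \<open>\<phi> (r+1)\<close> is the map induced by
  \<open>\<phi> r\<close> on homology.\<close>

definition ss_morphism ::
  "('p, 'n, 'z) precat_scheme \<Rightarrow> nat \<Rightarrow> ('p, 'n) specseq \<Rightarrow> ('p, 'n) specseq \<Rightarrow>
   (nat \<Rightarrow> int \<Rightarrow> int \<Rightarrow> 'n) \<Rightarrow> bool" where
  "ss_morphism A r0 T T' \<phi> \<longleftrightarrow> (\<forall>r\<ge>r0. \<forall>p q.
     \<phi> r p q \<in> Hom A (sE T r p q) (sE T' r p q) \<and>
     \<phi> r (p + int r) (q - int r + 1) \<cdot>\<^bsub>A\<^esub> sd T r p q = sd T' r p q \<cdot>\<^bsub>A\<^esub> \<phi> r p q \<and>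
     (\<exists>\<zeta> \<in> Hom A (Src A (sZ T r p q)) (Src A (sZ T' r p q)).
        sZ T' r p q \<cdot>\<^bsub>A\<^esub> \<zeta> = \<phi> r p q \<cdot>\<^bsub>A\<^esub> sZ T r p q \<and>
        sQ T' r p q \<cdot>\<^bsub>A\<^esub> \<zeta> = \<phi> (Suc r) p q \<cdot>\<^bsub>A\<^esub> sQ T r p q))"

text \<open>\<open>T\<close> converges to the graded object \<open>M\<close> with the decreasing filtration \<open>F\<close>, where \<open>F n p\<close> embeds
  \<open>F\<^sub>pM\<^sub>n\<close> into \<open>M\<^sub>n\<close>: the filtration of each \<open>M\<^sub>n\<close> is finite, each \<open>E\<^sub>r\<^bsup>pq\<^esup>\<close> is eventually stationary,
  and the stable value is isomorphic to \<open>F\<^sub>pM\<^bsub>p+q\<^esub> / F\<^bsub>p+1\<^esub>M\<^bsub>p+q\<^esub>\<close>.\<close>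

definition converges ::
  "('p, 'n, 'z) precat_scheme \<Rightarrow> ('p, 'n) specseq \<Rightarrow> (int \<Rightarrow> 'p) \<Rightarrow> (int \<Rightarrow> int \<Rightarrow> 'n) \<Rightarrow> bool" where
  "converges A T M F \<longleftrightarrow>
     (\<forall>n p. monic A (F n p) \<and> Tgt A (F n p) = M n \<and>
        (\<exists>\<iota> \<in> Hom A (Src A (F n (p + 1))) (Src A (F n p)). F n p \<cdot>\<^bsub>A\<^esub> \<iota> = F n (p + 1))) \<and>
     (\<forall>n. (\<exists>a. \<forall>p\<le>a. is_iso A (F n p)) \<and> (\<exists>b. \<forall>p\<ge>b. zero_object A (Src A (F n p)))) \<and>
     (\<forall>p q. \<exists>r0\<ge>1.
        (\<forall>r\<ge>r0. sd T r p q = Nul A (sE T r p q) (sE T r (p + int r) (q - int r + 1)) \<and>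
           sd T r (p - int r) (q + int r - 1)
             = Nul A (sE T r (p - int r) (q + int r - 1)) (sE T r p q)) \<and>
        (\<exists>\<iota> \<in> Hom A (Src A (F (p + q) (p + 1))) (Src A (F (p + q) p)).
           F (p + q) p \<cdot>\<^bsub>A\<^esub> \<iota> = F (p + q) (p + 1) \<and>
           (\<exists>\<epsilon> \<in> Hom A (Src A (F (p + q) p)) (sE T r0 p q). is_cokernel A \<iota> \<epsilon>)))"

section \<open>Weight spectral sequences\<close>

text \<open>The exact couple obtained by applying \<open>H\<close> to the triangles
  \<open>X\<^sup>k[-1] \<rightarrow> X\<^bsup>w\<ge>k+1\<^esup>[-1] \<rightarrow> X\<^bsup>w\<ge>k\<^esup> \<rightarrow> X\<^sup>k\<close>. The shifts account for the \<open>[-1]\<close> in the sources and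
  targets of \<open>tw_v\<close> and \<open>tw_x\<close>.\<close>

definition weight_couple ::
  "('o, 'm, 'z) tricat_scheme \<Rightarrow> ('o, 'm, 'p, 'n) functr \<Rightarrow> ('o, 'm) tower \<Rightarrow> ('p, 'n) couple" where
  "weight_couple C H P = \<lparr>
     cD = \<lambda>p q. FO H (ShO C q (tw_ge P p)),
     cE = \<lambda>p q. FO H (ShO C q (tw_gr P p)),
     ci = \<lambda>p q. FM H (ShM C (q + 1) (tw_v P (p - 1))),
     cj = \<lambda>p q. FM H (ShM C q (tw_y P p)),
     ck = \<lambda>p q. FM H (ShM C (q + 1) (tw_x C P p))\<rparr>"

definition weight_ss ::
  "('o, 'm, 'y) tricat_scheme \<Rightarrow> ('p, 'n, 'z) precat_scheme \<Rightarrow> ('o, 'm, 'p, 'n) functr \<Rightarrow>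
   ('o, 'm) tower \<Rightarrow> ('p, 'n) specseq \<Rightarrow> bool" where
  "weight_ss C A H P T \<longleftrightarrow> spectral_sequence A T \<and> comes_from_couple A (weight_couple C H P) T"

text \<open>\<open>\<phi> : T(H, X) \<rightarrow> T(H', X)\<close> is the morphism induced by the transformation \<open>\<Phi> : H \<rightarrow> H'\<close>
  (for one tower \<open>P\<close>): on \<open>E\<^sub>1\<^bsup>pq\<^esup> = H\<^sub>q(X\<^sup>p)\<close> it is given by \<open>\<Phi>\<close>.\<close>

definition induced_by_transformation ::
  "('o, 'm, 'y) tricat_scheme \<Rightarrow> ('p, 'n, 'z) precat_scheme \<Rightarrow> ('o, 'm) tower \<Rightarrow>
   ('p, 'n) specseq \<Rightarrow> ('p, 'n) specseq \<Rightarrow> ('o \<Rightarrow> 'n) \<Rightarrow> (nat \<Rightarrow> int \<Rightarrow> int \<Rightarrow> 'n) \<Rightarrow> bool" where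
  "induced_by_transformation C A P T T' \<Phi> \<phi> \<longleftrightarrow>
     ss_morphism A 1 T T' \<phi> \<and> (\<forall>p q. \<phi> 1 p q = \<Phi> (ShO C q (tw_gr P p)))"

text \<open>\<open>\<phi> : T(H, X) \<rightarrow> T(H, X')\<close>, defined from \<open>E\<^sub>2\<close> on, is the morphism induced by \<open>g : X \<rightarrow> X'\<close>:
  it continues, on the pages \<open>r \<ge> 2\<close>, the maps \<open>H\<^sub>q(\<alpha>\<^sup>p)\<close> on \<open>E\<^sub>1\<close> for every extension
  \<open>(\<beta>, \<alpha>)\<close> of \<open>g\<close> to the towers.\<close>

definition induced_by_morphism ::
  "('o, 'm, 'y) tricat_scheme \<Rightarrow> ('p, 'n, 'z) precat_scheme \<Rightarrow> ('o, 'm, 'p, 'n) functr \<Rightarrow>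
   ('o, 'm) tower \<Rightarrow> ('o, 'm) tower \<Rightarrow> ('p, 'n) specseq \<Rightarrow> ('p, 'n) specseq \<Rightarrow>
   'm \<Rightarrow> (nat \<Rightarrow> int \<Rightarrow> int \<Rightarrow> 'n) \<Rightarrow> bool" where
  "induced_by_morphism C A H P P' T T' g \<phi> \<longleftrightarrow>
     ss_morphism A 2 T T' \<phi> \<and>
     (\<forall>\<beta> \<alpha>. tower_extension C P P' g \<beta> \<alpha> \<longrightarrow>
        ss_morphism A 1 T T' (\<phi>(1 := \<lambda>p q. FM H (ShM C q (\<alpha> p)))))"

end

theory Submission
  imports Defs
begin

text \<open>
  Exactness in an abelian category is tested on generalized elements \<open>W \<rightarrow> X\<close>, where \<open>W\<close> may be
  replaced by the source of an epimorphism onto it; so derived couples can be handled by the usual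
  diagram chases. For large \<open>r\<close> the map \<open>k\<close> of the \<open>r\<close>-th derived couple vanishes at the place \<open>(p, q)\<close>,
  hence \<open>E\<^sub>r\<^bsup>pq\<^esup>\<close> is the cokernel of \<open>i\<close> between two copies of \<open>D\<^sub>r\<close>, and these are the images of
  \<open>H\<^sub>q(X\<^bsup>w\<ge>p\<^esup>)\<close> and \<open>H\<^bsub>q-1\<^esub>(X\<^bsup>w\<ge>p+1\<^esup>)\<close> in \<open>H\<^bsub>p+q\<^esub>(X)\<close>. Orthogonality extends a morphism
  \<open>X \<rightarrow> X'\<close> to the towers and shows that two extensions differ on the weight complexes by
  \<open>h' \<circ> t + s \<circ> h\<close>, so that they agree from the second page on.
\<close>

section \<open>Generalized elements in abelian categories\<close>

text \<open>The obstacle in II is that the tower is arbitrary: even for bounded \<open>X\<close> the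
  objects \<open>tw_ge P k\<close> need not become zero or stabilize, so the exact couple need not
  be bounded in the textbook sense. What survives concerns single maps: far up, \<open>i\<close>
  itself is zero, and far down, everything that dies in \<open>H(X)\<close> is killed by one
  application of \<open>i\<close>. Derived couples replace \<open>D\<close> by iterated images of
  \<open>i\<close>, and on these images the weak conditions suffice. Kernels, images, homology
  objects and pages are arbitrary choices. Therefore maps on later pages come from universal
  properties, and equalities between them from cancelling epimorphisms and monomorphisms. In IV the
  map on the first page depends on an extension of \<open>g\<close> to the towers, which is not
  unique since third maps of triangles are not. The difference of two extensions need not be a chain
  homotopy in the usual sense, but one summand vanishes on cycles and the other lands in boundaries,
  so homology does not see it.\<close>

context category
begin

declare Src_Obj [simp] Tgt_Obj [simp]

lemma in_Hom: "f \<in> Hom C X Y \<longleftrightarrow> f \<in> Arr C \<and> Src C f = X \<and> Tgt C f = Y"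
  by (simp add: Hom_def)

lemma Hom_Obj: "f \<in> Hom C X Y \<Longrightarrow> X \<in> Obj C" "f \<in> Hom C X Y \<Longrightarrow> Y \<in> Obj C"
  using Src_Obj Tgt_Obj by (auto simp: in_Hom)

lemma Idn_simps [simp]:
  assumes "X \<in> Obj C"
  shows "Idn C X \<in> Arr C" "Src C (Idn C X) = X" "Tgt C (Idn C X) = X"
  using Idn_Hom[OF assms] by (auto simp: in_Hom)

lemma Cmp_simps [simp]:
  assumes "f \<in> Arr C" "g \<in> Arr C" "Tgt C f = Src C g"
  shows "g \<cdot> f \<in> Arr C" "Src C (g \<cdot> f) = Src C f" "Tgt C (g \<cdot> f) = Tgt C g"
  using Cmp_Hom[of f "Src C f" "Src C g" g "Tgt C g"] assms by (auto simp: in_Hom)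

lemma assoc [simp]:
  assumes "f \<in> Arr C" "g \<in> Arr C" "h \<in> Arr C" "Tgt C f = Src C g" "Tgt C g = Src C h"
  shows "(h \<cdot> g) \<cdot> f = h \<cdot> (g \<cdot> f)"
  using assms Cmp_assoc[of f "Src C f" "Tgt C f" g "Tgt C g" h "Tgt C h"] by (simp add: in_Hom)

lemma Cmp_Idn [simp]:
  assumes "f \<in> Arr C"
  shows "Src C f = X \<Longrightarrow> f \<cdot> Idn C X = f" "Tgt C f = Y \<Longrightarrow> Idn C Y \<cdot> f = f"
  using assms Cmp_Idn_right Cmp_Idn_left by (auto simp: in_Hom)

text \<open>To be used with \<open>THEN\<close>: composites are kept right-nested, so that an equation \<open>a \<cdot> b = c\<close> does not
  apply to \<open>a \<cdot> (b \<cdot> x)\<close>.\<close>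

lemma pull:
  assumes "a \<cdot> b = c" "a \<in> Arr C" "b \<in> Arr C" "x \<in> Arr C" "Tgt C x = Src C b" "Tgt C b = Src C a"
  shows "a \<cdot> (b \<cdot> x) = c \<cdot> x"
  using assms assoc by metis

lemma monicD:
  assumes "monic C m" "m \<cdot> g = m \<cdot> h" "g \<in> Arr C" "h \<in> Arr C"
    "Src C g = Src C h" "Tgt C g = Src C m" "Tgt C h = Src C m"
  shows "g = h"
proof -
  have "g \<in> Hom C (Src C h) (Src C m)" "h \<in> Hom C (Src C h) (Src C m)" "Src C h \<in> Obj C"
    using assms Src_Obj by (auto simp: in_Hom)
  then show ?thesis
    using assms(1,2) unfolding monic_def by blast
qed

lemma epicD:
  assumes "epic C e" "g \<cdot> e = h \<cdot> e" "g \<in> Arr C" "h \<in> Arr C"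
    "Tgt C g = Tgt C h" "Src C g = Tgt C e" "Src C h = Tgt C e"
  shows "g = h"
proof -
  have "g \<in> Hom C (Tgt C e) (Tgt C h)" "h \<in> Hom C (Tgt C e) (Tgt C h)" "Tgt C h \<in> Obj C"
    using assms Tgt_Obj by (auto simp: in_Hom)
  then show ?thesis
    using assms(1,2) unfolding epic_def by blast
qed

lemma monic_Arr: "monic C m \<Longrightarrow> m \<in> Arr C"
  by (simp add: monic_def)

lemma epic_Arr: "epic C m \<Longrightarrow> m \<in> Arr C"
  by (simp add: epic_def)

lemma epic_Cmp:
  assumes "epic C e" "epic C e'" "Tgt C e = Src C e'"
  shows "epic C (e' \<cdot> e)"
proof -
  have "g = h" if "W \<in> Obj C" "g \<in> Hom C (Tgt C e') W" "h \<in> Hom C (Tgt C e') W"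
      "g \<cdot> (e' \<cdot> e) = h \<cdot> (e' \<cdot> e)" for W g h
  proof -
    have "(g \<cdot> e') \<cdot> e = (h \<cdot> e') \<cdot> e"
      using that assms by (simp add: epic_Arr in_Hom)
    then have "g \<cdot> e' = h \<cdot> e'"
      using that assms by - (rule epicD[OF assms(1)]; auto simp: epic_Arr in_Hom)
    then show ?thesis
      using that assms by - (rule epicD[OF assms(2)]; auto simp: epic_Arr in_Hom)
  qed
  then show ?thesis
    using assms unfolding epic_def by simp
qed

lemma monic_Cmp:
  assumes "monic C e" "monic C e'" "Tgt C e = Src C e'"
  shows "monic C (e' \<cdot> e)"
proof -
  have "g = h" if "W \<in> Obj C" "g \<in> Hom C W (Src C e)" "h \<in> Hom C W (Src C e)"
      "(e' \<cdot> e) \<cdot> g = (e' \<cdot> e) \<cdot> h" for W g h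
  proof -
    have "e' \<cdot> (e \<cdot> g) = e' \<cdot> (e \<cdot> h)"
      using that assms by (simp add: monic_Arr in_Hom)
    then have "e \<cdot> g = e \<cdot> h"
      using that assms by - (rule monicD[OF assms(2)]; auto simp: monic_Arr in_Hom)
    then show ?thesis
      using that assms by - (rule monicD[OF assms(1)]; auto simp: monic_Arr in_Hom)
  qed
  then show ?thesis
    using assms unfolding monic_def by simp
qed

lemma epic_Idn: "X \<in> Obj C \<Longrightarrow> epic C (Idn C X)"
  unfolding epic_def by (auto simp: in_Hom)

lemma monic_Idn: "X \<in> Obj C \<Longrightarrow> monic C (Idn C X)"
  unfolding monic_def by (auto simp: in_Hom)

end

section \<open>Additive categories: arithmetic in Hom groups, kernels and cokernels\<close>

context additive_category
begin

lemma Nul_simps [simp]: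
  assumes "X \<in> Obj C" "Y \<in> Obj C"
  shows "Nul C X Y \<in> Arr C" "Src C (Nul C X Y) = X" "Tgt C (Nul C X Y) = Y"
proof -
  interpret G: comm_group "hom_group C X Y" by (rule hom_group[OF assms])
  show "Nul C X Y \<in> Arr C" "Src C (Nul C X Y) = X" "Tgt C (Nul C X Y) = Y"
    using G.one_closed by (auto simp: hom_group_def in_Hom)
qed

lemma Pls_simps [simp]:
  assumes "f \<in> Arr C" "g \<in> Arr C" "Src C g = Src C f" "Tgt C g = Tgt C f"
  shows "f \<boxplus> g \<in> Arr C" "Src C (f \<boxplus> g) = Src C f" "Tgt C (f \<boxplus> g) = Tgt C f"
proof -
  interpret G: comm_group "hom_group C (Src C f) (Tgt C f)"
    using assms Src_Obj Tgt_Obj by (intro hom_group) auto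
  show "f \<boxplus> g \<in> Arr C" "Src C (f \<boxplus> g) = Src C f" "Tgt C (f \<boxplus> g) = Tgt C f"
    using G.m_closed[of f g] assms by (auto simp: hom_group_def in_Hom)
qed

lemma neg_simps [simp]:
  assumes "f \<in> Arr C"
  shows "neg C f \<in> Arr C" "Src C (neg C f) = Src C f" "Tgt C (neg C f) = Tgt C f"
proof -
  interpret G: comm_group "hom_group C (Src C f) (Tgt C f)"
    using assms Src_Obj Tgt_Obj by (intro hom_group) auto
  show "neg C f \<in> Arr C" "Src C (neg C f) = Src C f" "Tgt C (neg C f) = Tgt C f"
    using G.inv_closed[of f] assms unfolding neg_def by (auto simp: hom_group_def in_Hom)
qed

lemma Pls_assoc:
  assumes "f \<in> Arr C" "g \<in> Arr C" "h \<in> Arr C" "Src C g = Src C f" "Tgt C g = Tgt C f"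
    "Src C h = Src C f" "Tgt C h = Tgt C f"
  shows "(f \<boxplus> g) \<boxplus> h = f \<boxplus> (g \<boxplus> h)"
proof -
  interpret G: comm_group "hom_group C (Src C f) (Tgt C f)"
    using assms Src_Obj Tgt_Obj by (intro hom_group) auto
  show ?thesis
    using G.m_assoc[of f g h] assms by (auto simp: hom_group_def in_Hom)
qed

lemma Pls_comm:
  assumes "f \<in> Arr C" "g \<in> Arr C" "Src C g = Src C f" "Tgt C g = Tgt C f"
  shows "f \<boxplus> g = g \<boxplus> f"
proof -
  interpret G: comm_group "hom_group C (Src C f) (Tgt C f)"
    using assms Src_Obj Tgt_Obj by (intro hom_group) auto
  show ?thesis
    using G.m_comm[of f g] assms by (auto simp: hom_group_def in_Hom)
qed

lemma Pls_Nul [simp]: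
  assumes "f \<in> Arr C" "Src C f = X" "Tgt C f = Y"
  shows "f \<boxplus> Nul C X Y = f" "Nul C X Y \<boxplus> f = f"
proof -
  interpret G: comm_group "hom_group C X Y"
    using assms Src_Obj Tgt_Obj by (intro hom_group) auto
  show "f \<boxplus> Nul C X Y = f" "Nul C X Y \<boxplus> f = f"
    using G.l_one[of f] G.r_one[of f] assms by (auto simp: hom_group_def in_Hom)
qed

lemma Pls_neg [simp]:
  assumes "f \<in> Arr C"
  shows "f \<boxplus> neg C f = Nul C (Src C f) (Tgt C f)" "neg C f \<boxplus> f = Nul C (Src C f) (Tgt C f)"
proof -
  interpret G: comm_group "hom_group C (Src C f) (Tgt C f)"
    using assms Src_Obj Tgt_Obj by (intro hom_group) auto
  show "f \<boxplus> neg C f = Nul C (Src C f) (Tgt C f)" "neg C f \<boxplus> f = Nul C (Src C f) (Tgt C f)"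
    using G.r_inv[of f] G.l_inv[of f] assms unfolding neg_def by (auto simp: hom_group_def in_Hom)
qed

lemma Cmp_Pls:
  assumes "f \<in> Arr C" "g \<in> Arr C" "h \<in> Arr C" "Src C g = Src C f" "Tgt C g = Tgt C f"
  shows "Src C h = Tgt C f \<Longrightarrow> h \<cdot> (f \<boxplus> g) = (h \<cdot> f) \<boxplus> (h \<cdot> g)"
    "Tgt C h = Src C f \<Longrightarrow> (f \<boxplus> g) \<cdot> h = (f \<cdot> h) \<boxplus> (g \<cdot> h)"
  using assms Cmp_Pls_right[of f "Src C f" "Tgt C f" g h "Tgt C h"]
    Cmp_Pls_left[of h "Src C h" "Src C f" f "Tgt C f" g] by (auto simp: in_Hom)

lemma Pls_cancel:
  assumes "f \<in> Arr C" "g \<in> Arr C" "h \<in> Arr C" "Src C g = Src C f" "Tgt C g = Tgt C f"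
    "Src C h = Src C f" "Tgt C h = Tgt C f"
  shows "f \<boxplus> g = f \<boxplus> h \<longleftrightarrow> g = h"
proof -
  interpret G: comm_group "hom_group C (Src C f) (Tgt C f)"
    using assms Src_Obj Tgt_Obj by (intro hom_group) auto
  show ?thesis
    using G.right_cancel[of f g h] Pls_comm[of f g] Pls_comm[of f h] assms by (auto simp: hom_group_def in_Hom)
qed

lemma Nul_unique:
  assumes "f \<in> Arr C" "f \<boxplus> f = f"
  shows "f = Nul C (Src C f) (Tgt C f)"
  using Pls_cancel[of f f "Nul C (Src C f) (Tgt C f)"] assms by simp

lemma Cmp_Nul [simp]:
  assumes "g \<in> Arr C" "Src C g = Y" "X \<in> Obj C"
  shows "g \<cdot> Nul C X Y = Nul C X (Tgt C g)"
proof -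
  have Y: "Y \<in> Obj C" using assms Src_Obj by auto
  have "g \<cdot> Nul C X Y = g \<cdot> (Nul C X Y \<boxplus> Nul C X Y)"
    using assms Y by simp
  also have "\<dots> = (g \<cdot> Nul C X Y) \<boxplus> (g \<cdot> Nul C X Y)"
    using assms Y by (intro Cmp_Pls) auto
  finally show ?thesis
    using Nul_unique[of "g \<cdot> Nul C X Y"] assms Y by simp
qed

lemma Nul_Cmp [simp]:
  assumes "g \<in> Arr C" "Tgt C g = Y" "Z \<in> Obj C"
  shows "Nul C Y Z \<cdot> g = Nul C (Src C g) Z"
proof -
  have Y: "Y \<in> Obj C" using assms Tgt_Obj by auto
  have "Nul C Y Z \<cdot> g = (Nul C Y Z \<boxplus> Nul C Y Z) \<cdot> g"
    using assms Y by simp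
  also have "\<dots> = (Nul C Y Z \<cdot> g) \<boxplus> (Nul C Y Z \<cdot> g)"
    using assms Y by (intro Cmp_Pls) auto
  finally show ?thesis
    using Nul_unique[of "Nul C Y Z \<cdot> g"] assms Y by simp
qed

lemma eq_neg:
  assumes "f \<in> Arr C" "g \<in> Arr C" "Src C g = Src C f" "Tgt C g = Tgt C f"
    "f \<boxplus> g = Nul C (Src C f) (Tgt C f)"
  shows "g = neg C f"
  using Pls_cancel[of f g "neg C f"] assms by simp

lemma eq_if_diff_Nul:
  assumes "f \<in> Arr C" "g \<in> Arr C" "Src C g = Src C f" "Tgt C g = Tgt C f"
    "f \<boxplus> neg C g = Nul C (Src C f) (Tgt C f)"
  shows "f = g"
proof -
  have "neg C g \<boxplus> f = neg C g \<boxplus> g"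
    using assms Pls_comm[of f "neg C g"] by simp
  then show ?thesis
    using Pls_cancel[of "neg C g" f g] assms by simp
qed

lemma Cmp_neg [simp]:
  assumes "f \<in> Arr C" "g \<in> Arr C" "Tgt C f = Src C g"
  shows "g \<cdot> neg C f = neg C (g \<cdot> f)"
proof (rule eq_neg)
  show "(g \<cdot> f) \<boxplus> (g \<cdot> neg C f) = Nul C (Src C (g \<cdot> f)) (Tgt C (g \<cdot> f))"
    using assms by (simp flip: Cmp_Pls(1))
qed (use assms in auto)

lemma neg_Cmp [simp]:
  assumes "f \<in> Arr C" "g \<in> Arr C" "Tgt C f = Src C g"
  shows "neg C g \<cdot> f = neg C (g \<cdot> f)"
proof (rule eq_neg)
  show "(g \<cdot> f) \<boxplus> (neg C g \<cdot> f) = Nul C (Src C (g \<cdot> f)) (Tgt C (g \<cdot> f))"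
    using assms by (simp flip: Cmp_Pls(2))
qed (use assms in auto)

lemma neg_neg [simp]:
  assumes "f \<in> Arr C"
  shows "neg C (neg C f) = f"
  using assms eq_neg[of "neg C f" f] by simp

lemma neg_Nul [simp]:
  assumes "X \<in> Obj C" "Y \<in> Obj C"
  shows "neg C (Nul C X Y) = Nul C X Y"
  using assms eq_neg[of "Nul C X Y" "Nul C X Y"] by simp

lemma zero_object_Hom:
  assumes "zero_object C Z" "f \<in> Arr C"
  shows "Tgt C f = Z \<Longrightarrow> f = Nul C (Src C f) Z" "Src C f = Z \<Longrightarrow> f = Nul C Z (Tgt C f)"
proof -
  have Z: "Z \<in> Obj C" using assms by (simp add: zero_object_def)
  {
    assume "Tgt C f = Z"
    then show "f = Nul C (Src C f) Z"
      using assms Src_Obj[of f] Z unfolding zero_object_def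
      by (metis Nul_simps in_Hom)
  }
  {
    assume "Src C f = Z"
    then show "f = Nul C Z (Tgt C f)"
      using assms Tgt_Obj[of f] Z unfolding zero_object_def
      by (metis Nul_simps in_Hom)
  }
qed

lemma zero_object_iff:
  "zero_object C Z \<longleftrightarrow> Z \<in> Obj C \<and> Idn C Z = Nul C Z Z"
proof (intro iffI conjI)
  assume "zero_object C Z"
  then show "Z \<in> Obj C" "Idn C Z = Nul C Z Z"
    using zero_object_Hom(1)[of Z "Idn C Z"] by (auto simp: zero_object_def)
next
  assume *: "Z \<in> Obj C \<and> Idn C Z = Nul C Z Z"
  have "f = Nul C X Z" if "f \<in> Hom C X Z" for f X
    using that * Nul_Cmp[of f Z Z] Cmp_Idn(2)[of f Z] by (simp add: in_Hom)
  moreover have "f = Nul C Z X" if "f \<in> Hom C Z X" for f X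
    using that * Cmp_Nul[of f Z Z] Cmp_Idn(1)[of f Z] by (simp add: in_Hom)
  ultimately show "zero_object C Z"
    using * unfolding zero_object_def by (metis Nul_simps in_Hom)
qed

text \<open>Additivity reduces cancellation to a test on zero: the hypothesis is applied to the
  difference of two maps with equal composites.\<close>

lemma monicI:
  assumes "m \<in> Arr C"
    and "\<And>x. \<lbrakk>x \<in> Arr C; Tgt C x = Src C m; m \<cdot> x = Nul C (Src C x) (Tgt C m)\<rbrakk>
          \<Longrightarrow> x = Nul C (Src C x) (Src C m)"
  shows "monic C m"
proof -
  have "g = h" if "g \<in> Hom C W (Src C m)" "h \<in> Hom C W (Src C m)" "m \<cdot> g = m \<cdot> h" for W g h
  proof -
    have "m \<cdot> (g \<boxplus> neg C h) = Nul C W (Tgt C m)"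
      using that assms(1) by (simp add: in_Hom Cmp_Pls)
    then have "g \<boxplus> neg C h = Nul C W (Src C m)"
      using assms(2)[of "g \<boxplus> neg C h"] that assms(1) by (simp add: in_Hom)
    then show ?thesis
      using eq_if_diff_Nul[of g h] that by (simp add: in_Hom)
  qed
  then show ?thesis
    using assms unfolding monic_def by blast
qed

lemma epicI:
  assumes "m \<in> Arr C"
    and "\<And>x. \<lbrakk>x \<in> Arr C; Src C x = Tgt C m; x \<cdot> m = Nul C (Src C m) (Tgt C x)\<rbrakk>
          \<Longrightarrow> x = Nul C (Tgt C m) (Tgt C x)"
  shows "epic C m"
proof -
  have "g = h" if "g \<in> Hom C (Tgt C m) W" "h \<in> Hom C (Tgt C m) W" "g \<cdot> m = h \<cdot> m" for W g h
  proof -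
    have "(g \<boxplus> neg C h) \<cdot> m = Nul C (Src C m) W"
      using that assms(1) by (simp add: in_Hom Cmp_Pls)
    then have "g \<boxplus> neg C h = Nul C (Tgt C m) W"
      using assms(2)[of "g \<boxplus> neg C h"] that assms(1) by (simp add: in_Hom)
    then show ?thesis
      using eq_if_diff_Nul[of g h] that by (simp add: in_Hom)
  qed
  then show ?thesis
    using assms unfolding epic_def by blast
qed

lemma monic_Nul:
  assumes "monic C m" "m \<cdot> x = Nul C (Src C x) (Tgt C m)" "x \<in> Arr C" "Tgt C x = Src C m"
  shows "x = Nul C (Src C x) (Src C m)"
  using assms by - (rule monicD[OF assms(1)]; auto simp: monic_Arr Src_Obj)

lemma epic_Nul:
  assumes "epic C e" "x \<cdot> e = Nul C (Src C e) (Tgt C x)" "x \<in> Arr C" "Src C x = Tgt C e"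
  shows "x = Nul C (Tgt C e) (Tgt C x)"
  using assms by - (rule epicD[OF assms(1)]; auto simp: epic_Arr)

lemma kernel_simps:
  assumes "is_kernel C f k"
  shows "f \<in> Arr C" "k \<in> Arr C" "Tgt C k = Src C f" "f \<cdot> k = Nul C (Src C k) (Tgt C f)"
  using assms by (auto simp: is_kernel_def)

lemma kernel_lift:
  assumes "is_kernel C f k" "x \<in> Arr C" "Tgt C x = Src C f" "f \<cdot> x = Nul C (Src C x) (Tgt C f)"
  obtains u where "u \<in> Arr C" "Src C u = Src C x" "Tgt C u = Src C k" "k \<cdot> u = x"
proof -
  have "\<exists>!u. u \<in> Hom C (Src C x) (Src C k) \<and> k \<cdot> u = x"
    using assms Src_Obj[of x] unfolding is_kernel_def by (auto simp: in_Hom)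
  then show thesis using that by (auto simp: in_Hom)
qed

lemma kernel_monic:
  assumes "is_kernel C f k"
  shows "monic C k"
proof -
  have "g = h" if "W \<in> Obj C" "g \<in> Hom C W (Src C k)" "h \<in> Hom C W (Src C k)" "k \<cdot> g = k \<cdot> h" for W g h
  proof -
    have "k \<cdot> h \<in> Hom C W (Src C f)" "f \<cdot> (k \<cdot> h) = Nul C W (Tgt C f)"
      using that kernel_simps[OF assms] kernel_simps(4)[OF assms, THEN pull] by (auto simp: in_Hom)
    then have "\<exists>!u. u \<in> Hom C W (Src C k) \<and> k \<cdot> u = k \<cdot> h"
      using assms that unfolding is_kernel_def by blast
    then show ?thesis using that by blast
  qed
  then show ?thesis
    using kernel_simps[OF assms] unfolding monic_def by blast
qed

lemma kernelI:
  assumes "f \<in> Arr C" "monic C k" "Tgt C k = Src C f" "f \<cdot> k = Nul C (Src C k) (Tgt C f)"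
    and "\<And>x. \<lbrakk>x \<in> Arr C; Tgt C x = Src C f; f \<cdot> x = Nul C (Src C x) (Tgt C f)\<rbrakk>
           \<Longrightarrow> \<exists>u. u \<in> Arr C \<and> Src C u = Src C x \<and> Tgt C u = Src C k \<and> k \<cdot> u = x"
  shows "is_kernel C f k"
proof -
  have "\<exists>!u. u \<in> Hom C W (Src C k) \<and> k \<cdot> u = g"
    if g: "W \<in> Obj C" "g \<in> Hom C W (Src C f)" "f \<cdot> g = Nul C W (Tgt C f)" for W g
  proof -
    obtain u where "u \<in> Hom C W (Src C k)" "k \<cdot> u = g"
      using assms(5)[of g] g unfolding in_Hom by metis
    then show ?thesis
      by (metis monicD[OF assms(2)] in_Hom)
  qed
  then show ?thesis
    using assms monic_Arr unfolding is_kernel_def by blast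
qed

lemma cokernel_simps:
  assumes "is_cokernel C f c"
  shows "f \<in> Arr C" "c \<in> Arr C" "Src C c = Tgt C f" "c \<cdot> f = Nul C (Src C f) (Tgt C c)"
  using assms by (auto simp: is_cokernel_def)

lemma cokernel_desc:
  assumes "is_cokernel C f c" "x \<in> Arr C" "Src C x = Tgt C f" "x \<cdot> f = Nul C (Src C f) (Tgt C x)"
  obtains u where "u \<in> Arr C" "Src C u = Tgt C c" "Tgt C u = Tgt C x" "u \<cdot> c = x"
proof -
  have "\<exists>!u. u \<in> Hom C (Tgt C c) (Tgt C x) \<and> u \<cdot> c = x"
    using assms Tgt_Obj[of x] unfolding is_cokernel_def by (auto simp: in_Hom)
  then show thesis using that by (auto simp: in_Hom)
qed

lemma cokernel_epic:
  assumes "is_cokernel C f c"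
  shows "epic C c"
proof -
  have "g = h" if "W \<in> Obj C" "g \<in> Hom C (Tgt C c) W" "h \<in> Hom C (Tgt C c) W" "g \<cdot> c = h \<cdot> c" for W g h
  proof -
    have "h \<cdot> c \<in> Hom C (Tgt C f) W" "(h \<cdot> c) \<cdot> f = Nul C (Src C f) W"
      using that cokernel_simps[OF assms] by (auto simp: in_Hom)
    then have "\<exists>!u. u \<in> Hom C (Tgt C c) W \<and> u \<cdot> c = h \<cdot> c"
      using assms that unfolding is_cokernel_def by blast
    then show ?thesis using that by blast
  qed
  then show ?thesis
    using cokernel_simps[OF assms] unfolding epic_def by blast
qed

lemma cokernelI:
  assumes "f \<in> Arr C" "epic C c" "Src C c = Tgt C f" "c \<cdot> f = Nul C (Src C f) (Tgt C c)"
    and "\<And>x. \<lbrakk>x \<in> Arr C; Src C x = Tgt C f; x \<cdot> f = Nul C (Src C f) (Tgt C x)\<rbrakk>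
           \<Longrightarrow> \<exists>u. u \<in> Arr C \<and> Src C u = Tgt C c \<and> Tgt C u = Tgt C x \<and> u \<cdot> c = x"
  shows "is_cokernel C f c"
proof -
  have "\<exists>!u. u \<in> Hom C (Tgt C c) W \<and> u \<cdot> c = g"
    if g: "W \<in> Obj C" "g \<in> Hom C (Tgt C f) W" "g \<cdot> f = Nul C (Src C f) W" for W g
  proof -
    obtain u where "u \<in> Hom C (Tgt C c) W" "u \<cdot> c = g"
      using assms(5)[of g] g unfolding in_Hom by metis
    then show ?thesis
      by (metis epicD[OF assms(2)] in_Hom)
  qed
  then show ?thesis
    using assms epic_Arr unfolding is_cokernel_def by blast
qed

end

section \<open>Abelian categories: images, pullbacks of epimorphisms, exactness\<close>

context abelian_category
begin

text \<open>The epimorphism \<open>d\<close> is a cokernel of some \<open>g\<close>, and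
  \<open>g\<close> factors through the kernel \<open>k\<close>; hence a map killing \<open>k\<close>
  kills \<open>g\<close> and descends along \<open>d\<close>.\<close>

lemma epic_cokernel_of_kernel:
  assumes "epic C d" "is_kernel C d k"
  shows "is_cokernel C k d"
proof -
  note k = kernel_simps[OF assms(2)]
  obtain g where g: "is_cokernel C g d" using epic_cokernel[OF assms(1)] by blast
  note gs = cokernel_simps[OF g]
  obtain u where u: "u \<in> Arr C" "Src C u = Src C g" "Tgt C u = Src C k" "k \<cdot> u = g"
    by (rule kernel_lift[OF assms(2), of g]) (use gs in auto)
  show ?thesis
  proof (rule cokernelI)
    fix x assume x: "x \<in> Arr C" "Src C x = Tgt C k" "x \<cdot> k = Nul C (Src C k) (Tgt C x)"
    have "x \<cdot> g = (x \<cdot> k) \<cdot> u" using x(1,2) u k by simp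
    also have "\<dots> = Nul C (Src C g) (Tgt C x)"
      unfolding x(3) using x(1,2) u k by simp
    finally have "x \<cdot> g = Nul C (Src C g) (Tgt C x)" .
    then show "\<exists>u. u \<in> Arr C \<and> Src C u = Tgt C d \<and> Tgt C u = Tgt C x \<and> u \<cdot> d = x"
      using cokernel_desc[OF g, of x] x gs k by metis
  qed (use k assms in auto)
qed

text \<open>Epicness of \<open>t\<close> is the nontrivial part. If \<open>u\<close> kills
  \<open>t\<close> and \<open>k\<close> is the kernel of \<open>u\<close>, then \<open>f\<close>
  factors through the subobject \<open>m \<cdot> k\<close> of the image \<open>m\<close>; minimality
  of the image gives \<open>k\<close> a right inverse, so \<open>u\<close> is zero.\<close>

lemma image_factor:
  assumes "is_image C f m"
  obtains t where "epic C t" "t \<in> Arr C" "Src C t = Src C f" "Tgt C t = Src C m" "m \<cdot> t = f"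
proof -
  obtain c where c: "is_cokernel C f c" "is_kernel C c m"
    using assms unfolding is_image_def by blast
  note cs = cokernel_simps[OF c(1)] and ms = kernel_simps[OF c(2)]
  have mm: "monic C m" by (rule kernel_monic[OF c(2)])
  obtain t where t: "t \<in> Arr C" "Src C t = Src C f" "Tgt C t = Src C m" "m \<cdot> t = f"
    by (rule kernel_lift[OF c(2), of f]) (use cs in auto)
  have "epic C t"
  proof (rule epicI)
    fix u assume u: "u \<in> Arr C" "Src C u = Tgt C t" "u \<cdot> t = Nul C (Src C t) (Tgt C u)"
    obtain k where k: "is_kernel C u k" using ex_kernel u by blast
    note ks = kernel_simps[OF k]
    obtain t' where t': "t' \<in> Arr C" "Src C t' = Src C t" "Tgt C t' = Src C k" "k \<cdot> t' = t"
      by (rule kernel_lift[OF k, of t]) (use u t in auto)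
    \<comment> \<open>Being a kernel, \<open>m \<cdot> k\<close> is detected by a map
      \<open>g\<close>. This \<open>g\<close> kills \<open>f\<close>, hence factors through the
      cokernel \<open>c\<close>, hence kills \<open>m\<close>; so \<open>m\<close> lifts back along
      \<open>m \<cdot> k\<close>.\<close>
    have "monic C (m \<cdot> k)"
      using mm kernel_monic[OF k] ks u t by (intro monic_Cmp) auto
    then obtain g where g: "is_kernel C g (m \<cdot> k)" using monic_kernel by blast
    have ty: "Src C g = Tgt C f" "Src C m = Tgt C k" "Src C u = Src C m"
      using kernel_simps[OF g] ks ms cs u t by auto
    have "g \<cdot> f = (g \<cdot> (m \<cdot> k)) \<cdot> t'"
      using kernel_simps(1)[OF g] ty ks(2) ms cs t t' by simp
    also have "\<dots> = Nul C (Src C f) (Tgt C g)"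
      using kernel_simps[OF g] ty ks(2) ms cs t t' by simp
    finally obtain g' where g': "g' \<in> Arr C" "Src C g' = Tgt C c" "Tgt C g' = Tgt C g" "g' \<cdot> c = g"
      using cokernel_desc[OF c(1), of g] kernel_simps(1)[OF g] ty by metis
    have "g \<cdot> m = g' \<cdot> (c \<cdot> m)" using g' ms cs by auto
    also have "\<dots> = Nul C (Src C m) (Tgt C g)" using g' ms by simp
    finally obtain v where v: "v \<in> Arr C" "Src C v = Src C m" "Tgt C v = Src C (m \<cdot> k)" "(m \<cdot> k) \<cdot> v = m"
      using kernel_lift[OF g, of m] ms ty cs by metis
    have "m \<cdot> (k \<cdot> v) = m \<cdot> Idn C (Src C m)"
      using v ks(2) ms ty by simp
    then have kv: "k \<cdot> v = Idn C (Src C m)"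
      using v ks(2) ms ty by - (rule monicD[OF mm]; auto)
    have "u = u \<cdot> (k \<cdot> v)" using kv u t by simp
    also have "\<dots> = Nul C (Src C u) (Tgt C u)"
      using ks(4)[THEN pull, of v] ks(1-3) v ms ty(1,2) by simp
    finally show "u = Nul C (Tgt C t) (Tgt C u)"
      using u t by simp
  qed (use t in auto)
  then show thesis using that t by blast
qed

lemma ex_image:
  assumes "f \<in> Arr C"
  shows "\<exists>m. is_image C f m"
proof -
  obtain c where "is_cokernel C f c" using ex_cokernel assms by blast
  moreover obtain k where "is_kernel C c k" using ex_kernel cokernel_simps(2)[OF calculation] by blast
  ultimately show ?thesis unfolding is_image_def by blast
qed

lemma image_simps:
  assumes "is_image C f m"
  shows "f \<in> Arr C" "m \<in> Arr C" "monic C m" "Tgt C m = Tgt C f"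
  using assms cokernel_simps kernel_simps kernel_monic unfolding is_image_def by metis+

text \<open>Recasts the lifting property of an image as a test against all maps that kill
  \<open>f\<close>, so that later chases need not name a cokernel; the proof applies the test to the
  cokernel itself.\<close>

lemma image_lift:
  assumes m: "is_image C f m" and x: "x \<in> Arr C" "Tgt C x = Tgt C f"
    and vanish: "\<And>g. \<lbrakk>g \<in> Arr C; Src C g = Tgt C f; g \<cdot> f = Nul C (Src C f) (Tgt C g)\<rbrakk>
            \<Longrightarrow> g \<cdot> x = Nul C (Src C x) (Tgt C g)"
  obtains u where "u \<in> Arr C" "Src C u = Src C x" "Tgt C u = Src C m" "m \<cdot> u = x"
proof -
  obtain c where c: "is_cokernel C f c" "is_kernel C c m"
    using m unfolding is_image_def by blast
  show thesis
    using that kernel_lift[OF c(2), of x] vanish[of c] cokernel_simps[OF c(1)] x by metis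
qed

text \<open>Any epi-mono factorization computes the image: \<open>c \<cdot> m\<close> vanishes
  because the epimorphism \<open>t\<close> can be cancelled, and conversely a map with kernel
  \<open>m\<close> kills \<open>f\<close>, so it factors through \<open>c\<close>, and whatever
  \<open>c\<close> kills lies in \<open>m\<close>.\<close>

lemma imageI:
  assumes "monic C m" "epic C t" "Tgt C t = Src C m" "m \<cdot> t = f"
  shows "is_image C f m"
proof -
  have ty: "m \<in> Arr C" "t \<in> Arr C" "f \<in> Arr C" "Src C f = Src C t" "Tgt C f = Tgt C m"
    using assms monic_Arr epic_Arr by auto
  obtain c where c: "is_cokernel C f c" using ex_cokernel ty by blast
  note cs = cokernel_simps[OF c]
  have "(c \<cdot> m) \<cdot> t = Nul C (Src C t) (Tgt C (c \<cdot> m))"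
    using cs ty assms by simp
  then have cm: "c \<cdot> m = Nul C (Src C m) (Tgt C c)"
    using epic_Nul[OF assms(2), of "c \<cdot> m"] cs ty assms by simp
  obtain g where g: "is_kernel C g m" using monic_kernel assms by blast
  note gs = kernel_simps[OF g]
  have "g \<cdot> f = (g \<cdot> m) \<cdot> t" using gs(1-3) ty assms by simp
  also have "\<dots> = Nul C (Src C f) (Tgt C g)" using gs ty assms by simp
  finally obtain g' where g': "g' \<in> Arr C" "Src C g' = Tgt C c" "Tgt C g' = Tgt C g" "g' \<cdot> c = g"
    using cokernel_desc[OF c, of g] gs(1,3) ty by metis
  have "is_kernel C c m"
  proof (rule kernelI)
    fix x assume x: "x \<in> Arr C" "Tgt C x = Src C c" "c \<cdot> x = Nul C (Src C x) (Tgt C c)"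
    have "g \<cdot> x = g' \<cdot> (c \<cdot> x)" using g' x cs by auto
    also have "\<dots> = Nul C (Src C x) (Tgt C g)" using x g' cs by simp
    finally show "\<exists>u. u \<in> Arr C \<and> Src C u = Src C x \<and> Tgt C u = Src C m \<and> m \<cdot> u = x"
      using kernel_lift[OF g, of x] x cs gs ty by metis
  qed (use cs ty cm assms in auto)
  then show ?thesis using c unfolding is_image_def by blast
qed

text \<open>The pullback of \<open>p\<close> and \<open>x\<close> is the kernel \<open>k\<close> of
  \<open>d\<close>, the difference of the two maps out of a biproduct; its components are
  \<open>y\<close> and \<open>\<epsilon>\<close>. This is what allows a generalized element to be
  lifted along an epimorphism after a change of its domain.\<close>

lemma epic_pullback:
  assumes p: "epic C p" and x: "x \<in> Arr C" "Tgt C x = Tgt C p"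
  obtains \<epsilon> y where "epic C \<epsilon>" "\<epsilon> \<in> Arr C" "y \<in> Arr C" "Tgt C \<epsilon> = Src C x" "Src C y = Src C \<epsilon>"
    "Tgt C y = Src C p" "p \<cdot> y = x \<cdot> \<epsilon>"
proof -
  have pA: "p \<in> Arr C" using p epic_Arr by blast
  define S where "S = Src C p"
  define W where "W = Src C x"
  have SW: "S \<in> Obj C" "W \<in> Obj C" using pA x Src_Obj by (auto simp: S_def W_def)
  obtain B where B: "B \<in> Obj C" "biproduct C S W B" using ex_biproduct SW by blast
  obtain i1 i2 p1 p2 where
    i: "i1 \<in> Hom C S B" "i2 \<in> Hom C W B" "p1 \<in> Hom C B S" "p2 \<in> Hom C B W"
    and eqs: "p1 \<cdot> i1 = Idn C S" "p2 \<cdot> i2 = Idn C W" "p1 \<cdot> i2 = Nul C W S" "p2 \<cdot> i1 = Nul C S W"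
    using B(2) unfolding biproduct_def by blast
  define d where "d = (p \<cdot> p1) \<boxplus> neg C (x \<cdot> p2)"
  have dA: "d \<in> Arr C" "Src C d = B" "Tgt C d = Tgt C p"
    using i pA x unfolding d_def by (auto simp: in_Hom S_def W_def)
  have di1: "d \<cdot> i1 = p"
    using i pA x eqs B unfolding d_def
    by (auto simp: in_Hom S_def W_def Cmp_Pls(2))
  have "epic C d"
  proof (rule epicI)
    fix u assume u: "u \<in> Arr C" "Src C u = Tgt C d" "u \<cdot> d = Nul C (Src C d) (Tgt C u)"
    have "u \<cdot> p = (u \<cdot> d) \<cdot> i1" using u(1,2) dA i di1 by (simp add: in_Hom)
    also have "\<dots> = Nul C (Src C p) (Tgt C u)"
      using u dA i by (simp add: in_Hom S_def)
    finally show "u = Nul C (Tgt C d) (Tgt C u)"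
      using epic_Nul[OF p, of u] u dA by simp
  qed (use dA in auto)
  moreover obtain k where k: "is_kernel C d k" using ex_kernel dA by blast
  ultimately have coker: "is_cokernel C k d" by (rule epic_cokernel_of_kernel)
  note ks = kernel_simps[OF k]
  \<comment> \<open>Since \<open>d\<close> is epic, it is the cokernel of \<open>k\<close>. A map
    \<open>u\<close> killing \<open>p2 \<cdot> k\<close> gives
    \<open>u \<cdot> p2 = v \<cdot> d\<close>; restricting to the first summand gives
    \<open>v \<cdot> p = 0\<close>, so \<open>v\<close> and then \<open>u\<close> vanish.\<close>
  have "epic C (p2 \<cdot> k)"
  proof (rule epicI)
    fix u assume u: "u \<in> Arr C" "Src C u = Tgt C (p2 \<cdot> k)" "u \<cdot> (p2 \<cdot> k) = Nul C (Src C (p2 \<cdot> k)) (Tgt C u)"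
    have u': "Src C u = W" "(u \<cdot> p2) \<cdot> k = Nul C (Src C k) (Tgt C u)"
      using u ks(2,3) i dA by (auto simp: in_Hom)
    obtain v where v: "v \<in> Arr C" "Src C v = Tgt C d" "Tgt C v = Tgt C (u \<cdot> p2)" "v \<cdot> d = u \<cdot> p2"
      by (rule cokernel_desc[OF coker, of "u \<cdot> p2"]) (use u(1) u' i ks dA in \<open>auto simp: in_Hom\<close>)
    have "v \<cdot> p = (v \<cdot> d) \<cdot> i1" using v(1,2) dA i di1 by (simp add: in_Hom)
    also have "\<dots> = u \<cdot> (p2 \<cdot> i1)" unfolding v(4) using u(1) u' i by (simp add: in_Hom)
    also have "\<dots> = Nul C (Src C p) (Tgt C v)"
      using eqs u u' v i SW by (simp add: in_Hom S_def)
    finally have v0: "v = Nul C (Tgt C p) (Tgt C v)"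
      using epic_Nul[OF p, of v] v dA by simp
    have "v \<cdot> d = Nul C (Tgt C p) (Tgt C v) \<cdot> d"
      using v0 by (rule arg_cong)
    then have up2: "u \<cdot> p2 = Nul C B (Tgt C u)"
      using v dA u(1) u'(1) i pA by (simp add: in_Hom)
    have "u = (u \<cdot> p2) \<cdot> i2"
      using eqs u(1) u'(1) i by (simp add: in_Hom)
    also have "\<dots> = Nul C (Tgt C (p2 \<cdot> k)) (Tgt C u)"
      unfolding up2 using u(1) i B ks dA by (simp add: in_Hom)
    finally show "u = Nul C (Tgt C (p2 \<cdot> k)) (Tgt C u)" .
  qed (use ks i dA in \<open>auto simp: in_Hom\<close>)
  moreover have "p \<cdot> (p1 \<cdot> k) = x \<cdot> (p2 \<cdot> k)"
  proof (rule eq_if_diff_Nul)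
    have "d \<cdot> k = (p \<cdot> (p1 \<cdot> k)) \<boxplus> neg C (x \<cdot> (p2 \<cdot> k))"
      using i pA x ks(2,3) dA unfolding d_def
      by (auto simp: in_Hom S_def W_def Cmp_Pls(2))
    then show "(p \<cdot> (p1 \<cdot> k)) \<boxplus> neg C (x \<cdot> (p2 \<cdot> k))
        = Nul C (Src C (p \<cdot> (p1 \<cdot> k))) (Tgt C (p \<cdot> (p1 \<cdot> k)))"
      using ks i pA dA by (simp add: in_Hom S_def)
  qed (use ks i pA x dA in \<open>auto simp: in_Hom S_def W_def\<close>)
  ultimately show thesis
    using that[of "p2 \<cdot> k" "p1 \<cdot> k"] i ks dA by (simp add: in_Hom S_def W_def)
qed

lemma exact_comp:
  assumes "exact_at C f g"
  shows "f \<in> Arr C" "g \<in> Arr C" "Tgt C f = Src C g" "g \<cdot> f = Nul C (Src C f) (Tgt C g)"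
proof -
  obtain m where m: "is_image C f m" "is_kernel C g m"
    using assms unfolding exact_at_def by blast
  obtain t where t: "t \<in> Arr C" "Src C t = Src C f" "Tgt C t = Src C m" "m \<cdot> t = f"
    using image_factor[OF m(1)] by metis
  show *: "f \<in> Arr C" "g \<in> Arr C" "Tgt C f = Src C g"
    using image_simps[OF m(1)] kernel_simps[OF m(2)] by auto
  show "g \<cdot> f = Nul C (Src C f) (Tgt C g)"
    using kernel_simps(4)[OF m(2), THEN pull, of t] t kernel_simps(1-3)[OF m(2)] by simp
qed

text \<open>Exactness in elementwise form: an element killed by \<open>g\<close> has a preimage
  after precomposition with an epimorphism, obtained by pulling back along the epic half of
  \<open>f\<close>.\<close>

lemma exact_lift:
  assumes "exact_at C f g" "x \<in> Arr C" "Tgt C x = Src C g" "g \<cdot> x = Nul C (Src C x) (Tgt C g)"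
  obtains \<epsilon> y where "epic C \<epsilon>" "\<epsilon> \<in> Arr C" "y \<in> Arr C" "Tgt C \<epsilon> = Src C x" "Src C y = Src C \<epsilon>"
    "Tgt C y = Src C f" "f \<cdot> y = x \<cdot> \<epsilon>"
proof -
  obtain m where m: "is_image C f m" "is_kernel C g m"
    using assms unfolding exact_at_def by blast
  obtain t where t: "epic C t" "t \<in> Arr C" "Src C t = Src C f" "Tgt C t = Src C m" "m \<cdot> t = f"
    using image_factor[OF m(1)] by metis
  obtain u where u: "u \<in> Arr C" "Src C u = Src C x" "Tgt C u = Src C m" "m \<cdot> u = x"
    using kernel_lift[OF m(2) assms(2-4)] by metis
  obtain \<epsilon> y where e: "epic C \<epsilon>" "\<epsilon> \<in> Arr C" "y \<in> Arr C" "Tgt C \<epsilon> = Src C u" "Src C y = Src C \<epsilon>"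
    "Tgt C y = Src C t" "t \<cdot> y = u \<cdot> \<epsilon>"
    using epic_pullback[OF t(1), of u] u t by metis
  have "f \<cdot> y = m \<cdot> (t \<cdot> y)"
    using t e kernel_simps[OF m(2)] assoc[of y t m] by simp
  also have "\<dots> = x \<cdot> \<epsilon>"
    using u e kernel_simps[OF m(2)] assoc[of \<epsilon> u m] by simp
  finally show thesis
    using that[of \<epsilon> y] e u t by simp
qed

text \<open>Converse of the elementwise lifting, and the way exactness of derived couples is proved.
  A map killing \<open>f\<close> kills \<open>x\<close> after the epimorphism
  \<open>\<epsilon>\<close>, hence kills \<open>x\<close>, so \<open>x\<close> lies in the
  image.\<close>

lemma exactI:
  assumes fg: "f \<in> Arr C" "g \<in> Arr C" "Tgt C f = Src C g" "g \<cdot> f = Nul C (Src C f) (Tgt C g)"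
    and lift: "\<And>x. \<lbrakk>x \<in> Arr C; Tgt C x = Src C g; g \<cdot> x = Nul C (Src C x) (Tgt C g)\<rbrakk>
      \<Longrightarrow> \<exists>\<epsilon> y. epic C \<epsilon> \<and> y \<in> Arr C \<and> Tgt C \<epsilon> = Src C x \<and> Src C y = Src C \<epsilon> \<and>
            Tgt C y = Src C f \<and> f \<cdot> y = x \<cdot> \<epsilon>"
  shows "exact_at C f g"
proof -
  obtain m where m: "is_image C f m" using ex_image fg by blast
  obtain t where t: "epic C t" "t \<in> Arr C" "Src C t = Src C f" "Tgt C t = Src C m" "m \<cdot> t = f"
    using image_factor[OF m] by metis
  note ms = image_simps[OF m]
  have "is_kernel C g m"
  proof (rule kernelI)
    have "(g \<cdot> m) \<cdot> t = Nul C (Src C t) (Tgt C (g \<cdot> m))"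
      using fg t ms by simp
    then show "g \<cdot> m = Nul C (Src C m) (Tgt C g)"
      using epic_Nul[OF t(1), of "g \<cdot> m"] fg t ms by simp
  next
    fix x assume x: "x \<in> Arr C" "Tgt C x = Src C g" "g \<cdot> x = Nul C (Src C x) (Tgt C g)"
    obtain \<epsilon> y where e: "epic C \<epsilon>" "y \<in> Arr C" "Tgt C \<epsilon> = Src C x" "Src C y = Src C \<epsilon>"
            "Tgt C y = Src C f" "f \<cdot> y = x \<cdot> \<epsilon>"
      using lift[OF x] by blast
    show "\<exists>u. u \<in> Arr C \<and> Src C u = Src C x \<and> Tgt C u = Src C m \<and> m \<cdot> u = x"
    proof (rule image_lift[OF m])
      fix h assume h: "h \<in> Arr C" "Src C h = Tgt C f" "h \<cdot> f = Nul C (Src C f) (Tgt C h)"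
      have "(h \<cdot> x) \<cdot> \<epsilon> = h \<cdot> (f \<cdot> y)"
        using e h(1,2) x(1,2) fg by (simp add: epic_Arr)
      also have "\<dots> = Nul C (Src C \<epsilon>) (Tgt C (h \<cdot> x))"
        using h(3)[THEN pull, of y] e h(1,2) x(1,2) fg by simp
      finally show "h \<cdot> x = Nul C (Src C x) (Tgt C h)"
        using epic_Nul[OF e(1), of "h \<cdot> x"] e h x fg by simp
    qed (use x fg in auto)
  qed (use fg ms in auto)
  then show ?thesis using m unfolding exact_at_def by blast
qed

lemma exact_cokernel:
  assumes "is_cokernel C f c"
  shows "exact_at C f c"
proof -
  obtain m where "is_kernel C c m" using ex_kernel cokernel_simps(2)[OF assms] by blast
  then show ?thesis using assms unfolding exact_at_def is_image_def by blast
qed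

text \<open>Lift the identity of the source of \<open>g\<close>: since \<open>g\<close> kills it,
  some epimorphism factors as \<open>f \<cdot> y\<close>, which makes \<open>f\<close> epic.\<close>

lemma exact_epic:
  assumes "exact_at C f g" "g = Nul C (Src C g) (Tgt C g)"
  shows "epic C f"
proof -
  note fg = exact_comp[OF assms(1)]
  have "g \<cdot> Idn C (Src C g) = Nul C (Src C g) (Tgt C g)"
    using fg assms(2) by simp
  then obtain \<epsilon> y where e: "epic C \<epsilon>" "\<epsilon> \<in> Arr C" "y \<in> Arr C" "Tgt C \<epsilon> = Src C g" "Src C y = Src C \<epsilon>"
    "Tgt C y = Src C f" "f \<cdot> y = \<epsilon>"
    using exact_lift[OF assms(1), of "Idn C (Src C g)"] fg
    by (metis Cmp_Idn(2) Idn_simps Src_Obj)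
  show ?thesis
  proof (rule epicI)
    fix x assume x: "x \<in> Arr C" "Src C x = Tgt C f" "x \<cdot> f = Nul C (Src C f) (Tgt C x)"
    have "x \<cdot> \<epsilon> = Nul C (Src C \<epsilon>) (Tgt C x)"
      using x(3)[THEN pull, of y] e x(1,2) fg by simp
    then show "x = Nul C (Tgt C f) (Tgt C x)"
      using epic_Nul[OF e(1), of x] x e fg by simp
  qed (use fg in auto)
qed

lemma exact_epic_cokernel:
  assumes "exact_at C f g" "epic C g"
  shows "is_cokernel C f g"
proof -
  obtain m where m: "is_image C f m" "is_kernel C g m"
    using assms unfolding exact_at_def by blast
  obtain t where t: "epic C t" "t \<in> Arr C" "Src C t = Src C f" "Tgt C t = Src C m" "m \<cdot> t = f"
    using image_factor[OF m(1)] by metis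
  have c: "is_cokernel C m g" by (rule epic_cokernel_of_kernel[OF assms(2) m(2)])
  note cs = cokernel_simps[OF c] and fg = exact_comp[OF assms(1)]
  show ?thesis
  proof (rule cokernelI)
    fix x assume x: "x \<in> Arr C" "Src C x = Tgt C f" "x \<cdot> f = Nul C (Src C f) (Tgt C x)"
    have "(x \<cdot> m) \<cdot> t = Nul C (Src C t) (Tgt C (x \<cdot> m))"
      using x t cs fg by simp
    then have "x \<cdot> m = Nul C (Src C m) (Tgt C x)"
      using epic_Nul[OF t(1), of "x \<cdot> m"] x t cs fg by simp
    then show "\<exists>u. u \<in> Arr C \<and> Src C u = Tgt C g \<and> Tgt C u = Tgt C x \<and> u \<cdot> g = x"
      using cokernel_desc[OF c, of x] x cs fg by metis
  qed (use fg assms in auto)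
qed

text \<open>A monomorphism has zero kernel and an epimorphism is the cokernel of its kernel. The
  identity kills that zero map, so it descends along \<open>f\<close> to a one-sided inverse, and
  cancelling \<open>f\<close> makes it two-sided.\<close>

lemma monic_epic_iso:
  assumes "monic C f" "epic C f"
  shows "is_iso C f"
proof -
  have f: "f \<in> Arr C" using assms monic_Arr by blast
  obtain k where "is_kernel C f k" using ex_kernel f by blast
  moreover have "k = Nul C (Src C k) (Src C f)"
    using monic_Nul[OF assms(1), of k] kernel_simps[OF calculation] by simp
  ultimately have k: "is_cokernel C k f" "k = Nul C (Src C k) (Src C f)"
    using epic_cokernel_of_kernel[OF assms(2)] by auto
  have "Idn C (Src C f) \<cdot> k = k"
    using cokernel_simps[OF k(1)] f by simp
  also note k(2)
  also have "Nul C (Src C k) (Src C f) = Nul C (Src C k) (Tgt C (Idn C (Src C f)))"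
    using f by simp
  finally have "Idn C (Src C f) \<cdot> k = Nul C (Src C k) (Tgt C (Idn C (Src C f)))" .
  then obtain u where u: "u \<in> Arr C" "Src C u = Tgt C f" "Tgt C u = Src C f" "u \<cdot> f = Idn C (Src C f)"
    using cokernel_desc[OF k(1), of "Idn C (Src C f)"] cokernel_simps[OF k(1)] f
    by (metis Idn_simps Src_Obj)
  have "(f \<cdot> u) \<cdot> f = Idn C (Tgt C f) \<cdot> f" using u f by simp
  then have "f \<cdot> u = Idn C (Tgt C f)"
    using u f by - (rule epicD[OF assms(2)]; auto)
  then show ?thesis
    using f u unfolding is_iso_def by (auto simp: in_Hom)
qed

end

section \<open>Derived couples\<close>

context abelian_category
begin

lemma homologyE:
  assumes "is_homology C f g z e"
  obtains b where "b \<in> Hom C (Src C f) (Src C z)" "z \<cdot> b = f" "is_cokernel C b e"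
  using assms unfolding is_homology_def by blast

lemma homology_simps:
  assumes "is_homology C f g z e"
  shows "is_kernel C g z" "monic C z" "epic C e" "z \<in> Arr C" "e \<in> Arr C" "Tgt C z = Src C g"
    "Src C e = Src C z" "f \<in> Arr C" "g \<in> Arr C" "Tgt C f = Src C g"
proof -
  obtain b where b: "b \<in> Hom C (Src C f) (Src C z)" "z \<cdot> b = f" "is_cokernel C b e"
    using homologyE[OF assms] by blast
  show k: "is_kernel C g z" using assms unfolding is_homology_def by blast
  show "monic C z" "epic C e" "z \<in> Arr C" "e \<in> Arr C" "Tgt C z = Src C g"
    "Src C e = Src C z" "g \<in> Arr C"
    using b k kernel_monic cokernel_epic kernel_simps[OF k] cokernel_simps[OF b(3)] by (auto simp: in_Hom)
  show "f \<in> Arr C" "Tgt C f = Src C g"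
    using b kernel_simps[OF k] by (auto simp: in_Hom)
qed

lemma ex_homology:
  assumes "f \<in> Arr C" "g \<in> Arr C" "Tgt C f = Src C g" "g \<cdot> f = Nul C (Src C f) (Tgt C g)"
  shows "\<exists>z e. is_homology C f g z e"
proof -
  obtain z where z: "is_kernel C g z" using ex_kernel assms by blast
  obtain b where b: "b \<in> Arr C" "Src C b = Src C f" "Tgt C b = Src C z" "z \<cdot> b = f"
    by (rule kernel_lift[OF z, of f]) (use assms in auto)
  obtain e where "is_cokernel C b e" using ex_cokernel b by blast
  then show ?thesis
    using z b in_Hom unfolding is_homology_def by blast
qed

text \<open>The map \<open>t\<close> has the same kernel as \<open>i\<close>, namely the image of
  \<open>k\<close>. So \<open>t\<close> is a cokernel of \<open>k\<close>, and
  \<open>e \<cdot> l\<close> descends along it because \<open>l \<cdot> k\<close> is the boundary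
  map \<open>b\<close>.\<close>

lemma derived_j:
  assumes hom: "k \<in> Hom C E0 D" "i \<in> Hom C D Dm" "t \<in> Hom C D D'" "s \<in> Hom C D' Dm"
      "j \<in> Hom C D E1" "d1 \<in> Hom C E1 E2"
    and ex: "exact_at C k i" and t: "epic C t" and s: "monic C s" and st: "s \<cdot> t = i"
    and homol: "is_homology C (j \<cdot> k) d1 z e" and dj: "d1 \<cdot> j = Nul C D E2"
  shows "\<exists>l j'. l \<in> Hom C D (Src C z) \<and> z \<cdot> l = j \<and> j' \<in> Hom C D' (Tgt C e) \<and> j' \<cdot> t = e \<cdot> l"
proof -
  note h = homology_simps[OF homol]
  obtain b where b: "b \<in> Hom C (Src C (j \<cdot> k)) (Src C z)" "z \<cdot> b = j \<cdot> k" "is_cokernel C b e"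
    by (rule homologyE[OF homol])
  have "Tgt C z = E1" using h hom by (simp add: in_Hom)
  obtain l where l: "l \<in> Arr C" "Src C l = Src C j" "Tgt C l = Src C z" "z \<cdot> l = j"
    by (rule kernel_lift[OF h(1), of j]) (use hom dj in \<open>auto simp: in_Hom\<close>)
  have "exact_at C k t"
  proof (rule exactI)
    have "s \<cdot> (t \<cdot> k) = i \<cdot> k" using hom by (simp add: in_Hom flip: st)
    also have "\<dots> = Nul C E0 Dm" using exact_comp[OF ex] hom by (simp add: in_Hom)
    finally show "t \<cdot> k = Nul C (Src C k) (Tgt C t)"
      using monic_Nul[OF s, of "t \<cdot> k"] hom by (simp add: in_Hom)
  next
    fix x assume x: "x \<in> Arr C" "Tgt C x = Src C t" "t \<cdot> x = Nul C (Src C x) (Tgt C t)"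
    have "i \<cdot> x = s \<cdot> (t \<cdot> x)" using x(1,2) hom by (simp add: in_Hom flip: st)
    also have "\<dots> = Nul C (Src C x) Dm" using x hom by (simp add: in_Hom)
    finally have "i \<cdot> x = Nul C (Src C x) (Tgt C i)" using hom by (simp add: in_Hom)
    then show "\<exists>\<epsilon> y. epic C \<epsilon> \<and> y \<in> Arr C \<and> Tgt C \<epsilon> = Src C x \<and> Src C y = Src C \<epsilon> \<and>
            Tgt C y = Src C k \<and> k \<cdot> y = x \<cdot> \<epsilon>"
      using exact_lift[OF ex, of x] x hom unfolding in_Hom by metis
  qed (use hom in \<open>auto simp: in_Hom\<close>)
  then have tk: "is_cokernel C k t" using exact_epic_cokernel t by blast
  have "z \<cdot> (l \<cdot> k) = z \<cdot> b" using l(4)[THEN pull, of k] l(1-3) b(2) h hom by (simp add: in_Hom)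
  then have "l \<cdot> k = b"
    using l(1-3) b(1) h hom by - (rule monicD[OF h(2)]; auto simp: in_Hom)
  then have "(e \<cdot> l) \<cdot> k = Nul C (Src C k) (Tgt C (e \<cdot> l))"
    using cokernel_simps[OF b(3)] l(1-3) h hom b(1) by (simp add: in_Hom)
  then obtain j' where "j' \<in> Arr C" "Src C j' = Tgt C t" "Tgt C j' = Tgt C (e \<cdot> l)" "j' \<cdot> t = e \<cdot> l"
    by (rule cokernel_desc[OF tk, rotated 2]) (use l h hom in \<open>auto simp: in_Hom\<close>)
  then show ?thesis
    using l h hom by (auto simp: in_Hom)
qed

text \<open>On cycles \<open>k\<close> lands in the kernel of \<open>j\<close>, which is the image
  of \<open>i\<close>, so \<open>k \<cdot> z\<close> lifts along \<open>s\<close>; the lift kills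
  boundaries because \<open>k \<cdot> jm\<close> is zero.\<close>

lemma derived_k:
  assumes hom: "i \<in> Hom C D1 D" "j \<in> Hom C D E1" "k \<in> Hom C E D" "jm \<in> Hom C Dm E" "km \<in> Hom C E0 Dm"
    and im: "is_image C i s" and ex: "exact_at C i j" and kj: "k \<cdot> jm = Nul C Dm D"
    and homol: "is_homology C (jm \<cdot> km) (j \<cdot> k) z e"
  shows "\<exists>k'. k' \<in> Hom C (Tgt C e) (Src C s) \<and> s \<cdot> (k' \<cdot> e) = k \<cdot> z"
proof -
  note h = homology_simps[OF homol]
  obtain b where b: "b \<in> Hom C (Src C (jm \<cdot> km)) (Src C z)" "z \<cdot> b = jm \<cdot> km" "is_cokernel C b e"
    by (rule homologyE[OF homol])
  note ims = image_simps[OF im]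
  have zE: "Tgt C z = E" "z \<in> Arr C" "e \<in> Arr C" "Src C e = Src C z"
    using h(4-7) hom by (auto simp: in_Hom)
  obtain \<kappa> where \<kappa>: "\<kappa> \<in> Arr C" "Src C \<kappa> = Src C (k \<cdot> z)" "Tgt C \<kappa> = Src C s" "s \<cdot> \<kappa> = k \<cdot> z"
  proof (rule image_lift[OF im, of "k \<cdot> z"])
    fix g assume g: "g \<in> Arr C" "Src C g = Tgt C i" "g \<cdot> i = Nul C (Src C i) (Tgt C g)"
    have j0: "j \<cdot> (k \<cdot> z) = Nul C (Src C z) E1"
      using kernel_simps(4)[OF h(1)] zE hom by (simp add: in_Hom)
    obtain \<epsilon> y where e: "epic C \<epsilon>" "\<epsilon> \<in> Arr C" "y \<in> Arr C" "Tgt C \<epsilon> = Src C (k \<cdot> z)" "Src C y = Src C \<epsilon>"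
      "Tgt C y = Src C i" "i \<cdot> y = (k \<cdot> z) \<cdot> \<epsilon>"
      by (rule exact_lift[OF ex, of "k \<cdot> z"]) (use j0 zE hom in \<open>auto simp: in_Hom\<close>)
    have "(g \<cdot> (k \<cdot> z)) \<cdot> \<epsilon> = g \<cdot> ((k \<cdot> z) \<cdot> \<epsilon>)"
      using e(2,4) g(1,2) zE hom by (simp add: in_Hom)
    also have "\<dots> = g \<cdot> (i \<cdot> y)" using e(7) by simp
    also have "\<dots> = Nul C (Src C \<epsilon>) (Tgt C g)"
      using g(3)[THEN pull, of y] e(2,3,5,6) g(1,2) hom by (simp add: in_Hom)
    finally show "g \<cdot> (k \<cdot> z) = Nul C (Src C (k \<cdot> z)) (Tgt C g)"
      using epic_Nul[OF e(1), of "g \<cdot> (k \<cdot> z)"] e(2,4) g(1,2) zE hom by (simp add: in_Hom)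
  qed (use zE hom in \<open>auto simp: in_Hom\<close>)
  have "s \<cdot> (\<kappa> \<cdot> b) = (k \<cdot> z) \<cdot> b"
    using \<kappa>(4)[THEN pull, of b] \<kappa>(1-3) b(1) zE hom ims(2,4) by (simp add: in_Hom)
  also have "\<dots> = (k \<cdot> jm) \<cdot> km"
    using b(1,2) zE hom by (simp add: in_Hom)
  also have "\<dots> = Nul C E0 D"
    unfolding kj using hom Hom_Obj[OF hom(1)] by (simp add: in_Hom)
  finally have "\<kappa> \<cdot> b = Nul C E0 (Src C s)"
    using monic_Nul[OF ims(3), of "\<kappa> \<cdot> b"] \<kappa>(1-3) b(1) zE hom ims(2,4) by (simp add: in_Hom)
  then have "\<kappa> \<cdot> b = Nul C (Src C b) (Tgt C \<kappa>)" using \<kappa> b(1) hom by (simp add: in_Hom)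
  then obtain k' where "k' \<in> Arr C" "Src C k' = Tgt C e" "Tgt C k' = Tgt C \<kappa>" "k' \<cdot> e = \<kappa>"
    by (rule cokernel_desc[OF b(3), rotated 2]) (use \<kappa> b(1) zE hom in \<open>auto simp: in_Hom\<close>)
  then show ?thesis
    using \<kappa> by (auto simp: in_Hom)
qed

text \<open>An element \<open>x\<close> killed by \<open>t \<cdot> s\<close> maps under
  \<open>s\<close> to an element killed by \<open>i\<close>, which after an epimorphism has the form
  \<open>k \<cdot> y\<close>. Since \<open>j\<close> vanishes on the image of \<open>i\<close>, this
  \<open>y\<close> is a cycle, and its class is the preimage of \<open>x\<close>.\<close>

lemma derived_exact_ki:
  assumes hom: "k \<in> Hom C E D" "i \<in> Hom C D Dm" "s \<in> Hom C D' D" "t \<in> Hom C D D'm" "sm \<in> Hom C D'm Dm"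
      "j \<in> Hom C D E1" "k' \<in> Hom C E' D'" "e \<in> Hom C (Src C z) E'"
    and ex: "exact_at C k i" and s: "monic C s" and t: "epic C t" and sm: "monic C sm"
    and st: "sm \<cdot> t = i" and js: "j \<cdot> s = Nul C D' E1"
    and z: "is_kernel C (j \<cdot> k) z" and e: "epic C e" and k': "s \<cdot> (k' \<cdot> e) = k \<cdot> z"
  shows "exact_at C k' (t \<cdot> s)"
proof (rule exactI)
  note zs = kernel_simps[OF z]
  have zE: "Tgt C z = E" using zs hom by (simp add: in_Hom)
  have "sm \<cdot> (((t \<cdot> s) \<cdot> k') \<cdot> e) = i \<cdot> (s \<cdot> (k' \<cdot> e))"
    using hom zs(2) zE by (simp add: in_Hom flip: st)
  also have "\<dots> = (i \<cdot> k) \<cdot> z"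
    unfolding k' using hom zs(2) zE by (simp add: in_Hom)
  also have "\<dots> = Nul C (Src C z) Dm"
    using exact_comp[OF ex] hom zs(2) zE Hom_Obj(2)[OF hom(2)] by (simp add: in_Hom)
  finally have "((t \<cdot> s) \<cdot> k') \<cdot> e = Nul C (Src C z) D'm"
    using monic_Nul[OF sm, of "((t \<cdot> s) \<cdot> k') \<cdot> e"] hom zs(2) zE by (simp add: in_Hom)
  then show "(t \<cdot> s) \<cdot> k' = Nul C (Src C k') (Tgt C (t \<cdot> s))"
    using epic_Nul[OF e, of "(t \<cdot> s) \<cdot> k'"] hom zs(2) zE by (simp add: in_Hom)
next
  note zs = kernel_simps[OF z]
  have zE: "Tgt C z = E" using zs hom by (simp add: in_Hom)
  fix x assume x: "x \<in> Arr C" "Tgt C x = Src C (t \<cdot> s)" "(t \<cdot> s) \<cdot> x = Nul C (Src C x) (Tgt C (t \<cdot> s))"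
  have xD: "Tgt C x = D'" using x hom by (simp add: in_Hom)
  have "i \<cdot> (s \<cdot> x) = sm \<cdot> ((t \<cdot> s) \<cdot> x)" using x(1) xD hom by (simp add: in_Hom flip: st)
  also have "\<dots> = Nul C (Src C x) Dm" unfolding x(3) using x(1) hom by (simp add: in_Hom)
  finally have ix: "i \<cdot> (s \<cdot> x) = Nul C (Src C x) Dm" .
  obtain \<epsilon> y where y: "epic C \<epsilon>" "\<epsilon> \<in> Arr C" "y \<in> Arr C" "Tgt C \<epsilon> = Src C (s \<cdot> x)" "Src C y = Src C \<epsilon>"
    "Tgt C y = Src C k" "k \<cdot> y = (s \<cdot> x) \<cdot> \<epsilon>"
    by (rule exact_lift[OF ex, of "s \<cdot> x"]) (use ix x(1) xD hom in \<open>auto simp: in_Hom\<close>)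
  have \<epsilon>x: "Tgt C \<epsilon> = Src C x" using y x(1) xD hom by (simp add: in_Hom)
  have "(j \<cdot> k) \<cdot> y = (j \<cdot> s) \<cdot> (x \<cdot> \<epsilon>)"
    using y \<epsilon>x x(1) xD hom by (simp add: in_Hom)
  also have "\<dots> = Nul C (Src C y) (Tgt C (j \<cdot> k))"
    unfolding js using y(2,5) \<epsilon>x x(1) xD hom Hom_Obj[OF hom(6)] by (simp add: in_Hom)
  finally have "(j \<cdot> k) \<cdot> y = Nul C (Src C y) (Tgt C (j \<cdot> k))" .
  then obtain y' where y': "y' \<in> Arr C" "Src C y' = Src C y" "Tgt C y' = Src C z" "z \<cdot> y' = y"
    by (rule kernel_lift[OF z, rotated 2]) (use y hom in \<open>auto simp: in_Hom\<close>)
  have "s \<cdot> (k' \<cdot> (e \<cdot> y')) = k \<cdot> (z \<cdot> y')"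
    using k'[THEN pull, of y'] y'(1-3) hom zs(2) zE by (simp add: in_Hom)
  also have "\<dots> = (s \<cdot> x) \<cdot> \<epsilon>" unfolding y'(4) y(7) ..
  also have "\<dots> = s \<cdot> (x \<cdot> \<epsilon>)" using y(2,4) \<epsilon>x x(1) xD hom by (simp add: in_Hom)
  finally have "k' \<cdot> (e \<cdot> y') = x \<cdot> \<epsilon>"
    using y'(1-3) hom zs(2) zE \<epsilon>x x(1) xD y(2,5) by - (rule monicD[OF s]; simp add: in_Hom)
  then show "\<exists>\<epsilon> y. epic C \<epsilon> \<and> y \<in> Arr C \<and> Tgt C \<epsilon> = Src C x \<and> Src C y = Src C \<epsilon> \<and>
            Tgt C y = Src C k' \<and> k' \<cdot> y = x \<cdot> \<epsilon>"
    using y y' \<epsilon>x hom by (intro exI[of _ \<epsilon>] exI[of _ "e \<cdot> y'"]) (simp add: in_Hom)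
qed (use hom in \<open>auto simp: in_Hom\<close>)

text \<open>Up to epimorphisms: lift \<open>x\<close> along \<open>t\<close> to \<open>y\<close>.
  That \<open>j'\<close> kills \<open>x\<close> means that \<open>j \<cdot> y\<close> is a boundary
  \<open>j \<cdot> (k \<cdot> v)\<close>. Correcting \<open>y\<close> by \<open>k \<cdot> v\<close>
  puts it in the image of \<open>i2\<close> without changing its image under \<open>t\<close>,
  because \<open>t\<close> kills \<open>k\<close>.\<close>

lemma derived_exact_ij:
  assumes hom: "t \<in> Hom C D1 D'" "s \<in> Hom C D' D" "s1 \<in> Hom C D'1 D1" "t1 \<in> Hom C D2 D'1"
      "i2 \<in> Hom C D2 D1" "i \<in> Hom C D1 D" "j \<in> Hom C D1 E" "k \<in> Hom C E0 D1" "j' \<in> Hom C D' E'"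
      "e \<in> Hom C Z E'" "l \<in> Hom C D1 Z" "z \<in> Hom C Z E" "b \<in> Hom C E0 Z"
    and t: "epic C t" and s: "monic C s" and t1: "epic C t1" and st: "s \<cdot> t = i" and st1: "s1 \<cdot> t1 = i2"
    and ij: "exact_at C i2 j" and ki: "exact_at C k i" and j': "j' \<cdot> t = e \<cdot> l" and l: "z \<cdot> l = j"
    and z: "monic C z" and zb: "z \<cdot> b = j \<cdot> k" and e: "is_cokernel C b e"
  shows "exact_at C (t \<cdot> s1) j'"
proof (rule exactI)
  have obj: "E \<in> Obj C" "E' \<in> Obj C" "D' \<in> Obj C" "D'1 \<in> Obj C" "D1 \<in> Obj C" "D2 \<in> Obj C" "Z \<in> Obj C"
    using hom Hom_Obj by blast+
  have "(j \<cdot> s1) \<cdot> t1 = Nul C D2 E" using exact_comp[OF ij] hom st1 by (simp add: in_Hom)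
  then have js: "j \<cdot> s1 = Nul C D'1 E"
    using epic_Nul[OF t1, of "j \<cdot> s1"] hom by (simp add: in_Hom)
  have "z \<cdot> (l \<cdot> s1) = Nul C D'1 E" using js hom by (simp add: in_Hom flip: l)
  then have ls: "l \<cdot> s1 = Nul C D'1 Z" using monic_Nul[OF z, of "l \<cdot> s1"] hom by (simp add: in_Hom)
  have "j' \<cdot> (t \<cdot> s1) = e \<cdot> (l \<cdot> s1)" using j'[THEN pull, of s1] hom by (simp add: in_Hom)
  then show "j' \<cdot> (t \<cdot> s1) = Nul C (Src C (t \<cdot> s1)) (Tgt C j')"
    unfolding ls using hom obj by (simp add: in_Hom)
next
  fix x assume x: "x \<in> Arr C" "Tgt C x = Src C j'" "j' \<cdot> x = Nul C (Src C x) (Tgt C j')"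
  have xD: "Tgt C x = D'" using x hom by (simp add: in_Hom)
  obtain \<epsilon> y where y: "epic C \<epsilon>" "\<epsilon> \<in> Arr C" "y \<in> Arr C" "Tgt C \<epsilon> = Src C x" "Src C y = Src C \<epsilon>"
    "Tgt C y = Src C t" "t \<cdot> y = x \<cdot> \<epsilon>"
    by (rule epic_pullback[OF t, of x]) (use x(1) xD hom in \<open>auto simp: in_Hom\<close>)
  have yD: "Tgt C y = D1" using y hom by (simp add: in_Hom)
  have "e \<cdot> (l \<cdot> y) = j' \<cdot> (t \<cdot> y)"
    using j'[THEN pull, of y] y(2-6) hom by (simp add: in_Hom)
  also have "\<dots> = Nul C (Src C y) E'"
    unfolding y(7) using x(3)[THEN pull, of \<epsilon>] x(1) xD y(2-5) hom by (simp add: in_Hom)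
  finally have "e \<cdot> (l \<cdot> y) = Nul C (Src C y) E'" .
  then obtain \<epsilon>' v where v: "epic C \<epsilon>'" "\<epsilon>' \<in> Arr C" "v \<in> Arr C" "Tgt C \<epsilon>' = Src C (l \<cdot> y)" "Src C v = Src C \<epsilon>'"
    "Tgt C v = Src C b" "b \<cdot> v = (l \<cdot> y) \<cdot> \<epsilon>'"
    using y(2-6) hom by - (rule exact_lift[OF exact_cokernel[OF e], of "l \<cdot> y"]; simp add: in_Hom)
  have \<epsilon>'y: "Tgt C \<epsilon>' = Src C y" using v y hom by (simp add: in_Hom)
  have vE: "Tgt C v = E0" using v hom by (simp add: in_Hom)
  have "j \<cdot> (y \<cdot> \<epsilon>') = z \<cdot> (b \<cdot> v)"
    unfolding v(7) using v(2) y(3) \<epsilon>'y yD hom by (simp add: in_Hom flip: l)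
  also have "\<dots> = j \<cdot> (k \<cdot> v)"
    using zb[THEN pull, of v] v(3) vE hom by (simp add: in_Hom)
  finally have jj: "j \<cdot> (y \<cdot> \<epsilon>') = j \<cdot> (k \<cdot> v)" .
  define w where "w = (y \<cdot> \<epsilon>') \<boxplus> neg C (k \<cdot> v)"
  have w: "w \<in> Arr C" "Tgt C w = D1" "Src C w = Src C v"
    using v(2,3,5) y(3) \<epsilon>'y yD vE hom unfolding w_def by (simp_all add: in_Hom)
  have "j \<cdot> w = (j \<cdot> (k \<cdot> v)) \<boxplus> neg C (j \<cdot> (k \<cdot> v))"
    using v(2,3,5) y(3) \<epsilon>'y yD vE hom unfolding w_def by (simp add: in_Hom Cmp_Pls(1) jj)
  then have "j \<cdot> w = Nul C (Src C w) E"
    using v(3) vE hom w by (simp add: in_Hom)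
  then obtain \<epsilon>'' u where u: "epic C \<epsilon>''" "\<epsilon>'' \<in> Arr C" "u \<in> Arr C" "Tgt C \<epsilon>'' = Src C w" "Src C u = Src C \<epsilon>''"
    "Tgt C u = Src C i2" "i2 \<cdot> u = w \<cdot> \<epsilon>''"
    using w hom by - (rule exact_lift[OF ij, of w]; simp add: in_Hom)
  have uD: "Tgt C u = D2" using u hom by (simp add: in_Hom)
  have ysum: "y \<cdot> \<epsilon>' = w \<boxplus> (k \<cdot> v)"
    using v(2,3,5) y(3) \<epsilon>'y yD vE hom unfolding w_def by (simp add: in_Hom Pls_assoc)
  have "s \<cdot> (t \<cdot> (k \<cdot> v)) = (i \<cdot> k) \<cdot> v"
    using v(3) vE hom by (simp add: in_Hom flip: st)
  also have "\<dots> = Nul C (Src C v) D"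
    using exact_comp[OF ki] v(3) vE hom Hom_Obj(2)[OF hom(2)] by (simp add: in_Hom)
  finally have tk: "t \<cdot> (k \<cdot> v) = Nul C (Src C v) D'"
    using monic_Nul[OF s, of "t \<cdot> (k \<cdot> v)"] v(3) vE hom by (simp add: in_Hom)
  have "x \<cdot> (\<epsilon> \<cdot> (\<epsilon>' \<cdot> \<epsilon>'')) = (t \<cdot> y) \<cdot> (\<epsilon>' \<cdot> \<epsilon>'')"
    unfolding y(7) using x(1) y(2-5) v(2,5) \<epsilon>'y u(2,4) w by simp
  also have "\<dots> = (t \<cdot> (y \<cdot> \<epsilon>')) \<cdot> \<epsilon>''"
    using y(3) yD v(2,5) \<epsilon>'y u(2,4) w hom by (simp add: in_Hom)
  also have "t \<cdot> (y \<cdot> \<epsilon>') = t \<cdot> w"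
    unfolding ysum using w v(3) vE hom tk by (simp add: in_Hom Cmp_Pls(1))
  also have "(t \<cdot> w) \<cdot> \<epsilon>'' = t \<cdot> (i2 \<cdot> u)"
    unfolding u(7) using w u(2,4) hom by (simp add: in_Hom)
  also have "\<dots> = (t \<cdot> s1) \<cdot> (t1 \<cdot> u)"
    using u(3) uD hom by (simp add: in_Hom flip: st1)
  finally have "(t \<cdot> s1) \<cdot> (t1 \<cdot> u) = x \<cdot> (\<epsilon> \<cdot> (\<epsilon>' \<cdot> \<epsilon>''))" by simp
  moreover have "epic C (\<epsilon> \<cdot> (\<epsilon>' \<cdot> \<epsilon>''))"
    using y v u w \<epsilon>'y by (intro epic_Cmp) auto
  ultimately show "\<exists>\<epsilon> y. epic C \<epsilon> \<and> y \<in> Arr C \<and> Tgt C \<epsilon> = Src C x \<and> Src C y = Src C \<epsilon> \<and>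
            Tgt C y = Src C (t \<cdot> s1) \<and> (t \<cdot> s1) \<cdot> y = x \<cdot> \<epsilon>"
    using u(2,3,4,5) uD y(2,4,5) v(2,4,5) \<epsilon>'y w hom
    by (intro exI[of _ "\<epsilon> \<cdot> (\<epsilon>' \<cdot> \<epsilon>'')"] exI[of _ "t1 \<cdot> u"]) (simp add: in_Hom)
qed (use hom in \<open>auto simp: in_Hom\<close>)

text \<open>Up to epimorphisms: a class killed by \<open>k'\<close> is represented by a cycle
  \<open>y\<close> with \<open>k \<cdot> (z \<cdot> y) = 0\<close>, so \<open>z \<cdot> y\<close>
  comes from \<open>j\<close>. Cancelling the monic \<open>z\<close> turns this into
  \<open>y = l \<cdot> v\<close>, and \<open>t \<cdot> v\<close> is the preimage.\<close>

lemma derived_exact_jk: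
  assumes hom: "t \<in> Hom C D D'" "l \<in> Hom C D Z" "z \<in> Hom C Z E" "j \<in> Hom C D E" "k \<in> Hom C E D1"
      "e \<in> Hom C Z E'" "j' \<in> Hom C D' E'" "k' \<in> Hom C E' D'1" "s \<in> Hom C D'1 D1"
    and t: "epic C t" and l: "z \<cdot> l = j" and z: "monic C z" and ex: "exact_at C j k" and e: "epic C e"
    and j': "j' \<cdot> t = e \<cdot> l" and k': "s \<cdot> (k' \<cdot> e) = k \<cdot> z" and s: "monic C s"
  shows "exact_at C j' k'"
proof (rule exactI)
  have "s \<cdot> ((k' \<cdot> j') \<cdot> t) = (s \<cdot> (k' \<cdot> e)) \<cdot> l" using hom j' by (simp add: in_Hom)
  also have "\<dots> = k \<cdot> j" unfolding k' using hom l by (simp add: in_Hom)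
  also have "\<dots> = Nul C D D1" using exact_comp[OF ex] hom by (simp add: in_Hom)
  finally have "(k' \<cdot> j') \<cdot> t = Nul C D D'1"
    using monic_Nul[OF s, of "(k' \<cdot> j') \<cdot> t"] hom by (simp add: in_Hom)
  then show "k' \<cdot> j' = Nul C (Src C j') (Tgt C k')"
    using epic_Nul[OF t, of "k' \<cdot> j'"] hom by (simp add: in_Hom)
next
  fix x assume x: "x \<in> Arr C" "Tgt C x = Src C k'" "k' \<cdot> x = Nul C (Src C x) (Tgt C k')"
  have xE: "Tgt C x = E'" using x hom by (simp add: in_Hom)
  obtain \<epsilon> y where y: "epic C \<epsilon>" "\<epsilon> \<in> Arr C" "y \<in> Arr C" "Tgt C \<epsilon> = Src C x" "Src C y = Src C \<epsilon>"
    "Tgt C y = Src C e" "e \<cdot> y = x \<cdot> \<epsilon>"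
    by (rule epic_pullback[OF e, of x]) (use x(1) xE hom in \<open>auto simp: in_Hom\<close>)
  have yZ: "Tgt C y = Z" using y hom by (simp add: in_Hom)
  have "k \<cdot> (z \<cdot> y) = s \<cdot> (k' \<cdot> (e \<cdot> y))"
    using k'[THEN sym, THEN pull, of y] y(3) yZ hom by (simp add: in_Hom)
  also have "\<dots> = s \<cdot> ((k' \<cdot> x) \<cdot> \<epsilon>)" using y(2,4,7) x(1) xE hom by (simp add: in_Hom)
  also have "\<dots> = Nul C (Src C y) D1" unfolding x(3) using y(2,4,5) x(1) hom Hom_Obj(2)[OF hom(8)] by (simp add: in_Hom)
  finally have "k \<cdot> (z \<cdot> y) = Nul C (Src C y) D1" .
  then obtain \<epsilon>' v where v: "epic C \<epsilon>'" "\<epsilon>' \<in> Arr C" "v \<in> Arr C" "Tgt C \<epsilon>' = Src C (z \<cdot> y)" "Src C v = Src C \<epsilon>'"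
    "Tgt C v = Src C j" "j \<cdot> v = (z \<cdot> y) \<cdot> \<epsilon>'"
    using y(3) yZ hom by - (rule exact_lift[OF ex, of "z \<cdot> y"]; simp add: in_Hom)
  have \<epsilon>'y: "Tgt C \<epsilon>' = Src C y" using v y(3) yZ hom by (simp add: in_Hom)
  have vD: "Tgt C v = D" using v hom by (simp add: in_Hom)
  have "z \<cdot> (y \<cdot> \<epsilon>') = z \<cdot> (l \<cdot> v)"
    using v(2,3,7) y(3) yZ \<epsilon>'y vD hom by (simp add: in_Hom flip: l)
  then have yl: "y \<cdot> \<epsilon>' = l \<cdot> v"
    using v(2,3,5) y(3) yZ \<epsilon>'y vD hom by - (rule monicD[OF z]; simp add: in_Hom)
  have "j' \<cdot> (t \<cdot> v) = e \<cdot> (l \<cdot> v)" using j'[THEN pull, of v] v(3) vD hom by (simp add: in_Hom)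
  also have "\<dots> = (e \<cdot> y) \<cdot> \<epsilon>'" using v(2) y(3) yZ \<epsilon>'y hom by (simp add: in_Hom yl)
  also have "\<dots> = x \<cdot> (\<epsilon> \<cdot> \<epsilon>')" unfolding y(7) using v(2) y(2,4,5) x(1) \<epsilon>'y by simp
  finally have "j' \<cdot> (t \<cdot> v) = x \<cdot> (\<epsilon> \<cdot> \<epsilon>')" .
  moreover have "epic C (\<epsilon> \<cdot> \<epsilon>')" using y v \<epsilon>'y by (intro epic_Cmp) auto
  ultimately show "\<exists>\<epsilon> y. epic C \<epsilon> \<and> y \<in> Arr C \<and> Tgt C \<epsilon> = Src C x \<and> Src C y = Src C \<epsilon> \<and>
            Tgt C y = Src C j' \<and> j' \<cdot> y = x \<cdot> \<epsilon>"
    using v(2,3,5) vD y(2,4,5) \<epsilon>'y hom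
    by (intro exI[of _ "\<epsilon> \<cdot> \<epsilon>'"] exI[of _ "t \<cdot> v"]) (simp add: in_Hom)
qed (use hom in \<open>auto simp: in_Hom\<close>)

text \<open>Where the bidegree depends on \<open>r\<close> or two places are involved, the shifted
  indices are variables constrained by equations, so that the facts apply to goals whose indices
  agree only up to arithmetic.\<close>

lemma exact_coupleD:
  assumes "exact_couple C r K"
  shows "cD K p q \<in> Obj C" "cE K p q \<in> Obj C"
    "ci K p q \<in> Hom C (cD K p q) (cD K (p - 1) (q + 1))"
    "\<lbrakk>p' = p + int r - 1; q' = q - int r + 1\<rbrakk> \<Longrightarrow> cj K p q \<in> Hom C (cD K p q) (cE K p' q')"
    "ck K p q \<in> Hom C (cE K p q) (cD K (p + 1) q)"
    "exact_at C (ck K (p - 1) q) (ci K p q)"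
    "\<lbrakk>p' = p + 1; q' = q - 1\<rbrakk> \<Longrightarrow> exact_at C (ci K p' q') (cj K p q)"
    "\<lbrakk>p' = p - int r + 1; q' = q + int r - 1\<rbrakk> \<Longrightarrow> exact_at C (cj K p' q') (ck K p q)"
  using assms unfolding exact_couple_def by simp_all

lemma couple_diff_Hom:
  assumes "exact_couple C r K" "p' = p + int r" "q' = q - int r + 1"
  shows "couple_diff C K p q \<in> Hom C (cE K p q) (cE K p' q')"
  using exact_coupleD(4)[OF assms(1), of p' "p + 1" q' q] exact_coupleD(5)[OF assms(1), of p q] assms
  unfolding couple_diff_def by (simp add: in_Hom)

lemma cj_ci:
  assumes K: "exact_couple C r K" and "p' = p + int r - 1" "q' = q - int r + 1"
  shows "cj K p q \<cdot> ci K (p + 1) (q - 1) = Nul C (cD K (p + 1) (q - 1)) (cE K p' q')"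
  using exact_comp(4)[OF exact_coupleD(7)[OF K refl refl, of p q]]
    exact_coupleD(4)[OF K, of p' p q' q] exact_coupleD(3)[OF K, of "p + 1" "q - 1"] assms
  by (simp add: in_Hom)

lemma ck_cj:
  assumes K: "exact_couple C r K" and "p' = p - int r + 1" "q' = q + int r - 1"
  shows "ck K p q \<cdot> cj K p' q' = Nul C (cD K p' q') (cD K (p + 1) q)"
  using exact_comp(4)[OF exact_coupleD(8)[OF assms]]
    exact_coupleD(4)[OF K, of p p' q q'] exact_coupleD(5)[OF K, of p q] assms
  by (simp add: in_Hom)

lemma ci_ck:
  assumes K: "exact_couple C r K"
  shows "ci K p q \<cdot> ck K (p - 1) q = Nul C (cE K (p - 1) q) (cD K (p - 1) (q + 1))"
  using exact_comp(4)[OF exact_coupleD(6)[OF assms]]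
    exact_coupleD(3)[OF K, of p q] exact_coupleD(5)[OF K, of "p - 1" q] assms
  by (simp add: in_Hom)

lemma couple_diff_couple_diff:
  assumes K: "exact_couple C r K" and "p' = p + int r" "q' = q - int r + 1"
    "p'' = p + 2 * int r" "q'' = q - 2 * int r + 2"
  shows "couple_diff C K p' q' \<cdot> couple_diff C K p q = Nul C (cE K p q) (cE K p'' q'')"
proof -
  have hom: "cj K (p' + 1) q' \<in> Hom C (cD K (p' + 1) q') (cE K p'' q'')"
    "cj K (p + 1) q \<in> Hom C (cD K (p + 1) q) (cE K p' q')"
    "ck K p' q' \<in> Hom C (cE K p' q') (cD K (p' + 1) q')"
    "ck K p q \<in> Hom C (cE K p q) (cD K (p + 1) q)"
    by (rule exact_coupleD[OF K]; use assms in simp)+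
  have "ck K p' q' \<cdot> cj K (p + 1) q = Nul C (cD K (p + 1) q) (cD K (p' + 1) q')"
    using assms by (intro ck_cj[OF K]) auto
  note this[THEN pull, of "ck K p q"]
  then have "ck K p' q' \<cdot> (cj K (p + 1) q \<cdot> ck K p q) = Nul C (cE K p q) (cD K (p' + 1) q')"
    using hom Hom_Obj(2)[OF hom(3)] by (simp add: in_Hom)
  then show ?thesis
    using hom Hom_Obj(1)[OF hom(4)] unfolding couple_diff_def by (simp add: in_Hom)
qed

lemma couple_homology:
  assumes K: "exact_couple C r K"
  shows "\<exists>z e. is_homology C (couple_diff C K (p - int r) (q + int r - 1)) (couple_diff C K p q) z e"
proof (rule ex_homology)
  have 1: "couple_diff C K (p - int r) (q + int r - 1)
       \<in> Hom C (cE K (p - int r) (q + int r - 1)) (cE K p q)"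
    by (rule couple_diff_Hom[OF K]) auto
  have 2: "couple_diff C K p q \<in> Hom C (cE K p q) (cE K (p + int r) (q - int r + 1))"
    by (rule couple_diff_Hom[OF K]) auto
  have 3: "couple_diff C K p q \<cdot> couple_diff C K (p - int r) (q + int r - 1)
     = Nul C (cE K (p - int r) (q + int r - 1)) (cE K (p + int r) (q - int r + 1))"
    by (rule couple_diff_couple_diff[OF K]) auto
  show "couple_diff C K (p - int r) (q + int r - 1) \<in> Arr C" "couple_diff C K p q \<in> Arr C"
    "Tgt C (couple_diff C K (p - int r) (q + int r - 1)) = Src C (couple_diff C K p q)"
    "couple_diff C K p q \<cdot> couple_diff C K (p - int r) (q + int r - 1)
      = Nul C (Src C (couple_diff C K (p - int r) (q + int r - 1))) (Tgt C (couple_diff C K p q))"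
    using 1 2 3 by (auto simp: in_Hom)
qed

lemma ex_derived_couple:
  assumes K: "exact_couple C r K"
  shows "\<exists>K' z e. derived_couple C r K K' z e \<and> exact_couple C (Suc r) K'"
proof -
  note KD = exact_coupleD[OF K]
  obtain z e where homol: "\<And>p q. is_homology C (couple_diff C K (p - int r) (q + int r - 1))
      (couple_diff C K p q) (z p q) (e p q)"
    using couple_homology[OF K] by metis
  note h = homology_simps[OF homol]
  have z: "z p q \<in> Hom C (Src C (z p q)) (cE K p q)" and e: "e p q \<in> Hom C (Src C (z p q)) (Tgt C (e p q))" for p q
    using h[of p q] couple_diff_Hom[OF K refl refl, of p q] by (auto simp: in_Hom)
  \<comment> \<open>The inclusion \<open>s p q\<close> is indexed by its target, so it is an image
    of the \<open>i\<close> that ends at \<open>(p, q)\<close> and starts at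
    \<open>(p + 1, q - 1)\<close>.\<close>
  have "\<exists>s. is_image C (ci K (p + 1) (q - 1)) s" for p q
    using ex_image KD(3)[of "p + 1" "q - 1"] by (simp add: in_Hom)
  then obtain s where im: "\<And>p q. is_image C (ci K (p + 1) (q - 1)) (s p q)" by metis
  have s: "s p q \<in> Hom C (Src C (s p q)) (cD K p q)" "monic C (s p q)" for p q
    using image_simps[OF im[of p q]] KD(3)[of "p + 1" "q - 1"] by (auto simp: in_Hom)
  have im': "is_image C (ci K p q) (s (p - 1) (q + 1))" for p q
    using im[of "p - 1" "q + 1"] by simp
  have "\<exists>t. epic C t \<and> t \<in> Hom C (cD K p q) (Src C (s (p - 1) (q + 1))) \<and>
      s (p - 1) (q + 1) \<cdot> t = ci K p q" for p q
    using image_factor[OF im'[of p q]] KD(3)[of p q] unfolding in_Hom by metis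
  then obtain t where t: "\<And>p q. epic C (t p q)"
      "\<And>p q. t p q \<in> Hom C (cD K p q) (Src C (s (p - 1) (q + 1)))"
      "\<And>p q. s (p - 1) (q + 1) \<cdot> t p q = ci K p q"
    by metis
  have cj: "cj K p q \<in> Hom C (cD K p q) (cE K (p + int r - 1) (q - int r + 1))" for p q
    by (rule KD(4)) auto
  have "\<exists>l j'. l \<in> Hom C (cD K p q) (Src C (z (p + int r - 1) (q - int r + 1))) \<and>
      z (p + int r - 1) (q - int r + 1) \<cdot> l = cj K p q \<and>
      j' \<in> Hom C (Src C (s (p - 1) (q + 1))) (Tgt C (e (p + int r - 1) (q - int r + 1))) \<and>
      j' \<cdot> t p q = e (p + int r - 1) (q - int r + 1) \<cdot> l" for p q
  proof (rule derived_j)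
    show "ck K (p - 1) q \<in> Hom C (cE K (p - 1) q) (cD K p q)" using KD(5)[of "p - 1" q] by simp
    show "exact_at C (ck K (p - 1) q) (ci K p q)" by (rule KD(6))
    show "is_homology C (cj K p q \<cdot> ck K (p - 1) q)
        (couple_diff C K (p + int r - 1) (q - int r + 1))
        (z (p + int r - 1) (q - int r + 1)) (e (p + int r - 1) (q - int r + 1))"
      using homol[of "p + int r - 1" "q - int r + 1"] by (simp add: couple_diff_def)
    show d: "couple_diff C K (p + int r - 1) (q - int r + 1)
      \<in> Hom C (cE K (p + int r - 1) (q - int r + 1)) (cE K (p + 2 * int r - 1) (q - 2 * int r + 2))"
      by (rule couple_diff_Hom[OF K]) auto
    have "ck K (p + int r - 1) (q - int r + 1) \<cdot> cj K p q = Nul C (cD K p q) (cD K (p + int r) (q - int r + 1))"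
      using ck_cj[OF K, of p "p + int r - 1" q "q - int r + 1"] by simp
    moreover have "cj K (p + int r) (q - int r + 1) \<in> Hom C (cD K (p + int r) (q - int r + 1))
        (cE K (p + 2 * int r - 1) (q - 2 * int r + 2))"
      by (rule KD(4)) auto
    moreover have "ck K (p + int r - 1) (q - int r + 1) \<in> Hom C (cE K (p + int r - 1) (q - int r + 1))
        (cD K (p + int r) (q - int r + 1))"
      using KD(5)[of "p + int r - 1" "q - int r + 1"] by simp
    ultimately show "couple_diff C K (p + int r - 1) (q - int r + 1) \<cdot> cj K p q =
        Nul C (cD K p q) (cE K (p + 2 * int r - 1) (q - 2 * int r + 2))"
      using cj[of p q] KD(1) unfolding couple_diff_def by (simp add: in_Hom)
  qed (use t s KD(3) cj in auto)
  then obtain l j where l: "\<And>p q. l p q \<in> Hom C (cD K p q) (Src C (z (p + int r - 1) (q - int r + 1)))"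
      "\<And>p q. z (p + int r - 1) (q - int r + 1) \<cdot> l p q = cj K p q"
    and j: "\<And>p q. j p q \<in> Hom C (Src C (s (p - 1) (q + 1))) (Tgt C (e (p + int r - 1) (q - int r + 1)))"
      "\<And>p q. j p q \<cdot> t p q = e (p + int r - 1) (q - int r + 1) \<cdot> l p q"
    by metis
  have "\<exists>k'. k' \<in> Hom C (Tgt C (e p q)) (Src C (s (p + 1) q)) \<and> s (p + 1) q \<cdot> (k' \<cdot> e p q) = ck K p q \<cdot> z p q" for p q
  proof (rule derived_k[OF _ _ _ _ _ im])
    show "is_homology C (cj K (p - int r + 1) (q + int r - 1) \<cdot> ck K (p - int r) (q + int r - 1))
      (cj K (p + 1) q \<cdot> ck K p q) (z p q) (e p q)"
      using homol[of p q] by (simp add: couple_diff_def)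
    show "ck K p q \<cdot> cj K (p - int r + 1) (q + int r - 1)
        = Nul C (cD K (p - int r + 1) (q + int r - 1)) (cD K (p + 1) q)"
      by (rule ck_cj[OF K]) auto
    show "exact_at C (ci K (p + 1 + 1) (q - 1)) (cj K (p + 1) q)" by (rule KD(7)) auto
    show "ci K (p + 1 + 1) (q - 1) \<in> Hom C (cD K (p + 1 + 1) (q - 1)) (cD K (p + 1) q)"
      using KD(3)[of "p + 1 + 1" "q - 1"] by (simp add: algebra_simps)
    show "cj K (p - int r + 1) (q + int r - 1) \<in> Hom C (cD K (p - int r + 1) (q + int r - 1)) (cE K p q)"
      by (rule KD(4)) auto
    show "ck K (p - int r) (q + int r - 1) \<in> Hom C (cE K (p - int r) (q + int r - 1)) (cD K (p - int r + 1) (q + int r - 1))"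
      by (rule KD(5))
  qed (use cj KD(5) in auto)
  then obtain k where k: "\<And>p q. k p q \<in> Hom C (Tgt C (e p q)) (Src C (s (p + 1) q))"
      "\<And>p q. s (p + 1) q \<cdot> (k p q \<cdot> e p q) = ck K p q \<cdot> z p q"
    by metis
  \<comment> \<open>The map \<open>j p q\<close> starts at the image of the \<open>i\<close> out of
    \<open>(p, q)\<close>, which sits at \<open>(p - 1, q + 1)\<close>. Indexing it by its own
    source gives the shift in \<open>cj\<close> and changes the bidegree from
    \<open>(r - 1, 1 - r)\<close> to \<open>(r, -r)\<close>.\<close>
  define K' where "K' = \<lparr>cD = \<lambda>p q. Src C (s p q), cE = \<lambda>p q. Tgt C (e p q),
     ci = \<lambda>p q. t p q \<cdot> s p q, cj = \<lambda>p q. j (p + 1) (q - 1), ck = k\<rparr>"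
  have "derived_couple C r K K' z e"
    unfolding derived_couple_def
  proof (rule conjI, use homol in \<open>simp add: K'_def\<close>, rule exI[of _ s], rule exI[of _ t], intro allI conjI)
    fix p q
    show "\<exists>l\<in>Hom C (cD K p q) (Src C (z (p + int r - 1) (q - int r + 1))).
          z (p + int r - 1) (q - int r + 1) \<cdot> l = cj K p q \<and>
          cj K' (p - 1) (q + 1) \<cdot> t p q = e (p + int r - 1) (q - int r + 1) \<cdot> l"
      using l j by (intro bexI[of _ "l p q"]) (auto simp: K'_def)
    show "s (p + 1) q \<cdot> ck K' p q \<cdot> e p q = ck K p q \<cdot> z p q" using k by (simp add: K'_def)
  qed (use s t im' in \<open>auto simp: K'_def\<close>)
  moreover have "exact_couple C (Suc r) K'"
    unfolding exact_couple_def
  proof (intro allI conjI)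
    fix p q
    show "cD K' p q \<in> Obj C" using s(1)[of p q] Hom_Obj by (auto simp: K'_def)
    show "cE K' p q \<in> Obj C" using e[of p q] Hom_Obj by (auto simp: K'_def)
    show "ci K' p q \<in> Hom C (cD K' p q) (cD K' (p - 1) (q + 1))"
      using s(1)[of p q] t(2)[of p q] by (simp add: K'_def in_Hom)
    show "cj K' p q \<in> Hom C (cD K' p q) (cE K' (p + int (Suc r) - 1) (q - int (Suc r) + 1))"
      using j(1)[of "p + 1" "q - 1"] by (simp add: K'_def algebra_simps)
    show "ck K' p q \<in> Hom C (cE K' p q) (cD K' (p + 1) q)"
      using k by (simp add: K'_def)
    \<comment> \<open>That \<open>j\<close> vanishes on the image of \<open>i\<close> is checked
      after composing with the epic half of \<open>i\<close>.\<close>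
    have js: "cj K p q \<cdot> s p q = Nul C (Src C (s p q)) (cE K (p + int r - 1) (q - int r + 1))" for p q
    proof -
      have "(cj K p q \<cdot> s p q) \<cdot> t (p + 1) (q - 1) = Nul C (cD K (p + 1) (q - 1)) (cE K (p + int r - 1) (q - int r + 1))"
        using cj_ci[OF K refl refl, of p q] t(2,3)[of "p + 1" "q - 1"] s(1)[of p q] cj[of p q] by (simp add: in_Hom)
      then show ?thesis
        using epic_Nul[OF t(1)[of "p + 1" "q - 1"], of "cj K p q \<cdot> s p q"]
          t(2,3)[of "p + 1" "q - 1"] s(1)[of p q] cj[of p q] by (simp add: in_Hom)
    qed
    show "exact_at C (ck K' (p - 1) q) (ci K' p q)"
      unfolding K'_def couple.simps
    proof (rule derived_exact_ki[where k="ck K (p - 1) q" and i="ci K p q" and sm="s (p - 1) (q + 1)"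
          and j="cj K p q" and e="e (p - 1) q" and z="z (p - 1) q"])
      show "ck K (p - 1) q \<in> Hom C (cE K (p - 1) q) (cD K p q)" using KD(5)[of "p - 1" q] by simp
      show "is_kernel C (cj K p q \<cdot> ck K (p - 1) q) (z (p - 1) q)"
        using h(1)[of "p - 1" q] by (simp add: couple_diff_def)
      show "k (p - 1) q \<in> Hom C (Tgt C (e (p - 1) q)) (Src C (s p q))" using k(1)[of "p - 1" q] by simp
      show "s p q \<cdot> k (p - 1) q \<cdot> e (p - 1) q = ck K (p - 1) q \<cdot> z (p - 1) q"
        using k(2)[of "p - 1" q] by simp
    qed (use KD s t cj e js h(3) in auto)
    show "exact_at C (ci K' (p + 1) (q - 1)) (cj K' p q)"
      unfolding K'_def couple.simps
    proof -
      let ?z = "z (p + int r) (q - int r)" and ?e = "e (p + int r) (q - int r)"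
      obtain b where b: "b \<in> Hom C (Src C (couple_diff C K p (q - 1))) (Src C ?z)"
          "?z \<cdot> b = couple_diff C K p (q - 1)" "is_cokernel C b ?e"
        using homologyE[OF homol[of "p + int r" "q - int r"]] by auto
      show "exact_at C (t (p + 1) (q - 1) \<cdot> s (p + 1) (q - 1)) (j (p + 1) (q - 1))"
      proof (rule derived_exact_ij[where t="t (p + 1) (q - 1)" and ?s1.0="s (p + 1) (q - 1)" and s="s p q"
            and ?t1.0="t (p + 1 + 1) (q - 1 - 1)" and ?i2.0="ci K (p + 1 + 1) (q - 1 - 1)" and i="ci K (p + 1) (q - 1)"
            and j="cj K (p + 1) (q - 1)" and k="ck K p (q - 1)" and e="?e" and z="?z" and b=b
            and l="l (p + 1) (q - 1)"])
      show "is_cokernel C b ?e" by fact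
      show "b \<in> Hom C (cE K p (q - 1)) (Src C ?z)"
        using b(1) couple_diff_Hom[OF K refl refl, of p "q - 1"] by (simp add: in_Hom)
      show "?z \<cdot> b = cj K (p + 1) (q - 1) \<cdot> ck K p (q - 1)"
        using b(2) by (simp add: couple_diff_def)
      show "exact_at C (ck K p (q - 1)) (ci K (p + 1) (q - 1))"
        using KD(6)[of "p + 1" "q - 1"] by simp
      show "exact_at C (ci K (p + 1 + 1) (q - 1 - 1)) (cj K (p + 1) (q - 1))" by (rule KD(7)) auto
      show "t (p + 1) (q - 1) \<in> Hom C (cD K (p + 1) (q - 1)) (Src C (s p q))"
        using t(2)[of "p + 1" "q - 1"] by simp
      show "t (p + 1 + 1) (q - 1 - 1) \<in> Hom C (cD K (p + 1 + 1) (q - 1 - 1)) (Src C (s (p + 1) (q - 1)))"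
        using t(2)[of "p + 1 + 1" "q - 1 - 1"] by (simp add: algebra_simps)
      show "ci K (p + 1 + 1) (q - 1 - 1) \<in> Hom C (cD K (p + 1 + 1) (q - 1 - 1)) (cD K (p + 1) (q - 1))"
        using KD(3)[of "p + 1 + 1" "q - 1 - 1"] by (simp add: algebra_simps)
      show "ci K (p + 1) (q - 1) \<in> Hom C (cD K (p + 1) (q - 1)) (cD K p q)"
        using KD(3)[of "p + 1" "q - 1"] by simp
      show "cj K (p + 1) (q - 1) \<in> Hom C (cD K (p + 1) (q - 1)) (cE K (p + int r) (q - int r))"
        by (rule KD(4)) auto
      show "ck K p (q - 1) \<in> Hom C (cE K p (q - 1)) (cD K (p + 1) (q - 1))" by (rule KD(5))
      show "j (p + 1) (q - 1) \<in> Hom C (Src C (s p q)) (Tgt C ?e)"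
        using j(1)[of "p + 1" "q - 1"] by (simp add: algebra_simps)
      show "l (p + 1) (q - 1) \<in> Hom C (cD K (p + 1) (q - 1)) (Src C ?z)"
        using l(1)[of "p + 1" "q - 1"] by (simp add: algebra_simps)
      show "?z \<cdot> l (p + 1) (q - 1) = cj K (p + 1) (q - 1)"
        using l(2)[of "p + 1" "q - 1"] by (simp add: algebra_simps)
      show "j (p + 1) (q - 1) \<cdot> t (p + 1) (q - 1) = ?e \<cdot> l (p + 1) (q - 1)"
        using j(2)[of "p + 1" "q - 1"] by (simp add: algebra_simps)
      show "s p q \<cdot> t (p + 1) (q - 1) = ci K (p + 1) (q - 1)"
        using t(3)[of "p + 1" "q - 1"] by simp
      show "s (p + 1) (q - 1) \<cdot> t (p + 1 + 1) (q - 1 - 1) = ci K (p + 1 + 1) (q - 1 - 1)"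
        using t(3)[of "p + 1 + 1" "q - 1 - 1"] by (simp add: algebra_simps)
      show "monic C (z (p + int r) (q - int r))" by (rule h(2))
      qed (use s t z e in auto)
    qed
    have idx: "p - int (Suc r) + 1 + 1 = p - int r + 1" "q + int (Suc r) - 1 - 1 = q + int r - 1" by auto
    have "p - int r + 1 + int r - 1 = p" "q + int r - 1 - int r + 1 = q"
      "p - int r + 1 - 1 = p - int r" "q + int r - 1 + 1 = q + int r" by auto
    note jl = j[of "p - int r + 1" "q + int r - 1", unfolded this]
      l[of "p - int r + 1" "q + int r - 1", unfolded this] t[of "p - int r + 1" "q + int r - 1", unfolded this]
    show "exact_at C (cj K' (p - int (Suc r) + 1) (q + int (Suc r) - 1)) (ck K' p q)"
      unfolding K'_def couple.simps idx
    proof (rule derived_exact_jk[where t="t (p - int r + 1) (q + int r - 1)" and l="l (p - int r + 1) (q + int r - 1)"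
          and z="z p q" and j="cj K (p - int r + 1) (q + int r - 1)" and k="ck K p q" and e="e p q" and s="s (p + 1) q"])
      show "exact_at C (cj K (p - int r + 1) (q + int r - 1)) (ck K p q)"
        by (rule KD(8)) auto
      show "cj K (p - int r + 1) (q + int r - 1) \<in> Hom C (cD K (p - int r + 1) (q + int r - 1)) (cE K p q)"
        by (rule KD(4)) auto
      show "j (p - int r + 1) (q + int r - 1) \<in> Hom C (Src C (s (p - int r) (q + int r))) (Tgt C (e p q))"
        by (rule jl)
      show "l (p - int r + 1) (q + int r - 1) \<in> Hom C (cD K (p - int r + 1) (q + int r - 1)) (Src C (z p q))"
        by (rule jl)
      show "t (p - int r + 1) (q + int r - 1) \<in> Hom C (cD K (p - int r + 1) (q + int r - 1)) (Src C (s (p - int r) (q + int r)))"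
        by (rule jl)
    qed (use jl s z e h k KD(5) in auto)
  qed
  ultimately show ?thesis by blast
qed

lemma ex_spectral_sequence:
  assumes K: "exact_couple C 1 K"
  shows "\<exists>T. spectral_sequence C T \<and> comes_from_couple C K T"
proof -
  \<comment> \<open>Derived couples are only known to exist, so the sequence comes from dependent
    choice. Here \<open>Ks r\<close> is the couple with number \<open>r + 1\<close>; the shift is
    undone by \<open>r - 1\<close> in \<open>T\<close>.\<close>
  have "\<exists>Ks. \<forall>r. (exact_couple C (Suc r) (Ks r) \<and> (r = 0 \<longrightarrow> Ks r = K)) \<and>
      (\<exists>z e. derived_couple C (Suc r) (Ks r) (Ks (Suc r)) z e)"
  proof (rule dependent_nat_choice)
    show "\<exists>x. exact_couple C (Suc 0) x \<and> (0 = 0 \<longrightarrow> x = K)" using K by auto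
    show "\<exists>y. (exact_couple C (Suc (Suc r)) y \<and> (Suc r = 0 \<longrightarrow> y = K)) \<and>
        (\<exists>z e. derived_couple C (Suc r) x y z e)"
      if "exact_couple C (Suc r) x \<and> (r = 0 \<longrightarrow> x = K)" for x r
      using ex_derived_couple[of "Suc r" x] that by auto
  qed
  then obtain Ks where Ks: "\<And>r. exact_couple C (Suc r) (Ks r)" "Ks 0 = K"
      "\<And>r. \<exists>z e. derived_couple C (Suc r) (Ks r) (Ks (Suc r)) z e" by metis
  then obtain z e where ze: "\<And>r. derived_couple C (Suc r) (Ks r) (Ks (Suc r)) (z r) (e r)" by metis
  define T where "T = \<lparr>sE = \<lambda>r. cE (Ks (r - 1)), sd = \<lambda>r. couple_diff C (Ks (r - 1)),
    sZ = \<lambda>r. z (r - 1), sQ = \<lambda>r. e (r - 1)\<rparr>"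
  have "comes_from_couple C K T"
    unfolding comes_from_couple_def
  proof (intro exI[of _ "\<lambda>r. Ks (r - 1)"] conjI allI impI)
    fix r :: nat assume "1 \<le> r"
    then obtain r' where r': "r = Suc r'" by (cases r) auto
    show "exact_couple C r (Ks (r - 1))"
      "derived_couple C r (Ks (r - 1)) (Ks (Suc r - 1)) (sZ T r) (sQ T r)"
      using Ks ze by (simp_all add: r' T_def)
  qed (use Ks in \<open>auto simp: T_def\<close>)
  moreover have "spectral_sequence C T"
    unfolding spectral_sequence_def
  proof (intro allI impI)
    fix r :: nat and p q assume "1 \<le> r"
    then obtain r' where r': "r = Suc r'" by (cases r) auto
    note K = Ks(1)[of r', folded r'] and D = ze[of r', folded r']
    have "sd T r p q \<in> Hom C (sE T r p q) (sE T r (p + int r) (q - int r + 1))"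
      using couple_diff_Hom[OF K refl refl, of p q] by (simp add: T_def r')
    moreover have "sd T r (p + int r) (q - int r + 1) \<cdot> sd T r p q =
       Nul C (sE T r p q) (sE T r (p + 2 * int r) (q - 2 * int r + 2))"
      using couple_diff_couple_diff[OF K refl refl refl refl, of p q] by (simp add: T_def r')
    ultimately show "sE T r p q \<in> Obj C \<and>
       sd T r p q \<in> Hom C (sE T r p q) (sE T r (p + int r) (q - int r + 1)) \<and>
       sd T r (p + int r) (q - int r + 1) \<cdot> sd T r p q =
       Nul C (sE T r p q) (sE T r (p + 2 * int r) (q - 2 * int r + 2)) \<and>
       is_homology C (sd T r (p - int r) (q + int r - 1)) (sd T r p q) (sZ T r p q) (sQ T r p q) \<and>
       Tgt C (sQ T r p q) = sE T (Suc r) p q"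
      using D exact_coupleD(2)[OF K] unfolding derived_couple_def by (simp add: T_def r')
  qed
  ultimately show ?thesis by blast
qed

end

section \<open>Morphisms of couples and of spectral sequences\<close>

definition couple_morphism ::
  "('o, 'm, 'z) precat_scheme \<Rightarrow> nat \<Rightarrow> ('o, 'm) couple \<Rightarrow> ('o, 'm) couple \<Rightarrow>
   (int \<Rightarrow> int \<Rightarrow> 'm) \<Rightarrow> (int \<Rightarrow> int \<Rightarrow> 'm) \<Rightarrow> bool" where
  "couple_morphism A r K K' \<beta> \<alpha> \<longleftrightarrow> (\<forall>p q.
     \<beta> p q \<in> Hom A (cD K p q) (cD K' p q) \<and>
     \<alpha> p q \<in> Hom A (cE K p q) (cE K' p q) \<and>
     \<beta> (p - 1) (q + 1) \<cdot>\<^bsub>A\<^esub> ci K p q = ci K' p q \<cdot>\<^bsub>A\<^esub> \<beta> p q \<and>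
     \<alpha> (p + int r - 1) (q - int r + 1) \<cdot>\<^bsub>A\<^esub> cj K p q = cj K' p q \<cdot>\<^bsub>A\<^esub> \<beta> p q \<and>
     \<beta> (p + 1) q \<cdot>\<^bsub>A\<^esub> ck K p q = ck K' p q \<cdot>\<^bsub>A\<^esub> \<alpha> p q)"

context abelian_category
begin

text \<open>The map \<open>\<zeta>\<close> on cycles is returned together with the map
  \<open>\<alpha>2\<close> on homology, because a morphism of spectral sequences ties consecutive
  pages together through it. Compatibility with \<open>f\<close> carries boundaries to boundaries,
  so \<open>e' \<cdot> \<zeta>\<close> descends.\<close>

lemma homology_map:
  assumes h: "is_homology C f g z e" and h': "is_homology C f' g' z' e'"
    and hom: "\<alpha> \<in> Hom C (Src C g) (Src C g')" "\<alpha>1 \<in> Hom C (Tgt C g) (Tgt C g')" "\<alpha>0 \<in> Hom C (Src C f) (Src C f')"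
    and g: "g' \<cdot> \<alpha> = \<alpha>1 \<cdot> g" and f: "\<alpha> \<cdot> f = f' \<cdot> \<alpha>0"
  obtains \<zeta> \<alpha>2 where "\<zeta> \<in> Hom C (Src C z) (Src C z')" "\<alpha>2 \<in> Hom C (Tgt C e) (Tgt C e')"
    "z' \<cdot> \<zeta> = \<alpha> \<cdot> z" "e' \<cdot> \<zeta> = \<alpha>2 \<cdot> e"
proof -
  note hs = homology_simps(4-10)[OF h] homology_simps(4-10)[OF h']
  obtain b where b: "b \<in> Hom C (Src C f) (Src C z)" "z \<cdot> b = f" "is_cokernel C b e"
    using homologyE[OF h] by blast
  obtain b' where b': "b' \<in> Hom C (Src C f') (Src C z')" "z' \<cdot> b' = f'" "is_cokernel C b' e'"
    using homologyE[OF h'] by blast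
  have "g' \<cdot> (\<alpha> \<cdot> z) = \<alpha>1 \<cdot> (g \<cdot> z)"
    using g[THEN pull, of z] hs hom by (simp add: in_Hom)
  also have "\<dots> = Nul C (Src C z) (Tgt C g')"
    using kernel_simps(4)[OF homology_simps(1)[OF h]] hs hom by (simp add: in_Hom)
  finally have "g' \<cdot> (\<alpha> \<cdot> z) = Nul C (Src C (\<alpha> \<cdot> z)) (Tgt C g')" using hs hom by (simp add: in_Hom)
  then obtain \<zeta> where \<zeta>: "\<zeta> \<in> Arr C" "Src C \<zeta> = Src C (\<alpha> \<cdot> z)" "Tgt C \<zeta> = Src C z'" "z' \<cdot> \<zeta> = \<alpha> \<cdot> z"
    by (rule kernel_lift[OF homology_simps(1)[OF h'], rotated 2]) (use hs hom in \<open>auto simp: in_Hom\<close>)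
  have \<zeta>z: "Src C \<zeta> = Src C z" using \<zeta> hs hom by (simp add: in_Hom)
  have "z' \<cdot> (\<zeta> \<cdot> b) = \<alpha> \<cdot> f"
    using \<zeta>(4)[THEN pull, of b] \<zeta>(1,3) \<zeta>z b(1,2) hs hom by (simp add: in_Hom)
  also have "\<dots> = z' \<cdot> (b' \<cdot> \<alpha>0)"
    unfolding f b'(2)[symmetric] using b'(1) hs hom by (simp add: in_Hom)
  finally have "\<zeta> \<cdot> b = b' \<cdot> \<alpha>0"
    using \<zeta>(1,3) \<zeta>z b(1) b'(1) hs hom
    by - (rule monicD[OF homology_simps(2)[OF h']]; simp add: in_Hom)
  then have "(e' \<cdot> \<zeta>) \<cdot> b = (e' \<cdot> b') \<cdot> \<alpha>0"
    using \<zeta>(1,3) \<zeta>z b(1) b'(1) hs hom by (simp add: in_Hom)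
  also have "\<dots> = Nul C (Src C b) (Tgt C (e' \<cdot> \<zeta>))"
    using cokernel_simps(4)[OF b'(3)] \<zeta>(1,3) \<zeta>z b(1) b'(1) hs hom by (simp add: in_Hom)
  finally obtain \<alpha>2 where "\<alpha>2 \<in> Arr C" "Src C \<alpha>2 = Tgt C e" "Tgt C \<alpha>2 = Tgt C (e' \<cdot> \<zeta>)" "\<alpha>2 \<cdot> e = e' \<cdot> \<zeta>"
    by (rule cokernel_desc[OF b(3), rotated 2]) (use \<zeta>(1,3) \<zeta>z b(1) hs in \<open>auto simp: in_Hom\<close>)
  then show thesis
    using that[of \<zeta> \<alpha>2] \<zeta> \<zeta>z hs by (auto simp: in_Hom)
qed

lemma image_map:
  assumes im: "is_image C i s" "is_image C i' s'"
    and hom: "\<beta> \<in> Hom C (Src C i) (Src C i')" "\<beta>m \<in> Hom C (Tgt C i) (Tgt C i')"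
    and eq: "\<beta>m \<cdot> i = i' \<cdot> \<beta>"
  obtains \<gamma> where "\<gamma> \<in> Hom C (Src C s) (Src C s')" "s' \<cdot> \<gamma> = \<beta>m \<cdot> s"
proof -
  note ss = image_simps[OF im(1)] image_simps[OF im(2)]
  obtain t where t: "epic C t" "t \<in> Arr C" "Src C t = Src C i" "Tgt C t = Src C s" "s \<cdot> t = i"
    by (rule image_factor[OF im(1)])
  obtain \<gamma> where "\<gamma> \<in> Arr C" "Src C \<gamma> = Src C (\<beta>m \<cdot> s)" "Tgt C \<gamma> = Src C s'" "s' \<cdot> \<gamma> = \<beta>m \<cdot> s"
  proof (rule image_lift[OF im(2), of "\<beta>m \<cdot> s"])
    fix g assume g: "g \<in> Arr C" "Src C g = Tgt C i'" "g \<cdot> i' = Nul C (Src C i') (Tgt C g)"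
    have "(g \<cdot> (\<beta>m \<cdot> s)) \<cdot> t = g \<cdot> (\<beta>m \<cdot> i)"
      using g(1,2) ss hom t by (simp add: in_Hom)
    also have "\<dots> = Nul C (Src C i) (Tgt C g)"
      unfolding eq using g(3)[THEN pull, of \<beta>] g(1,2) ss hom by (simp add: in_Hom)
    finally show "g \<cdot> (\<beta>m \<cdot> s) = Nul C (Src C (\<beta>m \<cdot> s)) (Tgt C g)"
      using epic_Nul[OF t(1), of "g \<cdot> (\<beta>m \<cdot> s)"] g(1,2) ss hom t(2-4) by (simp add: in_Hom)
  qed (use ss hom in \<open>auto simp: in_Hom\<close>)
  then show thesis using that ss hom by (auto simp: in_Hom)
qed

text \<open>Adds to the definition what the comparisons need: \<open>s\<close> is monic as an image,
  and \<open>t\<close> is epic. The latter holds because the factorization of \<open>i\<close>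
  through its image has an epic half and is unique, \<open>s\<close> being cancellable.\<close>

lemma derived_coupleE:
  assumes K: "exact_couple C r K" and D: "derived_couple C r K K' z e" and K': "exact_couple C (Suc r) K'"
  obtains s t l where
    "\<And>p q. s p q \<in> Hom C (cD K' p q) (cD K p q)"
    "\<And>p q. monic C (s p q)"
    "\<And>p q. is_image C (ci K p q) (s (p - 1) (q + 1))"
    "\<And>p q. t p q \<in> Hom C (cD K p q) (cD K' (p - 1) (q + 1))"
    "\<And>p q. epic C (t p q)"
    "\<And>p q. s (p - 1) (q + 1) \<cdot> t p q = ci K p q"
    "\<And>p q. ci K' p q = t p q \<cdot> s p q"
    "\<And>p q p' q'. \<lbrakk>p' = p + int r - 1; q' = q - int r + 1\<rbrakk> \<Longrightarrow> l p q \<in> Hom C (cD K p q) (Src C (z p' q'))"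
    "\<And>p q p' q'. \<lbrakk>p' = p + int r - 1; q' = q - int r + 1\<rbrakk> \<Longrightarrow> z p' q' \<cdot> l p q = cj K p q"
    "\<And>p q p' q'. \<lbrakk>p' = p + int r - 1; q' = q - int r + 1\<rbrakk> \<Longrightarrow>
        cj K' (p - 1) (q + 1) \<cdot> t p q = e p' q' \<cdot> l p q"
    "\<And>p q. s (p + 1) q \<cdot> (ck K' p q \<cdot> e p q) = ck K p q \<cdot> z p q"
    "\<And>p q. is_homology C (couple_diff C K (p - int r) (q + int r - 1)) (couple_diff C K p q) (z p q) (e p q)"
    "\<And>p q. Tgt C (e p q) = cE K' p q"
    "\<And>p q. z p q \<in> Hom C (Src C (z p q)) (cE K p q)"
    "\<And>p q. e p q \<in> Hom C (Src C (z p q)) (cE K' p q)"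
proof -
  have homol: "\<And>p q. is_homology C (couple_diff C K (p - int r) (q + int r - 1)) (couple_diff C K p q) (z p q) (e p q)"
    and eT: "\<And>p q. Tgt C (e p q) = cE K' p q"
    using D unfolding derived_couple_def by auto
  obtain s t where st: "\<And>p q. s p q \<in> Hom C (cD K' p q) (cD K p q)"
    "\<And>p q. t p q \<in> Hom C (cD K p q) (cD K' (p - 1) (q + 1))"
    "\<And>p q. is_image C (ci K p q) (s (p - 1) (q + 1))"
    "\<And>p q. s (p - 1) (q + 1) \<cdot> t p q = ci K p q"
    "\<And>p q. ci K' p q = t p q \<cdot> s p q"
    "\<And>p q. s (p + 1) q \<cdot> (ck K' p q \<cdot> e p q) = ck K p q \<cdot> z p q"
    and "\<And>p q. \<exists>l\<in>Hom C (cD K p q) (Src C (z (p + int r - 1) (q - int r + 1))).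
           z (p + int r - 1) (q - int r + 1) \<cdot> l = cj K p q \<and>
           cj K' (p - 1) (q + 1) \<cdot> t p q = e (p + int r - 1) (q - int r + 1) \<cdot> l"
    using D unfolding derived_couple_def by metis
  then obtain l where l: "\<And>p q. l p q \<in> Hom C (cD K p q) (Src C (z (p + int r - 1) (q - int r + 1)))"
    "\<And>p q. z (p + int r - 1) (q - int r + 1) \<cdot> l p q = cj K p q"
    "\<And>p q. cj K' (p - 1) (q + 1) \<cdot> t p q = e (p + int r - 1) (q - int r + 1) \<cdot> l p q"
    by metis
  have z: "z p q \<in> Hom C (Src C (z p q)) (cE K p q)" and e: "e p q \<in> Hom C (Src C (z p q)) (cE K' p q)" for p q
    using homology_simps[OF homol, of p q] couple_diff_Hom[OF K refl refl, of p q] eT by (auto simp: in_Hom)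
  have s: "monic C (s p q)" for p q
    using image_simps(3)[OF st(3)[of "p + 1" "q - 1"]] by simp
  have t: "epic C (t p q)" for p q
  proof -
    obtain t' where t': "epic C t'" "t' \<in> Arr C" "Src C t' = Src C (ci K p q)"
        "Tgt C t' = Src C (s (p - 1) (q + 1))" "s (p - 1) (q + 1) \<cdot> t' = ci K p q"
      by (rule image_factor[OF st(3)[of p q]])
    have "t p q = t'"
      using t'(2-5) st(1)[of "p - 1" "q + 1"] st(2,4)[of p q] exact_coupleD(3)[OF K, of p q]
      by - (rule monicD[OF s[of "p - 1" "q + 1"]]; simp add: in_Hom)
    then show ?thesis using t' by simp
  qed
  show thesis
    by (rule that[of s t l]) (use st l s t z e homol eT in auto)
qed

lemma couple_morphism_diff:
  assumes K: "exact_couple C r K" and K': "exact_couple C r K'" and m: "couple_morphism C r K K' \<beta> \<alpha>"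
  shows "\<alpha> (p + int r) (q - int r + 1) \<cdot> couple_diff C K p q = couple_diff C K' p q \<cdot> \<alpha> p q"
proof -
  have hom: "cj K (p + 1) q \<in> Hom C (cD K (p + 1) q) (cE K (p + int r) (q - int r + 1))"
    "cj K' (p + 1) q \<in> Hom C (cD K' (p + 1) q) (cE K' (p + int r) (q - int r + 1))"
    "ck K p q \<in> Hom C (cE K p q) (cD K (p + 1) q)"
    "ck K' p q \<in> Hom C (cE K' p q) (cD K' (p + 1) q)"
    by (rule exact_coupleD[OF K] exact_coupleD[OF K']; simp)+
  have m': "\<beta> (p + 1) q \<in> Hom C (cD K (p + 1) q) (cD K' (p + 1) q)"
    "\<alpha> p q \<in> Hom C (cE K p q) (cE K' p q)"
    "\<alpha> (p + int r) (q - int r + 1) \<in> Hom C (cE K (p + int r) (q - int r + 1)) (cE K' (p + int r) (q - int r + 1))"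
    "\<alpha> (p + 1 + int r - 1) (q - int r + 1) \<cdot> cj K (p + 1) q = cj K' (p + 1) q \<cdot> \<beta> (p + 1) q"
    "\<beta> (p + 1) q \<cdot> ck K p q = ck K' p q \<cdot> \<alpha> p q"
    using m unfolding couple_morphism_def by blast+
  have "p + 1 + int r - 1 = p + int r" by simp
  note m4 = m'(4)[unfolded this]
  have "\<alpha> (p + int r) (q - int r + 1) \<cdot> (cj K (p + 1) q \<cdot> ck K p q) = cj K' (p + 1) q \<cdot> (\<beta> (p + 1) q \<cdot> ck K p q)"
    using m4[THEN pull, of "ck K p q"] hom m'(1-3) by (simp add: in_Hom)
  also have "\<dots> = (cj K' (p + 1) q \<cdot> ck K' p q) \<cdot> \<alpha> p q"
    unfolding m'(5) using hom m'(1-3) by (simp add: in_Hom)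
  finally show ?thesis unfolding couple_diff_def .
qed

text \<open>The epic \<open>t\<close> is cancelled on the right, which leaves an equation between
  maps into cycles; that one is checked after the monic \<open>z'\<close>.\<close>

lemma derived_morphism_j:
  assumes hom: "t \<in> Hom C D D2" "l \<in> Hom C D Z" "z \<in> Hom C Z E" "e \<in> Hom C Z E2" "j2 \<in> Hom C D2 E2"
      "t' \<in> Hom C D' D2'" "l' \<in> Hom C D' Z'" "z' \<in> Hom C Z' E'" "e' \<in> Hom C Z' E2'" "j2' \<in> Hom C D2' E2'"
      "\<alpha> \<in> Hom C E E'" "\<beta> \<in> Hom C D D'" "\<alpha>2 \<in> Hom C E2 E2'" "\<beta>2 \<in> Hom C D2 D2'" "\<zeta> \<in> Hom C Z Z'"
    and j2: "j2 \<cdot> t = e \<cdot> l" "j2' \<cdot> t' = e' \<cdot> l'" and \<alpha>: "\<alpha> \<cdot> (z \<cdot> l) = (z' \<cdot> l') \<cdot> \<beta>"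
    and \<zeta>: "z' \<cdot> \<zeta> = \<alpha> \<cdot> z" "e' \<cdot> \<zeta> = \<alpha>2 \<cdot> e" and \<beta>2: "\<beta>2 \<cdot> t = t' \<cdot> \<beta>"
    and t: "epic C t" and z': "monic C z'"
  shows "\<alpha>2 \<cdot> j2 = j2' \<cdot> \<beta>2"
proof -
  have "z' \<cdot> (\<zeta> \<cdot> l) = z' \<cdot> (l' \<cdot> \<beta>)"
    using \<zeta>(1)[THEN pull, of l] \<alpha> hom by (simp add: in_Hom)
  then have \<zeta>l: "\<zeta> \<cdot> l = l' \<cdot> \<beta>"
    using hom by - (rule monicD[OF z']; simp add: in_Hom)
  have "(\<alpha>2 \<cdot> j2) \<cdot> t = e' \<cdot> (\<zeta> \<cdot> l)"
    using \<zeta>(2)[THEN pull, of l] j2(1) hom by (simp add: in_Hom)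
  also have "\<dots> = (j2' \<cdot> \<beta>2) \<cdot> t"
    unfolding \<zeta>l using j2(2)[THEN pull, of \<beta>] \<beta>2 hom by (simp add: in_Hom)
  finally show ?thesis
    using hom by - (rule epicD[OF t]; simp add: in_Hom)
qed

text \<open>Classes are replaced by cycles through the epic \<open>e\<close>, and the values are
  compared in the old couple through the monic \<open>s'\<close>.\<close>

lemma derived_morphism_k:
  assumes hom: "z \<in> Hom C Z E" "e \<in> Hom C Z E2" "k \<in> Hom C E D" "s \<in> Hom C D2 D" "k2 \<in> Hom C E2 D2"
      "z' \<in> Hom C Z' E'" "e' \<in> Hom C Z' E2'" "k' \<in> Hom C E' D'" "s' \<in> Hom C D2' D'" "k2' \<in> Hom C E2' D2'"
      "\<alpha> \<in> Hom C E E'" "\<beta> \<in> Hom C D D'" "\<alpha>2 \<in> Hom C E2 E2'" "\<beta>2 \<in> Hom C D2 D2'" "\<zeta> \<in> Hom C Z Z'"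
    and k2: "s \<cdot> (k2 \<cdot> e) = k \<cdot> z" "s' \<cdot> (k2' \<cdot> e') = k' \<cdot> z'" and \<alpha>: "\<beta> \<cdot> k = k' \<cdot> \<alpha>"
    and \<zeta>: "z' \<cdot> \<zeta> = \<alpha> \<cdot> z" "e' \<cdot> \<zeta> = \<alpha>2 \<cdot> e" and \<beta>2: "s' \<cdot> \<beta>2 = \<beta> \<cdot> s"
    and e: "epic C e" and s': "monic C s'"
  shows "\<beta>2 \<cdot> k2 = k2' \<cdot> \<alpha>2"
proof -
  have "s' \<cdot> (k2' \<cdot> (\<alpha>2 \<cdot> e)) = (s' \<cdot> (k2' \<cdot> e')) \<cdot> \<zeta>"
    using hom \<zeta>(2) by (simp add: in_Hom)
  also have "\<dots> = (k' \<cdot> \<alpha>) \<cdot> z"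
    unfolding k2 using hom \<zeta>(1) by (simp add: in_Hom)
  also have "\<dots> = \<beta> \<cdot> (s \<cdot> (k2 \<cdot> e))"
    unfolding \<alpha>[symmetric] k2 using hom by (simp add: in_Hom)
  also have "\<dots> = s' \<cdot> (\<beta>2 \<cdot> (k2 \<cdot> e))"
    using \<beta>2[THEN pull, of "k2 \<cdot> e"] hom by (simp add: in_Hom)
  finally have "k2' \<cdot> (\<alpha>2 \<cdot> e) = \<beta>2 \<cdot> (k2 \<cdot> e)"
    using hom by - (rule monicD[OF s']; simp add: in_Hom)
  then have "(\<beta>2 \<cdot> k2) \<cdot> e = (k2' \<cdot> \<alpha>2) \<cdot> e" using hom by (simp add: in_Hom)
  then show ?thesis
    using hom by - (rule epicD[OF e]; simp add: in_Hom)
qed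

text \<open>Homology gives \<open>\<alpha>2\<close> and images give \<open>\<beta>2\<close>; the
  squares for the derived maps follow from the old ones by cancelling epic and monic parts. The maps
  on cycles are exported because the definition of a morphism of spectral sequences asks for
  them.\<close>

lemma derived_couple_morphism:
  assumes K: "exact_couple C r K" "exact_couple C r K'" "exact_couple C (Suc r) L" "exact_couple C (Suc r) L'"
    and D: "derived_couple C r K L z e" "derived_couple C r K' L' z' e'"
    and m: "couple_morphism C r K K' \<beta> \<alpha>"
  obtains \<beta>2 \<alpha>2 where "couple_morphism C (Suc r) L L' \<beta>2 \<alpha>2"
    "\<And>p q. \<exists>\<zeta>\<in>Hom C (Src C (z p q)) (Src C (z' p q)). z' p q \<cdot> \<zeta> = \<alpha> p q \<cdot> z p q \<and> e' p q \<cdot> \<zeta> = \<alpha>2 p q \<cdot> e p q"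
proof -
  obtain s t l where st: "\<And>p q. s p q \<in> Hom C (cD L p q) (cD K p q)" "\<And>p q. monic C (s p q)"
      "\<And>p q. is_image C (ci K p q) (s (p - 1) (q + 1))"
      "\<And>p q. t p q \<in> Hom C (cD K p q) (cD L (p - 1) (q + 1))" "\<And>p q. epic C (t p q)"
      "\<And>p q. s (p - 1) (q + 1) \<cdot> t p q = ci K p q" "\<And>p q. ci L p q = t p q \<cdot> s p q"
      and l: "\<And>p q p' q'. \<lbrakk>p' = p + int r - 1; q' = q - int r + 1\<rbrakk> \<Longrightarrow> l p q \<in> Hom C (cD K p q) (Src C (z p' q'))"
      "\<And>p q p' q'. \<lbrakk>p' = p + int r - 1; q' = q - int r + 1\<rbrakk> \<Longrightarrow> z p' q' \<cdot> l p q = cj K p q"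
      "\<And>p q p' q'. \<lbrakk>p' = p + int r - 1; q' = q - int r + 1\<rbrakk> \<Longrightarrow> cj L (p - 1) (q + 1) \<cdot> t p q = e p' q' \<cdot> l p q"
      and k: "\<And>p q. s (p + 1) q \<cdot> (ck L p q \<cdot> e p q) = ck K p q \<cdot> z p q"
      and h: "\<And>p q. is_homology C (couple_diff C K (p - int r) (q + int r - 1)) (couple_diff C K p q) (z p q) (e p q)"
      "\<And>p q. Tgt C (e p q) = cE L p q"
      and ze: "\<And>p q. z p q \<in> Hom C (Src C (z p q)) (cE K p q)" "\<And>p q. e p q \<in> Hom C (Src C (z p q)) (cE L p q)"
    using derived_coupleE[OF K(1) D(1) K(3)] by metis
  obtain s' t' l' where st': "\<And>p q. s' p q \<in> Hom C (cD L' p q) (cD K' p q)" "\<And>p q. monic C (s' p q)"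
      "\<And>p q. is_image C (ci K' p q) (s' (p - 1) (q + 1))"
      "\<And>p q. t' p q \<in> Hom C (cD K' p q) (cD L' (p - 1) (q + 1))" "\<And>p q. epic C (t' p q)"
      "\<And>p q. s' (p - 1) (q + 1) \<cdot> t' p q = ci K' p q" "\<And>p q. ci L' p q = t' p q \<cdot> s' p q"
      and l': "\<And>p q p' q'. \<lbrakk>p' = p + int r - 1; q' = q - int r + 1\<rbrakk> \<Longrightarrow> l' p q \<in> Hom C (cD K' p q) (Src C (z' p' q'))"
      "\<And>p q p' q'. \<lbrakk>p' = p + int r - 1; q' = q - int r + 1\<rbrakk> \<Longrightarrow> z' p' q' \<cdot> l' p q = cj K' p q"
      "\<And>p q p' q'. \<lbrakk>p' = p + int r - 1; q' = q - int r + 1\<rbrakk> \<Longrightarrow> cj L' (p - 1) (q + 1) \<cdot> t' p q = e' p' q' \<cdot> l' p q"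
      and k': "\<And>p q. s' (p + 1) q \<cdot> (ck L' p q \<cdot> e' p q) = ck K' p q \<cdot> z' p q"
      and h': "\<And>p q. is_homology C (couple_diff C K' (p - int r) (q + int r - 1)) (couple_diff C K' p q) (z' p q) (e' p q)"
      "\<And>p q. Tgt C (e' p q) = cE L' p q"
      and ze': "\<And>p q. z' p q \<in> Hom C (Src C (z' p q)) (cE K' p q)" "\<And>p q. e' p q \<in> Hom C (Src C (z' p q)) (cE L' p q)"
    using derived_coupleE[OF K(2) D(2) K(4)] by metis
  have m: "\<And>p q. \<beta> p q \<in> Hom C (cD K p q) (cD K' p q)" "\<And>p q. \<alpha> p q \<in> Hom C (cE K p q) (cE K' p q)"
     "\<And>p q. \<beta> (p - 1) (q + 1) \<cdot> ci K p q = ci K' p q \<cdot> \<beta> p q"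
     "\<And>p q. \<alpha> (p + int r - 1) (q - int r + 1) \<cdot> cj K p q = cj K' p q \<cdot> \<beta> p q"
     "\<And>p q. \<beta> (p + 1) q \<cdot> ck K p q = ck K' p q \<cdot> \<alpha> p q"
     and md: "\<And>p q. \<alpha> (p + int r) (q - int r + 1) \<cdot> couple_diff C K p q = couple_diff C K' p q \<cdot> \<alpha> p q"
    using m couple_morphism_diff[OF K(1,2) m] unfolding couple_morphism_def by blast+
  have "\<exists>\<zeta> \<alpha>2. \<zeta> \<in> Hom C (Src C (z p q)) (Src C (z' p q)) \<and> \<alpha>2 \<in> Hom C (cE L p q) (cE L' p q) \<and>
      z' p q \<cdot> \<zeta> = \<alpha> p q \<cdot> z p q \<and> e' p q \<cdot> \<zeta> = \<alpha>2 \<cdot> e p q" for p q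
  proof -
    note d = couple_diff_Hom[OF K(1), of _ p _ q, OF refl refl] couple_diff_Hom[OF K(2), of _ p _ q, OF refl refl]
      couple_diff_Hom[OF K(1), of p "p - int r" q "q + int r - 1"] couple_diff_Hom[OF K(2), of p "p - int r" q "q + int r - 1"]
    obtain \<zeta> \<alpha>2 where "\<zeta> \<in> Hom C (Src C (z p q)) (Src C (z' p q))" "\<alpha>2 \<in> Hom C (Tgt C (e p q)) (Tgt C (e' p q))"
      "z' p q \<cdot> \<zeta> = \<alpha> p q \<cdot> z p q" "e' p q \<cdot> \<zeta> = \<alpha>2 \<cdot> e p q"
    proof (rule homology_map[OF h(1)[of p q] h'(1)[of p q], where \<alpha> = "\<alpha> p q" and ?\<alpha>1.0 = "\<alpha> (p + int r) (q - int r + 1)"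
         and ?\<alpha>0.0 = "\<alpha> (p - int r) (q + int r - 1)"])
      show "\<alpha> p q \<cdot> couple_diff C K (p - int r) (q + int r - 1) =
          couple_diff C K' (p - int r) (q + int r - 1) \<cdot> \<alpha> (p - int r) (q + int r - 1)"
        using md[of "p - int r" "q + int r - 1"] by simp
    qed (use m(2) d md[of p q] in \<open>auto simp: in_Hom\<close>)
    then show ?thesis using h(2) h'(2) by auto
  qed
  then obtain \<zeta> \<alpha>2 where \<zeta>: "\<And>p q. \<zeta> p q \<in> Hom C (Src C (z p q)) (Src C (z' p q))"
      "\<And>p q. \<alpha>2 p q \<in> Hom C (cE L p q) (cE L' p q)"
      "\<And>p q. z' p q \<cdot> \<zeta> p q = \<alpha> p q \<cdot> z p q" "\<And>p q. e' p q \<cdot> \<zeta> p q = \<alpha>2 p q \<cdot> e p q"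
    by metis
  have "\<exists>\<gamma>. \<gamma> \<in> Hom C (cD L p q) (cD L' p q) \<and> s' p q \<cdot> \<gamma> = \<beta> p q \<cdot> s p q" for p q
  proof -
    obtain \<gamma> where "\<gamma> \<in> Hom C (Src C (s p q)) (Src C (s' p q))" "s' p q \<cdot> \<gamma> = \<beta> p q \<cdot> s p q"
    proof (rule image_map[where i = "ci K (p + 1) (q - 1)" and i' = "ci K' (p + 1) (q - 1)" and \<beta> = "\<beta> (p + 1) (q - 1)"])
      show "is_image C (ci K (p + 1) (q - 1)) (s p q)" "is_image C (ci K' (p + 1) (q - 1)) (s' p q)"
        "\<beta> p q \<cdot> ci K (p + 1) (q - 1) = ci K' (p + 1) (q - 1) \<cdot> \<beta> (p + 1) (q - 1)"
        using st(3)[of "p + 1" "q - 1"] st'(3)[of "p + 1" "q - 1"] m(3)[of "p + 1" "q - 1"] by simp_all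
      show "\<beta> (p + 1) (q - 1) \<in> Hom C (Src C (ci K (p + 1) (q - 1))) (Src C (ci K' (p + 1) (q - 1)))"
        "\<beta> p q \<in> Hom C (Tgt C (ci K (p + 1) (q - 1))) (Tgt C (ci K' (p + 1) (q - 1)))"
        using m(1)[of "p + 1" "q - 1"] m(1)[of p q] exact_coupleD(3)[OF K(1), of "p + 1" "q - 1"]
          exact_coupleD(3)[OF K(2), of "p + 1" "q - 1"] by (auto simp: in_Hom)
    qed
    then show ?thesis using st(1)[of p q] st'(1)[of p q] by (auto simp: in_Hom)
  qed
  then obtain \<beta>2 where \<beta>2: "\<And>p q. \<beta>2 p q \<in> Hom C (cD L p q) (cD L' p q)"
      "\<And>p q. s' p q \<cdot> \<beta>2 p q = \<beta> p q \<cdot> s p q" by metis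
  have \<beta>t: "\<beta>2 (p - 1) (q + 1) \<cdot> t p q = t' p q \<cdot> \<beta> p q" for p q
  proof -
    note hom = st(1)[of "p - 1" "q + 1"] st'(1)[of "p - 1" "q + 1"] st(4)[of p q] st'(4)[of p q]
      \<beta>2(1)[of "p - 1" "q + 1"] m(1)[of p q] m(1)[of "p - 1" "q + 1"]
    have "s' (p - 1) (q + 1) \<cdot> (\<beta>2 (p - 1) (q + 1) \<cdot> t p q) = \<beta> (p - 1) (q + 1) \<cdot> ci K p q"
      using \<beta>2(2)[of "p - 1" "q + 1", THEN pull, of "t p q"] st(6)[of p q] hom by (simp add: in_Hom)
    also have "\<dots> = s' (p - 1) (q + 1) \<cdot> (t' p q \<cdot> \<beta> p q)"
      unfolding m(3) st'(6)[symmetric] using hom by (simp add: in_Hom)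
    finally show ?thesis
      using hom by - (rule monicD[OF st'(2)[of "p - 1" "q + 1"]]; simp add: in_Hom)
  qed
  show thesis
  proof (rule that)
    show "couple_morphism C (Suc r) L L' \<beta>2 \<alpha>2"
      unfolding couple_morphism_def
    proof (intro allI conjI)
      fix p q
      show "\<beta>2 p q \<in> Hom C (cD L p q) (cD L' p q)" by (rule \<beta>2)
      show "\<alpha>2 p q \<in> Hom C (cE L p q) (cE L' p q)" by (rule \<zeta>)
      show "\<beta>2 (p - 1) (q + 1) \<cdot> ci L p q = ci L' p q \<cdot> \<beta>2 p q"
        using \<beta>t[of p q, THEN pull, of "s p q"] \<beta>2(1)[of p q] \<beta>2(1)[of "p - 1" "q + 1"] \<beta>2(2)[of p q]
          st(1)[of p q] st'(1)[of p q] st(4)[of p q] st'(4)[of p q] m(1)[of p q]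
        unfolding st(7) st'(7) by (simp add: in_Hom)
      have idx: "p + int (Suc r) - 1 = p + int r" "q - int (Suc r) + 1 = q - int r"
        "p + 1 + int r - 1 = p + int r" "q - 1 - int r + 1 = q - int r" "p + 1 - 1 = p" "q - 1 + 1 = q" by auto
      show "\<alpha>2 (p + int (Suc r) - 1) (q - int (Suc r) + 1) \<cdot> cj L p q = cj L' p q \<cdot> \<beta>2 p q"
        unfolding idx
      proof (rule derived_morphism_j[where t = "t (p + 1) (q - 1)" and t' = "t' (p + 1) (q - 1)" and l = "l (p + 1) (q - 1)"
            and l' = "l' (p + 1) (q - 1)" and z = "z (p + int r) (q - int r)" and z' = "z' (p + int r) (q - int r)"
            and e = "e (p + int r) (q - int r)" and e' = "e' (p + int r) (q - int r)" and \<alpha> = "\<alpha> (p + int r) (q - int r)"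
            and \<beta> = "\<beta> (p + 1) (q - 1)" and \<zeta> = "\<zeta> (p + int r) (q - int r)"])
        show "t (p + 1) (q - 1) \<in> Hom C (cD K (p + 1) (q - 1)) (cD L p q)"
          "t' (p + 1) (q - 1) \<in> Hom C (cD K' (p + 1) (q - 1)) (cD L' p q)"
          using st(4)[of "p + 1" "q - 1"] st'(4)[of "p + 1" "q - 1"] by simp_all
        show "l (p + 1) (q - 1) \<in> Hom C (cD K (p + 1) (q - 1)) (Src C (z (p + int r) (q - int r)))"
          by (rule l) auto
        show "l' (p + 1) (q - 1) \<in> Hom C (cD K' (p + 1) (q - 1)) (Src C (z' (p + int r) (q - int r)))"
          by (rule l') auto
        show "cj L p q \<in> Hom C (cD L p q) (cE L (p + int r) (q - int r))"
          by (rule exact_coupleD(4)[OF K(3)]) auto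
        show "cj L' p q \<in> Hom C (cD L' p q) (cE L' (p + int r) (q - int r))"
          by (rule exact_coupleD(4)[OF K(4)]) auto
        show "cj L p q \<cdot> t (p + 1) (q - 1) = e (p + int r) (q - int r) \<cdot> l (p + 1) (q - 1)"
          using l(3)[of "p + int r" "p + 1" "q - int r" "q - 1"] by simp
        show "cj L' p q \<cdot> t' (p + 1) (q - 1) = e' (p + int r) (q - int r) \<cdot> l' (p + 1) (q - 1)"
          using l'(3)[of "p + int r" "p + 1" "q - int r" "q - 1"] by simp
        show "\<alpha> (p + int r) (q - int r) \<cdot> (z (p + int r) (q - int r) \<cdot> l (p + 1) (q - 1)) =
            (z' (p + int r) (q - int r) \<cdot> l' (p + 1) (q - 1)) \<cdot> \<beta> (p + 1) (q - 1)"
          using l(2)[of "p + int r" "p + 1" "q - int r" "q - 1"] l'(2)[of "p + int r" "p + 1" "q - int r" "q - 1"]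
            m(4)[of "p + 1" "q - 1"] idx by simp
        show "\<beta>2 p q \<cdot> t (p + 1) (q - 1) = t' (p + 1) (q - 1) \<cdot> \<beta> (p + 1) (q - 1)"
          using \<beta>t[of "p + 1" "q - 1"] by simp
        show "monic C (z' (p + int r) (q - int r))" by (rule homology_simps(2)[OF h'(1)])
      qed (use ze ze' m \<zeta> \<beta>2 st in auto)
      show "\<beta>2 (p + 1) q \<cdot> ck L p q = ck L' p q \<cdot> \<alpha>2 p q"
      proof (rule derived_morphism_k[where z = "z p q" and z' = "z' p q" and e = "e p q" and e' = "e' p q"
           and s = "s (p + 1) q" and s' = "s' (p + 1) q" and k = "ck K p q" and k' = "ck K' p q"
           and \<alpha> = "\<alpha> p q" and \<beta> = "\<beta> (p + 1) q" and \<zeta> = "\<zeta> p q"])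
        show "epic C (e p q)" by (rule homology_simps(3)[OF h(1)])
      qed (use ze ze' m \<zeta> \<beta>2 st st' k k' exact_coupleD(5)[OF K(1)] exact_coupleD(5)[OF K(2)]
            exact_coupleD(5)[OF K(3)] exact_coupleD(5)[OF K(4)] in auto)
    qed
    show "\<exists>\<zeta>\<in>Hom C (Src C (z p q)) (Src C (z' p q)). z' p q \<cdot> \<zeta> = \<alpha> p q \<cdot> z p q \<and> e' p q \<cdot> \<zeta> = \<alpha>2 p q \<cdot> e p q" for p q
      using \<zeta>[of p q] by blast
  qed
qed

text \<open>Dependent choice over the pages: \<open>m r\<close> compares the couples with number
  \<open>r + 1\<close>, and the relation imposed between consecutive choices is the clause on cycles
  required of a morphism of spectral sequences.\<close>

lemma ex_ss_morphism:
  assumes T: "comes_from_couple C K T" and T': "comes_from_couple C K' T'"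
    and m: "couple_morphism C 1 K K' \<beta> \<alpha>"
  obtains \<phi> where "ss_morphism C 1 T T' \<phi>" "\<phi> 1 = \<alpha>"
proof -
  obtain Ks where Ks: "Ks 1 = K" "\<And>r. r \<ge> 1 \<Longrightarrow> exact_couple C r (Ks r)"
      "\<And>r. r \<ge> 1 \<Longrightarrow> derived_couple C r (Ks r) (Ks (Suc r)) (sZ T r) (sQ T r)"
      "\<And>r p q. r \<ge> 1 \<Longrightarrow> sE T r p q = cE (Ks r) p q \<and> sd T r p q = couple_diff C (Ks r) p q"
    using T unfolding comes_from_couple_def by metis
  obtain Ks' where Ks': "Ks' 1 = K'" "\<And>r. r \<ge> 1 \<Longrightarrow> exact_couple C r (Ks' r)"
      "\<And>r. r \<ge> 1 \<Longrightarrow> derived_couple C r (Ks' r) (Ks' (Suc r)) (sZ T' r) (sQ T' r)"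
      "\<And>r p q. r \<ge> 1 \<Longrightarrow> sE T' r p q = cE (Ks' r) p q \<and> sd T' r p q = couple_diff C (Ks' r) p q"
    using T' unfolding comes_from_couple_def by metis
  have "\<exists>m. \<forall>r. (couple_morphism C (Suc r) (Ks (Suc r)) (Ks' (Suc r)) (fst (m r)) (snd (m r)) \<and>
       (r = 0 \<longrightarrow> m r = (\<beta>, \<alpha>))) \<and>
     (\<forall>p q. \<exists>\<zeta>\<in>Hom C (Src C (sZ T (Suc r) p q)) (Src C (sZ T' (Suc r) p q)).
        sZ T' (Suc r) p q \<cdot> \<zeta> = snd (m r) p q \<cdot> sZ T (Suc r) p q \<and>
        sQ T' (Suc r) p q \<cdot> \<zeta> = snd (m (Suc r)) p q \<cdot> sQ T (Suc r) p q)"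
  proof (rule dependent_nat_choice)
    show "\<exists>x. couple_morphism C (Suc 0) (Ks (Suc 0)) (Ks' (Suc 0)) (fst x) (snd x) \<and> (0 = 0 \<longrightarrow> x = (\<beta>, \<alpha>))"
      using m Ks(1) Ks'(1) by simp
  next
    fix x r assume x: "couple_morphism C (Suc r) (Ks (Suc r)) (Ks' (Suc r)) (fst x) (snd x) \<and> (r = 0 \<longrightarrow> x = (\<beta>, \<alpha>))"
    show "\<exists>y. (couple_morphism C (Suc (Suc r)) (Ks (Suc (Suc r))) (Ks' (Suc (Suc r))) (fst y) (snd y) \<and>
            (Suc r = 0 \<longrightarrow> y = (\<beta>, \<alpha>))) \<and>
           (\<forall>p q. \<exists>\<zeta>\<in>Hom C (Src C (sZ T (Suc r) p q)) (Src C (sZ T' (Suc r) p q)).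
               sZ T' (Suc r) p q \<cdot> \<zeta> = snd x p q \<cdot> sZ T (Suc r) p q \<and>
               sQ T' (Suc r) p q \<cdot> \<zeta> = snd y p q \<cdot> sQ T (Suc r) p q)"
    proof -
      obtain \<beta>2 \<alpha>2 where *: "couple_morphism C (Suc (Suc r)) (Ks (Suc (Suc r))) (Ks' (Suc (Suc r))) \<beta>2 \<alpha>2"
          "\<And>p q. \<exists>\<zeta>\<in>Hom C (Src C (sZ T (Suc r) p q)) (Src C (sZ T' (Suc r) p q)).
               sZ T' (Suc r) p q \<cdot> \<zeta> = snd x p q \<cdot> sZ T (Suc r) p q \<and>
               sQ T' (Suc r) p q \<cdot> \<zeta> = \<alpha>2 p q \<cdot> sQ T (Suc r) p q"
        by (rule derived_couple_morphism[OF Ks(2) Ks'(2) Ks(2) Ks'(2) Ks(3) Ks'(3) x[THEN conjunct1]]) auto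
      then show ?thesis
        by (intro exI[of _ "(\<beta>2, \<alpha>2)"]) simp
    qed
  qed
  then obtain m where m: "\<And>r. couple_morphism C (Suc r) (Ks (Suc r)) (Ks' (Suc r)) (fst (m r)) (snd (m r))"
      "m 0 = (\<beta>, \<alpha>)"
      "\<And>r p q. \<exists>\<zeta>\<in>Hom C (Src C (sZ T (Suc r) p q)) (Src C (sZ T' (Suc r) p q)).
        sZ T' (Suc r) p q \<cdot> \<zeta> = snd (m r) p q \<cdot> sZ T (Suc r) p q \<and>
        sQ T' (Suc r) p q \<cdot> \<zeta> = snd (m (Suc r)) p q \<cdot> sQ T (Suc r) p q" by metis
  show thesis
  proof (rule that[of "\<lambda>r. snd (m (r - 1))"])
    show "ss_morphism C 1 T T' (\<lambda>r. snd (m (r - 1)))"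
      unfolding ss_morphism_def
    proof (intro allI impI)
      fix r :: nat and p q assume "1 \<le> r"
      then obtain r' where r': "r = Suc r'" by (cases r) auto
      have "snd (m r') p q \<in> Hom C (cE (Ks r) p q) (cE (Ks' r) p q)"
        using m(1)[of r'] unfolding couple_morphism_def r' by blast
      moreover have "snd (m r') (p + int r) (q - int r + 1) \<cdot> couple_diff C (Ks r) p q = couple_diff C (Ks' r) p q \<cdot> snd (m r') p q"
        using couple_morphism_diff[OF Ks(2) Ks'(2) m(1)[of r'], of p q] by (simp add: r')
      ultimately show "snd (m (r - 1)) p q \<in> Hom C (sE T r p q) (sE T' r p q) \<and>
         snd (m (r - 1)) (p + int r) (q - int r + 1) \<cdot> sd T r p q = sd T' r p q \<cdot> snd (m (r - 1)) p q \<and>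
         (\<exists>\<zeta>\<in>Hom C (Src C (sZ T r p q)) (Src C (sZ T' r p q)).
            sZ T' r p q \<cdot> \<zeta> = snd (m (r - 1)) p q \<cdot> sZ T r p q \<and>
            sQ T' r p q \<cdot> \<zeta> = snd (m (Suc r - 1)) p q \<cdot> sQ T r p q)"
        using m(3)[of r' p q] Ks(4)[of r] Ks'(4)[of r] by (simp add: r')
    qed
  qed (use m in simp)
qed

section \<open>Morphisms of spectral sequences: uniqueness, composition, sums, homotopy\<close>

lemma spectral_sequenceD:
  assumes "spectral_sequence C T" "r \<ge> 1"
  shows "sE T r p q \<in> Obj C"
    "sd T r p q \<in> Hom C (sE T r p q) (sE T r (p + int r) (q - int r + 1))"
    "is_homology C (sd T r (p - int r) (q + int r - 1)) (sd T r p q) (sZ T r p q) (sQ T r p q)"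
    "sZ T r p q \<in> Hom C (Src C (sZ T r p q)) (sE T r p q)"
    "sQ T r p q \<in> Hom C (Src C (sZ T r p q)) (sE T (Suc r) p q)"
    "monic C (sZ T r p q)" "epic C (sQ T r p q)"
proof -
  show "sE T r p q \<in> Obj C"
    and d: "sd T r p q \<in> Hom C (sE T r p q) (sE T r (p + int r) (q - int r + 1))"
    and h: "is_homology C (sd T r (p - int r) (q + int r - 1)) (sd T r p q) (sZ T r p q) (sQ T r p q)"
    using assms unfolding spectral_sequence_def by simp_all
  have "Tgt C (sQ T r p q) = sE T (Suc r) p q" "Src C (sd T r p q) = sE T r p q"
    using assms unfolding spectral_sequence_def by (auto simp: in_Hom)
  then show "sZ T r p q \<in> Hom C (Src C (sZ T r p q)) (sE T r p q)"
    "sQ T r p q \<in> Hom C (Src C (sZ T r p q)) (sE T (Suc r) p q)"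
    "monic C (sZ T r p q)" "epic C (sQ T r p q)"
    using homology_simps[OF h] by (auto simp: in_Hom)
qed

lemma ss_morphismD:
  assumes "ss_morphism C r0 T T' \<phi>" "r \<ge> r0"
  shows "\<phi> r p q \<in> Hom C (sE T r p q) (sE T' r p q)"
    "\<phi> r (p + int r) (q - int r + 1) \<cdot> sd T r p q = sd T' r p q \<cdot> \<phi> r p q"
    "\<exists>\<zeta>\<in>Hom C (Src C (sZ T r p q)) (Src C (sZ T' r p q)).
        sZ T' r p q \<cdot> \<zeta> = \<phi> r p q \<cdot> sZ T r p q \<and> sQ T' r p q \<cdot> \<zeta> = \<phi> (Suc r) p q \<cdot> sQ T r p q"
  using assms unfolding ss_morphism_def by simp_all

lemma ss_morphismI:
  assumes "\<And>r p q. r \<ge> r0 \<Longrightarrow> \<phi> r p q \<in> Hom C (sE T r p q) (sE T' r p q)"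
    "\<And>r p q. r \<ge> r0 \<Longrightarrow>
      \<phi> r (p + int r) (q - int r + 1) \<cdot> sd T r p q = sd T' r p q \<cdot> \<phi> r p q"
    "\<And>r p q. r \<ge> r0 \<Longrightarrow> \<exists>\<zeta>. \<zeta> \<in> Hom C (Src C (sZ T r p q)) (Src C (sZ T' r p q)) \<and>
        sZ T' r p q \<cdot> \<zeta> = \<phi> r p q \<cdot> sZ T r p q \<and> sQ T' r p q \<cdot> \<zeta> = \<phi> (Suc r) p q \<cdot> sQ T r p q"
  shows "ss_morphism C r0 T T' \<phi>"
  unfolding ss_morphism_def
proof (intro allI impI conjI)
  fix r p q assume r: "r0 \<le> r"
  show "\<phi> r p q \<in> Hom C (sE T r p q) (sE T' r p q)"
    "\<phi> r (p + int r) (q - int r + 1) \<cdot> sd T r p q = sd T' r p q \<cdot> \<phi> r p q"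
    using assms(1,2)[OF r] by auto
  show "\<exists>\<zeta>\<in>Hom C (Src C (sZ T r p q)) (Src C (sZ T' r p q)).
        sZ T' r p q \<cdot> \<zeta> = \<phi> r p q \<cdot> sZ T r p q \<and> sQ T' r p q \<cdot> \<zeta> = \<phi> (Suc r) p q \<cdot> sQ T r p q"
    using assms(3)[OF r, of p q] by blast
qed

text \<open>Page \<open>r\<close> determines page \<open>r + 1\<close>: the map on cycles is unique
  because the inclusion of cycles is monic, and then the map on homology because the projection from
  cycles is epic.\<close>

lemma ss_morphism_unique:
  assumes T: "spectral_sequence C T" and T': "spectral_sequence C T'" and r0: "r0 \<ge> 1"
    and \<phi>: "ss_morphism C r0 T T' \<phi>" and \<psi>: "ss_morphism C r0 T T' \<psi>" and eq: "\<phi> r0 = \<psi> r0"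
    and r: "r \<ge> r0"
  shows "\<phi> r = \<psi> r"
  using r
proof (induction r rule: dec_induct)
  case (step r)
  have r1: "r \<ge> 1" using step r0 by simp
  show ?case
  proof (intro ext)
    fix p q
    note z = spectral_sequenceD[OF T r1, of p q] and z' = spectral_sequenceD[OF T' r1, of p q]
    obtain \<zeta> where \<zeta>: "\<zeta> \<in> Hom C (Src C (sZ T r p q)) (Src C (sZ T' r p q))"
      "sZ T' r p q \<cdot> \<zeta> = \<phi> r p q \<cdot> sZ T r p q" "sQ T' r p q \<cdot> \<zeta> = \<phi> (Suc r) p q \<cdot> sQ T r p q"
      using ss_morphismD(3)[OF \<phi>] step by blast
    obtain \<xi> where \<xi>: "\<xi> \<in> Hom C (Src C (sZ T r p q)) (Src C (sZ T' r p q))"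
      "sZ T' r p q \<cdot> \<xi> = \<psi> r p q \<cdot> sZ T r p q" "sQ T' r p q \<cdot> \<xi> = \<psi> (Suc r) p q \<cdot> sQ T r p q"
      using ss_morphismD(3)[OF \<psi>] step by blast
    have "\<zeta> = \<xi>"
      by (rule monicD[OF z'(6)]) (use \<zeta>(1,2) \<xi>(1,2) step.IH z'(4) in \<open>auto simp: in_Hom\<close>)
    then have "\<phi> (Suc r) p q \<cdot> sQ T r p q = \<psi> (Suc r) p q \<cdot> sQ T r p q"
      using \<zeta>(3) \<xi>(3) by simp
    then show "\<phi> (Suc r) p q = \<psi> (Suc r) p q"
      by (rule epicD[OF z(7)])
        (use z(5) ss_morphismD(1)[OF \<phi>, of "Suc r" p q] ss_morphismD(1)[OF \<psi>, of "Suc r" p q] step in \<open>auto simp: in_Hom\<close>)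
  qed
qed (rule eq)

lemma ss_morphism_Idn:
  assumes T: "spectral_sequence C T" and r0: "r0 \<ge> 1"
  shows "ss_morphism C r0 T T (\<lambda>r p q. Idn C (sE T r p q))"
proof (rule ss_morphismI)
  fix r p q assume "r0 \<le> r"
  then have r1: "r \<ge> 1" using r0 by simp
  note z = spectral_sequenceD[OF T r1, of p q]
  show "Idn C (sE T r p q) \<in> Hom C (sE T r p q) (sE T r p q)" using z(1) by (simp add: in_Hom)
  show "Idn C (sE T r (p + int r) (q - int r + 1)) \<cdot> sd T r p q = sd T r p q \<cdot> Idn C (sE T r p q)"
    using z(2) by (simp add: in_Hom)
  show "\<exists>\<zeta>. \<zeta> \<in> Hom C (Src C (sZ T r p q)) (Src C (sZ T r p q)) \<and>
        sZ T r p q \<cdot> \<zeta> = Idn C (sE T r p q) \<cdot> sZ T r p q \<and>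
        sQ T r p q \<cdot> \<zeta> = Idn C (sE T (Suc r) p q) \<cdot> sQ T r p q"
    using z(4,5) Hom_Obj(1)[OF z(4)] by (intro exI[of _ "Idn C (Src C (sZ T r p q))"]) (simp add: in_Hom)
qed

lemma ss_morphism_Cmp:
  assumes T: "spectral_sequence C T" and T': "spectral_sequence C T'" and T'': "spectral_sequence C T''"
    and r0: "r0 \<ge> 1" and \<phi>: "ss_morphism C r0 T T' \<phi>" and \<psi>: "ss_morphism C r0 T' T'' \<psi>"
  shows "ss_morphism C r0 T T'' (\<lambda>r p q. \<psi> r p q \<cdot> \<phi> r p q)"
proof (rule ss_morphismI)
  fix r p q assume r: "r0 \<le> r"
  then have r1: "r \<ge> 1" using r0 by simp
  let ?p = "p + int r" and ?q = "q - int r + 1"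
  note z = spectral_sequenceD[OF T r1, of p q] and z' = spectral_sequenceD[OF T' r1, of p q]
    and z'' = spectral_sequenceD[OF T'' r1, of p q]
  note \<phi>D = ss_morphismD[OF \<phi> r] and \<psi>D = ss_morphismD[OF \<psi> r]
  note d = z(2) z'(2) z''(2) \<phi>D(1)[of p q] \<phi>D(1)[of ?p ?q]
    \<psi>D(1)[of p q] \<psi>D(1)[of ?p ?q]
  show "\<psi> r p q \<cdot> \<phi> r p q \<in> Hom C (sE T r p q) (sE T'' r p q)"
    using d by (simp add: in_Hom)
  have "(\<psi> r ?p ?q \<cdot> \<phi> r ?p ?q) \<cdot> sd T r p q = \<psi> r ?p ?q \<cdot> (sd T' r p q \<cdot> \<phi> r p q)"
    using d \<phi>D(2)[of p q] by (simp add: in_Hom)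
  also have "\<dots> = (sd T'' r p q \<cdot> \<psi> r p q) \<cdot> \<phi> r p q"
    using d \<psi>D(2)[of p q, THEN pull, of "\<phi> r p q"] by (simp add: in_Hom)
  finally show "(\<psi> r ?p ?q \<cdot> \<phi> r ?p ?q) \<cdot> sd T r p q = sd T'' r p q \<cdot> (\<psi> r p q \<cdot> \<phi> r p q)"
    using d by (simp add: in_Hom)
  obtain \<zeta> where \<zeta>: "\<zeta> \<in> Hom C (Src C (sZ T r p q)) (Src C (sZ T' r p q))"
      "sZ T' r p q \<cdot> \<zeta> = \<phi> r p q \<cdot> sZ T r p q" "sQ T' r p q \<cdot> \<zeta> = \<phi> (Suc r) p q \<cdot> sQ T r p q"
    using \<phi>D(3) by blast
  obtain \<xi> where \<xi>: "\<xi> \<in> Hom C (Src C (sZ T' r p q)) (Src C (sZ T'' r p q))"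
      "sZ T'' r p q \<cdot> \<xi> = \<psi> r p q \<cdot> sZ T' r p q" "sQ T'' r p q \<cdot> \<xi> = \<psi> (Suc r) p q \<cdot> sQ T' r p q"
    using \<psi>D(3) by blast
  note s = ss_morphismD(1)[OF \<phi>, of "Suc r" p q] ss_morphismD(1)[OF \<psi>, of "Suc r" p q]
  show "\<exists>\<zeta>. \<zeta> \<in> Hom C (Src C (sZ T r p q)) (Src C (sZ T'' r p q)) \<and>
        sZ T'' r p q \<cdot> \<zeta> = (\<psi> r p q \<cdot> \<phi> r p q) \<cdot> sZ T r p q \<and>
        sQ T'' r p q \<cdot> \<zeta> = (\<psi> (Suc r) p q \<cdot> \<phi> (Suc r) p q) \<cdot> sQ T r p q"
    using \<zeta> \<xi> \<xi>(2,3)[THEN pull, of \<zeta>] z(4,5) z'(4,5) z''(4,5) d s r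
    by (intro exI[of _ "\<xi> \<cdot> \<zeta>"]) (simp add: in_Hom)
qed

lemma ss_morphism_Pls:
  assumes T: "spectral_sequence C T" and T': "spectral_sequence C T'"
    and r0: "r0 \<ge> 1" and \<phi>: "ss_morphism C r0 T T' \<phi>" and \<psi>: "ss_morphism C r0 T T' \<psi>"
  shows "ss_morphism C r0 T T' (\<lambda>r p q. \<phi> r p q \<boxplus> \<psi> r p q)"
proof (rule ss_morphismI)
  fix r p q assume r: "r0 \<le> r"
  then have r1: "r \<ge> 1" using r0 by simp
  let ?p = "p + int r" and ?q = "q - int r + 1"
  note z = spectral_sequenceD[OF T r1, of p q] and z' = spectral_sequenceD[OF T' r1, of p q]
  note \<phi>D = ss_morphismD[OF \<phi> r] and \<psi>D = ss_morphismD[OF \<psi> r]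
  note d = z(2) z'(2) \<phi>D(1)[of p q] \<phi>D(1)[of ?p ?q]
    \<psi>D(1)[of p q] \<psi>D(1)[of ?p ?q]
  show "\<phi> r p q \<boxplus> \<psi> r p q \<in> Hom C (sE T r p q) (sE T' r p q)"
    using d by (simp add: in_Hom)
  show "(\<phi> r ?p ?q \<boxplus> \<psi> r ?p ?q) \<cdot> sd T r p q = sd T' r p q \<cdot> (\<phi> r p q \<boxplus> \<psi> r p q)"
    using d \<phi>D(2)[of p q] \<psi>D(2)[of p q] by (simp add: in_Hom Cmp_Pls)
  obtain \<zeta> where \<zeta>: "\<zeta> \<in> Hom C (Src C (sZ T r p q)) (Src C (sZ T' r p q))"
      "sZ T' r p q \<cdot> \<zeta> = \<phi> r p q \<cdot> sZ T r p q" "sQ T' r p q \<cdot> \<zeta> = \<phi> (Suc r) p q \<cdot> sQ T r p q"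
    using \<phi>D(3) by blast
  obtain \<xi> where \<xi>: "\<xi> \<in> Hom C (Src C (sZ T r p q)) (Src C (sZ T' r p q))"
      "sZ T' r p q \<cdot> \<xi> = \<psi> r p q \<cdot> sZ T r p q" "sQ T' r p q \<cdot> \<xi> = \<psi> (Suc r) p q \<cdot> sQ T r p q"
    using \<psi>D(3) by blast
  note s = ss_morphismD(1)[OF \<phi>, of "Suc r" p q] ss_morphismD(1)[OF \<psi>, of "Suc r" p q]
  show "\<exists>\<zeta>. \<zeta> \<in> Hom C (Src C (sZ T r p q)) (Src C (sZ T' r p q)) \<and>
        sZ T' r p q \<cdot> \<zeta> = (\<phi> r p q \<boxplus> \<psi> r p q) \<cdot> sZ T r p q \<and>
        sQ T' r p q \<cdot> \<zeta> = (\<phi> (Suc r) p q \<boxplus> \<psi> (Suc r) p q) \<cdot> sQ T r p q"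
    using \<zeta> \<xi> z(4,5) z'(4,5) d s r
    by (intro exI[of _ "\<zeta> \<boxplus> \<xi>"]) (simp add: in_Hom Cmp_Pls)
qed

lemma ss_morphism_Suc:
  assumes "ss_morphism C r0 T T' \<phi>"
  shows "ss_morphism C (Suc r0) T T' \<phi>"
  using assms unfolding ss_morphism_def by simp

lemma ss_morphism_cong:
  assumes "ss_morphism C r0 T T' \<phi>" "\<And>r. r \<ge> r0 \<Longrightarrow> \<phi> r = \<psi> r"
  shows "ss_morphism C r0 T T' \<psi>"
  using assms unfolding ss_morphism_def by simp

text \<open>Chain homotopic maps on the first page induce the same maps from the second page on; the two
  parts \<open>s\<close> and \<open>t\<close> of the homotopy may be unrelated.\<close>

lemma ss_morphism_homotopic:
  assumes T: "spectral_sequence C T" and T': "spectral_sequence C T'" and \<phi>: "ss_morphism C 1 T T' \<phi>"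
    and \<alpha>: "\<And>p q. \<alpha> p q \<in> Hom C (sE T 1 p q) (sE T' 1 p q)"
      "\<And>p q. \<alpha> (p + 1) q \<cdot> sd T 1 p q = sd T' 1 p q \<cdot> \<alpha> p q"
    and t: "\<And>p q. t p q \<in> Hom C (sE T 1 p q) (sE T' 1 (p - 1) q)"
    and s: "\<And>p q. s p q \<in> Hom C (sE T 1 (p + 1) q) (sE T' 1 p q)"
    and eq: "\<And>p q. \<alpha> p q = \<phi> 1 p q \<boxplus> ((sd T' 1 (p - 1) q \<cdot> t p q) \<boxplus> (s p q \<cdot> sd T 1 p q))"
  shows "ss_morphism C 1 T T' (\<phi>(1 := \<alpha>))"
proof (rule ss_morphismI)
  fix r :: nat and p q assume r: "1 \<le> r"
  note \<phi>D = ss_morphismD[OF \<phi>]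
  note z = spectral_sequenceD[OF T order.refl, of p q] and z' = spectral_sequenceD[OF T' order.refl, of p q]
  show "(\<phi>(1 := \<alpha>)) r p q \<in> Hom C (sE T r p q) (sE T' r p q)"
    using \<phi>D(1)[OF r] \<alpha>(1) by auto
  show "(\<phi>(1 := \<alpha>)) r (p + int r) (q - int r + 1) \<cdot> sd T r p q = sd T' r p q \<cdot> (\<phi>(1 := \<alpha>)) r p q"
    using \<phi>D(2)[OF r] \<alpha>(2) by auto
  obtain \<zeta> where \<zeta>: "\<zeta> \<in> Hom C (Src C (sZ T 1 p q)) (Src C (sZ T' 1 p q))"
      "sZ T' 1 p q \<cdot> \<zeta> = \<phi> 1 p q \<cdot> sZ T 1 p q" "sQ T' 1 p q \<cdot> \<zeta> = \<phi> (Suc 1) p q \<cdot> sQ T 1 p q"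
    using \<phi>D(3)[of 1 p q] by auto
  have h': "is_homology C (sd T' 1 (p - 1) q) (sd T' 1 p q) (sZ T' 1 p q) (sQ T' 1 p q)"
    using z'(3) by simp
  have d: "sd T 1 p q \<in> Hom C (sE T 1 p q) (sE T 1 (p + 1) q)"
    "sd T' 1 (p - 1) q \<in> Hom C (sE T' 1 (p - 1) q) (sE T' 1 p q)"
    using z(2) spectral_sequenceD(2)[OF T' order.refl, of "p - 1" q] by auto
  obtain b where b: "b \<in> Hom C (Src C (sd T' 1 (p - 1) q)) (Src C (sZ T' 1 p q))"
    "sZ T' 1 p q \<cdot> b = sd T' 1 (p - 1) q" "is_cokernel C b (sQ T' 1 p q)"
    using homologyE[OF h'] by blast
  \<comment> \<open>On cycles the summand of the homotopy ending in \<open>sd T 1\<close> vanishes,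
    while the one starting with \<open>sd T' 1\<close> factors through the boundaries by
    \<open>b\<close>. So the new map on cycles is the old one plus a boundary, which
    \<open>sQ T' 1\<close> kills.\<close>
  define \<xi> where "\<xi> = \<zeta> \<boxplus> (b \<cdot> (t p q \<cdot> sZ T 1 p q))"
  note hom = z(4,5) z'(4,5) d b(1) t[of p q] s[of p q] \<phi>D(1)[OF order.refl, of p q] \<zeta>(1)
  have dz: "sd T 1 p q \<cdot> sZ T 1 p q = Nul C (Src C (sZ T 1 p q)) (sE T 1 (p + 1) q)"
    using kernel_simps(4)[OF homology_simps(1)[OF z(3)]] d by (simp add: in_Hom)
  have eb: "sQ T' 1 p q \<cdot> b = Nul C (Src C b) (sE T' (Suc 1) p q)"
    using cokernel_simps(4)[OF b(3)] z'(5) by (simp add: in_Hom)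
  have \<xi>: "\<xi> \<in> Hom C (Src C (sZ T 1 p q)) (Src C (sZ T' 1 p q))"
    using hom unfolding \<xi>_def by (simp add: in_Hom)
  have 1: "sZ T' 1 p q \<cdot> \<xi> = (\<phi> 1 p q \<cdot> sZ T 1 p q) \<boxplus> (sd T' 1 (p - 1) q \<cdot> (t p q \<cdot> sZ T 1 p q))"
    using hom b(2)[THEN pull, of "t p q \<cdot> sZ T 1 p q"] \<zeta>(2) unfolding \<xi>_def by (simp add: in_Hom Cmp_Pls)
  have "\<alpha> p q \<cdot> sZ T 1 p q = (\<phi> 1 p q \<cdot> sZ T 1 p q) \<boxplus> ((sd T' 1 (p - 1) q \<cdot> (t p q \<cdot> sZ T 1 p q)) \<boxplus>
      (s p q \<cdot> (sd T 1 p q \<cdot> sZ T 1 p q)))"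
    using hom unfolding eq by (simp add: in_Hom Cmp_Pls)
  also have "s p q \<cdot> (sd T 1 p q \<cdot> sZ T 1 p q) = Nul C (Src C (sZ T 1 p q)) (sE T' 1 p q)"
    unfolding dz using hom by (simp add: in_Hom)
  also have "(sd T' 1 (p - 1) q \<cdot> (t p q \<cdot> sZ T 1 p q)) \<boxplus> \<dots> = sd T' 1 (p - 1) q \<cdot> (t p q \<cdot> sZ T 1 p q)"
    using hom by (simp add: in_Hom)
  finally have "\<alpha> p q \<cdot> sZ T 1 p q = sZ T' 1 p q \<cdot> \<xi>" using 1 by simp
  moreover have "sQ T' 1 p q \<cdot> \<xi> = \<phi> (Suc 1) p q \<cdot> sQ T 1 p q"
  proof -
    have "sQ T' 1 p q \<cdot> \<xi> = (sQ T' 1 p q \<cdot> \<zeta>) \<boxplus> (sQ T' 1 p q \<cdot> (b \<cdot> (t p q \<cdot> sZ T 1 p q)))"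
      using hom unfolding \<xi>_def by (simp add: in_Hom Cmp_Pls)
    also have "sQ T' 1 p q \<cdot> (b \<cdot> (t p q \<cdot> sZ T 1 p q)) = Nul C (Src C (sZ T 1 p q)) (sE T' (Suc 1) p q)"
      using hom eb[THEN pull, of "t p q \<cdot> sZ T 1 p q"] Hom_Obj(2)[OF z'(5)] by (simp add: in_Hom)
    also have "(sQ T' 1 p q \<cdot> \<zeta>) \<boxplus> \<dots> = sQ T' 1 p q \<cdot> \<zeta>"
      using hom by (simp add: in_Hom)
    finally show ?thesis using \<zeta>(3) by simp
  qed
  ultimately have "\<exists>\<xi>. \<xi> \<in> Hom C (Src C (sZ T 1 p q)) (Src C (sZ T' 1 p q)) \<and>
      sZ T' 1 p q \<cdot> \<xi> = \<alpha> p q \<cdot> sZ T 1 p q \<and> sQ T' 1 p q \<cdot> \<xi> = \<phi> (Suc 1) p q \<cdot> sQ T 1 p q"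
    using \<xi> by auto
  then show "\<exists>\<zeta>. \<zeta> \<in> Hom C (Src C (sZ T r p q)) (Src C (sZ T' r p q)) \<and>
        sZ T' r p q \<cdot> \<zeta> = (\<phi>(1 := \<alpha>)) r p q \<cdot> sZ T r p q \<and>
        sQ T' r p q \<cdot> \<zeta> = (\<phi>(1 := \<alpha>)) (Suc r) p q \<cdot> sQ T r p q"
    using \<phi>D(3)[OF r, of p q] r by (cases "r = 1") auto
qed

end

section \<open>Convergence\<close>

context abelian_category
begin

lemma image_unique:
  assumes im: "is_image C f m" "is_image C f m'"
  obtains \<theta> \<theta>' where "\<theta> \<in> Hom C (Src C m) (Src C m')" "\<theta>' \<in> Hom C (Src C m') (Src C m)"
    "m' \<cdot> \<theta> = m" "m \<cdot> \<theta>' = m'" "\<theta>' \<cdot> \<theta> = Idn C (Src C m)" "\<theta> \<cdot> \<theta>' = Idn C (Src C m')"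
proof -
  note ms = image_simps[OF im(1)] image_simps[OF im(2)]
  obtain \<theta> where \<theta>: "\<theta> \<in> Hom C (Src C m) (Src C m')" "m' \<cdot> \<theta> = Idn C (Tgt C f) \<cdot> m"
    by (rule image_map[OF im, of "Idn C (Src C f)" "Idn C (Tgt C f)"]) (use ms in \<open>auto simp: in_Hom\<close>)
  obtain \<theta>' where \<theta>': "\<theta>' \<in> Hom C (Src C m') (Src C m)" "m \<cdot> \<theta>' = Idn C (Tgt C f) \<cdot> m'"
    by (rule image_map[OF im(2,1), of "Idn C (Src C f)" "Idn C (Tgt C f)"]) (use ms in \<open>auto simp: in_Hom\<close>)
  have 1: "m' \<cdot> \<theta> = m" "m \<cdot> \<theta>' = m'" using \<theta>(2) \<theta>'(2) ms by auto
  have "m \<cdot> (\<theta>' \<cdot> \<theta>) = m \<cdot> Idn C (Src C m)"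
    using 1(2)[THEN pull, of \<theta>] 1(1) \<theta>(1) \<theta>'(1) ms(2) by (simp add: in_Hom)
  then have 2: "\<theta>' \<cdot> \<theta> = Idn C (Src C m)"
    using \<theta>(1) \<theta>'(1) ms(2) by - (rule monicD[OF ms(3)]; simp add: in_Hom)
  have "m' \<cdot> (\<theta> \<cdot> \<theta>') = m' \<cdot> Idn C (Src C m')"
    using 1(1)[THEN pull, of \<theta>'] 1(2) \<theta>(1) \<theta>'(1) ms(6) by (simp add: in_Hom)
  then have "\<theta> \<cdot> \<theta>' = Idn C (Src C m')"
    using \<theta>(1) \<theta>'(1) ms(6) by - (rule monicD[OF ms(7)]; simp add: in_Hom)
  then show thesis using that \<theta> \<theta>' 1 2 by blast
qed

lemma iso_epic:
  assumes "\<theta> \<in> Hom C X Y" "\<theta>' \<in> Hom C Y X" "\<theta> \<cdot> \<theta>' = Idn C Y"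
  shows "epic C \<theta>"
proof (rule epicI)
  fix x assume x: "x \<in> Arr C" "Src C x = Tgt C \<theta>" "x \<cdot> \<theta> = Nul C (Src C \<theta>) (Tgt C x)"
  have "x = (x \<cdot> \<theta>) \<cdot> \<theta>'" using x(1,2) assms by (simp add: in_Hom)
  also have "\<dots> = Nul C (Tgt C \<theta>) (Tgt C x)" unfolding x(3) using x(1) assms by (simp add: in_Hom)
  finally show "x = Nul C (Tgt C \<theta>) (Tgt C x)" .
qed (use assms in \<open>auto simp: in_Hom\<close>)

text \<open>Carries a cokernel along a change of source and target. On the source an epimorphism is
  enough, since precomposing with it does not change which maps kill \<open>\<iota>\<close>.\<close>

lemma cokernel_transport:
  assumes c: "is_cokernel C f c" and \<iota>: "\<iota> \<in> Hom C X1 X0"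
    and \<theta>1: "\<theta>1 \<in> Hom C (Src C f) X1" "epic C \<theta>1"
    and \<theta>0: "\<theta>0 \<in> Hom C (Tgt C f) X0" "\<theta>0' \<in> Hom C X0 (Tgt C f)" "\<theta>0' \<cdot> \<theta>0 = Idn C (Tgt C f)" "\<theta>0 \<cdot> \<theta>0' = Idn C X0"
    and eq: "\<iota> \<cdot> \<theta>1 = \<theta>0 \<cdot> f"
  shows "is_cokernel C \<iota> (c \<cdot> \<theta>0')"
proof -
  note cs = cokernel_simps[OF c]
  note hom = \<iota> \<theta>1(1) \<theta>0(1,2)
  show ?thesis
  proof (rule cokernelI)
    show "epic C (c \<cdot> \<theta>0')"
      using cs hom iso_epic[OF \<theta>0(2,1,3)] cokernel_epic[OF c] by (intro epic_Cmp) (auto simp: in_Hom)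
    have "((c \<cdot> \<theta>0') \<cdot> \<iota>) \<cdot> \<theta>1 = c \<cdot> (\<theta>0' \<cdot> (\<theta>0 \<cdot> f))"
      using cs(1-3) hom eq by (simp add: in_Hom)
    also have "\<dots> = c \<cdot> f"
      using cs(1-3) hom \<theta>0(3)[THEN pull, of f] by (simp add: in_Hom)
    also have "\<dots> = Nul C (Src C \<theta>1) (Tgt C ((c \<cdot> \<theta>0') \<cdot> \<iota>))"
      using cs hom by (simp add: in_Hom)
    finally show "(c \<cdot> \<theta>0') \<cdot> \<iota> = Nul C (Src C \<iota>) (Tgt C (c \<cdot> \<theta>0'))"
      using epic_Nul[OF \<theta>1(2), of "(c \<cdot> \<theta>0') \<cdot> \<iota>"] cs(1-3) hom by (simp add: in_Hom)
  next
    fix x assume x: "x \<in> Arr C" "Src C x = Tgt C \<iota>" "x \<cdot> \<iota> = Nul C (Src C \<iota>) (Tgt C x)"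
    have "(x \<cdot> \<theta>0) \<cdot> f = x \<cdot> (\<iota> \<cdot> \<theta>1)" unfolding eq using x(1,2) cs(1) hom by (simp add: in_Hom)
    also have "\<dots> = (x \<cdot> \<iota>) \<cdot> \<theta>1" using x(1,2) hom by (simp add: in_Hom)
    also have "\<dots> = Nul C (Src C f) (Tgt C (x \<cdot> \<theta>0))"
      unfolding x(3) using x(1,2) hom by (simp add: in_Hom)
    finally obtain u where u: "u \<in> Arr C" "Src C u = Tgt C c" "Tgt C u = Tgt C (x \<cdot> \<theta>0)" "u \<cdot> c = x \<cdot> \<theta>0"
      by (rule cokernel_desc[OF c, rotated 2]) (use x(1,2) hom in \<open>auto simp: in_Hom\<close>)
    have "u \<cdot> (c \<cdot> \<theta>0') = x \<cdot> (\<theta>0 \<cdot> \<theta>0')"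
      using u(4)[THEN pull, of \<theta>0'] u(1-3) x(1,2) cs(2,3) hom by (simp add: in_Hom)
    then have "u \<cdot> (c \<cdot> \<theta>0') = x" unfolding \<theta>0(4) using x(1,2) hom by (simp add: in_Hom)
    then show "\<exists>u. u \<in> Arr C \<and> Src C u = Tgt C (c \<cdot> \<theta>0') \<and> Tgt C u = Tgt C x \<and> u \<cdot> (c \<cdot> \<theta>0') = x"
      using u x(1,2) cs(2,3) hom by (auto simp: in_Hom)
  qed (use cs hom in \<open>auto simp: in_Hom\<close>)
qed

text \<open>In the \<open>r\<close>-th derived couple, \<open>D\<^sub>r\<close> is the image of the \<open>(r-1)\<close>-st iterate of \<open>i\<close>; \<open>S\<close> and \<open>T\<close>
  below are the two parts of its epi-mono factorization.\<close>

lemma iterated_image: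
  assumes Ks: "\<And>r. r \<ge> 1 \<Longrightarrow> exact_couple C r (Ks r)"
      "\<And>r. r \<ge> 1 \<Longrightarrow> derived_couple C r (Ks r) (Ks (Suc r)) (z r) (e r)"
    and K: "Ks 1 = K"
    and \<eta>: "\<And>p q. \<eta> p q \<in> Hom C (cD K p q) (M (p + q))"
      "\<And>p q. \<eta> (p - 1) (q + 1) \<cdot> ci K p q = \<eta> p q"
    and r: "r \<ge> 1"
  shows "\<exists>S T. \<forall>p q.
     S p q \<in> Hom C (cD (Ks r) p q) (cD K p q) \<and> monic C (S p q) \<and>
     T p q \<in> Hom C (cD K p q) (cD (Ks r) (p - int r + 1) (q + int r - 1)) \<and> epic C (T p q) \<and>
     S (p - 1) (q + 1) \<cdot> ci (Ks r) p q = ci K p q \<cdot> S p q \<and>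
     \<eta> (p - int r + 1) (q + int r - 1) \<cdot> (S (p - int r + 1) (q + int r - 1) \<cdot> T p q) = \<eta> p q \<and>
     (r \<ge> 2 \<longrightarrow> ci K p q = Nul C (cD K p q) (cD K (p - 1) (q + 1)) \<longrightarrow>
        S (p - int r + 1) (q + int r - 1) \<cdot> T p q = Nul C (cD K p q) (cD K (p - int r + 1) (q + int r - 1))) \<and>
     (r \<ge> 2 \<longrightarrow> (\<exists>u \<in> Hom C (cD K p q) (cD K (p - int r + 2) (q + int r - 2)).
        S (p - int r + 1) (q + int r - 1) \<cdot> T p q = ci K (p - int r + 2) (q + int r - 2) \<cdot> u \<and>
        \<eta> (p - int r + 2) (q + int r - 2) \<cdot> u = \<eta> p q))"
  using r
proof (induction r rule: dec_induct)
  case base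
  have K1: "exact_couple C 1 K" using Ks(1)[of 1] K by simp
  show ?case
    using exact_coupleD(1,3)[OF K1] \<eta>(1) K
    by (intro exI[of _ "\<lambda>p q. Idn C (cD K p q)"]) (auto simp: in_Hom epic_Idn monic_Idn)
next
  case (step r)
  have K1: "exact_couple C 1 K" using Ks(1)[of 1] K by simp
  note KD = exact_coupleD[OF K1]
  from step.IH obtain S T where
    ST: "\<And>p q. S p q \<in> Hom C (cD (Ks r) p q) (cD K p q)" "\<And>p q. monic C (S p q)"
     "\<And>p q. T p q \<in> Hom C (cD K p q) (cD (Ks r) (p - int r + 1) (q + int r - 1))" "\<And>p q. epic C (T p q)"
     "\<And>p q. S (p - 1) (q + 1) \<cdot> ci (Ks r) p q = ci K p q \<cdot> S p q"
     "\<And>p q. \<eta> (p - int r + 1) (q + int r - 1) \<cdot> (S (p - int r + 1) (q + int r - 1) \<cdot> T p q) = \<eta> p q"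
    and z: "\<And>p q. r \<ge> 2 \<Longrightarrow> ci K p q = Nul C (cD K p q) (cD K (p - 1) (q + 1)) \<Longrightarrow>
        S (p - int r + 1) (q + int r - 1) \<cdot> T p q = Nul C (cD K p q) (cD K (p - int r + 1) (q + int r - 1))"
    by metis
  have rr: "exact_couple C r (Ks r)" "derived_couple C r (Ks r) (Ks (Suc r)) (z r) (e r)" "exact_couple C (Suc r) (Ks (Suc r))"
    using Ks step.hyps by auto
  obtain s t where s: "\<And>p q. s p q \<in> Hom C (cD (Ks (Suc r)) p q) (cD (Ks r) p q)" "\<And>p q. monic C (s p q)"
      and t: "\<And>p q. t p q \<in> Hom C (cD (Ks r) p q) (cD (Ks (Suc r)) (p - 1) (q + 1))" "\<And>p q. epic C (t p q)"
      and st: "\<And>p q. s (p - 1) (q + 1) \<cdot> t p q = ci (Ks r) p q" "\<And>p q. ci (Ks (Suc r)) p q = t p q \<cdot> s p q"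
    using derived_coupleE[OF rr] by metis
  define S' where "S' p q = S p q \<cdot> s p q" for p q
  define T' where "T' p q = t (p - int r + 1) (q + int r - 1) \<cdot> T p q" for p q
  have idx: "p - int r + 1 - 1 = p - int r" "q + int r - 1 + 1 = q + int r"
    "p - int (Suc r) + 1 = p - int r" "q + int (Suc r) - 1 = q + int r"
    "p - int (Suc r) + 2 = p - int r + 1" "q + int (Suc r) - 2 = q + int r - 1" for p q by auto
  note t' = t(1)[of "p - int r + 1" "q + int r - 1" for p q, unfolded idx]
    and st' = st(1)[of "p - int r + 1" "q + int r - 1" for p q, unfolded idx]
    and S5 = ST(5)[of "p - int r + 1" "q + int r - 1" for p q, unfolded idx]
    and \<eta>2 = \<eta>(2)[of "p - int r + 1" "q + int r - 1" for p q, unfolded idx]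
    and ci' = exact_coupleD(3)[OF rr(1), of "p - int r + 1" "q + int r - 1" for p q, unfolded idx]
    and cK' = KD(3)[of "p - int r + 1" "q + int r - 1" for p q, unfolded idx]
  \<comment> \<open>The new iterate is \<open>i\<close> applied to the old one, because
    \<open>S\<close> intertwines \<open>i\<close> on the derived term with \<open>i\<close> on
    \<open>D\<close>. The clauses on \<open>\<eta>\<close>, on vanishing and on \<open>u\<close> are
    read off from this equation.\<close>
  have S'T': "S' (p - int r) (q + int r) \<cdot> T' p q =
      ci K (p - int r + 1) (q + int r - 1) \<cdot> (S (p - int r + 1) (q + int r - 1) \<cdot> T p q)" for p q
  proof -
    note hom = s(1)[of "p - int r" "q + int r"] t'[of p q] ST(1)[of "p - int r" "q + int r"] ST(3)[of p q]
      ST(1)[of "p - int r + 1" "q + int r - 1"] cK'[of p q] ci'[of p q]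
    have "S' (p - int r) (q + int r) \<cdot> T' p q =
        S (p - int r) (q + int r) \<cdot> (ci (Ks r) (p - int r + 1) (q + int r - 1) \<cdot> T p q)"
      using st'[of p q, THEN pull, of "T p q"] hom unfolding S'_def T'_def by (simp add: in_Hom)
    also have "\<dots> = ci K (p - int r + 1) (q + int r - 1) \<cdot> (S (p - int r + 1) (q + int r - 1) \<cdot> T p q)"
      using S5[of p q, THEN pull, of "T p q"] hom by (simp add: in_Hom)
    finally show ?thesis .
  qed
  show ?case
  proof (rule exI[of _ S'], rule exI[of _ T'], intro allI conjI impI, unfold idx)
    fix p q
    show "S' p q \<in> Hom C (cD (Ks (Suc r)) p q) (cD K p q)"
      using s(1)[of p q] ST(1)[of p q] unfolding S'_def by (simp add: in_Hom)
    show "monic C (S' p q)"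
      using s[of p q] ST(1,2)[of p q] unfolding S'_def by (intro monic_Cmp) (auto simp: in_Hom)
    show "T' p q \<in> Hom C (cD K p q) (cD (Ks (Suc r)) (p - int r) (q + int r))"
      using t'[of p q] ST(3)[of p q] unfolding T'_def by (simp add: in_Hom)
    show "epic C (T' p q)"
      using t'[of p q] t(2) ST(3,4)[of p q] unfolding T'_def by (intro epic_Cmp) (auto simp: in_Hom)
    show "S' (p - 1) (q + 1) \<cdot> ci (Ks (Suc r)) p q = ci K p q \<cdot> S' p q"
      using st(1)[of p q, THEN pull, of "s p q"] ST(5)[of p q, THEN pull, of "s p q"] s(1)[of p q]
        s(1)[of "p - 1" "q + 1"] t(1)[of p q] ST(1)[of p q] ST(1)[of "p - 1" "q + 1"] KD(3)[of p q]
        exact_coupleD(3)[OF rr(1), of p q]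
      unfolding st(2) S'_def by (simp add: in_Hom)
    note \<eta>1 = \<eta>(1)[of p q] \<eta>(1)[of "p - int r" "q + int r"] \<eta>(1)[of "p - int r + 1" "q + int r - 1"]
    note hom = ST(3)[of p q] ST(1)[of "p - int r + 1" "q + int r - 1"] cK'[of p q] \<eta>1
    show "\<eta> (p - int r) (q + int r) \<cdot> (S' (p - int r) (q + int r) \<cdot> T' p q) = \<eta> p q"
      unfolding S'T' using \<eta>2[of p q, THEN pull, of "S (p - int r + 1) (q + int r - 1) \<cdot> T p q"] ST(6)[of p q] hom
      by (simp add: in_Hom)
    \<comment> \<open>At \<open>r = 1\<close> no vanishing is inherited, but then the outer factor
      is the very \<open>i\<close> assumed to vanish; for larger \<open>r\<close> the inner factor
      is zero by induction.\<close>
    show "S' (p - int r) (q + int r) \<cdot> T' p q = Nul C (cD K p q) (cD K (p - int r) (q + int r))"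
      if ci0: "ci K p q = Nul C (cD K p q) (cD K (p - 1) (q + 1))"
    proof (cases "r = 1")
      case True
      have "ci K (p - int r + 1) (q + int r - 1) = Nul C (cD K p q) (cD K (p - int r) (q + int r))"
        using ci0 True by simp
      then show ?thesis
        unfolding S'T' using hom KD(1) True by (simp add: in_Hom)
    next
      case False
      then have "S (p - int r + 1) (q + int r - 1) \<cdot> T p q = Nul C (cD K p q) (cD K (p - int r + 1) (q + int r - 1))"
        using z[of p q] ci0 step.hyps by simp
      then show ?thesis
        unfolding S'T' using hom KD(1) by (simp add: in_Hom)
    qed
    \<comment> \<open>The witness is the old iterate: it stops one application of \<open>i\<close>
      earlier, which is the place where a hypothesis on the kernel of \<open>\<eta>\<close> can be
      applied.\<close>
    show "\<exists>u \<in> Hom C (cD K p q) (cD K (p - int r + 1) (q + int r - 1)).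
        S' (p - int r) (q + int r) \<cdot> T' p q = ci K (p - int r + 1) (q + int r - 1) \<cdot> u \<and>
        \<eta> (p - int r + 1) (q + int r - 1) \<cdot> u = \<eta> p q"
      using S'T'[of p q] ST(6)[of p q] hom
      by (intro bexI[of _ "S (p - int r + 1) (q + int r - 1) \<cdot> T p q"]) (auto simp: in_Hom)
  qed
qed

lemma image_of_epic:
  assumes "is_image C f m" "epic C f"
  shows "is_iso C m"
proof -
  obtain t where t: "epic C t" "t \<in> Arr C" "Src C t = Src C f" "Tgt C t = Src C m" "m \<cdot> t = f"
    by (rule image_factor[OF assms(1)])
  note ms = image_simps[OF assms(1)]
  have "epic C m"
  proof (rule epicI)
    fix x assume x: "x \<in> Arr C" "Src C x = Tgt C m" "x \<cdot> m = Nul C (Src C m) (Tgt C x)"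
    have "x \<cdot> f = (x \<cdot> m) \<cdot> t" using x(1,2) t ms by auto
    also have "\<dots> = Nul C (Src C f) (Tgt C x)" unfolding x(3) using x(1) t by simp
    finally show "x = Nul C (Tgt C m) (Tgt C x)"
      using epic_Nul[OF assms(2), of x] x ms by simp
  qed (use ms in auto)
  then show ?thesis using monic_epic_iso ms by blast
qed

lemma image_of_Nul:
  assumes "is_image C (Nul C X Y) m" "X \<in> Obj C" "Y \<in> Obj C"
  shows "zero_object C (Src C m)"
proof -
  obtain t where t: "epic C t" "t \<in> Arr C" "Src C t = Src C (Nul C X Y)" "Tgt C t = Src C m" "m \<cdot> t = Nul C X Y"
    by (rule image_factor[OF assms(1)])
  note ms = image_simps[OF assms(1)]
  have "t = Nul C (Src C t) (Src C m)"
    using monic_Nul[OF ms(3), of t] t ms assms by simp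
  then have "Idn C (Src C m) \<cdot> t = Nul C (Src C t) (Tgt C (Idn C (Src C m)))"
    using t ms by simp
  then have "Idn C (Src C m) = Nul C (Src C m) (Src C m)"
    using epic_Nul[OF t(1), of "Idn C (Src C m)"] t ms by simp
  then show ?thesis using zero_object_iff ms by simp
qed

lemma image_Cmp_factor:
  assumes im: "is_image C f m" "is_image C (f \<cdot> g) m'" and g: "g \<in> Arr C" "Tgt C g = Src C f"
  shows "\<exists>\<iota>\<in>Hom C (Src C m') (Src C m). m \<cdot> \<iota> = m'"
proof -
  note ms = image_simps[OF im(1)] image_simps[OF im(2)]
  obtain \<iota> where "\<iota> \<in> Hom C (Src C m') (Src C m)" "m \<cdot> \<iota> = Idn C (Tgt C f) \<cdot> m'"
    by (rule image_map[OF im(2,1), of g "Idn C (Tgt C f)"]) (use ms g in \<open>auto simp: in_Hom\<close>)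
  then show ?thesis using ms g by auto
qed

text \<open>The hypotheses do not ask \<open>D\<close> to vanish or stabilize. By
  \<open>top\<close>, \<open>i\<close> is zero far up, so iterates that start there vanish. By
  \<open>bot\<close>, far down the comparison map \<open>\<eta>\<close> is epic and one application
  of \<open>i\<close> kills its kernel, so that \<open>\<eta>\<close> becomes monic on derived
  terms.\<close>

lemma couple_converges:
  assumes T: "comes_from_couple C K T"
    and \<eta>: "\<And>p q. \<eta> p q \<in> Hom C (cD K p q) (M (p + q))"
      "\<And>p q. \<eta> (p - 1) (q + 1) \<cdot> ci K p q = \<eta> p q"
    and F: "\<And>n p. is_image C (\<eta> p (n - p)) (F n p)"
    and top: "\<And>n. \<exists>b. \<forall>p\<ge>b. ci K p (n - p) = Nul C (cD K p (n - p)) (cD K (p - 1) (n - p + 1))"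
    and bot: "\<And>n. \<exists>a. \<forall>p\<le>a. epic C (\<eta> p (n - p)) \<and>
      (\<forall>x. x \<in> Arr C \<longrightarrow> Tgt C x = cD K p (n - p) \<longrightarrow> \<eta> p (n - p) \<cdot> x = Nul C (Src C x) (M n) \<longrightarrow>
         ci K p (n - p) \<cdot> x = Nul C (Src C x) (cD K (p - 1) (n - p + 1)))"
  shows "converges C T M F"
proof -
  obtain Ks where Ks: "Ks 1 = K" "\<And>r. r \<ge> 1 \<Longrightarrow> exact_couple C r (Ks r)"
      "\<And>r. r \<ge> 1 \<Longrightarrow> derived_couple C r (Ks r) (Ks (Suc r)) (sZ T r) (sQ T r)"
      "\<And>r p q. r \<ge> 1 \<Longrightarrow> sE T r p q = cE (Ks r) p q \<and> sd T r p q = couple_diff C (Ks r) p q"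
    using T unfolding comes_from_couple_def by metis
  have K1: "exact_couple C 1 K" using Ks(2)[of 1] Ks(1) by simp
  note KD = exact_coupleD[OF K1]
  have M: "M n \<in> Obj C" for n using Hom_Obj(2)[OF \<eta>(1)[of 0 n]] by simp
  have Fs: "F n p \<in> Arr C" "monic C (F n p)" "Tgt C (F n p) = M n" for n p
    using image_simps[OF F[of p n]] \<eta>(1)[of p "n - p"] by (auto simp: in_Hom)
  have F\<iota>: "\<exists>\<iota> \<in> Hom C (Src C (F n (p + 1))) (Src C (F n p)). F n p \<cdot> \<iota> = F n (p + 1)" for n p
  proof (rule image_Cmp_factor[OF F])
    show "is_image C (\<eta> p (n - p) \<cdot> ci K (p + 1) (n - (p + 1))) (F n (p + 1))"
      using F[of "p + 1" n] \<eta>(2)[of "p + 1" "n - (p + 1)"] by simp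
  qed (use KD(3)[of "p + 1" "n - (p + 1)"] \<eta>(1)[of p "n - p"] in \<open>auto simp: in_Hom\<close>)
  have Fiso: "\<exists>a. \<forall>p\<le>a. is_iso C (F n p)" for n
  proof -
    obtain a where "\<forall>p\<le>a. epic C (\<eta> p (n - p))" using bot by blast
    then show ?thesis using image_of_epic[OF F] by blast
  qed
  have Fzero: "\<exists>b. \<forall>p\<ge>b. zero_object C (Src C (F n p))" for n
  proof -
    obtain b where b: "\<forall>p\<ge>b. ci K p (n - p) = Nul C (cD K p (n - p)) (cD K (p - 1) (n - p + 1))"
      using top by blast
    have "zero_object C (Src C (F n p))" if "p \<ge> b" for p
    proof (rule image_of_Nul)
      have "\<eta> (p - 1) (n - p + 1) \<cdot> ci K p (n - p) = Nul C (cD K p (n - p)) (M n)"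
        using \<eta>(1)[of "p - 1" "n - p + 1"] KD(1) b that by (simp add: in_Hom)
      then show "is_image C (Nul C (cD K p (n - p)) (M n)) (F n p)"
        using F[of p n] \<eta>(2)[of p "n - p"] by simp
    qed (use M KD(1) in auto)
    then show ?thesis by blast
  qed
  have stable: "\<exists>r0\<ge>1.
        (\<forall>r\<ge>r0. sd T r p q = Nul C (sE T r p q) (sE T r (p + int r) (q - int r + 1)) \<and>
           sd T r (p - int r) (q + int r - 1)
             = Nul C (sE T r (p - int r) (q + int r - 1)) (sE T r p q)) \<and>
        (\<exists>\<iota> \<in> Hom C (Src C (F (p + q) (p + 1))) (Src C (F (p + q) p)).
           F (p + q) p \<cdot> \<iota> = F (p + q) (p + 1) \<and>
           (\<exists>\<epsilon> \<in> Hom C (Src C (F (p + q) p)) (sE T r0 p q). is_cokernel C \<iota> \<epsilon>))" for p q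
  proof -
    obtain a where a: "\<And>p' x. \<lbrakk>p' \<le> a; x \<in> Arr C; Tgt C x = cD K p' (p + q - p');
        \<eta> p' (p + q - p') \<cdot> x = Nul C (Src C x) (M (p + q))\<rbrakk> \<Longrightarrow>
         ci K p' (p + q - p') \<cdot> x = Nul C (Src C x) (cD K (p' - 1) (p + q - p' + 1))"
      using bot[of "p + q"] by blast
    \<comment> \<open>The map \<open>k\<close> out of place \<open>(p, q)\<close> lands at
      \<open>(p + 1, q)\<close>, so \<open>top\<close> is used in total degree
      \<open>p + q + 1\<close>, whereas \<open>bot\<close> is used in degree
      \<open>p + q\<close>.\<close>
    obtain b where b: "\<And>p'. p' \<ge> b \<Longrightarrow>
        ci K p' (p + q + 1 - p') = Nul C (cD K p' (p + q + 1 - p')) (cD K (p' - 1) (p + q + 1 - p' + 1))"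
      using top[of "p + q + 1"] by blast
    \<comment> \<open>The bounds ensure that at least one \<open>i\<close> has been applied
      (\<open>r \<ge> 2\<close>), that the iterate ending at \<open>(p + 1, q)\<close> starts with a
      zero map (\<open>p + r \<ge> b\<close>), and that \<open>bot\<close> holds one application of
      \<open>i\<close> before the derived terms belonging to both \<open>p\<close> and
      \<open>p + 1\<close> (\<open>p - r + 3 \<le> a\<close>).\<close>
    define r0 where "r0 = nat (max 2 (max (b - p) (p + 3 - a)))"
    have r0: "r \<ge> 2" "p + int r \<ge> b" "p - int r + 3 \<le> a" if "r \<ge> r0" for r
      using that unfolding r0_def by linarith+
    have main: "sd T r p q = Nul C (sE T r p q) (sE T r (p + int r) (q - int r + 1)) \<and>
        sd T r (p - int r) (q + int r - 1) = Nul C (sE T r (p - int r) (q + int r - 1)) (sE T r p q) \<and>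
        (\<exists>\<iota> \<in> Hom C (Src C (F (p + q) (p + 1))) (Src C (F (p + q) p)).
           F (p + q) p \<cdot> \<iota> = F (p + q) (p + 1) \<and>
           (\<exists>\<epsilon> \<in> Hom C (Src C (F (p + q) p)) (sE T r p q). is_cokernel C \<iota> \<epsilon>))" if "r \<ge> r0" for r
    proof -
      have r: "r \<ge> 1" "r \<ge> 2" "p + int r \<ge> b" "p - int r + 2 \<le> a" "p - int r + 3 \<le> a"
        using r0[OF that] by auto
      note rD = exact_coupleD[OF Ks(2)[OF r(1)]]
      note E = Ks(4)[OF r(1)]
      obtain S U where
        S: "\<And>p q. S p q \<in> Hom C (cD (Ks r) p q) (cD K p q)" "\<And>p q. monic C (S p q)"
        and U: "\<And>p q. U p q \<in> Hom C (cD K p q) (cD (Ks r) (p - int r + 1) (q + int r - 1))" "\<And>p q. epic C (U p q)"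
        and Si: "\<And>p q. S (p - 1) (q + 1) \<cdot> ci (Ks r) p q = ci K p q \<cdot> S p q"
        and \<eta>SU: "\<And>p q. \<eta> (p - int r + 1) (q + int r - 1) \<cdot> (S (p - int r + 1) (q + int r - 1) \<cdot> U p q) = \<eta> p q"
        and SU0: "\<And>p q. ci K p q = Nul C (cD K p q) (cD K (p - 1) (q + 1)) \<Longrightarrow>
           S (p - int r + 1) (q + int r - 1) \<cdot> U p q = Nul C (cD K p q) (cD K (p - int r + 1) (q + int r - 1))"
        and SUu: "\<And>p q. \<exists>u \<in> Hom C (cD K p q) (cD K (p - int r + 2) (q + int r - 2)).
          S (p - int r + 1) (q + int r - 1) \<cdot> U p q = ci K (p - int r + 2) (q + int r - 2) \<cdot> u \<and>
          \<eta> (p - int r + 2) (q + int r - 2) \<cdot> u = \<eta> p q"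
        using iterated_image[OF Ks(2,3,1) \<eta> r(1)] r(2) by metis
      define \<eta>r where "\<eta>r p q = \<eta> (p - int r + 1) (q + int r - 1) \<cdot> S (p - int r + 1) (q + int r - 1)" for p q
      have \<eta>r: "\<eta>r p q \<in> Hom C (cD (Ks r) (p - int r + 1) (q + int r - 1)) (M (p + q))"
        "\<eta>r p q \<cdot> U p q = \<eta> p q" for p q
        using S(1)[of "p - int r + 1" "q + int r - 1"] \<eta>(1)[of "p - int r + 1" "q + int r - 1"] U(1)[of p q] \<eta>SU[of p q]
        unfolding \<eta>r_def by (auto simp: in_Hom)
      \<comment> \<open>An element killed by \<open>\<eta>r\<close> lifts along \<open>U\<close> to
        \<open>y\<close>. There \<open>\<eta>\<close> kills \<open>u \<cdot> y\<close>, so by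
        \<open>bot\<close> the next \<open>i\<close> kills it too, and the result of that
        \<open>i\<close> is \<open>S \<cdot> (U \<cdot> y)\<close>. Hence
        \<open>U \<cdot> y = 0\<close>, and the derived term embeds as the image of
        \<open>\<eta>\<close>.\<close>
      have \<eta>r_image: "is_image C (\<eta> p' q') (\<eta>r p' q')" "monic C (\<eta>r p' q')"
        if p': "p' + q' = p + q" "p' - int r + 2 \<le> a" for p' q'
      proof -
        let ?P = "p' - int r + 2" and ?Q = "q' + int r - 2"
        have PQ: "p + q - ?P = ?Q" "?P - 1 = p' - int r + 1" "?Q + 1 = q' + int r - 1"
          using p' by auto
        obtain u where u: "u \<in> Hom C (cD K p' q') (cD K ?P ?Q)"
            "S (p' - int r + 1) (q' + int r - 1) \<cdot> U p' q' = ci K ?P ?Q \<cdot> u" "\<eta> ?P ?Q \<cdot> u = \<eta> p' q'"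
          using SUu by blast
        note hom = u(1) \<eta>r(1)[of p' q'] U(1)[of p' q'] S(1)[of "p' - int r + 1" "q' + int r - 1"] \<eta>(1)[of p' q']
          KD(3)[of ?P ?Q, unfolded PQ]
        have \<eta>P: "\<eta> ?P ?Q \<in> Hom C (cD K ?P ?Q) (M (p + q))" using \<eta>(1)[of ?P ?Q] p' by simp
        show "monic C (\<eta>r p' q')"
        proof (rule monicI)
          fix x assume x: "x \<in> Arr C" "Tgt C x = Src C (\<eta>r p' q')" "\<eta>r p' q' \<cdot> x = Nul C (Src C x) (Tgt C (\<eta>r p' q'))"
          have xD: "Tgt C x = cD (Ks r) (p' - int r + 1) (q' + int r - 1)" using x(2) hom by (simp add: in_Hom)
          obtain \<epsilon> y where y: "epic C \<epsilon>" "\<epsilon> \<in> Arr C" "y \<in> Arr C" "Tgt C \<epsilon> = Src C x" "Src C y = Src C \<epsilon>"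
            "Tgt C y = Src C (U p' q')" "U p' q' \<cdot> y = x \<cdot> \<epsilon>"
            by (rule epic_pullback[OF U(2)[of p' q'], of x]) (use x(1) xD hom in \<open>auto simp: in_Hom\<close>)
          have yD: "Tgt C y = cD K p' q'" using y(6) hom by (simp add: in_Hom)
          have "\<eta> ?P ?Q \<cdot> (u \<cdot> y) = \<eta> p' q' \<cdot> y"
            using u(3)[THEN pull, of y] y(3) yD hom \<eta>P by (simp add: in_Hom)
          also have "\<dots> = \<eta>r p' q' \<cdot> (U p' q' \<cdot> y)"
            using \<eta>r(2)[of p' q', THEN pull, of y] y(3) yD hom by (simp add: in_Hom)
          also have "\<dots> = (\<eta>r p' q' \<cdot> x) \<cdot> \<epsilon>"
            unfolding y(7) using x(1) xD y(2,4) hom by (simp add: in_Hom)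
          also have "\<dots> = Nul C (Src C (u \<cdot> y)) (M (p + q))"
            unfolding x(3) using x(1) y(2-5) yD hom M p' by (simp add: in_Hom)
          finally have "ci K ?P ?Q \<cdot> (u \<cdot> y) = Nul C (Src C (u \<cdot> y)) (cD K (p' - int r + 1) (q' + int r - 1))"
            using a[of ?P "u \<cdot> y", unfolded PQ] p' y(3) yD hom by (simp add: in_Hom)
          then have "S (p' - int r + 1) (q' + int r - 1) \<cdot> (U p' q' \<cdot> y) =
              Nul C (Src C y) (cD K (p' - int r + 1) (q' + int r - 1))"
            using u(2)[THEN pull, of y] y(3) yD hom by (simp add: in_Hom)
          then have "U p' q' \<cdot> y = Nul C (Src C y) (Tgt C x)"
            using monic_Nul[OF S(2), of "p' - int r + 1" "q' + int r - 1" "U p' q' \<cdot> y"] y(3) yD xD hom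
            by (simp add: in_Hom)
          then show "x = Nul C (Src C x) (Src C (\<eta>r p' q'))"
            using epic_Nul[OF y(1), of x] x(1) xD y(4,5,7) hom by (simp add: in_Hom)
        qed (use hom in \<open>auto simp: in_Hom\<close>)
        then show "is_image C (\<eta> p' q') (\<eta>r p' q')"
          using U(2)[of p' q'] \<eta>r(2)[of p' q'] hom by (intro imageI) (auto simp: in_Hom)
      qed
      let ?P = "p - int r + 1" and ?Q = "q + int r - 1"
      have idx: "?P + 1 = p - int r + 2" "?Q - 1 = q + int r - 2" "p - int r + 2 - 1 = ?P" "q + int r - 2 + 1 = ?Q"
         "p + 1 - int r + 1 = p - int r + 2" "q - 1 + int r - 1 = q + int r - 2"
         "p + int r - int r + 1 = p + 1" "q - int r + 1 + int r - 1 = q" by auto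
      note \<eta>r0 = \<eta>r_image[of p q, OF refl r(4)]
      have \<eta>r1: "is_image C (\<eta> (p + 1) (q - 1)) (\<eta>r (p + 1) (q - 1))"
        using r(5) by (intro \<eta>r_image) auto
      have \<eta>ri: "\<eta>r p q \<cdot> ci (Ks r) (p - int r + 2) (q + int r - 2) = \<eta>r (p + 1) (q - 1)"
        unfolding \<eta>r_def idx
        using Si[of "p - int r + 2" "q + int r - 2"] \<eta>(2)[of "p - int r + 2" "q + int r - 2", THEN pull, of "S (p - int r + 2) (q + int r - 2)"]
          S(1)[of "p - int r + 2" "q + int r - 2"] S(1)[of ?P ?Q] \<eta>(1)[of ?P ?Q] rD(3)[of "p - int r + 2" "q + int r - 2"]
          KD(3)[of "p - int r + 2" "q + int r - 2"]
        unfolding idx by (simp add: in_Hom)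
      \<comment> \<open>The map \<open>S\<close> at \<open>(p + 1, q)\<close> is zero, because
        \<open>U\<close> is epic and their composite starts with a zero \<open>i\<close>. Being
        monic as well, it forces every map into its source, in particular \<open>k\<close>, to
        vanish.\<close>
      have k0: "ck (Ks r) p q = Nul C (cE (Ks r) p q) (cD (Ks r) (p + 1) q)"
      proof -
        note U1 = U[of "p + int r" "q - int r + 1", unfolded idx] and SU1 = SU0[of "p + int r" "q - int r + 1", unfolded idx]
        note hom = U1(1) S(1)[of "p + 1" q] rD(5)[of p q]
        have "ci K (p + int r) (q - int r + 1) =
            Nul C (cD K (p + int r) (q - int r + 1)) (cD K (p + int r - 1) (q - int r + 1 + 1))"
          using b[OF r(3)] by (simp add: algebra_simps)
        then have "S (p + 1) q \<cdot> U (p + int r) (q - int r + 1) = Nul C (cD K (p + int r) (q - int r + 1)) (cD K (p + 1) q)"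
          by (rule SU1)
        then have "S (p + 1) q = Nul C (cD (Ks r) (p + 1) q) (cD K (p + 1) q)"
          using epic_Nul[OF U1(2), of "S (p + 1) q"] hom by (simp add: in_Hom)
        then have "S (p + 1) q \<cdot> ck (Ks r) p q = Nul C (cE (Ks r) p q) (cD K (p + 1) q)"
          using hom KD(1) by (simp add: in_Hom)
        then show ?thesis
          using monic_Nul[OF S(2), of "p + 1" q "ck (Ks r) p q"] hom by (simp add: in_Hom)
      qed
      \<comment> \<open>The embedding \<open>\<eta>r p q\<close> factors through the next
        \<open>i\<close>, and \<open>i\<close> kills \<open>k\<close>. So the embedding kills the
        \<open>k\<close> that enters the differential into \<open>(p, q)\<close>, and this
        \<open>k\<close> is zero.\<close>
      have km0: "ck (Ks r) (p - int r) (q + int r - 1) = Nul C (cE (Ks r) (p - int r) (q + int r - 1)) (cD (Ks r) ?P ?Q)"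
      proof -
        have idx2: "?P - 1 = p - int r" "?Q + 1 = q + int r" by auto
        note hom = rD(3)[of ?P ?Q, unfolded idx2] S(1)[of ?P ?Q] S(1)[of "p - int r" "q + int r"] \<eta>(1)[of ?P ?Q]
          \<eta>(1)[of "p - int r" "q + int r"] KD(3)[of ?P ?Q, unfolded idx2] rD(5)[of "p - int r" ?Q]
        have "\<eta> (p - int r) (q + int r) \<cdot> (S (p - int r) (q + int r) \<cdot> ci (Ks r) ?P ?Q) = \<eta>r p q"
          using Si[of ?P ?Q, unfolded idx2] \<eta>(2)[of ?P ?Q, unfolded idx2, THEN pull, of "S ?P ?Q"] hom
          unfolding \<eta>r_def by (simp add: in_Hom)
        then have "\<eta>r p q \<cdot> ck (Ks r) (p - int r) ?Q =
            \<eta> (p - int r) (q + int r) \<cdot> (S (p - int r) (q + int r) \<cdot> (ci (Ks r) ?P ?Q \<cdot> ck (Ks r) (p - int r) ?Q))"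
          using hom by (simp add: in_Hom flip: \<open>_ = \<eta>r p q\<close>)
        also have "ci (Ks r) ?P ?Q \<cdot> ck (Ks r) (p - int r) ?Q = Nul C (cE (Ks r) (p - int r) ?Q) (cD (Ks r) (p - int r) (q + int r))"
          using ci_ck[OF Ks(2)[OF r(1)], of ?P ?Q] unfolding idx2 .
        finally have "\<eta>r p q \<cdot> ck (Ks r) (p - int r) ?Q = Nul C (cE (Ks r) (p - int r) ?Q) (M (p + q))"
          using hom rD(2) by (simp add: in_Hom)
        then show ?thesis
          using monic_Nul[OF \<eta>r0(2), of "ck (Ks r) (p - int r) ?Q"] \<eta>r(1)[of p q] hom by (simp add: in_Hom)
      qed
      have cj1: "cj (Ks r) (p + 1) q \<in> Hom C (cD (Ks r) (p + 1) q) (cE (Ks r) (p + int r) (q - int r + 1))"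
        by (rule rD(4)) auto
      have cj0: "cj (Ks r) ?P ?Q \<in> Hom C (cD (Ks r) ?P ?Q) (cE (Ks r) p q)"
        by (rule rD(4)) auto
      have sd: "sd T r p q = Nul C (sE T r p q) (sE T r (p + int r) (q - int r + 1))"
        using E k0 cj1 rD(2) unfolding couple_diff_def by (simp add: in_Hom)
      have sd': "sd T r (p - int r) (q + int r - 1) = Nul C (sE T r (p - int r) (q + int r - 1)) (sE T r p q)"
        using E km0 cj0 rD(2) unfolding couple_diff_def by (simp add: in_Hom)
      have "epic C (cj (Ks r) ?P ?Q)"
        by (rule exact_epic[OF rD(8)[OF refl refl, of p q]]) (use k0 rD in simp)
      then have coker: "is_cokernel C (ci (Ks r) (p - int r + 2) (q + int r - 2)) (cj (Ks r) ?P ?Q)"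
        by (intro exact_epic_cokernel rD(7)) auto
      have F0: "is_image C (\<eta> p q) (F (p + q) p)" and F1: "is_image C (\<eta> (p + 1) (q - 1)) (F (p + q) (p + 1))"
        using F[of p "p + q"] F[of "p + 1" "p + q"] by simp_all
      \<comment> \<open>The embedded derived terms and the given \<open>F\<close> are images of the
        same maps, hence isomorphic as subobjects; the cokernel is carried over along these
        isomorphisms.\<close>
      obtain \<theta>0 \<theta>0' where \<theta>0: "\<theta>0 \<in> Hom C (Src C (\<eta>r p q)) (Src C (F (p + q) p))"
          "\<theta>0' \<in> Hom C (Src C (F (p + q) p)) (Src C (\<eta>r p q))"
          "F (p + q) p \<cdot> \<theta>0 = \<eta>r p q" "\<theta>0' \<cdot> \<theta>0 = Idn C (Src C (\<eta>r p q))" "\<theta>0 \<cdot> \<theta>0' = Idn C (Src C (F (p + q) p))"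
        using image_unique[OF \<eta>r0(1) F0] by metis
      obtain \<theta>1 \<theta>1' where \<theta>1: "\<theta>1 \<in> Hom C (Src C (\<eta>r (p + 1) (q - 1))) (Src C (F (p + q) (p + 1)))"
          "\<theta>1' \<in> Hom C (Src C (F (p + q) (p + 1))) (Src C (\<eta>r (p + 1) (q - 1)))"
          "F (p + q) (p + 1) \<cdot> \<theta>1 = \<eta>r (p + 1) (q - 1)" "\<theta>1 \<cdot> \<theta>1' = Idn C (Src C (F (p + q) (p + 1)))"
        using image_unique[OF \<eta>r1 F1] by metis
      obtain \<iota> where \<iota>: "\<iota> \<in> Hom C (Src C (F (p + q) (p + 1))) (Src C (F (p + q) p))" "F (p + q) p \<cdot> \<iota> = F (p + q) (p + 1)"
        using F\<iota> by blast
      note hom = \<theta>0(1,2) \<theta>1(1,2) \<iota>(1) \<eta>r(1)[of p q] \<eta>r(1)[of "p + 1" "q - 1", unfolded idx]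
        rD(3)[of "p - int r + 2" "q + int r - 2", unfolded idx] cj0
      have "F (p + q) p \<cdot> (\<iota> \<cdot> \<theta>1) = \<eta>r (p + 1) (q - 1)"
        using \<iota>(2)[THEN pull, of \<theta>1] \<theta>1(3) hom Fs by (simp add: in_Hom)
      also have "\<dots> = F (p + q) p \<cdot> (\<theta>0 \<cdot> ci (Ks r) (p - int r + 2) (q + int r - 2))"
        using \<theta>0(3)[THEN pull, of "ci (Ks r) (p - int r + 2) (q + int r - 2)"] \<eta>ri hom Fs by (simp add: in_Hom)
      finally have "\<iota> \<cdot> \<theta>1 = \<theta>0 \<cdot> ci (Ks r) (p - int r + 2) (q + int r - 2)"
        using hom Fs by - (rule monicD[OF Fs(2)[of "p + q" p]]; simp add: in_Hom)
      then have "is_cokernel C \<iota> (cj (Ks r) ?P ?Q \<cdot> \<theta>0')"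
        using hom \<theta>0 iso_epic[OF \<theta>1(1,2,4)]
        by - (rule cokernel_transport[OF coker \<iota>(1), where ?\<theta>1.0 = \<theta>1 and ?\<theta>0.0 = \<theta>0]; simp add: in_Hom)
      moreover have "cj (Ks r) ?P ?Q \<cdot> \<theta>0' \<in> Hom C (Src C (F (p + q) p)) (sE T r p q)"
        using hom E by (simp add: in_Hom)
      ultimately show ?thesis using sd sd' \<iota> by blast
    qed
    show ?thesis
    proof (intro exI[of _ r0] conjI allI impI)
      show "1 \<le> r0" using r0[of r0] by simp
    qed (use main main[of r0] in blast)+
  qed
  show ?thesis
    unfolding converges_def
    using Fs F\<iota> Fiso Fzero stable by blast
qed

end

section \<open>Weight structures\<close>

lemma additive_functor_Nul:
  assumes C: "additive_category C" and D: "additive_category D" and F: "additive_functor C D F"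
    and X: "X \<in> Obj C" "Y \<in> Obj C"
  shows "FM F (Nul C X Y) = Nul D (FO F X) (FO F Y)"
proof -
  interpret C: additive_category C by fact
  interpret D: additive_category D by fact
  interpret F: additive_functor C D F by fact
  have N: "Nul C X Y \<in> Hom C X Y" using X by (simp add: C.in_Hom)
  have "FM F (Nul C X Y) \<boxplus>\<^bsub>D\<^esub> FM F (Nul C X Y) = FM F (Nul C X Y)"
    using F.FM_Pls[OF N N] X by simp
  then show ?thesis
    using D.Nul_unique[of "FM F (Nul C X Y)"] F.FM_Hom[OF N] by (simp add: D.in_Hom)
qed

section \<open>Triangulated categories: shifts, and exactness of Hom on distinguished
  triangles\<close>

context triangulated_category
begin

lemma ShO_Obj [simp]: "X \<in> Obj C \<Longrightarrow> ShO C n X \<in> Obj C"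
  using additive_functor.FO_Obj[OF shift_functor] by auto

lemma ShM_simps [simp]:
  assumes "f \<in> Arr C"
  shows "ShM C n f \<in> Arr C" "Src C (ShM C n f) = ShO C n (Src C f)" "Tgt C (ShM C n f) = ShO C n (Tgt C f)"
  using additive_functor.FM_Hom[OF shift_functor, of f "Src C f" "Tgt C f" n] assms by (auto simp: in_Hom)

lemma ShM_Idn [simp]: "X \<in> Obj C \<Longrightarrow> ShM C n (Idn C X) = Idn C (ShO C n X)"
  using additive_functor.FM_Idn[OF shift_functor, of X n] by simp

lemma ShM_Cmp:
  assumes "f \<in> Arr C" "g \<in> Arr C" "Tgt C f = Src C g"
  shows "ShM C n (g \<cdot> f) = ShM C n g \<cdot> ShM C n f"
  using additive_functor.FM_Cmp[OF shift_functor, of f "Src C f" "Src C g" g "Tgt C g" n] assms by (auto simp: in_Hom)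

lemma ShM_Pls:
  assumes "f \<in> Arr C" "g \<in> Arr C" "Src C g = Src C f" "Tgt C g = Tgt C f"
  shows "ShM C n (f \<boxplus> g) = ShM C n f \<boxplus> ShM C n g"
  using additive_functor.FM_Pls[OF shift_functor, of f "Src C f" "Tgt C f" g n] assms by (auto simp: in_Hom)

lemma ShM_Nul [simp]:
  "X \<in> Obj C \<Longrightarrow> Y \<in> Obj C \<Longrightarrow> ShM C n (Nul C X Y) = Nul C (ShO C n X) (ShO C n Y)"
  using additive_functor_Nul[OF _ _ shift_functor] additive_category_axioms by fastforce

lemma ShO_ShO [simp]: "X \<in> Obj C \<Longrightarrow> ShO C m (ShO C n X) = ShO C (m + n) X"
  using ShO_add by simp

lemma ShM_ShM [simp]: "f \<in> Arr C \<Longrightarrow> ShM C m (ShM C n f) = ShM C (m + n) f"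
  using ShM_add by simp

declare ShO_0 [simp] ShM_0 [simp]

lemma ShM_eq_Nul:
  assumes "f \<in> Arr C" "ShM C n f = Nul C (ShO C n (Src C f)) (ShO C n (Tgt C f))"
  shows "f = Nul C (Src C f) (Tgt C f)"
proof -
  have "ShM C (- n) (ShM C n f) = ShM C (- n) (Nul C (ShO C n (Src C f)) (ShO C n (Tgt C f)))"
    using assms(2) by (rule arg_cong)
  then show ?thesis using assms(1) by simp
qed

lemma DistD:
  assumes "(f, g, h) \<in> Dist C"
  shows "f \<in> Arr C" "g \<in> Arr C" "h \<in> Arr C" "Tgt C f = Src C g" "Tgt C g = Src C h" "Tgt C h = ShO C 1 (Src C f)"
  using Dist_triangle[OF assms] unfolding triangle_def by auto

lemma Dist_rotate:
  assumes "(f, g, h) \<in> Dist C"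
  shows "(g, h, neg C (ShM C 1 f)) \<in> Dist C"
  using TR2[OF Dist_triangle[OF assms]] assms by simp

text \<open>Compare with the triangle of an identity, whose third vertex is zero: the morphism of
  triangles from \<open>TR3\<close> factors \<open>g \<cdot> f\<close> through zero.\<close>

lemma Dist_comp:
  assumes D: "(f, g, h) \<in> Dist C"
  shows "g \<cdot> f = Nul C (Src C f) (Tgt C g)"
proof -
  note t = DistD[OF D]
  obtain Z where Z: "zero_object C Z" using ex_zero by blast
  then have ZO: "Z \<in> Obj C" by (simp add: zero_object_def)
  have "(Idn C (Src C f), Nul C (Src C f) Z, Nul C Z (ShO C 1 (Src C f))) \<in> Dist C"
    using TR1_id[of "Src C f" Z] Z t by simp
  then have "\<exists>c \<in> Hom C (Src C (Nul C Z (ShO C 1 (Src C f)))) (Src C h). c \<cdot> Nul C (Src C f) Z = g \<cdot> f \<and>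
      ShM C 1 (Idn C (Src C f)) \<cdot> Nul C Z (ShO C 1 (Src C f)) = h \<cdot> c"
    by (rule TR3[OF _ D]) (use t ZO in \<open>auto simp: in_Hom\<close>)
  then show ?thesis using t ZO by (auto simp: in_Hom)
qed

text \<open>\<open>TR3\<close> is applied from the rotated triangle of the identity of
  \<open>W\<close> to the rotated triangle of \<open>f\<close>. The third map \<open>c\<close>
  starts at \<open>W[1]\<close>, the signs from the rotations cancel, and its shift by
  \<open>-1\<close> is the lift.\<close>

lemma Dist_lift:
  assumes D: "(f, g, h) \<in> Dist C" and u: "u \<in> Arr C" "Tgt C u = Src C g" "g \<cdot> u = Nul C (Src C u) (Tgt C g)"
  obtains v where "v \<in> Arr C" "Src C v = Src C u" "Tgt C v = Src C f" "f \<cdot> v = u"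
proof -
  note t = DistD[OF D]
  obtain Z where Z: "zero_object C Z" using ex_zero by blast
  then have ZO: "Z \<in> Obj C" by (simp add: zero_object_def)
  define W where "W = Src C u"
  have W: "W \<in> Obj C" using u by (simp add: W_def)
  have "(Idn C W, Nul C W Z, Nul C Z (ShO C 1 W)) \<in> Dist C"
    using TR1_id[OF W Z] .
  from Dist_rotate[OF this]
  have "(Nul C W Z, Nul C Z (ShO C 1 W), neg C (Idn C (ShO C 1 W))) \<in> Dist C"
    using W by simp
  then have "\<exists>c \<in> Hom C (Src C (neg C (Idn C (ShO C 1 W)))) (Src C (neg C (ShM C 1 f))).
      c \<cdot> Nul C Z (ShO C 1 W) = h \<cdot> Nul C Z (Tgt C g) \<and>
      ShM C 1 u \<cdot> neg C (Idn C (ShO C 1 W)) = neg C (ShM C 1 f) \<cdot> c"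
    by (rule TR3[OF _ Dist_rotate[OF D]]) (use t u W ZO in \<open>auto simp: in_Hom W_def\<close>)
  then obtain c where c: "c \<in> Arr C" "Src C c = ShO C 1 W" "Tgt C c = ShO C 1 (Src C f)"
      "ShM C 1 u \<cdot> neg C (Idn C (ShO C 1 W)) = neg C (ShM C 1 f) \<cdot> c"
    using t W by (auto simp: in_Hom)
  then have "neg C (ShM C 1 u) = neg C (ShM C 1 f \<cdot> c)"
    using t u W by (simp add: W_def)
  then have "neg C (neg C (ShM C 1 u)) = neg C (neg C (ShM C 1 f \<cdot> c))" by simp
  then have "ShM C 1 u = ShM C 1 f \<cdot> c" using t u c by simp
  then have "ShM C (- 1) (ShM C 1 u) = ShM C (- 1) (ShM C 1 f \<cdot> c)" by simp
  then have "f \<cdot> ShM C (- 1) c = u" using t(1) u(1) c(1-3) by (simp add: ShM_Cmp)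
  then show thesis
    using that[of "ShM C (- 1) c"] c(1-3) t(1) u(1) by (simp add: W_def)
qed

text \<open>Dual to the lifting property, with the triangle
  \<open>0 \<rightarrow> W \<rightarrow> W \<rightarrow> 0[1]\<close> as target of
  \<open>TR3\<close>; that triangle arises by rotating an identity triangle backwards, with
  \<open>0[1]\<close> as its zero object.\<close>

lemma Dist_desc:
  assumes D: "(f, g, h) \<in> Dist C" and u: "u \<in> Arr C" "Src C u = Tgt C f" "u \<cdot> f = Nul C (Src C f) (Tgt C u)"
  obtains v where "v \<in> Arr C" "Src C v = Tgt C g" "Tgt C v = Tgt C u" "v \<cdot> g = u"
proof -
  note t = DistD[OF D]
  obtain Z where Z: "zero_object C Z" using ex_zero by blast
  then have ZO: "Z \<in> Obj C" by (simp add: zero_object_def)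
  define W where "W = Tgt C u"
  have W: "W \<in> Obj C" using u by (simp add: W_def)
  have Z1: "zero_object C (ShO C 1 Z)"
    using Z ShM_Idn[of Z 1] ShM_Nul[of Z Z 1] unfolding zero_object_iff by simp
  have "triangle C (Nul C Z W) (Idn C W) (Nul C W (ShO C 1 Z))"
    using W ZO by (simp add: triangle_def)
  moreover have "(Idn C W, Nul C W (ShO C 1 Z), neg C (ShM C 1 (Nul C Z W))) \<in> Dist C"
    using TR1_id[OF W Z1] W ZO by simp
  ultimately have "(Nul C Z W, Idn C W, Nul C W (ShO C 1 Z)) \<in> Dist C"
    using TR2 by blast
  then have "\<exists>c \<in> Hom C (Src C h) (Src C (Nul C W (ShO C 1 Z))). c \<cdot> g = Idn C W \<cdot> u \<and>
      ShM C 1 (Nul C (Src C f) Z) \<cdot> h = Nul C W (ShO C 1 Z) \<cdot> c"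
    by (rule TR3[OF D]) (use t u W ZO in \<open>auto simp: in_Hom W_def\<close>)
  then obtain c where "c \<in> Hom C (Src C h) (Src C (Nul C W (ShO C 1 Z)))" "c \<cdot> g = Idn C W \<cdot> u" by blast
  then show thesis using that[of c] t(5) u(1) W ZO by (simp add: in_Hom W_def)
qed

end

text \<open>Adds no assumption; it only makes \<open>C\<close> the implicit structure, so that
  composites in \<open>C\<close> are written without an index.\<close>

locale weighted_category = weight_structure C w
  for C :: "('o, 'm, 'z) tricat_scheme" (structure) and w :: "'o weights"
begin

lemma Wle_Obj: "X \<in> Wle w \<Longrightarrow> X \<in> Obj C"
  using Wle_additive unfolding additive_class_def by blast

lemma Wge_Obj: "X \<in> Wge w \<Longrightarrow> X \<in> Obj C"
  using Wge_additive unfolding additive_class_def by blast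

lemma Wle_ShO:
  assumes "Y \<in> Wle w"
  shows "ShO C (int n) Y \<in> Wle w"
proof (induction n)
  case (Suc n)
  have "ShO C (int (Suc n)) Y = ShO C 1 (ShO C (int n) Y)"
    using Wle_Obj[OF assms] by simp
  then show ?case using Suc Wle_shift by auto
qed (use assms Wle_Obj in simp)

text \<open>Shifting by \<open>-m\<close> turns the target into \<open>Y[n - m]\<close> with
  \<open>n - m \<ge> 1\<close>. One shift is left for the orthogonality axiom, and the remaining
  nonnegative ones preserve \<open>Wle w\<close>.\<close>

lemma orthogonal_shift:
  assumes f: "f \<in> Arr C" "Src C f = ShO C m X" "Tgt C f = ShO C n Y"
    and X: "X \<in> Wge w" and Y: "Y \<in> Wle w" and mn: "m < n"
  shows "f = Nul C (ShO C m X) (ShO C n Y)"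
proof -
  note O = Wge_Obj[OF X] Wle_Obj[OF Y]
  have "ShO C (n - m - 1) Y \<in> Wle w"
    using Wle_ShO[OF Y, of "nat (n - m - 1)"] mn by simp
  then have "ShO C 1 (ShO C (n - m - 1) Y) \<in> ShO C 1 ` Wle w" by blast
  then have "ShO C (n - m) Y \<in> ShO C 1 ` Wle w" using O by simp
  then have "Hom C X (ShO C (n - m) Y) = {Nul C X (ShO C (n - m) Y)}"
    using orthogonality X unfolding orthogonal_def by blast
  moreover have "ShM C (- m) f \<in> Hom C X (ShO C (n - m) Y)"
    using f O by (simp add: in_Hom)
  ultimately have "ShM C (- m) f = Nul C (ShO C (- m) (Src C f)) (ShO C (- m) (Tgt C f))"
    using f O by simp
  then show ?thesis using ShM_eq_Nul[of f "- m"] f by simp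
qed

lemma orthogonal_neg1:
  assumes "f \<in> Hom C (ShO C (- 1) X) Y" "X \<in> Wge w" "Y \<in> Wle w"
  shows "f = Nul C (ShO C (- 1) X) Y"
  using orthogonal_shift[of f "- 1" X 0 Y] assms Wle_Obj by (simp add: in_Hom)

lemma weight_decompositionD:
  assumes "weight_decomposition C w X g f e" "X \<in> Obj C"
  shows "(g, f, e) \<in> Dist C" "g \<in> Hom C X (Tgt C g)" "f \<in> Hom C (Tgt C g) (Tgt C f)"
    "e \<in> Hom C (Tgt C f) (ShO C 1 X)" "Tgt C g \<in> Wle w" "Tgt C f \<in> Wge w"
  using assms DistD[of g f e] unfolding weight_decomposition_def by (auto simp: in_Hom)

text \<open>The obstruction to lifting \<open>ShM C 1 \<phi> \<cdot> e\<close> along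
  \<open>e'\<close> is a map from an object of \<open>Wge w\<close> to an object of
  \<open>Wle w\<close> shifted by \<open>1\<close>, which vanishes by orthogonality.\<close>

lemma weight_decomposition_map:
  assumes "weight_decomposition C w X g f e" "weight_decomposition C w X' g' f' e'" and \<phi>: "\<phi> \<in> Hom C X X'"
  obtains b where "b \<in> Hom C (Tgt C f) (Tgt C f')" "e' \<cdot> b = ShM C 1 \<phi> \<cdot> e"
proof -
  note D = weight_decompositionD[OF assms(1) Hom_Obj(1)[OF \<phi>]]
  note D' = weight_decompositionD[OF assms(2) Hom_Obj(2)[OF \<phi>]]
  note hom = D(2-4) D'(2-4) \<phi>
  have "(e', neg C (ShM C 1 g'), neg C (ShM C 1 f')) \<in> Dist C"
    using Dist_rotate[OF Dist_rotate[OF D'(1)]] .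
  then obtain b where "b \<in> Arr C" "Src C b = Src C (ShM C 1 \<phi> \<cdot> e)" "Tgt C b = Src C e'" "e' \<cdot> b = ShM C 1 \<phi> \<cdot> e"
  proof (rule Dist_lift[of _ _ _ "ShM C 1 \<phi> \<cdot> e"])
    have "neg C (ShM C 1 g') \<cdot> (ShM C 1 \<phi> \<cdot> e) = Nul C (ShO C 0 (Tgt C f)) (ShO C 1 (Tgt C g'))"
      by (rule orthogonal_shift[OF _ _ _ D(6) D'(5)]) (use hom Wge_Obj[OF D(6)] in \<open>auto simp: in_Hom\<close>)
    then show "neg C (ShM C 1 g') \<cdot> (ShM C 1 \<phi> \<cdot> e) = Nul C (Src C (ShM C 1 \<phi> \<cdot> e)) (Tgt C (neg C (ShM C 1 g')))"
      using hom Wge_Obj[OF D(6)] by (simp add: in_Hom)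
  qed (use hom in \<open>auto simp: in_Hom\<close>)
  then show thesis using that hom by (auto simp: in_Hom)
qed

text \<open>A map killed by \<open>e\<close> comes along \<open>f\<close> from a map into
  \<open>Wle w\<close>, and from \<open>Wge w\<close> shifted by \<open>-1\<close> there are only
  zero maps to it. This is the uniqueness by which squares in towers are shown to commute.\<close>

lemma weight_decomposition_mono:
  assumes D: "weight_decomposition C w X g f e" "X \<in> Obj C" and Y: "Y \<in> Wge w"
    and d: "d \<in> Hom C (ShO C (- 1) Y) (Tgt C f)" "e \<cdot> d = Nul C (ShO C (- 1) Y) (ShO C 1 X)"
  shows "d = Nul C (ShO C (- 1) Y) (Tgt C f)"
proof -
  note D' = weight_decompositionD[OF D]
  note hom = D'(2-4) d(1)
  obtain v where v: "v \<in> Arr C" "Src C v = Src C d" "Tgt C v = Src C f" "f \<cdot> v = d"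
    by (rule Dist_lift[OF Dist_rotate[OF D'(1)], of d]) (use hom d(2) D(2) in \<open>auto simp: in_Hom\<close>)
  have "v = Nul C (ShO C (- 1) Y) (Tgt C g)"
    by (rule orthogonal_neg1[OF _ Y D'(5)]) (use v hom in \<open>simp add: in_Hom\<close>)
  then show ?thesis
    using v(4) hom Wge_Obj[OF Y] by (auto simp: in_Hom)
qed

section \<open>Weight Postnikov towers, extensions of morphisms to them, and their
  homotopies\<close>

lemma weight_towerD:
  assumes P: "weight_tower C w X P" and X: "X \<in> Obj C"
  shows "weight_decomposition C w (ShO C k X) (tw_g P k) (tw_f P k) (tw_e P k)"
    "tw_g P k \<in> Hom C (ShO C k X) (tw_le P k)"
    "tw_f P k \<in> Hom C (tw_le P k) (tw_ge P (k + 1))"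
    "tw_e P k \<in> Hom C (tw_ge P (k + 1)) (ShO C (k + 1) X)"
    "tw_le P k \<in> Wle w" "tw_ge P k \<in> Wge w" "tw_gr P k \<in> Wle w" "tw_gr P k \<in> Wge w"
    "tw_v P k \<in> Hom C (ShO C (- 1) (tw_ge P (k + 1))) (tw_ge P k)"
    "tw_e P (k - 1) \<cdot> tw_v P k = ShM C (- 1) (tw_e P k)"
    "tw_c P k \<in> Hom C (tw_le P (k - 1)) (tw_gr P k)"
    "tw_d P k \<in> Hom C (tw_gr P k) (tw_le P k)"
    "tw_y P k \<in> Hom C (tw_ge P k) (tw_gr P k)"
    "(tw_x C P k, tw_v P k, tw_y P k) \<in> Dist C"
    "tw_c P k = tw_y P k \<cdot> tw_f P (k - 1)"
    "tw_x C P k \<in> Hom C (ShO C (- 1) (tw_gr P k)) (ShO C (- 1) (tw_ge P (k + 1)))"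
    "ShM C 1 (tw_x C P k) = tw_f P k \<cdot> tw_d P k"
    "tw_h C P k \<in> Hom C (tw_gr P k) (tw_gr P (k + 1))"
    "tw_h C P k = tw_y P (k + 1) \<cdot> (tw_f P k \<cdot> tw_d P k)"
proof -
  have P': "weight_decomposition C w (ShO C k X) (tw_g P k) (tw_f P k) (tw_e P k)"
    "Tgt C (tw_g P k) = tw_le P k" "Tgt C (tw_f P k) = tw_ge P (k + 1)"
    "tw_v P k \<in> Hom C (ShO C (- 1) (tw_ge P (k + 1))) (tw_ge P k)"
    "tw_e P (k - 1) \<cdot> tw_v P k = ShM C (- 1) (tw_e P k)"
    "tw_gr P k \<in> Wle w" "tw_gr P k \<in> Wge w"
    "tw_c P k \<in> Hom C (tw_le P (k - 1)) (tw_gr P k)"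
    "tw_d P k \<in> Hom C (tw_gr P k) (tw_le P k)"
    "tw_y P k \<in> Hom C (tw_ge P k) (tw_gr P k)"
    "(tw_x C P k, tw_v P k, tw_y P k) \<in> Dist C"
    "tw_c P k = tw_y P k \<cdot> tw_f P (k - 1)" for k
    using P unfolding weight_tower_def by blast+
  note W = weight_decompositionD[OF P'(1), unfolded P'(2,3)]
  have "Tgt C (tw_f P (k - 1)) \<in> Wge w"
    using P'(1)[of "k - 1"] unfolding weight_decomposition_def by blast
  then show "tw_ge P k \<in> Wge w" using P'(3)[of "k - 1"] by simp
  show g: "tw_g P k \<in> Hom C (ShO C k X) (tw_le P k)"
    and f: "\<And>k. tw_f P k \<in> Hom C (tw_le P k) (tw_ge P (k + 1))"
    and "tw_e P k \<in> Hom C (tw_ge P (k + 1)) (ShO C (k + 1) X)" "tw_le P k \<in> Wle w"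
    using W X by (auto simp: in_Hom add.commute)
  show "tw_x C P k \<in> Hom C (ShO C (- 1) (tw_gr P k)) (ShO C (- 1) (tw_ge P (k + 1)))"
    "ShM C 1 (tw_x C P k) = tw_f P k \<cdot> tw_d P k"
    using P'(9)[of k] f[of k] unfolding tw_x_def by (auto simp: in_Hom)
  show "tw_h C P k \<in> Hom C (tw_gr P k) (tw_gr P (k + 1))"
    using P'(9)[of k] P'(8)[of "k + 1"] unfolding tw_h_def by (auto simp: in_Hom)
  show "tw_h C P k = tw_y P (k + 1) \<cdot> (tw_f P k \<cdot> tw_d P k)"
    using P'(9,12)[of k] P'(12,10)[of "k + 1"] f[of k] unfolding tw_h_def by (auto simp: in_Hom)
  show "weight_decomposition C w (ShO C k X) (tw_g P k) (tw_f P k) (tw_e P k)"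
    "tw_gr P k \<in> Wle w" "tw_gr P k \<in> Wge w"
    "tw_v P k \<in> Hom C (ShO C (- 1) (tw_ge P (k + 1))) (tw_ge P k)"
    "tw_e P (k - 1) \<cdot> tw_v P k = ShM C (- 1) (tw_e P k)"
    "tw_c P k \<in> Hom C (tw_le P (k - 1)) (tw_gr P k)"
    "tw_d P k \<in> Hom C (tw_gr P k) (tw_le P k)"
    "tw_y P k \<in> Hom C (tw_ge P k) (tw_gr P k)"
    "(tw_x C P k, tw_v P k, tw_y P k) \<in> Dist C"
    "tw_c P k = tw_y P k \<cdot> tw_f P (k - 1)"
    by (rule P')+
qed

text \<open>The \<open>\<beta> k\<close> lift shifts of \<open>g\<close>. Their squares with
  \<open>tw_v\<close> commute because both composites agree after \<open>tw_e P'\<close> and start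
  at an object of \<open>Wge w\<close> shifted by \<open>-1\<close>. The \<open>\<alpha> k\<close>
  are then merely some third maps of morphisms of triangles.\<close>

lemma ex_tower_extension:
  assumes P: "weight_tower C w X P" and P': "weight_tower C w X' P'" and g: "g \<in> Hom C X X'"
  shows "\<exists>\<beta> \<alpha>. tower_extension C P P' g \<beta> \<alpha>"
proof -
  note D = weight_towerD[OF P Hom_Obj(1)[OF g]] and D' = weight_towerD[OF P' Hom_Obj(2)[OF g]]
  have "\<exists>b. b \<in> Hom C (tw_ge P k) (tw_ge P' k) \<and> tw_e P' (k - 1) \<cdot> b = ShM C k g \<cdot> tw_e P (k - 1)" for k
  proof -
    have "ShM C (k - 1) g \<in> Hom C (ShO C (k - 1) X) (ShO C (k - 1) X')" using g by (simp add: in_Hom)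
    then obtain b where "b \<in> Hom C (Tgt C (tw_f P (k - 1))) (Tgt C (tw_f P' (k - 1)))"
        "tw_e P' (k - 1) \<cdot> b = ShM C 1 (ShM C (k - 1) g) \<cdot> tw_e P (k - 1)"
      by (rule weight_decomposition_map[OF D(1) D'(1)])
    then show ?thesis
      using D(3)[of "k - 1"] D'(3)[of "k - 1"] g by (auto simp: in_Hom)
  qed
  then obtain \<beta> where \<beta>: "\<And>k. \<beta> k \<in> Hom C (tw_ge P k) (tw_ge P' k)"
      "\<And>k. tw_e P' (k - 1) \<cdot> \<beta> k = ShM C k g \<cdot> tw_e P (k - 1)" by metis
  have \<beta>v: "\<beta> k \<cdot> tw_v P k = tw_v P' k \<cdot> ShM C (- 1) (\<beta> (k + 1))" for k
  proof (rule eq_if_diff_Nul)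
    note hom = \<beta>(1)[of k] \<beta>(1)[of "k + 1"] D(9)[of k] D'(9)[of k] D(4)[of "k - 1"] D'(4)[of "k - 1"]
      D(4)[of k] D'(4)[of k] g
    have O: "tw_ge P k \<in> Obj C" "tw_ge P' k \<in> Obj C" "tw_ge P (k + 1) \<in> Obj C" "tw_ge P' (k + 1) \<in> Obj C" "X \<in> Obj C" "X' \<in> Obj C"
      using D(6) D'(6) Wge_Obj Hom_Obj[OF g] by auto
    let ?d = "(\<beta> k \<cdot> tw_v P k) \<boxplus> neg C (tw_v P' k \<cdot> ShM C (- 1) (\<beta> (k + 1)))"
    have "tw_e P' (k - 1) \<cdot> (\<beta> k \<cdot> tw_v P k) = ShM C k g \<cdot> (tw_e P (k - 1) \<cdot> tw_v P k)"
      using \<beta>(2)[of k, THEN pull, of "tw_v P k"] hom O by (simp add: in_Hom)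
    also have "\<dots> = ShM C (- 1) (ShM C (k + 1) g \<cdot> tw_e P k)"
      unfolding D(10) using hom O by (simp add: in_Hom ShM_Cmp)
    also have "\<dots> = ShM C (- 1) (tw_e P' k \<cdot> \<beta> (k + 1))"
      using \<beta>(2)[of "k + 1"] by simp
    also have "\<dots> = tw_e P' (k - 1) \<cdot> (tw_v P' k \<cdot> ShM C (- 1) (\<beta> (k + 1)))"
      using D'(10)[of k, THEN pull, of "ShM C (- 1) (\<beta> (k + 1))"] hom O by (simp add: in_Hom ShM_Cmp)
    finally have "tw_e P' (k - 1) \<cdot> ?d = Nul C (ShO C (- 1) (tw_ge P (k + 1))) (ShO C k X')"
      using hom O by (simp add: in_Hom Cmp_Pls)
    moreover have d: "?d \<in> Hom C (ShO C (- 1) (tw_ge P (k + 1))) (tw_ge P' k)"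
      using hom O by (simp add: in_Hom)
    ultimately have "?d = Nul C (ShO C (- 1) (tw_ge P (k + 1))) (tw_ge P' k)"
      using weight_decomposition_mono[OF D'(1)[of "k - 1"] _ D(6)[of "k + 1"], of ?d] D'(3)[of "k - 1"] O
      by (simp add: in_Hom)
    then show "?d = Nul C (Src C (\<beta> k \<cdot> tw_v P k)) (Tgt C (\<beta> k \<cdot> tw_v P k))"
      using hom O by (simp add: in_Hom)
  qed (use \<beta>(1)[of k] \<beta>(1)[of "k + 1"] D(9)[of k] D'(9)[of k] D(6) Wge_Obj in \<open>auto simp: in_Hom\<close>)
  have "\<exists>c. c \<in> Hom C (tw_gr P k) (tw_gr P' k) \<and> c \<cdot> tw_y P k = tw_y P' k \<cdot> \<beta> k \<and>
      ShM C (- 1) (\<beta> (k + 1)) \<cdot> tw_x C P k = tw_x C P' k \<cdot> ShM C (- 1) c" for k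
  proof -
    note hom = \<beta>(1)[of k] \<beta>(1)[of "k + 1"] D(9)[of k] D'(9)[of k] D(13)[of k] D'(13)[of k] D(16)[of k] D'(16)[of k]
    have O: "tw_ge P (k + 1) \<in> Obj C" "tw_ge P' (k + 1) \<in> Obj C" "tw_gr P k \<in> Obj C" "tw_gr P' k \<in> Obj C"
      using D(6,7) D'(6,7) Wge_Obj Wle_Obj by auto
    \<comment> \<open>\<open>TR3\<close> supplies the map at the third vertex, so the triangles are
      rotated to make that vertex \<open>tw_gr\<close>. The sign on the rotated \<open>tw_x\<close>
      cancels, and a shift by \<open>-1\<close> restores the required square.\<close>
    have "\<exists>c \<in> Hom C (Src C (neg C (ShM C 1 (tw_x C P k)))) (Src C (neg C (ShM C 1 (tw_x C P' k)))).
        c \<cdot> tw_y P k = tw_y P' k \<cdot> \<beta> k \<and>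
        ShM C 1 (ShM C (- 1) (\<beta> (k + 1))) \<cdot> neg C (ShM C 1 (tw_x C P k)) = neg C (ShM C 1 (tw_x C P' k)) \<cdot> c"
      by (rule TR3[OF Dist_rotate[OF D(14)] Dist_rotate[OF D'(14)]]) (use \<beta>v[of k] hom O in \<open>auto simp: in_Hom\<close>)
    then obtain c where c: "c \<in> Hom C (tw_gr P k) (tw_gr P' k)" "c \<cdot> tw_y P k = tw_y P' k \<cdot> \<beta> k"
        "neg C (\<beta> (k + 1) \<cdot> ShM C 1 (tw_x C P k)) = neg C (ShM C 1 (tw_x C P' k) \<cdot> c)"
      using hom O by (auto simp: in_Hom)
    from arg_cong[OF c(3), of "neg C"] have "\<beta> (k + 1) \<cdot> ShM C 1 (tw_x C P k) = ShM C 1 (tw_x C P' k) \<cdot> c"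
      using c(1) hom O by (simp add: in_Hom)
    from arg_cong[OF this, of "ShM C (- 1)"] show ?thesis
      using c(1,2) hom O by (intro exI[of _ c]) (simp add: in_Hom ShM_Cmp)
  qed
  then obtain \<alpha> where \<alpha>: "\<And>k. \<alpha> k \<in> Hom C (tw_gr P k) (tw_gr P' k)" "\<And>k. \<alpha> k \<cdot> tw_y P k = tw_y P' k \<cdot> \<beta> k"
      "\<And>k. ShM C (- 1) (\<beta> (k + 1)) \<cdot> tw_x C P k = tw_x C P' k \<cdot> ShM C (- 1) (\<alpha> k)" by metis
  have "tower_extension C P P' g \<beta> \<alpha>"
    unfolding tower_extension_def using \<alpha> \<beta> \<beta>v by blast
  then show ?thesis by blast
qed

lemma tower_extension_Idn:
  assumes P: "weight_tower C w X P" and X: "X \<in> Obj C"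
  shows "tower_extension C P P (Idn C X) (\<lambda>k. Idn C (tw_ge P k)) (\<lambda>k. Idn C (tw_gr P k))"
  unfolding tower_extension_def
proof (intro allI)
  fix k
  note D = weight_towerD[OF P X]
  have O: "tw_ge P k \<in> Obj C" "tw_ge P (k + 1) \<in> Obj C" "tw_gr P k \<in> Obj C"
    using D(6,7) Wge_Obj Wle_Obj by auto
  show "Idn C (tw_ge P k) \<in> Hom C (tw_ge P k) (tw_ge P k) \<and>
     Idn C (tw_gr P k) \<in> Hom C (tw_gr P k) (tw_gr P k) \<and>
     tw_e P (k - 1) \<cdot> Idn C (tw_ge P k) = ShM C k (Idn C X) \<cdot> tw_e P (k - 1) \<and>
     ShM C (- 1) (Idn C (tw_ge P (k + 1))) \<cdot> tw_x C P k = tw_x C P k \<cdot> ShM C (- 1) (Idn C (tw_gr P k)) \<and>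
     Idn C (tw_ge P k) \<cdot> tw_v P k = tw_v P k \<cdot> ShM C (- 1) (Idn C (tw_ge P (k + 1))) \<and>
     Idn C (tw_gr P k) \<cdot> tw_y P k = tw_y P k \<cdot> Idn C (tw_ge P k)"
    using D(4)[of "k - 1"] D(9,13,16)[of k] O X by (simp add: in_Hom)
qed

lemma tower_extension_Cmp:
  assumes P: "weight_tower C w X P" and P': "weight_tower C w X' P'" and P'': "weight_tower C w X'' P''"
    and g: "g \<in> Hom C X X'" and h: "h \<in> Hom C X' X''"
    and E: "tower_extension C P P' g \<beta> \<alpha>" and E': "tower_extension C P' P'' h \<beta>' \<alpha>'"
  shows "tower_extension C P P'' (h \<cdot> g) (\<lambda>k. \<beta>' k \<cdot> \<beta> k) (\<lambda>k. \<alpha>' k \<cdot> \<alpha> k)"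
  unfolding tower_extension_def
proof (intro allI)
  fix k
  note D = weight_towerD[OF P Hom_Obj(1)[OF g]] and D' = weight_towerD[OF P' Hom_Obj(2)[OF g]]
    and D'' = weight_towerD[OF P'' Hom_Obj(2)[OF h]]
  have E: "\<beta> k \<in> Hom C (tw_ge P k) (tw_ge P' k)" "\<alpha> k \<in> Hom C (tw_gr P k) (tw_gr P' k)"
     "tw_e P' (k - 1) \<cdot> \<beta> k = ShM C k g \<cdot> tw_e P (k - 1)"
     "ShM C (- 1) (\<beta> (k + 1)) \<cdot> tw_x C P k = tw_x C P' k \<cdot> ShM C (- 1) (\<alpha> k)"
     "\<beta> k \<cdot> tw_v P k = tw_v P' k \<cdot> ShM C (- 1) (\<beta> (k + 1))"
     "\<alpha> k \<cdot> tw_y P k = tw_y P' k \<cdot> \<beta> k" for k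
    using E unfolding tower_extension_def by blast+
  have E': "\<beta>' k \<in> Hom C (tw_ge P' k) (tw_ge P'' k)" "\<alpha>' k \<in> Hom C (tw_gr P' k) (tw_gr P'' k)"
     "tw_e P'' (k - 1) \<cdot> \<beta>' k = ShM C k h \<cdot> tw_e P' (k - 1)"
     "ShM C (- 1) (\<beta>' (k + 1)) \<cdot> tw_x C P' k = tw_x C P'' k \<cdot> ShM C (- 1) (\<alpha>' k)"
     "\<beta>' k \<cdot> tw_v P' k = tw_v P'' k \<cdot> ShM C (- 1) (\<beta>' (k + 1))"
     "\<alpha>' k \<cdot> tw_y P' k = tw_y P'' k \<cdot> \<beta>' k" for k
    using E' unfolding tower_extension_def by blast+
  have O: "tw_ge P k \<in> Obj C" "tw_ge P (k + 1) \<in> Obj C" "tw_gr P k \<in> Obj C"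
    "tw_ge P' k \<in> Obj C" "tw_ge P' (k + 1) \<in> Obj C" "tw_gr P' k \<in> Obj C"
    "tw_ge P'' k \<in> Obj C" "tw_ge P'' (k + 1) \<in> Obj C" "tw_gr P'' k \<in> Obj C" "X \<in> Obj C" "X' \<in> Obj C" "X'' \<in> Obj C"
    using D(6,7) D'(6,7) D''(6,7) Wge_Obj Wle_Obj Hom_Obj[OF g] Hom_Obj[OF h] by auto
  note hom = E(1,2)[of k] E'(1,2)[of k] E(1)[of "k + 1"] E'(1)[of "k + 1"] g h
    D(4)[of "k - 1"] D(9,13,16)[of k] D'(4)[of "k - 1"] D'(9,13,16)[of k] D''(4)[of "k - 1"] D''(9,13,16)[of k]
  show "\<beta>' k \<cdot> \<beta> k \<in> Hom C (tw_ge P k) (tw_ge P'' k) \<and>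
     \<alpha>' k \<cdot> \<alpha> k \<in> Hom C (tw_gr P k) (tw_gr P'' k) \<and>
     tw_e P'' (k - 1) \<cdot> (\<beta>' k \<cdot> \<beta> k) = ShM C k (h \<cdot> g) \<cdot> tw_e P (k - 1) \<and>
     ShM C (- 1) (\<beta>' (k + 1) \<cdot> \<beta> (k + 1)) \<cdot> tw_x C P k = tw_x C P'' k \<cdot> ShM C (- 1) (\<alpha>' k \<cdot> \<alpha> k) \<and>
     (\<beta>' k \<cdot> \<beta> k) \<cdot> tw_v P k = tw_v P'' k \<cdot> ShM C (- 1) (\<beta>' (k + 1) \<cdot> \<beta> (k + 1)) \<and>
     (\<alpha>' k \<cdot> \<alpha> k) \<cdot> tw_y P k = tw_y P'' k \<cdot> (\<beta>' k \<cdot> \<beta> k)"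
  proof (intro conjI)
    show "tw_e P'' (k - 1) \<cdot> (\<beta>' k \<cdot> \<beta> k) = ShM C k (h \<cdot> g) \<cdot> tw_e P (k - 1)"
      using E'(3)[of k, THEN pull, of "\<beta> k"] E(3)[of k] hom O by (simp add: in_Hom ShM_Cmp)
    show "ShM C (- 1) (\<beta>' (k + 1) \<cdot> \<beta> (k + 1)) \<cdot> tw_x C P k = tw_x C P'' k \<cdot> ShM C (- 1) (\<alpha>' k \<cdot> \<alpha> k)"
      using E'(4)[of k, THEN pull, of "ShM C (- 1) (\<alpha> k)"] E(4)[of k] hom O by (simp add: in_Hom ShM_Cmp)
    show "(\<beta>' k \<cdot> \<beta> k) \<cdot> tw_v P k = tw_v P'' k \<cdot> ShM C (- 1) (\<beta>' (k + 1) \<cdot> \<beta> (k + 1))"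
      using E'(5)[of k, THEN pull, of "ShM C (- 1) (\<beta> (k + 1))"] E(5)[of k] hom O by (simp add: in_Hom ShM_Cmp)
    show "(\<alpha>' k \<cdot> \<alpha> k) \<cdot> tw_y P k = tw_y P'' k \<cdot> (\<beta>' k \<cdot> \<beta> k)"
      using E'(6)[of k, THEN pull, of "\<beta> k"] E(6)[of k] hom O by (simp add: in_Hom)
  qed (use hom in \<open>auto simp: in_Hom\<close>)
qed

text \<open>The difference of the \<open>\<beta>\<close> is killed by \<open>tw_e P'\<close>, hence
  factors through \<open>tw_gr P' (k - 1)\<close>, and orthogonality pushes the factor down to
  \<open>tw_gr P k\<close>: this is \<open>t\<close>. What remains of the difference of the
  \<open>\<alpha>\<close> kills \<open>tw_y P k\<close> and in the same way factors through
  \<open>tw_gr P (k + 1)\<close>: this is \<open>s\<close>. The two are found separately, so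
  \<open>s\<close> at \<open>k\<close> and \<open>t\<close> at \<open>k + 1\<close> are not claimed
  to agree.\<close>

lemma tower_extension_homotopy:
  assumes P: "weight_tower C w X P" and P': "weight_tower C w X' P'" and g: "g \<in> Hom C X X'"
    and E: "tower_extension C P P' g \<beta> \<alpha>" and E': "tower_extension C P P' g \<beta>' \<alpha>'"
  shows "\<exists>t s. t \<in> Hom C (tw_gr P k) (tw_gr P' (k - 1)) \<and> s \<in> Hom C (tw_gr P (k + 1)) (tw_gr P' k) \<and>
    \<alpha> k = \<alpha>' k \<boxplus> ((tw_h C P' (k - 1) \<cdot> t) \<boxplus> (s \<cdot> tw_h C P k))"
proof -
  note D = weight_towerD[OF P Hom_Obj(1)[OF g]] and D' = weight_towerD[OF P' Hom_Obj(2)[OF g]]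
  have E: "\<beta> k \<in> Hom C (tw_ge P k) (tw_ge P' k)" "\<alpha> k \<in> Hom C (tw_gr P k) (tw_gr P' k)"
     "tw_e P' (k - 1) \<cdot> \<beta> k = ShM C k g \<cdot> tw_e P (k - 1)"
     "\<alpha> k \<cdot> tw_y P k = tw_y P' k \<cdot> \<beta> k" for k
    using E unfolding tower_extension_def by blast+
  have E': "\<beta>' k \<in> Hom C (tw_ge P k) (tw_ge P' k)" "\<alpha>' k \<in> Hom C (tw_gr P k) (tw_gr P' k)"
     "tw_e P' (k - 1) \<cdot> \<beta>' k = ShM C k g \<cdot> tw_e P (k - 1)"
     "\<alpha>' k \<cdot> tw_y P k = tw_y P' k \<cdot> \<beta>' k" for k
    using E' unfolding tower_extension_def by blast+
  have O: "tw_ge P k \<in> Obj C" "tw_gr P k \<in> Obj C" "tw_le P k \<in> Obj C"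
    "tw_ge P' k \<in> Obj C" "tw_gr P' k \<in> Obj C" "tw_le P' k \<in> Obj C" "X \<in> Obj C" "X' \<in> Obj C" for k
    using D(5,6,7) D'(5,6,7) Wge_Obj Wle_Obj Hom_Obj[OF g] by auto
  have idx: "k - 1 + 1 = k" by simp
  define \<delta> where "\<delta> = \<beta> k \<boxplus> neg C (\<beta>' k)"
  define \<gamma> where "\<gamma> = \<alpha> k \<boxplus> neg C (\<alpha>' k)"
  have \<delta>: "\<delta> \<in> Hom C (tw_ge P k) (tw_ge P' k)"
    using E(1)[of k] E'(1)[of k] unfolding \<delta>_def by (simp add: in_Hom)
  have \<gamma>: "\<gamma> \<in> Hom C (tw_gr P k) (tw_gr P' k)"
    using E(2)[of k] E'(2)[of k] unfolding \<gamma>_def by (simp add: in_Hom)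
  have e\<delta>: "tw_e P' (k - 1) \<cdot> \<delta> = Nul C (tw_ge P k) (ShO C k X')"
    using E(1,3)[of k] E'(1,3)[of k] D(4)[of "k - 1"] D'(4)[of "k - 1"] g O
    unfolding \<delta>_def by (simp add: in_Hom Cmp_Pls)
  have \<gamma>y: "\<gamma> \<cdot> tw_y P k = tw_y P' k \<cdot> \<delta>"
    using E(1,2,4)[of k] E'(1,2,4)[of k] D(13)[of k] D'(13)[of k]
    unfolding \<delta>_def \<gamma>_def by (simp add: in_Hom Cmp_Pls)
  \<comment> \<open>Uniqueness of lifts one level down: \<open>tw_e P' (k - 2)\<close> detects this
    map, and after it the map becomes the shift of \<open>tw_e P' (k - 1) \<cdot> \<delta>\<close>,
    which is zero.\<close>
  have v\<delta>: "tw_v P' (k - 1) \<cdot> ShM C (- 1) \<delta> = Nul C (ShO C (- 1) (tw_ge P k)) (tw_ge P' (k - 1))"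
  proof -
    note hom = D'(9)[of "k - 1", unfolded idx] \<delta> D'(4)[of "k - 1"] D'(4)[of "k - 1 - 1"] D'(3)[of "k - 1 - 1"]
    have "tw_e P' (k - 1 - 1) \<cdot> (tw_v P' (k - 1) \<cdot> ShM C (- 1) \<delta>) = ShM C (- 1) (tw_e P' (k - 1) \<cdot> \<delta>)"
      using D'(10)[of "k - 1", THEN pull, of "ShM C (- 1) \<delta>"] hom O by (simp add: in_Hom ShM_Cmp)
    also have "\<dots> = Nul C (ShO C (- 1) (tw_ge P k)) (ShO C (k - 1) X')"
      unfolding e\<delta> using O by simp
    finally show ?thesis
      using weight_decomposition_mono[OF D'(1)[of "k - 1 - 1"] _ D(6)[of k], of "tw_v P' (k - 1) \<cdot> ShM C (- 1) \<delta>"] hom O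
      by (simp add: in_Hom)
  qed
  note x' = D'(16)[of "k - 1", unfolded idx] and v' = D'(9)[of "k - 1", unfolded idx]
  obtain \<tau> where \<tau>: "\<tau> \<in> Arr C" "Src C \<tau> = Src C (ShM C (- 1) \<delta>)" "Tgt C \<tau> = Src C (tw_x C P' (k - 1))"
      "tw_x C P' (k - 1) \<cdot> \<tau> = ShM C (- 1) \<delta>"
    by (rule Dist_lift[OF D'(14)[of "k - 1"], of "ShM C (- 1) \<delta>"]) (use \<delta> v\<delta> v' O in \<open>auto simp: in_Hom\<close>)
  define \<sigma> where "\<sigma> = ShM C 1 \<tau>"
  have \<sigma>: "\<sigma> \<in> Hom C (tw_ge P k) (tw_gr P' (k - 1))"
    using \<tau>(1-3) \<delta> x' O unfolding \<sigma>_def by (simp add: in_Hom)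
  have x\<sigma>: "(tw_f P' (k - 1) \<cdot> tw_d P' (k - 1)) \<cdot> \<sigma> = \<delta>"
    using arg_cong[OF \<tau>(4), of "ShM C 1"] \<tau>(1-3) \<delta> x' O unfolding \<sigma>_def D'(17)[symmetric]
    by (simp add: in_Hom ShM_Cmp)
  \<comment> \<open>Here, and again for \<open>neg C r\<close>, the graded piece of
    \<open>P'\<close> serves as an object of \<open>Wle w\<close>, while the source is an object of
    \<open>Wge w\<close> shifted by \<open>-1\<close>.\<close>
  have "\<sigma> \<cdot> tw_v P k = Nul C (ShO C (- 1) (tw_ge P (k + 1))) (tw_gr P' (k - 1))"
    by (rule orthogonal_neg1[OF _ D(6) D'(7)]) (use \<sigma> D(9)[of k] in \<open>auto simp: in_Hom\<close>)
  then have "\<sigma> \<cdot> tw_v P k = Nul C (Src C (tw_v P k)) (Tgt C \<sigma>)" using \<sigma> D(9)[of k] by (simp add: in_Hom)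
  then obtain t where t: "t \<in> Arr C" "Src C t = Tgt C (tw_y P k)" "Tgt C t = Tgt C \<sigma>" "t \<cdot> tw_y P k = \<sigma>"
    by (rule Dist_desc[OF Dist_rotate[OF D(14)[of k]], rotated 2]) (use \<sigma> D(9,13)[of k] in \<open>auto simp: in_Hom\<close>)
  have tH: "t \<in> Hom C (tw_gr P k) (tw_gr P' (k - 1))" using t \<sigma> D(13)[of k] by (simp add: in_Hom)
  note homs = D(3,12,13)[of k] D(13)[of "k + 1"] D(18)[of k] D'(3,12)[of "k - 1", unfolded idx] D'(13)[of k]
     D'(18)[of "k - 1", unfolded idx] tH \<sigma> \<gamma> \<delta>
  have "(tw_h C P' (k - 1) \<cdot> t) \<cdot> tw_y P k = tw_h C P' (k - 1) \<cdot> \<sigma>"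
    using t(4) homs by (simp add: in_Hom)
  also have "\<dots> = tw_y P' k \<cdot> ((tw_f P' (k - 1) \<cdot> tw_d P' (k - 1)) \<cdot> \<sigma>)"
    unfolding D'(19) idx using homs by (simp add: in_Hom)
  finally have hty: "(tw_h C P' (k - 1) \<cdot> t) \<cdot> tw_y P k = tw_y P' k \<cdot> \<delta>" unfolding x\<sigma> .
  \<comment> \<open>The part of \<open>\<gamma>\<close> not accounted for by \<open>t\<close>. It
    vanishes on \<open>tw_y P k\<close>, so it descends along the rotated triangle to a map
    \<open>r\<close> on \<open>tw_ge P (k + 1)\<close>; the sign from rotating is the reason why
    \<open>s\<close> is taken from \<open>neg C r\<close>.\<close>
  define \<rho> where "\<rho> = \<gamma> \<boxplus> neg C (tw_h C P' (k - 1) \<cdot> t)"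
  have \<rho>: "\<rho> \<in> Hom C (tw_gr P k) (tw_gr P' k)" using homs unfolding \<rho>_def by (simp add: in_Hom)
  have "\<rho> \<cdot> tw_y P k = (\<gamma> \<cdot> tw_y P k) \<boxplus> neg C ((tw_h C P' (k - 1) \<cdot> t) \<cdot> tw_y P k)"
    using homs unfolding \<rho>_def by (simp add: in_Hom Cmp_Pls)
  also have "\<dots> = Nul C (tw_ge P k) (tw_gr P' k)"
    unfolding hty \<gamma>y using homs by (simp add: in_Hom)
  finally have \<rho>y: "\<rho> \<cdot> tw_y P k = Nul C (tw_ge P k) (tw_gr P' k)" .
  have rot: "(tw_y P k, neg C (ShM C 1 (tw_x C P k)), neg C (ShM C 1 (tw_v P k))) \<in> Dist C"
    using Dist_rotate[OF Dist_rotate[OF D(14)]] .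
  note x = D(16)[of k]
  obtain r where r: "r \<in> Arr C" "Src C r = Tgt C (neg C (ShM C 1 (tw_x C P k)))" "Tgt C r = Tgt C \<rho>"
      "r \<cdot> neg C (ShM C 1 (tw_x C P k)) = \<rho>"
    by (rule Dist_desc[OF rot, of \<rho>]) (use \<rho> \<rho>y homs in \<open>auto simp: in_Hom\<close>)
  have rT: "Src C r = tw_ge P (k + 1)" "Tgt C r = tw_gr P' k" using r(1-3) x \<rho> O by (auto simp: in_Hom)
  have rv: "neg C r \<cdot> tw_v P (k + 1) = Nul C (ShO C (- 1) (tw_ge P (k + 1 + 1))) (tw_gr P' k)"
    by (rule orthogonal_neg1[OF _ D(6) D'(7)]) (use r(1) rT D(9)[of "k + 1"] in \<open>auto simp: in_Hom\<close>)
  obtain s where s: "s \<in> Arr C" "Src C s = Tgt C (tw_y P (k + 1))" "Tgt C s = Tgt C (neg C r)" "s \<cdot> tw_y P (k + 1) = neg C r"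
    by (rule Dist_desc[OF Dist_rotate[OF D(14)[of "k + 1"]], of "neg C r"]) (use r(1) rT rv D(9,13)[of "k + 1"] in \<open>auto simp: in_Hom\<close>)
  have sH: "s \<in> Hom C (tw_gr P (k + 1)) (tw_gr P' k)" using s r(1) rT homs by (simp add: in_Hom)
  have "s \<cdot> tw_h C P k = neg C r \<cdot> (tw_f P k \<cdot> tw_d P k)"
    unfolding D(19) using s(4)[THEN pull, of "tw_f P k \<cdot> tw_d P k"] sH homs by (simp add: in_Hom)
  also have "\<dots> = \<rho>"
    using r(4) r(1) rT x O unfolding D(17)[symmetric] by (simp add: in_Hom)
  finally have sh: "s \<cdot> tw_h C P k = \<rho>" .
  have "\<gamma> = (tw_h C P' (k - 1) \<cdot> t) \<boxplus> \<rho>"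
    using homs Pls_comm[of "tw_h C P' (k - 1) \<cdot> t" \<rho>] \<rho> unfolding \<rho>_def by (simp add: in_Hom Pls_assoc)
  moreover have "\<alpha> k = \<alpha>' k \<boxplus> \<gamma>"
    using E(2)[of k] E'(2)[of k] Pls_comm[of "\<alpha>' k" \<gamma>] \<gamma> unfolding \<gamma>_def by (simp add: in_Hom Pls_assoc)
  ultimately show ?thesis using tH sH sh by (intro exI[of _ t] exI[of _ s]) simp
qed

end

section \<open>Weight spectral sequences\<close>

text \<open>Maps that factor through each other on the source side are killed by the same maps,
  hence share a cokernel and so an image.\<close>

lemma (in abelian_category) is_image_cong:
  assumes m: "is_image C f m" and f': "f' = f \<cdot> b" "b \<in> Arr C" "Tgt C b = Src C f"
    and f: "f = f' \<cdot> a" "a \<in> Arr C" "Tgt C a = Src C f'"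
  shows "is_image C f' m"
proof -
  obtain c where c: "is_cokernel C f c" "is_kernel C c m" using m unfolding is_image_def by blast
  note cs = cokernel_simps[OF c(1)]
  have ty: "f' \<in> Arr C" "Src C f' = Src C b" "Tgt C f' = Tgt C f" "Src C a = Src C f"
    using f' cs(1) f by (metis Cmp_simps)+
  have "is_cokernel C f' c"
  proof (rule cokernelI)
    have "c \<cdot> (f \<cdot> b) = Nul C (Src C b) (Tgt C c)"
      using cs(4)[THEN pull, of b] cs(1-3) f'(2,3) by simp
    then show "c \<cdot> f' = Nul C (Src C f') (Tgt C c)" unfolding f'(1) using ty f'(1) cs(1) f'(2,3) by simp
  next
    fix x assume x: "x \<in> Arr C" "Src C x = Tgt C f'" "x \<cdot> f' = Nul C (Src C f') (Tgt C x)"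
    have "x \<cdot> (f' \<cdot> a) = Nul C (Src C a) (Tgt C x)"
      using x(3)[THEN pull, of a] x(1,2) ty(1) f(2,3) by simp
    then have "x \<cdot> f = Nul C (Src C f) (Tgt C x)" using f(1) ty(4) by simp
    then show "\<exists>u. u \<in> Arr C \<and> Src C u = Tgt C c \<and> Tgt C u = Tgt C x \<and> u \<cdot> c = x"
      using cokernel_desc[OF c(1), of x] x(1,2) ty(3) by metis
  qed (use cs ty cokernel_epic[OF c(1)] in auto)
  then show ?thesis using c(2) unfolding is_image_def by blast
qed

locale weighted_homology =
  C: weighted_category C w + A: abelian_category A + H: homological_functor C A H
  for C :: "('o, 'm, 'y) tricat_scheme" (structure) and w :: "'o weights"
    and A :: "('p, 'n, 'z) precat_scheme" and H :: "('o, 'm, 'p, 'n) functr"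
begin

lemma FO_Obj [simp]: "X \<in> Obj C \<Longrightarrow> FO H X \<in> Obj A"
  by (rule H.FO_Obj)

lemma FM_simps [simp]:
  assumes "f \<in> Arr C"
  shows "FM H f \<in> Arr A" "Src A (FM H f) = FO H (Src C f)" "Tgt A (FM H f) = FO H (Tgt C f)"
  using H.FM_Hom[of f "Src C f" "Tgt C f"] assms by (auto simp: A.in_Hom C.in_Hom)

lemma FM_Hom':
  assumes "f \<in> Hom C X Y"
  shows "FM H (ShM C n f) \<in> Hom A (FO H (ShO C n X)) (FO H (ShO C n Y))"
  using assms by (simp add: A.in_Hom C.in_Hom)

lemma FM_Cmp':
  assumes "f \<in> Arr C" "g \<in> Arr C" "Tgt C f = Src C g"
  shows "FM H (g \<cdot> f) = FM H g \<cdot>\<^bsub>A\<^esub> FM H f"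
  using H.FM_Cmp[of f "Src C f" "Src C g" g "Tgt C g"] assms by (simp add: C.in_Hom)

lemma FM_Pls':
  assumes "f \<in> Arr C" "g \<in> Arr C" "Src C g = Src C f" "Tgt C g = Tgt C f"
  shows "FM H (f \<boxplus> g) = FM H f \<boxplus>\<^bsub>A\<^esub> FM H g"
  using H.FM_Pls[of f "Src C f" "Tgt C f" g] assms by (simp add: C.in_Hom)

lemma FM_Nul [simp]: "X \<in> Obj C \<Longrightarrow> Y \<in> Obj C \<Longrightarrow> FM H (Nul C X Y) = Nul A (FO H X) (FO H Y)"
  by (rule additive_functor_Nul)
    (use C.additive_category_axioms A.additive_category_axioms H.additive_functor_axioms in auto)

lemma weight_couple_simps [simp]:
  "cD (weight_couple C H P) p q = FO H (ShO C q (tw_ge P p))"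
  "cE (weight_couple C H P) p q = FO H (ShO C q (tw_gr P p))"
  "ci (weight_couple C H P) p q = FM H (ShM C (q + 1) (tw_v P (p - 1)))"
  "cj (weight_couple C H P) p q = FM H (ShM C q (tw_y P p))"
  "ck (weight_couple C H P) p q = FM H (ShM C (q + 1) (tw_x C P p))"
  by (simp_all add: weight_couple_def)

lemma tower_Obj:
  assumes "weight_tower C w X P" "X \<in> Obj C"
  shows "tw_ge P k \<in> Obj C" "tw_gr P k \<in> Obj C" "tw_le P k \<in> Obj C"
  using C.weight_towerD(5-7)[OF assms] C.Wge_Obj C.Wle_Obj by auto

lemma exact_weight_couple:
  assumes P: "weight_tower C w X P" and X: "X \<in> Obj C"
  shows "exact_couple A 1 (weight_couple C H P)"
  unfolding exact_couple_def
proof (intro allI conjI)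
  fix p q
  note D = C.weight_towerD[OF P X] and O = tower_Obj[OF P X]
  note L = H.long_exact[OF D(14)]
  let ?K = "weight_couple C H P"
  show "cD ?K p q \<in> Obj A" "cE ?K p q \<in> Obj A" using O by simp_all
  show "ci ?K p q \<in> Hom A (cD ?K p q) (cD ?K (p - 1) (q + 1))"
    using D(9)[of "p - 1"] O by (simp add: C.in_Hom A.in_Hom)
  show "cj ?K p q \<in> Hom A (cD ?K p q) (cE ?K (p + int 1 - 1) (q - int 1 + 1))"
    using D(13)[of p] by (simp add: C.in_Hom A.in_Hom)
  show "ck ?K p q \<in> Hom A (cE ?K p q) (cD ?K (p + 1) q)"
    using D(16)[of p] O by (simp add: C.in_Hom A.in_Hom)
  show "exact_at A (ck ?K (p - 1) q) (ci ?K p q)"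
    using L[of "q + 1" "p - 1"] by simp
  show "exact_at A (ci ?K (p + 1) (q - 1)) (cj ?K p q)"
    using L[of q p] by simp
  show "exact_at A (cj ?K (p - int 1 + 1) (q + int 1 - 1)) (ck ?K p q)"
    using L[of q p] by simp
qed

text \<open>The composite of \<open>k\<close> and \<open>j\<close> is \<open>H\<close> applied to
  \<open>tw_x\<close> shifted by \<open>1\<close> followed by \<open>tw_y\<close>. The shifted
  \<open>tw_x\<close> is \<open>tw_f \<cdot> tw_d\<close>, and \<open>tw_y\<close> after
  \<open>tw_f\<close> is \<open>tw_c\<close>, which leaves the boundary of the weight
  complex.\<close>

lemma weight_couple_diff:
  assumes P: "weight_tower C w X P" and X: "X \<in> Obj C"
  shows "couple_diff A (weight_couple C H P) p q = FM H (ShM C q (tw_h C P p))"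
proof -
  note D = C.weight_towerD[OF P X] and O = tower_Obj[OF P X]
  have "ShM C (q + 1) (tw_x C P p) = ShM C q (tw_f P p \<cdot> tw_d P p)"
    using D(16)[of p] unfolding D(17)[symmetric] by (simp add: C.in_Hom)
  then show ?thesis
    using D(3,12)[of p] D(13)[of "p + 1"] unfolding D(19) couple_diff_def
    by (simp add: C.in_Hom C.ShM_Cmp FM_Cmp')
qed

lemma weight_ss_simps:
  assumes P: "weight_tower C w X P" and X: "X \<in> Obj C" and T: "weight_ss C A H P T"
  shows "sE T 1 p q = FO H (ShO C q (tw_gr P p))" "sd T 1 p q = FM H (ShM C q (tw_h C P p))"
proof -
  obtain Ks where "Ks 1 = weight_couple C H P" "\<And>r p q. r \<ge> 1 \<Longrightarrow> sE T r p q = cE (Ks r) p q \<and> sd T r p q = couple_diff A (Ks r) p q"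
    using T unfolding weight_ss_def comes_from_couple_def by metis
  then show "sE T 1 p q = FO H (ShO C q (tw_gr P p))" "sd T 1 p q = FM H (ShM C q (tw_h C P p))"
    using weight_couple_diff[OF P X] by auto
qed

lemma ex_weight_ss:
  assumes P: "weight_tower C w X P" and X: "X \<in> Obj C"
  shows "\<exists>T. weight_ss C A H P T"
  using A.ex_spectral_sequence[OF exact_weight_couple[OF P X]] unfolding weight_ss_def by blast

lemma tower_extension_couple_morphism:
  assumes P: "weight_tower C w X P" and P': "weight_tower C w X' P'" and g: "g \<in> Hom C X X'"
    and E: "tower_extension C P P' g \<beta> \<alpha>"
  shows "couple_morphism A 1 (weight_couple C H P) (weight_couple C H P')
    (\<lambda>p q. FM H (ShM C q (\<beta> p))) (\<lambda>p q. FM H (ShM C q (\<alpha> p)))"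
  unfolding couple_morphism_def
proof (intro allI)
  fix p q
  have X: "X \<in> Obj C" "X' \<in> Obj C" using g C.Hom_Obj by auto
  note D = C.weight_towerD[OF P X(1)] and O = tower_Obj[OF P X(1)] and D' = C.weight_towerD[OF P' X(2)]
    and O' = tower_Obj[OF P' X(2)]
  have E: "\<beta> k \<in> Hom C (tw_ge P k) (tw_ge P' k)" "\<alpha> k \<in> Hom C (tw_gr P k) (tw_gr P' k)"
     "ShM C (- 1) (\<beta> (k + 1)) \<cdot> tw_x C P k = tw_x C P' k \<cdot> ShM C (- 1) (\<alpha> k)"
     "\<beta> k \<cdot> tw_v P k = tw_v P' k \<cdot> ShM C (- 1) (\<beta> (k + 1))"
     "\<alpha> k \<cdot> tw_y P k = tw_y P' k \<cdot> \<beta> k" for k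
    using E unfolding tower_extension_def by blast+
  have shift: "FM H (ShM C n a) \<cdot>\<^bsub>A\<^esub> FM H (ShM C n b) = FM H (ShM C n c) \<cdot>\<^bsub>A\<^esub> FM H (ShM C n d)"
    if "a \<cdot> b = c \<cdot> d" "a \<in> Arr C" "b \<in> Arr C" "c \<in> Arr C" "d \<in> Arr C" "Src C a = Tgt C b" "Src C c = Tgt C d"
    for a b c d n
  proof -
    have "FM H (ShM C n (a \<cdot> b)) = FM H (ShM C n (c \<cdot> d))" using that(1) by simp
    then show ?thesis using that(2-) by (simp add: C.ShM_Cmp FM_Cmp')
  qed
  note hom = E(1)[of p] E(1)[of "p - 1"] E(1)[of "p + 1"] E(2)[of p]
    D(9)[of "p - 1"] D'(9)[of "p - 1"] D(13,16)[of p] D'(13,16)[of p]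
  have "FM H (ShM C (q + 1) (\<beta> (p - 1))) \<cdot>\<^bsub>A\<^esub> FM H (ShM C (q + 1) (tw_v P (p - 1)))
      = FM H (ShM C (q + 1) (tw_v P' (p - 1))) \<cdot>\<^bsub>A\<^esub> FM H (ShM C (q + 1) (ShM C (- 1) (\<beta> p)))"
    by (rule shift) (use E(4)[of "p - 1"] hom O O' in \<open>auto simp: C.in_Hom\<close>)
  moreover have "FM H (ShM C q (\<alpha> p)) \<cdot>\<^bsub>A\<^esub> FM H (ShM C q (tw_y P p)) = FM H (ShM C q (tw_y P' p)) \<cdot>\<^bsub>A\<^esub> FM H (ShM C q (\<beta> p))"
    by (rule shift) (use E(5)[of p] hom O O' in \<open>auto simp: C.in_Hom\<close>)
  moreover have "FM H (ShM C (q + 1) (ShM C (- 1) (\<beta> (p + 1)))) \<cdot>\<^bsub>A\<^esub> FM H (ShM C (q + 1) (tw_x C P p)) =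
      FM H (ShM C (q + 1) (tw_x C P' p)) \<cdot>\<^bsub>A\<^esub> FM H (ShM C (q + 1) (ShM C (- 1) (\<alpha> p)))"
    by (rule shift) (use E(3)[of p] hom O O' in \<open>auto simp: C.in_Hom\<close>)
  ultimately show "FM H (ShM C q (\<beta> p)) \<in> Hom A (cD (weight_couple C H P) p q) (cD (weight_couple C H P') p q) \<and>
     FM H (ShM C q (\<alpha> p)) \<in> Hom A (cE (weight_couple C H P) p q) (cE (weight_couple C H P') p q) \<and>
     FM H (ShM C (q + 1) (\<beta> (p - 1))) \<cdot>\<^bsub>A\<^esub> ci (weight_couple C H P) p q =
     ci (weight_couple C H P') p q \<cdot>\<^bsub>A\<^esub> FM H (ShM C q (\<beta> p)) \<and>
     FM H (ShM C (q - int 1 + 1) (\<alpha> (p + int 1 - 1))) \<cdot>\<^bsub>A\<^esub> cj (weight_couple C H P) p q =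
     cj (weight_couple C H P') p q \<cdot>\<^bsub>A\<^esub> FM H (ShM C q (\<beta> p)) \<and>
     FM H (ShM C q (\<beta> (p + 1))) \<cdot>\<^bsub>A\<^esub> ck (weight_couple C H P) p q =
     ck (weight_couple C H P') p q \<cdot>\<^bsub>A\<^esub> FM H (ShM C q (\<alpha> p))"
    using hom by (simp add: C.in_Hom A.in_Hom)
qed

lemma tower_extension_ss_morphism:
  assumes P: "weight_tower C w X P" and P': "weight_tower C w X' P'" and g: "g \<in> Hom C X X'"
    and T: "weight_ss C A H P T" and T': "weight_ss C A H P' T'"
    and E: "tower_extension C P P' g \<beta> \<alpha>"
  obtains \<phi> where "ss_morphism A 1 T T' \<phi>" "\<phi> 1 = (\<lambda>p q. FM H (ShM C q (\<alpha> p)))"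
  using A.ex_ss_morphism[OF _ _ tower_extension_couple_morphism[OF P P' g E]] T T' unfolding weight_ss_def by blast

text \<open>One extension is enough: by the homotopy formula any other one alters the first page
  only by terms that homology does not see, so the same later pages continue it.\<close>

lemma induced_by_morphismI:
  assumes P: "weight_tower C w X P" and P': "weight_tower C w X' P'" and g: "g \<in> Hom C X X'"
    and T: "weight_ss C A H P T" and T': "weight_ss C A H P' T'"
    and E: "tower_extension C P P' g \<beta> \<alpha>" and \<phi>: "ss_morphism A 2 T T' \<phi>"
    and \<phi>1: "ss_morphism A 1 T T' (\<phi>(1 := \<lambda>p q. FM H (ShM C q (\<alpha> p))))"
  shows "induced_by_morphism C A H P P' T T' g \<phi>"
  unfolding induced_by_morphism_def
proof (intro conjI allI impI \<phi>)
  fix \<beta>' \<alpha>' assume E': "tower_extension C P P' g \<beta>' \<alpha>'"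
  have X: "X \<in> Obj C" "X' \<in> Obj C" using g C.Hom_Obj by auto
  note D = C.weight_towerD[OF P X(1)] and D' = C.weight_towerD[OF P' X(2)]
  note S = weight_ss_simps[OF P X(1) T] and S' = weight_ss_simps[OF P' X(2) T']
  have ss: "spectral_sequence A T" "spectral_sequence A T'" using T T' unfolding weight_ss_def by auto
  have "\<exists>t s. \<forall>k. t k \<in> Hom C (tw_gr P k) (tw_gr P' (k - 1)) \<and> s k \<in> Hom C (tw_gr P (k + 1)) (tw_gr P' k) \<and>
    \<alpha>' k = \<alpha> k \<boxplus> ((tw_h C P' (k - 1) \<cdot> t k) \<boxplus> (s k \<cdot> tw_h C P k))"
    using C.tower_extension_homotopy[OF P P' g E' E] by metis
  then obtain t s where t: "\<And>k. t k \<in> Hom C (tw_gr P k) (tw_gr P' (k - 1))"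
      and s: "\<And>k. s k \<in> Hom C (tw_gr P (k + 1)) (tw_gr P' k)"
      and eq: "\<And>k. \<alpha>' k = \<alpha> k \<boxplus> ((tw_h C P' (k - 1) \<cdot> t k) \<boxplus> (s k \<cdot> tw_h C P k))" by metis
  obtain \<psi> where \<psi>: "ss_morphism A 1 T T' \<psi>" "\<psi> 1 = (\<lambda>p q. FM H (ShM C q (\<alpha>' p)))"
    by (rule tower_extension_ss_morphism[OF P P' g T T' E'])
  let ?\<phi> = "\<phi>(1 := \<lambda>p q. FM H (ShM C q (\<alpha> p)))"
  have "ss_morphism A 1 T T' (?\<phi>(1 := \<lambda>p q. FM H (ShM C q (\<alpha>' p))))"
  proof (rule A.ss_morphism_homotopic[OF ss \<phi>1, where t = "\<lambda>p q. FM H (ShM C q (t p))" and s = "\<lambda>p q. FM H (ShM C q (s p))"])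
    fix p q
    show "FM H (ShM C q (\<alpha>' p)) \<in> Hom A (sE T 1 p q) (sE T' 1 p q)"
      using A.ss_morphismD(1)[OF \<psi>(1) order.refl, of p q] \<psi>(2) by simp
    show "FM H (ShM C q (\<alpha>' (p + 1))) \<cdot>\<^bsub>A\<^esub> sd T 1 p q = sd T' 1 p q \<cdot>\<^bsub>A\<^esub> FM H (ShM C q (\<alpha>' p))"
      using A.ss_morphismD(2)[OF \<psi>(1) order.refl, of p q] \<psi>(2) by simp
    show "FM H (ShM C q (t p)) \<in> Hom A (sE T 1 p q) (sE T' 1 (p - 1) q)"
      unfolding S S' by (rule FM_Hom'[OF t])
    show "FM H (ShM C q (s p)) \<in> Hom A (sE T 1 (p + 1) q) (sE T' 1 p q)"
      unfolding S S' by (rule FM_Hom'[OF s])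
    have \<alpha>: "\<alpha> p \<in> Hom C (tw_gr P p) (tw_gr P' p)" using E unfolding tower_extension_def by blast
    show "FM H (ShM C q (\<alpha>' p)) = ?\<phi> 1 p q \<boxplus>\<^bsub>A\<^esub> ((sd T' 1 (p - 1) q \<cdot>\<^bsub>A\<^esub> FM H (ShM C q (t p))) \<boxplus>\<^bsub>A\<^esub>
        (FM H (ShM C q (s p)) \<cdot>\<^bsub>A\<^esub> sd T 1 p q))"
      unfolding S S' using eq[of p] \<alpha> t[of p] s[of p] D(18)[of p] D'(18)[of "p - 1"]
      by (simp add: C.in_Hom C.ShM_Pls C.ShM_Cmp FM_Pls' FM_Cmp')
  qed
  then show "ss_morphism A 1 T T' (\<phi>(1 := \<lambda>p q. FM H (ShM C q (\<alpha>' p))))" by simp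
qed

lemma ex_induced_by_morphism:
  assumes P: "weight_tower C w X P" and P': "weight_tower C w X' P'" and g: "g \<in> Hom C X X'"
    and T: "weight_ss C A H P T" and T': "weight_ss C A H P' T'"
  shows "\<exists>\<phi>. induced_by_morphism C A H P P' T T' g \<phi>"
proof -
  obtain \<beta> \<alpha> where E: "tower_extension C P P' g \<beta> \<alpha>" using C.ex_tower_extension[OF P P' g] by blast
  obtain \<phi> where \<phi>: "ss_morphism A 1 T T' \<phi>" "\<phi> 1 = (\<lambda>p q. FM H (ShM C q (\<alpha> p)))"
    by (rule tower_extension_ss_morphism[OF P P' g T T' E])
  have "\<phi>(1 := \<lambda>p q. FM H (ShM C q (\<alpha> p))) = \<phi>" using \<phi>(2) by (simp add: fun_upd_idem)
  then have "induced_by_morphism C A H P P' T T' g \<phi>"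
    using induced_by_morphismI[OF P P' g T T' E, of \<phi>] A.ss_morphism_Suc[OF \<phi>(1)] \<phi>(1)
    by (simp add: numeral_2_eq_2)
  then show ?thesis by blast
qed

text \<open>Since an extension of \<open>g\<close> exists, both morphisms continue one and the same
  map on the first page, and that page determines all later ones.\<close>

lemma induced_by_morphism_unique:
  assumes P: "weight_tower C w X P" and P': "weight_tower C w X' P'" and g: "g \<in> Hom C X X'"
    and T: "weight_ss C A H P T" and T': "weight_ss C A H P' T'"
    and \<phi>: "induced_by_morphism C A H P P' T T' g \<phi>" and \<psi>: "induced_by_morphism C A H P P' T T' g \<psi>"
    and r: "r \<ge> 2"
  shows "\<phi> r = \<psi> r"
proof -
  obtain \<beta> \<alpha> where E: "tower_extension C P P' g \<beta> \<alpha>" using C.ex_tower_extension[OF P P' g] by blast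
  let ?\<alpha> = "\<lambda>p q. FM H (ShM C q (\<alpha> p))"
  have "(\<phi>(1 := ?\<alpha>)) r = (\<psi>(1 := ?\<alpha>)) r"
  proof (rule A.ss_morphism_unique[OF _ _ order.refl])
    show "spectral_sequence A T" "spectral_sequence A T'" using T T' unfolding weight_ss_def by auto
    show "ss_morphism A 1 T T' (\<phi>(1 := ?\<alpha>))" "ss_morphism A 1 T T' (\<psi>(1 := ?\<alpha>))"
      using \<phi> \<psi> E unfolding induced_by_morphism_def by auto
  qed (use r in auto)
  then show ?thesis using r by simp
qed

lemma induced_by_morphism_Idn:
  assumes P: "weight_tower C w X P" and X: "X \<in> Obj C" and T: "weight_ss C A H P T"
  shows "induced_by_morphism C A H P P T T (Idn C X) (\<lambda>r p q. Idn A (sE T r p q))"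
proof (rule induced_by_morphismI[OF P P C.Idn_Hom[OF X] T T C.tower_extension_Idn[OF P X]])
  have ss: "spectral_sequence A T" using T unfolding weight_ss_def by auto
  show "ss_morphism A 2 T T (\<lambda>r p q. Idn A (sE T r p q))"
    by (rule A.ss_morphism_Idn[OF ss]) simp
  show "ss_morphism A 1 T T ((\<lambda>r p q. Idn A (sE T r p q))(1 := \<lambda>p q. FM H (ShM C q (Idn C (tw_gr P p)))))"
  proof (rule A.ss_morphism_cong[OF A.ss_morphism_Idn[OF ss order.refl]])
    fix r :: nat
    have "FM H (ShM C q (Idn C (tw_gr P p))) = Idn A (sE T 1 p q)" for p q
      using tower_Obj(2)[OF P X, of p] H.FM_Idn[of "ShO C q (tw_gr P p)"] weight_ss_simps(1)[OF P X T] by simp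
    then show "(\<lambda>p q. Idn A (sE T r p q)) =
         ((\<lambda>r p q. Idn A (sE T r p q))(1 := \<lambda>p q. FM H (ShM C q (Idn C (tw_gr P p))))) r" by simp
  qed
qed

lemma induced_by_morphism_Cmp:
  assumes P: "weight_tower C w X P" and P': "weight_tower C w X' P'" and P'': "weight_tower C w X'' P''"
    and g: "g \<in> Hom C X X'" and h: "h \<in> Hom C X' X''"
    and T: "weight_ss C A H P T" and T': "weight_ss C A H P' T'" and T'': "weight_ss C A H P'' T''"
    and \<phi>: "induced_by_morphism C A H P P' T T' g \<phi>" and \<psi>: "induced_by_morphism C A H P' P'' T' T'' h \<psi>"
  shows "induced_by_morphism C A H P P'' T T'' (h \<cdot> g) (\<lambda>r p q. \<psi> r p q \<cdot>\<^bsub>A\<^esub> \<phi> r p q)"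
proof -
  have ss: "spectral_sequence A T" "spectral_sequence A T'" "spectral_sequence A T''"
    using T T' T'' unfolding weight_ss_def by auto
  obtain \<beta> \<alpha> where E: "tower_extension C P P' g \<beta> \<alpha>" using C.ex_tower_extension[OF P P' g] by blast
  obtain \<beta>' \<alpha>' where E': "tower_extension C P' P'' h \<beta>' \<alpha>'" using C.ex_tower_extension[OF P' P'' h] by blast
  let ?\<alpha> = "\<lambda>p q. FM H (ShM C q (\<alpha> p))" and ?\<alpha>' = "\<lambda>p q. FM H (ShM C q (\<alpha>' p))"
  have 1: "ss_morphism A 1 T T' (\<phi>(1 := ?\<alpha>))" "ss_morphism A 1 T' T'' (\<psi>(1 := ?\<alpha>'))"
    using \<phi> \<psi> E E' unfolding induced_by_morphism_def by auto
  have "\<alpha> p \<in> Hom C (tw_gr P p) (tw_gr P' p)" "\<alpha>' p \<in> Hom C (tw_gr P' p) (tw_gr P'' p)" for p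
    using E E' unfolding tower_extension_def by auto
  then have "FM H (ShM C q (\<alpha>' p \<cdot> \<alpha> p)) = ?\<alpha>' p q \<cdot>\<^bsub>A\<^esub> ?\<alpha> p q" for p q
    by (simp add: C.in_Hom C.ShM_Cmp FM_Cmp')
  then have eq: "(\<lambda>r p q. \<psi> r p q \<cdot>\<^bsub>A\<^esub> \<phi> r p q)(1 := \<lambda>p q. FM H (ShM C q (\<alpha>' p \<cdot> \<alpha> p))) =
      (\<lambda>r p q. (\<psi>(1 := ?\<alpha>')) r p q \<cdot>\<^bsub>A\<^esub> (\<phi>(1 := ?\<alpha>)) r p q)"
    by (auto simp: fun_eq_iff)
  show ?thesis
  proof (rule induced_by_morphismI[OF P P'' C.Cmp_Hom[OF g h] T T'' C.tower_extension_Cmp[OF P P' P'' g h E E']])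
    show "ss_morphism A 2 T T'' (\<lambda>r p q. \<psi> r p q \<cdot>\<^bsub>A\<^esub> \<phi> r p q)"
      using \<phi> \<psi> unfolding induced_by_morphism_def by (intro A.ss_morphism_Cmp[OF ss]) auto
    show "ss_morphism A 1 T T'' ((\<lambda>r p q. \<psi> r p q \<cdot>\<^bsub>A\<^esub> \<phi> r p q)(1 := \<lambda>p q. FM H (ShM C q (\<alpha>' p \<cdot> \<alpha> p))))"
      unfolding eq by (intro A.ss_morphism_Cmp[OF ss] 1) auto
  qed
qed

text \<open>The identity also induces a morphism in the other direction; by functoriality and
  uniqueness both composites are identities from page 2 on.\<close>

lemma induced_by_Idn_iso:
  assumes P: "weight_tower C w X P" and P': "weight_tower C w X P'" and X: "X \<in> Obj C"
    and T: "weight_ss C A H P T" and T': "weight_ss C A H P' T'"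
    and \<phi>: "induced_by_morphism C A H P P' T T' (Idn C X) \<phi>" and r: "r \<ge> 2"
  shows "is_iso A (\<phi> r p q)"
proof -
  have I: "Idn C X \<in> Hom C X X" "Idn C X \<cdot> Idn C X = Idn C X" using X by (auto simp: C.in_Hom)
  obtain \<psi> where \<psi>: "induced_by_morphism C A H P' P T' T (Idn C X) \<psi>"
    using ex_induced_by_morphism[OF P' P I(1) T' T] by blast
  have \<phi>': "ss_morphism A 2 T T' \<phi>" and \<psi>': "ss_morphism A 2 T' T \<psi>"
    using \<phi> \<psi> unfolding induced_by_morphism_def by auto
  have "(\<lambda>p q. \<psi> r p q \<cdot>\<^bsub>A\<^esub> \<phi> r p q) = (\<lambda>p q. Idn A (sE T r p q))"
    using induced_by_morphism_unique[OF P P I(1) T T induced_by_morphism_Cmp[OF P P' P I(1) I(1) T T' T \<phi> \<psi>, unfolded I(2)]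
        induced_by_morphism_Idn[OF P X T] r] .
  moreover have "(\<lambda>p q. \<phi> r p q \<cdot>\<^bsub>A\<^esub> \<psi> r p q) = (\<lambda>p q. Idn A (sE T' r p q))"
    using induced_by_morphism_unique[OF P' P' I(1) T' T' induced_by_morphism_Cmp[OF P' P P' I(1) I(1) T' T T' \<psi> \<phi>, unfolded I(2)]
        induced_by_morphism_Idn[OF P' X T'] r] .
  ultimately have "\<psi> r p q \<cdot>\<^bsub>A\<^esub> \<phi> r p q = Idn A (sE T r p q)" "\<phi> r p q \<cdot>\<^bsub>A\<^esub> \<psi> r p q = Idn A (sE T' r p q)"
    by (auto simp: fun_eq_iff)
  then show ?thesis
    using A.ss_morphismD(1)[OF \<phi>' r, of p q] A.ss_morphismD(1)[OF \<psi>' r, of p q]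
    unfolding is_iso_def by (auto simp: A.in_Hom)
qed

end

text \<open>All squares are naturality squares of \<open>\<Phi>\<close> at shifts of the maps of the
  tower. Two functors are involved, so the locale is interpreted twice instead of being
  entered.\<close>

lemma transformation_couple_morphism:
  assumes "weighted_homology C w A H" "weighted_homology C w A H'" and \<Phi>: "transformation C A H H' \<Phi>"
    and P: "weight_tower C w X P" and X: "X \<in> Obj C"
  shows "couple_morphism A 1 (weight_couple C H P) (weight_couple C H' P)
    (\<lambda>p q. \<Phi> (ShO C q (tw_ge P p))) (\<lambda>p q. \<Phi> (ShO C q (tw_gr P p)))"
proof -
  interpret H: weighted_homology C w A H by fact
  interpret H': weighted_homology C w A H' by fact
  have \<Phi>1: "\<Phi> Y \<in> Hom A (FO H Y) (FO H' Y)" if "Y \<in> Obj C" for Y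
    using \<Phi> that unfolding transformation_def by blast
  have nat: "\<Phi> (ShO C n Z) \<cdot>\<^bsub>A\<^esub> FM H (ShM C n f) = FM H' (ShM C n f) \<cdot>\<^bsub>A\<^esub> \<Phi> (ShO C n Y)"
    if "f \<in> Hom C Y Z" for f n Y Z
  proof -
    have "ShM C n f \<in> Arr C" "Src C (ShM C n f) = ShO C n Y" "Tgt C (ShM C n f) = ShO C n Z"
      using that by (auto simp: H.C.in_Hom)
    then show ?thesis using \<Phi> unfolding transformation_def by metis
  qed
  note D = H.C.weight_towerD[OF P X] and O = H.tower_Obj[OF P X]
  show ?thesis
    unfolding couple_morphism_def
  proof (intro allI)
    fix p q
    have "\<Phi> (ShO C (q + 1) (tw_ge P (p - 1))) \<cdot>\<^bsub>A\<^esub> FM H (ShM C (q + 1) (tw_v P (p - 1))) =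
        FM H' (ShM C (q + 1) (tw_v P (p - 1))) \<cdot>\<^bsub>A\<^esub> \<Phi> (ShO C (q + 1) (ShO C (- 1) (tw_ge P (p - 1 + 1))))"
      by (rule nat[OF D(9)])
    moreover have "\<Phi> (ShO C q (tw_gr P p)) \<cdot>\<^bsub>A\<^esub> FM H (ShM C q (tw_y P p)) = FM H' (ShM C q (tw_y P p)) \<cdot>\<^bsub>A\<^esub> \<Phi> (ShO C q (tw_ge P p))"
      by (rule nat[OF D(13)])
    moreover have "\<Phi> (ShO C (q + 1) (ShO C (- 1) (tw_ge P (p + 1)))) \<cdot>\<^bsub>A\<^esub> FM H (ShM C (q + 1) (tw_x C P p)) =
        FM H' (ShM C (q + 1) (tw_x C P p)) \<cdot>\<^bsub>A\<^esub> \<Phi> (ShO C (q + 1) (ShO C (- 1) (tw_gr P p)))"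
      by (rule nat[OF D(16)])
    ultimately show "\<Phi> (ShO C q (tw_ge P p)) \<in> Hom A (cD (weight_couple C H P) p q) (cD (weight_couple C H' P) p q) \<and>
       \<Phi> (ShO C q (tw_gr P p)) \<in> Hom A (cE (weight_couple C H P) p q) (cE (weight_couple C H' P) p q) \<and>
       \<Phi> (ShO C (q + 1) (tw_ge P (p - 1))) \<cdot>\<^bsub>A\<^esub> ci (weight_couple C H P) p q =
       ci (weight_couple C H' P) p q \<cdot>\<^bsub>A\<^esub> \<Phi> (ShO C q (tw_ge P p)) \<and>
       \<Phi> (ShO C (q - int 1 + 1) (tw_gr P (p + int 1 - 1))) \<cdot>\<^bsub>A\<^esub> cj (weight_couple C H P) p q =
       cj (weight_couple C H' P) p q \<cdot>\<^bsub>A\<^esub> \<Phi> (ShO C q (tw_ge P p)) \<and>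
       \<Phi> (ShO C q (tw_ge P (p + 1))) \<cdot>\<^bsub>A\<^esub> ck (weight_couple C H P) p q =
       ck (weight_couple C H' P) p q \<cdot>\<^bsub>A\<^esub> \<Phi> (ShO C q (tw_gr P p))"
      using O \<Phi>1 by simp
  qed
qed

section \<open>Towers of bounded objects, and convergence of the weight spectral sequence\<close>

context weighted_category
begin

text \<open>If \<open>X\<close> is bounded above, the objects \<open>X\<^bsup>w\<ge>k\<^esup>\<close> with large \<open>k\<close> need not vanish, since the tower is
  arbitrary; but they are retracts of \<open>X\<^bsup>w\<le>k-1\<^esup>\<close>, which kills the maps between them. The dual
  remark applies to objects bounded below.\<close>

lemma tower_v_eq_Nul:
  assumes P: "weight_tower C w X P" and X: "X = ShO C (- l) Y" "Y \<in> Wle w" and k: "k > l"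
  shows "tw_v P k = Nul C (ShO C (- 1) (tw_ge P (k + 1))) (tw_ge P k)"
proof -
  have XO: "X \<in> Obj C" and Xk: "ShO C k X = ShO C (k - l) Y" using X Wle_Obj by auto
  note D = weight_towerD[OF P XO]
  have O: "tw_ge P k \<in> Obj C" using D(6) Wge_Obj by blast
  note e = D(4)[of "k - 1"] and f = D(3)[of "k - 1"]
  \<comment> \<open>This map goes from \<open>Wge w\<close> to \<open>Y[k - l]\<close> with
    \<open>k - l > 0\<close>, hence is zero; so the identity of \<open>tw_ge P k\<close> lifts along
    \<open>tw_f\<close>, which exhibits the retract.\<close>
  have "tw_e P (k - 1) = Nul C (ShO C 0 (tw_ge P k)) (ShO C (k - l) Y)"
    by (rule orthogonal_shift[OF _ _ _ D(6) X(2)]) (use e k O Xk in \<open>auto simp: in_Hom\<close>)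
  then have "tw_e P (k - 1) \<cdot> Idn C (tw_ge P k) = Nul C (tw_ge P k) (ShO C k X)"
    using O Xk XO e by (simp add: in_Hom)
  then obtain s where "s \<in> Arr C" "Src C s = Src C (Idn C (tw_ge P k))" "Tgt C s = Src C (tw_f P (k - 1))"
      "tw_f P (k - 1) \<cdot> s = Idn C (tw_ge P k)"
    by - (rule Dist_lift[OF Dist_rotate[OF weight_decompositionD(1)[OF D(1)[of "k - 1"]]], of "Idn C (tw_ge P k)"];
        use e O XO in \<open>simp add: in_Hom\<close>)
  then have "s \<in> Hom C (tw_ge P k) (tw_le P (k - 1))" "tw_f P (k - 1) \<cdot> s = Idn C (tw_ge P k)"
    using f O by (auto simp: in_Hom)
  moreover have "tw_f P (k - 1) \<in> Hom C (tw_le P (k - 1)) (tw_ge P k)" using f by simp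
  ultimately have "tw_ge P k \<in> Wle w"
    using Wle_Karoubi D(5)[of "k - 1"] O unfolding Karoubi_closed_def by blast
  then show ?thesis
    by (rule orthogonal_neg1[OF D(9) D(6)])
qed

text \<open>Now \<open>X[k]\<close> is a negative shift of an object of \<open>Wge w\<close>, so
  \<open>tw_g\<close> is zero and \<open>tw_f\<close> has a left inverse. The second conclusion
  makes \<open>weight_decomposition_mono\<close> available for maps out of \<open>tw_le P k\<close>
  shifted by \<open>-1\<close>.\<close>

lemma tower_g_eq_Nul:
  assumes P: "weight_tower C w X P" and X: "X = ShO C (- l) Y" "Y \<in> Wge w" and k: "k < l"
  shows "tw_g P k = Nul C (ShO C k X) (tw_le P k)" "tw_le P k \<in> Wge w"
proof -
  have XO: "X \<in> Obj C" and Xk: "ShO C k X = ShO C (k - l) Y" using X Wge_Obj by auto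
  note D = weight_towerD[OF P XO]
  have O: "tw_le P k \<in> Obj C" using D(5) Wle_Obj by blast
  note g = D(2)[of k] and f = D(3)[of k]
  have "tw_g P k = Nul C (ShO C (k - l) Y) (ShO C 0 (tw_le P k))"
    by (rule orthogonal_shift[OF _ _ _ X(2) D(5)]) (use g k O Xk in \<open>auto simp: in_Hom\<close>)
  then show g0: "tw_g P k = Nul C (ShO C k X) (tw_le P k)" using Xk O by simp
  then have "Idn C (tw_le P k) \<cdot> tw_g P k = Nul C (ShO C k X) (tw_le P k)"
    using O XO by simp
  then obtain r where "r \<in> Arr C" "Src C r = Tgt C (tw_f P k)" "Tgt C r = Tgt C (Idn C (tw_le P k))"
      "r \<cdot> tw_f P k = Idn C (tw_le P k)"
    by - (rule Dist_desc[OF weight_decompositionD(1)[OF D(1)[of k]], of "Idn C (tw_le P k)"];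
        use g O XO in \<open>simp add: in_Hom\<close>)
  then have "r \<in> Hom C (tw_ge P (k + 1)) (tw_le P k)" "r \<cdot> tw_f P k = Idn C (tw_le P k)"
    using f O by (auto simp: in_Hom)
  then show "tw_le P k \<in> Wge w"
    using Wge_Karoubi D(6)[of "k + 1"] O f unfolding Karoubi_closed_def by blast
qed

end

context weighted_homology
begin

text \<open>The identity of \<open>X[i - 1]\<close> extends to maps between the two decompositions
  in both directions, so the truncations factor through each other; this persists under
  \<open>H\<close> and leaves the image unchanged.\<close>

lemma weight_truncation_image:
  assumes X: "X \<in> Obj C" and s: "weight_truncation C w i X s" and s': "weight_truncation C w i X s'"
    and m: "is_image A (FM H (ShM C n s)) m"
  shows "is_image A (FM H (ShM C n s')) m"
proof -
  have factor: "\<exists>b. b \<in> Arr C \<and> Tgt C b = Src C s' \<and> s' \<cdot> b = s \<and> s' \<in> Arr C"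
    if s: "weight_truncation C w i X s" and s': "weight_truncation C w i X s'" for s s'
  proof -
    obtain g f e where d: "weight_decomposition C w (ShO C (i - 1) X) g f e" "s = ShM C (- i) e"
      using s unfolding weight_truncation_def by blast
    obtain g' f' e' where d': "weight_decomposition C w (ShO C (i - 1) X) g' f' e'" "s' = ShM C (- i) e'"
      using s' unfolding weight_truncation_def by blast
    have Y: "ShO C (i - 1) X \<in> Obj C" using X by simp
    obtain b where b: "b \<in> Hom C (Tgt C f) (Tgt C f')" "e' \<cdot> b = ShM C 1 (Idn C (ShO C (i - 1) X)) \<cdot> e"
      by (rule C.weight_decomposition_map[OF d(1) d'(1) C.Idn_Hom[OF Y]])
    have "e' \<cdot> b = e" using b C.weight_decompositionD(4)[OF d(1) Y] X by (simp add: C.in_Hom)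
    then have "ShM C (- i) (e' \<cdot> b) = s" using d(2) by simp
    then have "s' \<cdot> ShM C (- i) b = s"
      using b(1) C.weight_decompositionD(4)[OF d'(1) Y] d'(2) by (simp add: C.in_Hom C.ShM_Cmp)
    then show ?thesis
      using b(1) C.weight_decompositionD(4)[OF d'(1) Y] d'(2) by (intro exI[of _ "ShM C (- i) b"]) (simp add: C.in_Hom)
  qed
  obtain a where a: "a \<in> Arr C" "Tgt C a = Src C s'" "s' \<cdot> a = s" "s' \<in> Arr C" using factor[OF s s'] by blast
  obtain b where b: "b \<in> Arr C" "Tgt C b = Src C s" "s \<cdot> b = s'" "s \<in> Arr C" using factor[OF s' s] by blast
  have src: "Src C s = Src C a" "Src C s' = Src C b"
    using a b C.Cmp_simps(2) by metis+
  have "FM H (ShM C n (s' \<cdot> a)) = FM H (ShM C n s') \<cdot>\<^bsub>A\<^esub> FM H (ShM C n a)"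
    "FM H (ShM C n (s \<cdot> b)) = FM H (ShM C n s) \<cdot>\<^bsub>A\<^esub> FM H (ShM C n b)"
    using a(1,2,4) b(1,2,4) by (simp_all add: C.ShM_Cmp FM_Cmp')
  note eq = this[unfolded a(3) b(3)]
  show ?thesis
    by (rule A.is_image_cong[OF m eq(2) _ _ eq(1)]) (use a(1,2,4) b(1,2,4) src in auto)
qed

lemma weight_couple_top:
  assumes P: "weight_tower C w X P" and X: "X \<in> Obj C"
    and top: "X \<in> bounded_above C w \<or> (\<exists>N. \<forall>q\<ge>N. \<forall>Y\<in>wge C w q. zero_object A (FO H Y))"
  shows "\<exists>b. \<forall>p\<ge>b. FM H (ShM C (n - p + 1) (tw_v P (p - 1))) =
      Nul A (FO H (ShO C (n - p) (tw_ge P p))) (FO H (ShO C (n - p + 1) (tw_ge P (p - 1))))"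
  using top
proof
  note D = C.weight_towerD[OF P X] and O = tower_Obj[OF P X]
  {
    assume "X \<in> bounded_above C w"
    then obtain l Y where l: "X = ShO C (- l) Y" "Y \<in> Wle w" unfolding bounded_above_def wle_def by blast
    \<comment> \<open>The map at \<open>p\<close> is built from \<open>tw_v P (p - 1)\<close>, so
      the bound is what \<open>p - 1 > l\<close> requires.\<close>
    have "FM H (ShM C (n - p + 1) (tw_v P (p - 1))) =
      Nul A (FO H (ShO C (n - p) (tw_ge P p))) (FO H (ShO C (n - p + 1) (tw_ge P (p - 1))))" if "p \<ge> l + 2" for p
      using C.tower_v_eq_Nul[OF P l, of "p - 1"] that O by simp
    then show ?thesis by blast
  next
    assume "\<exists>N. \<forall>q\<ge>N. \<forall>Y\<in>wge C w q. zero_object A (FO H Y)"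
    then obtain N where N: "\<And>q Y. q \<ge> N \<Longrightarrow> Y \<in> Wge w \<Longrightarrow> zero_object A (FO H (ShO C (- q) Y))"
      unfolding wge_def by blast
    have "FM H (ShM C (n - p + 1) (tw_v P (p - 1))) =
      Nul A (FO H (ShO C (n - p) (tw_ge P p))) (FO H (ShO C (n - p + 1) (tw_ge P (p - 1))))" if "p \<ge> N + n" for p
    proof -
      \<comment> \<open>Shifting \<open>tw_ge P p\<close> by \<open>n - p\<close> puts it in
        \<open>wge C w (p - n)\<close>, whence the bound \<open>N + n\<close>.\<close>
      have "zero_object A (FO H (ShO C (n - p) (tw_ge P p)))" using N[of "p - n" "tw_ge P p"] D(6) that by simp
      then show ?thesis
        using A.zero_object_Hom(2)[of _ "FM H (ShM C (n - p + 1) (tw_v P (p - 1)))"] D(9)[of "p - 1"] O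
        by (simp add: C.in_Hom)
    qed
    then show ?thesis by blast
  }
qed

text \<open>Exactness of the weight decomposition under \<open>H\<close> reduces both claims to
  vanishing: if \<open>H(tw_g)\<close> is zero, \<open>H(tw_e)\<close> is epic; and as the kernel of
  \<open>H(tw_e)\<close> is the image of \<open>H(tw_f)\<close>, it suffices that
  \<open>H(tw_v)\<close> kills the latter. Injectivity of \<open>H(tw_e)\<close> itself need not
  hold for an arbitrary tower.\<close>

lemma weight_couple_bottom:
  assumes P: "weight_tower C w X P" and X: "X \<in> Obj C"
    and bot: "X \<in> bounded_below C w \<or> (\<exists>N. \<forall>q\<le>N. \<forall>Y\<in>wle C w q. zero_object A (FO H Y))"
  shows "\<exists>a. \<forall>p\<le>a. epic A (FM H (ShM C (n - p) (tw_e P (p - 1)))) \<and>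
      (\<forall>x. x \<in> Arr A \<longrightarrow> Tgt A x = FO H (ShO C (n - p) (tw_ge P p)) \<longrightarrow>
         FM H (ShM C (n - p) (tw_e P (p - 1))) \<cdot>\<^bsub>A\<^esub> x = Nul A (Src A x) (FO H (ShO C n X)) \<longrightarrow>
         FM H (ShM C (n - p + 1) (tw_v P (p - 1))) \<cdot>\<^bsub>A\<^esub> x = Nul A (Src A x) (FO H (ShO C (n - p + 1) (tw_ge P (p - 1)))))"
proof -
  note D = C.weight_towerD[OF P X] and O = tower_Obj[OF P X]
  let ?g = "\<lambda>p. FM H (ShM C (n - p + 1) (tw_g P (p - 1)))" and ?f = "\<lambda>p. FM H (ShM C (n - p) (tw_f P (p - 1)))"
    and ?v = "\<lambda>p. FM H (ShM C (n - p + 1) (tw_v P (p - 1)))" and ?e = "\<lambda>p. FM H (ShM C (n - p) (tw_e P (p - 1)))"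
  have hom: "?g p \<in> Hom A (FO H (ShO C n X)) (FO H (ShO C (n - p + 1) (tw_le P (p - 1))))"
    "?f p \<in> Hom A (FO H (ShO C (n - p) (tw_le P (p - 1)))) (FO H (ShO C (n - p) (tw_ge P p)))"
    "?v p \<in> Hom A (FO H (ShO C (n - p) (tw_ge P p))) (FO H (ShO C (n - p + 1) (tw_ge P (p - 1))))"
    "?e p \<in> Hom A (FO H (ShO C (n - p) (tw_ge P p))) (FO H (ShO C n X))" for p
    using D(2,3,4,9)[of "p - 1"] O X by (simp_all add: A.in_Hom C.in_Hom)
  have "\<exists>a. \<forall>p\<le>a. ?g p = Nul A (FO H (ShO C n X)) (FO H (ShO C (n - p + 1) (tw_le P (p - 1)))) \<and>
      ?v p \<cdot>\<^bsub>A\<^esub> ?f p = Nul A (FO H (ShO C (n - p) (tw_le P (p - 1)))) (FO H (ShO C (n - p + 1) (tw_ge P (p - 1))))"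
    using bot
  proof
    assume "X \<in> bounded_below C w"
    then obtain l Y where l: "X = ShO C (- l) Y" "Y \<in> Wge w" unfolding bounded_below_def wge_def by blast
    have "?g p = Nul A (FO H (ShO C n X)) (FO H (ShO C (n - p + 1) (tw_le P (p - 1)))) \<and>
      ?v p \<cdot>\<^bsub>A\<^esub> ?f p = Nul A (FO H (ShO C (n - p) (tw_le P (p - 1)))) (FO H (ShO C (n - p + 1) (tw_ge P (p - 1))))"
      if p: "p \<le> l" for p
    proof
      have p': "p - 1 < l" using p by simp
      note gN = C.tower_g_eq_Nul[OF P l p']
      show "?g p = Nul A (FO H (ShO C n X)) (FO H (ShO C (n - p + 1) (tw_le P (p - 1))))"
        using gN(1) O X by simp
      have idx: "p - 1 + 1 = p" by simp
      note homC = D(3,4,9)[of "p - 1", unfolded idx] D(3,4)[of "p - 1 - 1"]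
      let ?c = "tw_v P (p - 1) \<cdot> ShM C (- 1) (tw_f P (p - 1))"
      \<comment> \<open>The composite \<open>?c\<close> is zero by uniqueness of lifts:
        \<open>tw_e\<close> kills it because \<open>tw_e \<cdot> tw_f\<close> vanishes, and its
        source is \<open>tw_le P (p - 1)\<close> shifted by \<open>-1\<close>, where
        \<open>tw_le P (p - 1)\<close> lies in \<open>Wge w\<close> by boundedness of
        \<open>X\<close>.\<close>
      have "tw_e P (p - 1 - 1) \<cdot> ?c = ShM C (- 1) (tw_e P (p - 1) \<cdot> tw_f P (p - 1))"
        using D(10)[of "p - 1", THEN C.pull, of "ShM C (- 1) (tw_f P (p - 1))"] homC O X by (simp add: C.in_Hom C.ShM_Cmp)
      also have "tw_e P (p - 1) \<cdot> tw_f P (p - 1) = Nul C (tw_le P (p - 1)) (ShO C p X)"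
        using C.Dist_comp[OF C.Dist_rotate[OF C.weight_decompositionD(1)[OF D(1)[of "p - 1"]]]] homC X
        by (simp add: C.in_Hom)
      also have "ShM C (- 1) \<dots> = Nul C (ShO C (- 1) (tw_le P (p - 1))) (ShO C (p - 1) X)"
        using O X by simp
      finally have "?c = Nul C (ShO C (- 1) (tw_le P (p - 1))) (tw_ge P (p - 1))"
        using C.weight_decomposition_mono[OF D(1)[of "p - 1 - 1"] _ gN(2), of ?c] homC O X by (simp add: C.in_Hom)
      moreover have "?v p \<cdot>\<^bsub>A\<^esub> ?f p = FM H (ShM C (n - p + 1) ?c)"
        using homC O by (simp add: C.in_Hom C.ShM_Cmp FM_Cmp')
      ultimately show "?v p \<cdot>\<^bsub>A\<^esub> ?f p = Nul A (FO H (ShO C (n - p) (tw_le P (p - 1)))) (FO H (ShO C (n - p + 1) (tw_ge P (p - 1))))"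
        using O by simp
    qed
    then show ?thesis by blast
  next
    assume "\<exists>N. \<forall>q\<le>N. \<forall>Y\<in>wle C w q. zero_object A (FO H Y)"
    then obtain N where N: "\<And>q Y. q \<le> N \<Longrightarrow> Y \<in> Wle w \<Longrightarrow> zero_object A (FO H (ShO C (- q) Y))"
      unfolding wle_def by blast
    have "?g p = Nul A (FO H (ShO C n X)) (FO H (ShO C (n - p + 1) (tw_le P (p - 1)))) \<and>
      ?v p \<cdot>\<^bsub>A\<^esub> ?f p = Nul A (FO H (ShO C (n - p) (tw_le P (p - 1)))) (FO H (ShO C (n - p + 1) (tw_ge P (p - 1))))"
      if p: "p \<le> N + n" for p
    proof
      \<comment> \<open>The target of \<open>H(tw_g)\<close> has weight at most
        \<open>p - n - 1\<close> and the source of \<open>H(tw_f)\<close> weight at most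
        \<open>p - n\<close>; the bound \<open>p \<le> N + n\<close> covers both.\<close>
      have "zero_object A (FO H (ShO C (n - p + 1) (tw_le P (p - 1))))"
        using N[of "p - n - 1" "tw_le P (p - 1)"] D(5) p by (simp add: algebra_simps)
      then show "?g p = Nul A (FO H (ShO C n X)) (FO H (ShO C (n - p + 1) (tw_le P (p - 1))))"
        using A.zero_object_Hom(1)[of _ "?g p"] hom(1)[of p] by (simp add: A.in_Hom)
      have "zero_object A (FO H (ShO C (n - p) (tw_le P (p - 1))))"
        using N[of "p - n" "tw_le P (p - 1)"] D(5) p by simp
      then have "?f p = Nul A (FO H (ShO C (n - p) (tw_le P (p - 1)))) (FO H (ShO C (n - p) (tw_ge P p)))"
        using A.zero_object_Hom(2)[of _ "?f p"] hom(2)[of p] by (simp add: A.in_Hom)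
      then show "?v p \<cdot>\<^bsub>A\<^esub> ?f p = Nul A (FO H (ShO C (n - p) (tw_le P (p - 1)))) (FO H (ShO C (n - p + 1) (tw_ge P (p - 1))))"
        using hom(3)[of p] O by (simp add: A.in_Hom)
    qed
    then show ?thesis by blast
  qed
  then obtain a where a: "\<And>p. p \<le> a \<Longrightarrow> ?g p = Nul A (FO H (ShO C n X)) (FO H (ShO C (n - p + 1) (tw_le P (p - 1))))"
      "\<And>p. p \<le> a \<Longrightarrow> ?v p \<cdot>\<^bsub>A\<^esub> ?f p =
        Nul A (FO H (ShO C (n - p) (tw_le P (p - 1)))) (FO H (ShO C (n - p + 1) (tw_ge P (p - 1))))"
    by blast
  have "epic A (?e p) \<and> (\<forall>x. x \<in> Arr A \<longrightarrow> Tgt A x = FO H (ShO C (n - p) (tw_ge P p)) \<longrightarrow>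
         ?e p \<cdot>\<^bsub>A\<^esub> x = Nul A (Src A x) (FO H (ShO C n X)) \<longrightarrow>
         ?v p \<cdot>\<^bsub>A\<^esub> x = Nul A (Src A x) (FO H (ShO C (n - p + 1) (tw_ge P (p - 1)))))" if p: "p \<le> a" for p
  proof (intro conjI allI impI)
    have dist: "(tw_g P (p - 1), tw_f P (p - 1), tw_e P (p - 1)) \<in> Dist C"
      using C.weight_decompositionD(1)[OF D(1)[of "p - 1"]] X by simp
    have ex: "exact_at A (?f p) (?e p)" "exact_at A (?e p) (?g p)"
      using H.long_exact[OF dist, of "n - p"] by simp_all
    show "epic A (?e p)"
      by (rule A.exact_epic[OF ex(2)]) (use a(1)[OF p] hom(1)[of p] in \<open>simp add: A.in_Hom\<close>)
    fix x assume x: "x \<in> Arr A" "Tgt A x = FO H (ShO C (n - p) (tw_ge P p))"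
      "?e p \<cdot>\<^bsub>A\<^esub> x = Nul A (Src A x) (FO H (ShO C n X))"
    obtain \<epsilon> y where y: "epic A \<epsilon>" "\<epsilon> \<in> Arr A" "y \<in> Arr A" "Tgt A \<epsilon> = Src A x" "Src A y = Src A \<epsilon>"
      "Tgt A y = Src A (?f p)" "?f p \<cdot>\<^bsub>A\<^esub> y = x \<cdot>\<^bsub>A\<^esub> \<epsilon>"
      by (rule A.exact_lift[OF ex(1), of x]) (use x hom(4)[of p] in \<open>auto simp: A.in_Hom\<close>)
    have "(?v p \<cdot>\<^bsub>A\<^esub> x) \<cdot>\<^bsub>A\<^esub> \<epsilon> = ?v p \<cdot>\<^bsub>A\<^esub> (?f p \<cdot>\<^bsub>A\<^esub> y)"
      unfolding y(7) using x(1,2) y(2,4) hom(3)[of p] by (simp add: A.in_Hom)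
    also have "\<dots> = Nul A (Src A \<epsilon>) (FO H (ShO C (n - p + 1) (tw_ge P (p - 1))))"
      using a(2)[OF p, THEN A.pull, of y] y(3,5,6) hom(2,3)[of p] O by (simp add: A.in_Hom)
    finally show "?v p \<cdot>\<^bsub>A\<^esub> x = Nul A (Src A x) (FO H (ShO C (n - p + 1) (tw_ge P (p - 1))))"
      using A.epic_Nul[OF y(1), of "?v p \<cdot>\<^bsub>A\<^esub> x"] x(1,2) y(4) hom(3)[of p] by (simp add: A.in_Hom)
  qed
  then show ?thesis by blast
qed

text \<open>The comparison maps are \<open>H\<close> of shifts of \<open>tw_e\<close>, compatible
  with \<open>i\<close> by the equation that determines \<open>tw_v\<close>. Since
  \<open>tw_e P (p - 1)\<close> shifted by \<open>-p\<close> is one choice of the map from the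
  truncation at \<open>p\<close> to \<open>X\<close>, the same images give the filtration of
  convergence and the weight filtration.\<close>

lemma weight_ss_converges:
  assumes P: "weight_tower C w X P" and X: "X \<in> Obj C" and T: "weight_ss C A H P T"
    and top: "X \<in> bounded_above C w \<or> (\<exists>N. \<forall>q\<ge>N. \<forall>Y\<in>wge C w q. zero_object A (FO H Y))"
    and bot: "X \<in> bounded_below C w \<or> (\<exists>N. \<forall>q\<le>N. \<forall>Y\<in>wle C w q. zero_object A (FO H Y))"
  shows "\<exists>F. converges A T (\<lambda>n. FO H (ShO C n X)) F \<and>
     (\<forall>p q. weight_filtration C w A (shifted C H (p + q)) p X (F (p + q) p))"
proof -
  note D = C.weight_towerD[OF P X] and O = tower_Obj[OF P X]
  define \<eta> where "\<eta> p q = FM H (ShM C q (tw_e P (p - 1)))" for p q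
  have \<eta>: "\<eta> p q \<in> Hom A (FO H (ShO C q (tw_ge P p))) (FO H (ShO C (p + q) X))" for p q
    using D(4)[of "p - 1"] X unfolding \<eta>_def by (simp add: C.in_Hom A.in_Hom add.commute)
  define F where "F n p = (SOME m. is_image A (\<eta> p (n - p)) m)" for n p
  have F: "is_image A (\<eta> p (n - p)) (F n p)" for n p
  proof -
    have "\<exists>m. is_image A (\<eta> p (n - p)) m"
      using A.ex_image \<eta>[of p "n - p"] by (simp add: A.in_Hom)
    then show ?thesis unfolding F_def by (rule someI_ex)
  qed
  have "converges A T (\<lambda>n. FO H (ShO C n X)) F"
  proof (rule A.couple_converges[where K = "weight_couple C H P" and \<eta> = \<eta>])
    show "comes_from_couple A (weight_couple C H P) T" using T unfolding weight_ss_def by blast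
    show "\<eta> p q \<in> Hom A (cD (weight_couple C H P) p q) (FO H (ShO C (p + q) X))" for p q
      using \<eta> by simp
    show "\<eta> (p - 1) (q + 1) \<cdot>\<^bsub>A\<^esub> ci (weight_couple C H P) p q = \<eta> p q" for p q
    proof -
      have "\<eta> (p - 1) (q + 1) \<cdot>\<^bsub>A\<^esub> FM H (ShM C (q + 1) (tw_v P (p - 1))) =
          FM H (ShM C (q + 1) (tw_e P (p - 1 - 1) \<cdot> tw_v P (p - 1)))"
        using D(4)[of "p - 1 - 1"] D(9)[of "p - 1"] unfolding \<eta>_def by (simp add: C.in_Hom C.ShM_Cmp FM_Cmp')
      also have "\<dots> = \<eta> p q"
        unfolding D(10) \<eta>_def using D(4)[of "p - 1"] by (simp add: C.in_Hom)
      finally show ?thesis by simp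
    qed
    show "is_image A (\<eta> p (n - p)) (F n p)" for n p by (rule F)
    show "\<exists>b. \<forall>p\<ge>b. ci (weight_couple C H P) p (n - p) =
        Nul A (cD (weight_couple C H P) p (n - p)) (cD (weight_couple C H P) (p - 1) (n - p + 1))" for n
      using weight_couple_top[OF P X top, of n] by simp
    show "\<exists>a. \<forall>p\<le>a. epic A (\<eta> p (n - p)) \<and>
      (\<forall>x. x \<in> Arr A \<longrightarrow> Tgt A x = cD (weight_couple C H P) p (n - p) \<longrightarrow>
         \<eta> p (n - p) \<cdot>\<^bsub>A\<^esub> x = Nul A (Src A x) (FO H (ShO C n X)) \<longrightarrow>
         ci (weight_couple C H P) p (n - p) \<cdot>\<^bsub>A\<^esub> x = Nul A (Src A x) (cD (weight_couple C H P) (p - 1) (n - p + 1)))" for n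
      using weight_couple_bottom[OF P X bot, of n] unfolding \<eta>_def by simp
  qed
  moreover have "weight_filtration C w A (shifted C H (p + q)) p X (F (p + q) p)" for p q
    unfolding weight_filtration_def
  proof (intro conjI allI impI)
    have Fpq: "is_image A (\<eta> p q) (F (p + q) p)" using F[of p "p + q"] by simp
    show "F (p + q) p \<in> Arr A" "Tgt A (F (p + q) p) = FO (shifted C H (p + q)) X"
      using A.image_simps[OF Fpq] \<eta>[of p q] by (auto simp: A.in_Hom shifted_def)
    have "weight_truncation C w p X (ShM C (- p) (tw_e P (p - 1)))"
      unfolding weight_truncation_def using D(1)[of "p - 1"] by blast
    moreover fix s assume "weight_truncation C w p X s"
    moreover have "FM H (ShM C (p + q) (ShM C (- p) (tw_e P (p - 1)))) = \<eta> p q"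
      using D(4)[of "p - 1"] unfolding \<eta>_def by (simp add: C.in_Hom)
    ultimately show "is_image A (FM (shifted C H (p + q)) s) (F (p + q) p)"
      using weight_truncation_image[OF X, of p _ s "p + q" "F (p + q) p"] Fpq by (simp add: shifted_def)
  qed
  ultimately show ?thesis by blast
qed

end

theorem theorem2p3p2:
  fixes C :: "('o, 'm) tricat" and w :: "'o weights"
    and A :: "('p, 'n) precat" and H :: "('o, 'm, 'p, 'n) functr"
    and X :: 'o and P :: "('o, 'm) tower"
  assumes "weight_structure C w"
    and "abelian_category A"
    and "homological_functor C A H"
    and "X \<in> Obj C"
    and "weight_tower C w X P"
  shows
    \<comment> \<open>I\<close>
    "(\<exists>T. weight_ss C A H P T \<and>
       (\<forall>p q. sE T 1 p q = FO H (ShO C q (tw_gr P p)) \<and>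
              sd T 1 p q = FM H (ShM C q (tw_h C P p))))
    \<and>
    \<comment> \<open>II\<close>
    (\<forall>T. weight_ss C A H P T \<longrightarrow>
       X \<in> bounded_below C w \<inter> bounded_above C w \<or>
       ((\<exists>N. \<forall>q\<ge>N. \<forall>Y\<in>wge C w q. zero_object A (FO H Y)) \<and>
        (\<exists>N. \<forall>q\<le>N. \<forall>Y\<in>wle C w q. zero_object A (FO H Y))) \<or>
       (X \<in> bounded_above C w \<and> (\<exists>N. \<forall>q\<le>N. \<forall>Y\<in>wle C w q. zero_object A (FO H Y))) \<or>
       (X \<in> bounded_below C w \<and> (\<exists>N. \<forall>q\<ge>N. \<forall>Y\<in>wge C w q. zero_object A (FO H Y)))
       \<longrightarrow> (\<exists>F. converges A T (\<lambda>n. FO H (ShO C n X)) F \<and>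
               (\<forall>p q. weight_filtration C w A (shifted C H (p + q)) p X (F (p + q) p))))
    \<and>
    \<comment> \<open>III: the canonical morphism, identities, sums, compositions\<close>
    (\<forall>H' T T' \<Phi>. homological_functor C A H' \<longrightarrow> transformation C A H H' \<Phi> \<longrightarrow>
       weight_ss C A H P T \<longrightarrow> weight_ss C A H' P T' \<longrightarrow>
       (\<exists>\<phi>. induced_by_transformation C A P T T' \<Phi> \<phi>) \<and>
       (\<forall>\<phi> \<psi>. induced_by_transformation C A P T T' \<Phi> \<phi> \<longrightarrow>
              induced_by_transformation C A P T T' \<Phi> \<psi> \<longrightarrow> (\<forall>r\<ge>1. \<phi> r = \<psi> r)))
    \<and>
    (\<forall>T. weight_ss C A H P T \<longrightarrow>
       induced_by_transformation C A P T T (\<lambda>Y. Idn A (FO H Y)) (\<lambda>r p q. Idn A (sE T r p q)))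
    \<and>
    (\<forall>H' T T' \<Phi> \<Psi> \<phi> \<psi>. homological_functor C A H' \<longrightarrow>
       transformation C A H H' \<Phi> \<longrightarrow> transformation C A H H' \<Psi> \<longrightarrow>
       weight_ss C A H P T \<longrightarrow> weight_ss C A H' P T' \<longrightarrow>
       induced_by_transformation C A P T T' \<Phi> \<phi> \<longrightarrow>
       induced_by_transformation C A P T T' \<Psi> \<psi> \<longrightarrow>
       induced_by_transformation C A P T T'
         (\<lambda>Y. \<Phi> Y \<boxplus>\<^bsub>A\<^esub> \<Psi> Y) (\<lambda>r p q. \<phi> r p q \<boxplus>\<^bsub>A\<^esub> \<psi> r p q))
    \<and>
    (\<forall>H' H'' T T' T'' \<Phi> \<Psi> \<phi> \<psi>. homological_functor C A H' \<longrightarrow> homological_functor C A H'' \<longrightarrow>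
       transformation C A H H' \<Phi> \<longrightarrow> transformation C A H' H'' \<Psi> \<longrightarrow>
       weight_ss C A H P T \<longrightarrow> weight_ss C A H' P T' \<longrightarrow> weight_ss C A H'' P T'' \<longrightarrow>
       induced_by_transformation C A P T T' \<Phi> \<phi> \<longrightarrow>
       induced_by_transformation C A P T' T'' \<Psi> \<psi> \<longrightarrow>
       induced_by_transformation C A P T T''
         (\<lambda>Y. \<Psi> Y \<cdot>\<^bsub>A\<^esub> \<Phi> Y) (\<lambda>r p q. \<psi> r p q \<cdot>\<^bsub>A\<^esub> \<phi> r p q))
    \<and>
    \<comment> \<open>IV: the canonical morphism from page 2 on, identities, compositions, independence of the tower\<close>
    (\<forall>X' P' T T' g. weight_tower C w X' P' \<longrightarrow> g \<in> Hom C X X' \<longrightarrow>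
       weight_ss C A H P T \<longrightarrow> weight_ss C A H P' T' \<longrightarrow>
       (\<exists>\<beta> \<alpha>. tower_extension C P P' g \<beta> \<alpha>) \<and>
       (\<exists>\<phi>. induced_by_morphism C A H P P' T T' g \<phi>) \<and>
       (\<forall>\<phi> \<psi>. induced_by_morphism C A H P P' T T' g \<phi> \<longrightarrow>
              induced_by_morphism C A H P P' T T' g \<psi> \<longrightarrow> (\<forall>r\<ge>2. \<phi> r = \<psi> r)))
    \<and>
    (\<forall>T. weight_ss C A H P T \<longrightarrow>
       induced_by_morphism C A H P P T T (Idn C X) (\<lambda>r p q. Idn A (sE T r p q)))
    \<and>
    (\<forall>X' X'' P' P'' T T' T'' g h \<phi> \<psi>. weight_tower C w X' P' \<longrightarrow> weight_tower C w X'' P'' \<longrightarrow>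
       g \<in> Hom C X X' \<longrightarrow> h \<in> Hom C X' X'' \<longrightarrow>
       weight_ss C A H P T \<longrightarrow> weight_ss C A H P' T' \<longrightarrow> weight_ss C A H P'' T'' \<longrightarrow>
       induced_by_morphism C A H P P' T T' g \<phi> \<longrightarrow>
       induced_by_morphism C A H P' P'' T' T'' h \<psi> \<longrightarrow>
       induced_by_morphism C A H P P'' T T'' (h \<cdot>\<^bsub>C\<^esub> g) (\<lambda>r p q. \<psi> r p q \<cdot>\<^bsub>A\<^esub> \<phi> r p q))
    \<and>
    (\<forall>P' T T' \<phi>. weight_tower C w X P' \<longrightarrow> weight_ss C A H P T \<longrightarrow> weight_ss C A H P' T' \<longrightarrow>
       induced_by_morphism C A H P P' T T' (Idn C X) \<phi> \<longrightarrow>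
       (\<forall>r\<ge>2. \<forall>p q. is_iso A (\<phi> r p q)))"
proof -
  have weighted: "weighted_homology C w A H'" if "homological_functor C A H'" for H' :: "('o, 'm, 'p, 'n) functr"
    by (intro weighted_homology.intro weighted_category.intro assms(1,2) that)
  interpret H: weighted_homology C w A H by (rule weighted) fact
  note P = \<open>weight_tower C w X P\<close> and X = \<open>X \<in> Obj C\<close>
  have ss: "spectral_sequence A T" if "weight_ss C A H' P' T" for H' :: "('o, 'm, 'p, 'n) functr" and P' T
    using that unfolding weight_ss_def by blast
  have couple: "comes_from_couple A (weight_couple C H' P') T"
    if "weight_ss C A H' P' T" for H' :: "('o, 'm, 'p, 'n) functr" and P' T
    using that unfolding weight_ss_def by blast
  have transf: "(\<exists>\<phi>. induced_by_transformation C A P T T' \<Phi> \<phi>) \<and>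
       (\<forall>\<phi> \<psi>. induced_by_transformation C A P T T' \<Phi> \<phi> \<longrightarrow>
              induced_by_transformation C A P T T' \<Phi> \<psi> \<longrightarrow> (\<forall>r\<ge>1. \<phi> r = \<psi> r))"
    if H': "homological_functor C A H'" and \<Phi>: "transformation C A H H' \<Phi>"
      and T: "weight_ss C A H P T" and T': "weight_ss C A H' P T'" for H' T T' \<Phi>
  proof (intro conjI allI impI)
    obtain \<phi> where "ss_morphism A 1 T T' \<phi>" "\<phi> 1 = (\<lambda>p q. \<Phi> (ShO C q (tw_gr P p)))"
      by (rule H.A.ex_ss_morphism[OF couple[OF T] couple[OF T']
            transformation_couple_morphism[OF weighted[OF assms(3)] weighted[OF H'] \<Phi> P X]])
    then show "\<exists>\<phi>. induced_by_transformation C A P T T' \<Phi> \<phi>"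
      unfolding induced_by_transformation_def by auto
    fix \<phi> \<psi> and r :: nat
    assume "induced_by_transformation C A P T T' \<Phi> \<phi>" "induced_by_transformation C A P T T' \<Phi> \<psi>" "1 \<le> r"
    then show "\<phi> r = \<psi> r"
      by - (rule H.A.ss_morphism_unique[OF ss[OF T] ss[OF T'] order.refl, of \<phi> \<psi>];
          simp add: induced_by_transformation_def fun_eq_iff)
  qed
  have transf_Idn: "induced_by_transformation C A P T T (\<lambda>Y. Idn A (FO H Y)) (\<lambda>r p q. Idn A (sE T r p q))"
    if T: "weight_ss C A H P T" for T
    using H.A.ss_morphism_Idn[OF ss[OF T] order.refl] H.weight_ss_simps(1)[OF P X T]
    unfolding induced_by_transformation_def by simp
  have transf_Pls: "induced_by_transformation C A P T T'
         (\<lambda>Y. \<Phi> Y \<boxplus>\<^bsub>A\<^esub> \<Psi> Y) (\<lambda>r p q. \<phi> r p q \<boxplus>\<^bsub>A\<^esub> \<psi> r p q)"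
    if T: "weight_ss C A H P T" "weight_ss C A H' P T'"
      and \<phi>: "induced_by_transformation C A P T T' \<Phi> \<phi>" "induced_by_transformation C A P T T' \<Psi> \<psi>"
    for H' T T' \<Phi> \<Psi> \<phi> \<psi>
    using H.A.ss_morphism_Pls[OF ss[OF T(1)] ss[OF T(2)] order.refl] \<phi>
    unfolding induced_by_transformation_def by simp
  have transf_Cmp: "induced_by_transformation C A P T T''
         (\<lambda>Y. \<Psi> Y \<cdot>\<^bsub>A\<^esub> \<Phi> Y) (\<lambda>r p q. \<psi> r p q \<cdot>\<^bsub>A\<^esub> \<phi> r p q)"
    if T: "weight_ss C A H P T" "weight_ss C A H' P T'" "weight_ss C A H'' P T''"
      and \<phi>: "induced_by_transformation C A P T T' \<Phi> \<phi>" "induced_by_transformation C A P T' T'' \<Psi> \<psi>"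
    for H' H'' T T' T'' \<Phi> \<Psi> \<phi> \<psi>
    using H.A.ss_morphism_Cmp[OF ss[OF T(1)] ss[OF T(2)] ss[OF T(3)] order.refl] \<phi>
    unfolding induced_by_transformation_def by simp
  show ?thesis
  proof (intro conjI, goal_cases)
    case 1
    show ?case using H.ex_weight_ss[OF P X] H.weight_ss_simps[OF P X] by blast
  next
    case 2
    show ?case
    proof (intro allI impI, goal_cases)
      case (1 T)
      \<comment> \<open>The listed cases are the distributed form of a conjunction: a condition from
        above (\<open>X\<close> bounded above, or \<open>H\<close> vanishing on high weights)
        together with a condition from below (\<open>X\<close> bounded below, or \<open>H\<close>
        vanishing on low weights).\<close>
      then show ?case by (intro H.weight_ss_converges[OF P X]) blast+
    qed
  next
    case 3
    show ?case using transf by blast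
  next
    case 4
    show ?case using transf_Idn by blast
  next
    case 5
    show ?case using transf_Pls by blast
  next
    case 6
    show ?case using transf_Cmp by blast
  next
    case 7
    show ?case
      using H.C.ex_tower_extension[OF P] H.ex_induced_by_morphism[OF P] H.induced_by_morphism_unique[OF P] by blast
  next
    case 8
    show ?case using H.induced_by_morphism_Idn[OF P X] by blast
  next
    case 9
    show ?case using H.induced_by_morphism_Cmp[OF P] by blast
  next
    case 10
    show ?case using H.induced_by_Idn_iso[OF P _ X] by blast
  qed
qed

end
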